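(* Let $(c_L,c_M,h_L,h_M)\in\mathbb C^4$ with $c_M\neq 0$ be such that $2h_M+\frac{p^2-1}{12}c_M=0$ for some $p\in\mathbb Z_+$ and $h_L=h'_{p,r}$ for some $r\in\mathbb Z_+$. Then, with $m=\lfloor\frac{r-1}{2}\rfloor$, the Verma module $V_{W(2,2)}(c_L,c_M,h_L,h_M)$ over $W(2,2)$ has the following infinite composition series of submodules: $$V_{W(2,2)}(c_L,c_M,h_L,h_M)=\langle\mathrm S^0\mathbf 1\rangle\supset\langle\mathrm T_{p,r}\mathbf 1\rangle\supset\langle\mathrm S\mathbf 1\rangle\supset\langle\mathrm T_{p,r-2}(\mathrm S\mathbf 1)\rangle\supset\cdots\supset\langle\mathrm S^{m}\mathbf 1\rangle\supset\langle\mathrm T_{p,r-2m}(\mathrm S^{m}\mathbf 1)\rangle\supset\langle\mathrm S^{m+1}\mathbf 1\rangle\supset\langle\mathrm S^{m+2}\mathbf 1\rangle\supset\cdots.$$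
   Context: An infinite composition series is an infinite strictly descending chain of submodules all of whose consecutive quotients are irreducible. $W(2,2)$ is the complex Lie algebra with basis $L_n,M_n$ ($n\in\mathbb Z$), $\mathbf c_L,\mathbf c_M$ and brackets $[L_m,L_n]=(m-n)L_{m+n}+\frac1{12}\delta_{m+n,0}(m^3-m)\mathbf c_L$, $[L_m,M_n]=(m-n)M_{m+n}+\frac1{12}\delta_{m+n,0}(m^3-m)\mathbf c_M$, $[M_m,M_n]=0$, with $\mathbf c_L,\mathbf c_M$ central. $V_{W(2,2)}(c_L,c_M,h_L,h_M)$ is the Verma module generated freely over the negative part by a highest weight vector $\mathbf 1$ annihilated by all $L_n,M_n$ with $n>0$, on which $\mathbf c_L,\mathbf c_M,L_0,M_0$ act by $c_L,c_M,h_L,h_M$. $\langle u\rangle$ is the submodule generated by $u$. A singular vector (in a highest weight module) is a nonzero common eigenvector of $L_0,M_0,\mathbf c_L,\mathbf c_M$ annihilated by all $L_n,M_n$ with $n>0$. $\mathbb Z_+=\{1,2,\dots\}$. $U(\mathcal M_-)$ is the polynomial algebra in the $M_{-i}$, $i\ge1$; $U(\mathcal M_-)_n$ is the span of the monomials $M_{-\lambda}=M_{-\lambda_1}\cdots M_{-\lambda_k}$ with $\lambda$ a partition of $n$. $\mathrm S$ is the unique element of $U(\mathcal M_-)$ of the form $M_{-p}+\sum_\mu s_\mu M_{-\mu}$ (sum over partitions $\mu\ne(p)$ of $p$) such that $\mathrm S\mathbf 1$ is singular; it depends only on $p,c_M$. For $s\in\mathbb Z_+$: $h'_{p,s}=-\frac{p^2-1}{24}c_L+\frac{(13p+1)(p-1)}{12}+\frac{(1-s)p}{2}$.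 $\mathrm T=L_{-p}+\sum_{i=1}^{p-1}g_{p-i}(M)L_{-i}+\sum_{\nu}d_\nu M_{-\nu}$ (last sum over partitions $\nu$ of $p$ with at least two parts), where, with $k_i=\frac{12}{i(p-i)c_M}$, $g_1(M)=k_1M_{-1}$ and $g_i(M)=k_iM_{-i}+k_i\sum_{j=1}^{i-1}(1-\frac{j}{2p-i})g_j(M)M_{-(i-j)}$ for $2\le i\le p-1$, and the $d_\nu\in\mathbb C$ are the coefficients determined by $L_i\mathrm T\mathbf 1=0$ ($1\le i\le p-1$) in the Verma module with $h_L=h'_{p,1}$, $h_M=-\frac{p^2-1}{24}c_M$. For $s\in\mathbb Z_+$, $\mathrm T_{p,s}$ is the unique element of the form $\mathrm T^s+v_1\mathrm T^{s-1}+\cdots+v_s$, with $v_i\in U(\mathcal M_-)_{ip}$ not involving $M_{-p}$, such that the image of $\mathrm T_{p,s}\mathbf 1$ in $V_{W(2,2)}(c_L,c_M,h'_{p,s},h_M)/\langle\mathrm S\mathbf 1\rangle$ is a singular vector (here $\mathbf 1$ is the highest weight vector of $V_{W(2,2)}(c_L,c_M,h'_{p,s},h_M)$). *)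

theory Defs
  imports Complex_Main "HOL-Library.Poly_Mapping" "HOL-Algebra.Module" "HOL-Algebra.AbelCoset"
begin

section \<open>The Lie algebra W(2,2)\<close>

datatype w22_basis = BL int | BM int | BCL | BCM

fun w22_bracket :: "w22_basis \<Rightarrow> w22_basis \<Rightarrow> w22_basis \<Rightarrow>\<^sub>0 complex" where
  "w22_bracket (BL m) (BL n) =
     Poly_Mapping.single (BL (m + n)) (of_int (m - n)) +
     Poly_Mapping.single BCL (if m + n = 0 then of_int (m ^ 3 - m) / 12 else 0)"
| "w22_bracket (BL m) (BM n) =
     Poly_Mapping.single (BM (m + n)) (of_int (m - n)) +
     Poly_Mapping.single BCM (if m + n = 0 then of_int (m ^ 3 - m) / 12 else 0)"
| "w22_bracket (BM n) (BL m) =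
     - (Poly_Mapping.single (BM (m + n)) (of_int (m - n)) +
        Poly_Mapping.single BCM (if m + n = 0 then of_int (m ^ 3 - m) / 12 else 0))"
| "w22_bracket _ _ = 0"


section \<open>The universal enveloping algebra\<close>

text \<open>
  Words form the free monoid under concatenation, so that finitely supported functions on
  words, with the convolution product of \<^theory>\<open>HOL-Library.Poly_Mapping\<close>, form the tensor
  algebra of W(2,2). The enveloping algebra is its quotient by the two-sided ideal generated by
  the elements x y - y x - [x,y].
\<close>

instantiation list :: (type) monoid_add
begin
definition zero_list :: "'a list" where "zero_list = []"
definition plus_list :: "'a list \<Rightarrow> 'a list \<Rightarrow> 'a list" where "plus_list = append"
instance by standard (auto simp: zero_list_def plus_list_def)
end

type_synonym w22_tensor = "w22_basis list \<Rightarrow>\<^sub>0 complex"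

definition tensor_gen :: "w22_basis \<Rightarrow> w22_tensor" where
  "tensor_gen x = Poly_Mapping.single [x] 1"

definition tensor_lin :: "(w22_basis \<Rightarrow>\<^sub>0 complex) \<Rightarrow> w22_tensor" where
  "tensor_lin v = (\<Sum>z\<in>Poly_Mapping.keys v. Poly_Mapping.single [z] (Poly_Mapping.lookup v z))"

inductive_set lie_ideal :: "w22_tensor set" where
  zero: "0 \<in> lie_ideal"
| add: "\<lbrakk>a \<in> lie_ideal; b \<in> lie_ideal\<rbrakk> \<Longrightarrow> a + b \<in> lie_ideal"
| rel: "a * (tensor_gen x * tensor_gen y - tensor_gen y * tensor_gen x
          - tensor_lin (w22_bracket x y)) * b \<in> lie_ideal"

lemma lie_ideal_mult: "a \<in> lie_ideal \<Longrightarrow> c * a * d \<in> lie_ideal"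
proof (induction rule: lie_ideal.induct)
  case zero
  show ?case by (simp add: lie_ideal.zero)
next
  case (add a b)
  then show ?case by (simp add: distrib_left distrib_right lie_ideal.add)
next
  case (rel a x y b)
  show ?case using lie_ideal.rel[of "c * a" x y "b * d"] by (simp only: mult.assoc)
qed

lemma lie_ideal_left: "a \<in> lie_ideal \<Longrightarrow> c * a \<in> lie_ideal"
  using lie_ideal_mult[of a c 1] by simp

lemma lie_ideal_right: "a \<in> lie_ideal \<Longrightarrow> a * c \<in> lie_ideal"
  using lie_ideal_mult[of a 1 c] by simp

lemma lie_ideal_minus: "a \<in> lie_ideal \<Longrightarrow> - a \<in> lie_ideal"
  using lie_ideal_left[of a "- 1"] by simp

lemma lie_ideal_diff: "a \<in> lie_ideal \<Longrightarrow> b \<in> lie_ideal \<Longrightarrow> a - b \<in> lie_ideal"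
  using lie_ideal.add[OF _ lie_ideal_minus, of a b] by simp

lemma lookup_mult_zero:
  fixes a b :: w22_tensor
  shows "Poly_Mapping.lookup (a * b) 0 = Poly_Mapping.lookup a 0 * Poly_Mapping.lookup b 0"
proof -
  have eq: "(\<Sum>q. Poly_Mapping.lookup b q when (0::w22_basis list) = l + q) =
        (Poly_Mapping.lookup b 0 when l = 0)" for l
  proof (cases "l = 0")
    case True
    then show ?thesis by simp
  next
    case False
    then have "\<And>q. (0::w22_basis list) \<noteq> l + q"
      by (simp add: zero_list_def plus_list_def)
    with False show ?thesis by simp
  qed
  show ?thesis unfolding lookup_mult eq by (simp add: mult_when)
qed

lemma lookup_lie_ideal_zero: "a \<in> lie_ideal \<Longrightarrow> Poly_Mapping.lookup a 0 = 0"
proof (induction rule: lie_ideal.induct)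
  case (rel a x y b)
  have gen: "Poly_Mapping.lookup (tensor_gen z) 0 = 0" for z
    by (simp add: tensor_gen_def lookup_single zero_list_def)
  have lin: "Poly_Mapping.lookup (tensor_lin v) 0 = 0" for v
    by (simp add: tensor_lin_def lookup_sum lookup_single zero_list_def)
  show ?case by (simp add: lookup_mult_zero lookup_minus gen lin)
qed (simp_all add: lookup_add)

definition lie_rel :: "w22_tensor \<Rightarrow> w22_tensor \<Rightarrow> bool" where
  "lie_rel a b \<longleftrightarrow> a - b \<in> lie_ideal"

lemma equivp_lie_rel: "equivp lie_rel"
proof (rule equivpI)
  show "reflp lie_rel" by (rule reflpI) (simp add: lie_rel_def lie_ideal.zero)
  show "symp lie_rel"
  proof (rule sympI)
    fix a b assume "lie_rel a b"
    then show "lie_rel b a" using lie_ideal_minus[of "a - b"] by (simp add: lie_rel_def)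
  qed
  show "transp lie_rel"
  proof (rule transpI)
    fix a b c assume "lie_rel a b" "lie_rel b c"
    then show "lie_rel a c" using lie_ideal.add[of "a - b" "b - c"] by (simp add: lie_rel_def)
  qed
qed

quotient_type w22_env = w22_tensor / lie_rel
  by (rule equivp_lie_rel)

instantiation w22_env :: ring_1
begin

lift_definition zero_w22_env :: w22_env is 0 .
lift_definition one_w22_env :: w22_env is 1 .

lift_definition plus_w22_env :: "w22_env \<Rightarrow> w22_env \<Rightarrow> w22_env" is "(+)"
  unfolding lie_rel_def by (metis add_diff_add lie_ideal.add)

lift_definition uminus_w22_env :: "w22_env \<Rightarrow> w22_env" is uminus
  unfolding lie_rel_def by (metis lie_ideal_minus minus_diff_minus)

lift_definition minus_w22_env :: "w22_env \<Rightarrow> w22_env \<Rightarrow> w22_env" is "(-)"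
  unfolding lie_rel_def by (metis diff_diff_add diff_diff_eq2 add.commute add_diff_eq
      diff_add_eq_diff_diff_swap lie_ideal_diff)

lift_definition times_w22_env :: "w22_env \<Rightarrow> w22_env \<Rightarrow> w22_env" is "(*)"
proof -
  fix a a' b b' :: w22_tensor
  assume "lie_rel a a'" "lie_rel b b'"
  then have "(a - a') * b + a' * (b - b') \<in> lie_ideal"
    unfolding lie_rel_def by (intro lie_ideal.add lie_ideal_left lie_ideal_right)
  then show "lie_rel (a * b) (a' * b')"
    unfolding lie_rel_def by (simp add: left_diff_distrib right_diff_distrib)
qed

instance
proof
  show "(0::w22_env) \<noteq> 1"
  proof (transfer, rule notI)
    assume "lie_rel 0 1"
    then have "Poly_Mapping.lookup (0 - 1 :: w22_tensor) 0 = 0"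
      unfolding lie_rel_def by (rule lookup_lie_ideal_zero)
    then show False by (simp add: lookup_minus)
  qed
qed (transfer, simp add: lie_rel_def algebra_simps lie_ideal.zero)+

end

lift_definition env_scalar :: "complex \<Rightarrow> w22_env" is "\<lambda>c. Poly_Mapping.single 0 c" .

lift_definition env_gen :: "w22_basis \<Rightarrow> w22_env" is tensor_gen .

abbreviation UL :: "int \<Rightarrow> w22_env" where "UL n \<equiv> env_gen (BL n)"
abbreviation UM :: "int \<Rightarrow> w22_env" where "UM n \<equiv> env_gen (BM n)"
abbreviation UCL :: w22_env where "UCL \<equiv> env_gen BCL"
abbreviation UCM :: w22_env where "UCM \<equiv> env_gen BCM"


section \<open>Modules\<close>

text \<open>
  W(2,2)-modules are left modules over the enveloping algebra. The record of
  \<^theory>\<open>HOL-Algebra.Module\<close> is used for them (its fields mult and one play no role), but not the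
  locale of that theory, which is restricted to commutative rings of scalars.
\<close>

definition env_ring :: "w22_env ring" where
  "env_ring = \<lparr>carrier = UNIV, mult = (*), one = 1, zero = 0, add = (+)\<rparr>"

type_synonym 'v w22_module = "(w22_env, 'v) module"

abbreviation w22_submodule :: "'v set \<Rightarrow> 'v w22_module \<Rightarrow> bool" where
  "w22_submodule N V \<equiv> submodule N env_ring V"

definition generated_submodule :: "'v w22_module \<Rightarrow> 'v set \<Rightarrow> 'v set" where
  "generated_submodule V A = \<Inter>{N. w22_submodule N V \<and> A \<subseteq> N}"

definition quotient_module :: "'v w22_module \<Rightarrow> 'v set \<Rightarrow> 'v set w22_module" where
  "quotient_module V N =
    \<lparr>carrier = a_rcosets\<^bsub>V\<^esub> N, mult = undefined, one = undefined, zero = N, add = set_add V,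
     smult = (\<lambda>u C. \<Union>x\<in>C. N +>\<^bsub>V\<^esub> (u \<odot>\<^bsub>V\<^esub> x))\<rparr>"

definition irreducible_module :: "'v w22_module \<Rightarrow> bool" where
  "irreducible_module V \<longleftrightarrow> carrier V \<noteq> {\<zero>\<^bsub>V\<^esub>} \<and>
     (\<forall>N. w22_submodule N V \<longrightarrow> N = {\<zero>\<^bsub>V\<^esub>} \<or> N = carrier V)"

definition infinite_composition_series :: "'v w22_module \<Rightarrow> (nat \<Rightarrow> 'v set) \<Rightarrow> bool" where
  "infinite_composition_series V N \<longleftrightarrow>
     N 0 = carrier V \<and>
     (\<forall>i. w22_submodule (N i) V \<and> N (Suc i) \<subset> N i \<and>
          irreducible_module (quotient_module (V\<lparr>carrier := N i\<rparr>) (N (Suc i))))"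

definition singular_vector :: "'v w22_module \<Rightarrow> 'v \<Rightarrow> bool" where
  "singular_vector V x \<longleftrightarrow> x \<in> carrier V \<and> x \<noteq> \<zero>\<^bsub>V\<^esub> \<and>
     (\<forall>h\<in>{UL 0, UM 0, UCL, UCM}. \<exists>a. h \<odot>\<^bsub>V\<^esub> x = env_scalar a \<odot>\<^bsub>V\<^esub> x) \<and>
     (\<forall>n>0. UL n \<odot>\<^bsub>V\<^esub> x = \<zero>\<^bsub>V\<^esub> \<and> UM n \<odot>\<^bsub>V\<^esub> x = \<zero>\<^bsub>V\<^esub>)"


section \<open>Verma modules\<close>

definition regular_module :: "w22_env w22_module" where
  "regular_module =
    \<lparr>carrier = UNIV, mult = (*), one = 1, zero = 0, add = (+), smult = (*)\<rparr>"

definition verma_ideal ::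
    "complex \<Rightarrow> complex \<Rightarrow> complex \<Rightarrow> complex \<Rightarrow> w22_env set" where
  "verma_ideal cL cM hL hM = generated_submodule regular_module
     ({UL n |n. 0 < n} \<union> {UM n |n. 0 < n} \<union>
      {UL 0 - env_scalar hL, UM 0 - env_scalar hM, UCL - env_scalar cL, UCM - env_scalar cM})"

text \<open>
  The module induced from the one-dimensional representation of the nonnegative part, in the form
  U / J with J the left ideal above; by the Poincare-Birkhoff-Witt theorem it is free of rank one,
  on the coset of 1, over the enveloping algebra of the negative part.
\<close>

definition verma ::
    "complex \<Rightarrow> complex \<Rightarrow> complex \<Rightarrow> complex \<Rightarrow> w22_env set w22_module" where
  "verma cL cM hL hM = quotient_module regular_module (verma_ideal cL cM hL hM)"

definition verma_vec ::
    "complex \<Rightarrow> complex \<Rightarrow> complex \<Rightarrow> complex \<Rightarrow> w22_env set" where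
  "verma_vec cL cM hL hM = verma_ideal cL cM hL hM +>\<^bsub>regular_module\<^esub> 1"


section \<open>The elements S, T and T(p,s)\<close>

text \<open>A partition is the weakly decreasing list of its (positive) parts.\<close>

definition partitions :: "nat \<Rightarrow> nat list set" where
  "partitions n = {xs. sorted_wrt (\<ge>) xs \<and> 0 \<notin> set xs \<and> sum_list xs = n}"

definition UM_neg :: "nat list \<Rightarrow> w22_env" where
  "UM_neg xs = prod_list (map (\<lambda>i. UM (- int i)) xs)"

definition span_UM :: "nat list set \<Rightarrow> w22_env set" where
  "span_UM P = {\<Sum>xs\<in>P. env_scalar (a xs) * UM_neg xs |a. True}"

definition hM_crit :: "nat \<Rightarrow> complex \<Rightarrow> complex" where
  "hM_crit p cM = - ((of_nat p ^ 2 - 1) / 24) * cM"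

definition hL_crit :: "nat \<Rightarrow> nat \<Rightarrow> complex \<Rightarrow> complex" where
  "hL_crit p s cL = - ((of_nat p ^ 2 - 1) / 24) * cL
     + (13 * of_nat p + 1) * (of_nat p - 1) / 12 + (1 - of_nat s) * of_nat p / 2"

text \<open>The element S does not depend on the values of cL and hL, hence the quantification.\<close>

definition S_elem :: "nat \<Rightarrow> complex \<Rightarrow> w22_env" where
  "S_elem p cM = (THE u.
     (\<exists>w\<in>span_UM (partitions p - {[p]}). u = UM (- int p) + w) \<and>
     (\<forall>cL hL. singular_vector (verma cL cM hL (hM_crit p cM))
        (u \<odot>\<^bsub>verma cL cM hL (hM_crit p cM)\<^esub> verma_vec cL cM hL (hM_crit p cM))))"

definition k_coeff :: "nat \<Rightarrow> complex \<Rightarrow> nat \<Rightarrow> complex" where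
  "k_coeff p cM i = 12 / (of_nat i * (of_nat p - of_nat i) * cM)"

fun g_elem :: "nat \<Rightarrow> complex \<Rightarrow> nat \<Rightarrow> w22_env" where
  "g_elem p cM i =
     env_scalar (k_coeff p cM i) * UM (- int i) +
     env_scalar (k_coeff p cM i) *
       (\<Sum>j\<in>{1..<i}. env_scalar (1 - of_nat j / (2 * of_nat p - of_nat i)) *
          g_elem p cM j * UM (- int (i - j)))"

declare g_elem.simps [simp del]

definition T_elem :: "nat \<Rightarrow> complex \<Rightarrow> complex \<Rightarrow> w22_env" where
  "T_elem p cL cM = (THE u.
     (\<exists>w\<in>span_UM {xs \<in> partitions p. 2 \<le> length xs}.
        u = UL (- int p) + (\<Sum>i\<in>{1..<p}. g_elem p cM (p - i) * UL (- int i)) + w) \<and>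
     (let V = verma cL cM (hL_crit p 1 cL) (hM_crit p cM);
          v = verma_vec cL cM (hL_crit p 1 cL) (hM_crit p cM)
      in \<forall>i\<in>{1..<p}. UL (int i) \<odot>\<^bsub>V\<^esub> (u \<odot>\<^bsub>V\<^esub> v) = \<zero>\<^bsub>V\<^esub>))"

definition Tps_elem :: "nat \<Rightarrow> nat \<Rightarrow> complex \<Rightarrow> complex \<Rightarrow> w22_env" where
  "Tps_elem p s cL cM = (THE u.
     (\<exists>w. (\<forall>i\<in>{1..s}. w i \<in> span_UM {xs \<in> partitions (i * p). p \<notin> set xs}) \<and>
          u = T_elem p cL cM ^ s + (\<Sum>i\<in>{1..s}. w i * T_elem p cL cM ^ (s - i))) \<and>
     (let V = verma cL cM (hL_crit p s cL) (hM_crit p cM);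
          v = verma_vec cL cM (hL_crit p s cL) (hM_crit p cM);
          N = generated_submodule V {S_elem p cM \<odot>\<^bsub>V\<^esub> v}
      in singular_vector (quotient_module V N) (N +>\<^bsub>V\<^esub> (u \<odot>\<^bsub>V\<^esub> v))))"

text \<open>
  The modules of the series: for k up to m the two modules of index 2k and 2k+1, from index 2m+2
  on only the modules generated by the powers of S.
\<close>

definition series_module ::
    "nat \<Rightarrow> nat \<Rightarrow> complex \<Rightarrow> complex \<Rightarrow> complex \<Rightarrow> complex \<Rightarrow> nat \<Rightarrow> w22_env set set" where
  "series_module p r cL cM hL hM n =
     (let V = verma cL cM hL hM;
          v = verma_vec cL cM hL hM;
          m = (r - 1) div 2;
          S = S_elem p cM;
          k = n div 2
      in if n \<le> 2 * m + 1
         then if even n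
              then generated_submodule V {S ^ k \<odot>\<^bsub>V\<^esub> v}
              else generated_submodule V {Tps_elem p (r - 2 * k) cL cM \<odot>\<^bsub>V\<^esub> (S ^ k \<odot>\<^bsub>V\<^esub> v)}
         else generated_submodule V {S ^ (n - (m + 1)) \<odot>\<^bsub>V\<^esub> v})"

end

theory Submission imports Defs "HOL-Library.Multiset" begin

text \<open>Let \<open>U\<close> be the enveloping algebra and \<open>J(h)\<close> the left ideal with \<open>V(h) = U/J(h)\<close>, for fixed central charges
and the critical value of \<open>h\<^sub>M\<close>. Submodules of \<open>V(h)\<close> are left ideals containing \<open>J(h)\<close>, and the whole
argument takes place in \<open>U\<close>: the members of the series are \<open>U S\<^sup>k + J(h)\<close> and
\<open>U T(p,s) S\<^sup>k + J(h)\<close> with \<open>s + 2k = r\<close>.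

At the critical value of \<open>h\<^sub>M\<close> the commutator of \<open>M\<^sub>n\<close> and \<open>L\<^sub>-\<^sub>n\<close>, and likewise that of \<open>L\<^sub>n\<close> and \<open>M\<^sub>-\<^sub>n\<close>, acts
on the highest weight vector by \<open>n(n\<^sup>2 - p\<^sup>2) c\<^sub>M / 12\<close>, which vanishes for no positive \<open>n\<close> other than \<open>p\<close>. The
recursion for the \<open>g\<^sub>i\<close> is what makes the correction T of \<open>L\<^sub>-\<^sub>p\<close> preserve the vectors annihilated by
all \<open>M\<^sub>n\<close> with \<open>n > 0\<close> (\<open>UM_T_K\<close>), and S is the obstruction to \<open>M\<^sub>0\<close> commuting with T: \<open>[M\<^sub>0,T] = p S\<close>
(\<open>UM_0_T\<close>). Commuting this identity with \<open>L\<^sub>n\<close> shows that S gives a singular vector for every \<open>h\<close> (\<open>UL_S\<close>).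

In a quotient \<open>U/H\<close> with \<open>S \<in> H\<close> the pairing of positive with negative generators is inverted into
partial derivatives, and the resulting Euler operator multiplies a word of length \<open>n\<close> by \<open>n\<close>, up to shorter
words. A vector annihilated by all derivatives therefore has length 0 (\<open>euler_descent\<close>). Used once
with the \<open>L\<^sub>-\<^sub>i\<close> as variables this shows that the vectors annihilated by all \<open>M\<^sub>n\<close>, \<open>n > 0\<close>, are
combinations of the \<open>M\<^sub>-\<^sub>\<mu> T\<^sup>j\<close> (\<open>annihilated_by_M\<close>); used again with the \<open>M\<^sub>-\<^sub>i\<close> as variables it shows that
a singular vector has a single leading term \<open>T\<^sup>k\<close>. Since \<open>L\<^sub>p T\<^sup>k\<close> is \<open>b\<^sub>k T\<^sup>k\<^sup>-\<^sup>1\<close> up to multiples of the negative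
M (\<open>UL_p_T_power\<close>), with \<open>b\<^sub>k\<close> zero only for \<open>k = 0\<close> and for \<open>h = h'\<^sub>p\<^sub>,\<^sub>k\<close>, singular vectors modulo S of positive degree
exist at most for \<open>h = h'\<^sub>p\<^sub>,\<^sub>k\<close>, where they are unique up to scalars (\<open>singular_vectors\<close>, \<open>unique_T\<close>).
They do exist (\<open>exists_T\<close>): a combination of the \<open>M\<^sub>-\<^sub>\<mu> T\<^sup>j\<close> of degree \<open>kp\<close> that is annihilated by all words of
degree \<open>-kp\<close> in the \<open>L\<^sub>i\<close>, \<open>i > 0\<close>, solves a square linear system, indexed by the partitions of \<open>kp\<close> on both
sides, and \<open>b\<^sub>k = 0\<close> makes one of its equations void. A nonzero solution generates a proper submodule, whose
vectors of least degree are singular.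

Non-membership in a left ideal is always shown by a linear form. In place of the
Poincare-Birkhoff-Witt theorem, \<open>verma_functional\<close> extends any compatible form on words in the negative
generators to a form on \<open>U\<close> vanishing on \<open>J(h)\<close>; a small representation on monomials in two variables then
supplies forms that detect the terms \<open>L\<^sub>-\<^sub>p\<^sup>s M\<^sub>-\<^sub>p\<^sup>k\<close> (\<open>level_form\<close>). They separate the members of the series.

To see that nothing lies strictly between two consecutive members, a left ideal \<open>X\<close> between them is
replaced by the left ideal of all \<open>u\<close> with \<open>u S\<^sup>k \<in> X\<close>. It contains \<open>J(h + kp)\<close> because \<open>S\<^sup>k\<close> is singular of
degree \<open>kp\<close>, and it contains S, so the description of singular vectors modulo S applies to it
(\<open>above_H0\<close>, \<open>above_T\<close>). The parameters fit because \<open>h'\<^sub>p\<^sub>,\<^sub>r + kp = h'\<^sub>p\<^sub>,\<^sub>s\<close> if and only if \<open>s + 2k = r\<close>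
(\<open>hL_crit_shift\<close>), which also explains why the T(p,s) stop appearing after finitely many steps. The inclusion of
\<open>U S\<close> in the submodule of T(p,s) holds since \<open>M\<^sub>0 - h\<^sub>M\<close> for \<open>s = 1\<close>, and \<open>M\<^sub>n\<close> with \<open>n = (s-1)p\<close> for \<open>s > 1\<close>, takes T(p,s) to a nonzero
multiple of S (\<open>S_in_join\<close>).\<close>



section \<open>The enveloping algebra as a complex algebra\<close>

definition scale_env :: "complex \<Rightarrow> w22_env \<Rightarrow> w22_env" (infixr "\<cdot>" 75)
  where "c \<cdot> u = env_scalar c * u"

lemma env_scalar_add: "env_scalar (a + b) = env_scalar a + env_scalar b"
  by transfer (simp add: single_add lie_rel_def lie_ideal.zero)

lemma env_scalar_mult: "env_scalar (a * b) = env_scalar a * env_scalar b"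
  by transfer (simp add: mult_single lie_rel_def lie_ideal.zero)

lemma env_scalar_1: "env_scalar 1 = 1"
  by transfer (simp add: lie_rel_def lie_ideal.zero)

lemma env_scalar_0 [simp]: "env_scalar 0 = 0"
  by transfer (simp add: lie_rel_def lie_ideal.zero)

lemma poly_mapping_induct [case_names zero single add]:
  fixes t :: "'a \<Rightarrow>\<^sub>0 'b::comm_monoid_add"
  assumes "P 0" and "\<And>k v. P (Poly_Mapping.single k v)" and "\<And>f g. P f \<Longrightarrow> P g \<Longrightarrow> P (f + g)"
  shows "P t"
proof -
  have "t = (\<Sum>k\<in>Poly_Mapping.keys t. Poly_Mapping.single k (Poly_Mapping.lookup t k))"
    by (rule poly_mapping_eqI)
       (auto simp: lookup_sum lookup_single when_def sum.delta' in_keys_iff)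
  moreover have "P (\<Sum>k\<in>A. Poly_Mapping.single k (Poly_Mapping.lookup t k))" if "finite A" for A
    using that by (induction A) (auto intro: assms)
  ultimately show ?thesis by (metis finite_keys)
qed

lemma single_zero_commute: "Poly_Mapping.single 0 c * t = t * (Poly_Mapping.single 0 c :: w22_tensor)"
proof (induction t rule: poly_mapping_induct)
  case (single k v)
  show ?case by (simp add: mult_single mult.commute)
qed (simp_all add: distrib_left distrib_right)

lemma env_scalar_commute: "env_scalar c * u = u * env_scalar c"
  by transfer (simp add: lie_rel_def lie_ideal.zero single_zero_commute)

global_interpretation env: vector_space scale_env
  defines env_span = env.span and env_subspace = env.subspace
proof
  fix a b :: complex and x y :: w22_env
  show "a \<cdot> (x + y) = a \<cdot> x + a \<cdot> y" by (simp add: scale_env_def distrib_left)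
  show "(a + b) \<cdot> x = a \<cdot> x + b \<cdot> x" by (simp add: scale_env_def distrib_right env_scalar_add)
  show "a \<cdot> b \<cdot> x = (a * b) \<cdot> x" by (simp add: scale_env_def env_scalar_mult mult.assoc)
  show "1 \<cdot> x = x" by (simp add: scale_env_def env_scalar_1)
qed

lemma scale_mult_left [simp]: "(c \<cdot> u) * v = c \<cdot> (u * v)"
  by (simp add: scale_env_def mult.assoc)

lemma scale_mult_right [simp]: "u * (c \<cdot> v) = c \<cdot> (u * v)"
  by (simp add: scale_env_def env_scalar_commute flip: mult.assoc)
     (simp add: env_scalar_commute mult.assoc)

lemma env_scalar_eq: "env_scalar c = c \<cdot> 1"
  by (simp add: scale_env_def)

definition word :: "w22_basis list \<Rightarrow> w22_env" where
  "word ws = prod_list (map env_gen ws)"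

lemma word_simps [simp]:
  "word [] = 1" "word (x # ws) = env_gen x * word ws" "word (ws @ vs) = word ws * word vs"
  by (simp_all add: word_def)

lemma word_abs: "abs_w22_env (Poly_Mapping.single ws c) = c \<cdot> word ws"
proof (induction ws)
  case Nil
  show ?case by (simp add: env_scalar_eq[symmetric] env_scalar.abs_eq zero_list_def)
next
  case (Cons x ws)
  have "Poly_Mapping.single (x # ws) c = tensor_gen x * Poly_Mapping.single ws c"
    by (simp add: tensor_gen_def mult_single plus_list_def)
  then have "abs_w22_env (Poly_Mapping.single (x # ws) c) = env_gen x * (c \<cdot> word ws)"
    by (simp flip: Cons add: times_w22_env.abs_eq env_gen.abs_eq)
  then show ?case by simp
qed

lemma word_induct [case_names zero word add]:
  assumes "P 0" and "\<And>c ws. P (c \<cdot> word ws)"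
    and "\<And>u v. P u \<Longrightarrow> P v \<Longrightarrow> P (u + v)"
  shows "P u"
proof -
  obtain t where u: "u = abs_w22_env t" by (metis Quotient3_abs_rep Quotient3_w22_env)
  have "P (abs_w22_env t)"
  proof (induction t rule: poly_mapping_induct)
    case (single k v)
    show ?case using assms(2) by (simp add: word_abs)
  next
    case (add f g)
    then show ?case using assms(3) by (simp add: plus_w22_env.abs_eq[symmetric])
  qed (use assms(1) in \<open>simp add: zero_w22_env.abs_eq\<close>)
  then show ?thesis by (simp add: u)
qed

lemma span_words: "env_span (range word) = UNIV"
proof -
  have "u \<in> env_span (range word)" for u
    by (induction u rule: word_induct)
       (auto intro: env.span_zero env.span_scale env.span_base env.span_add)
  then show ?thesis by auto
qed

lemma tensor_lin_superset:
  assumes "finite A" "Poly_Mapping.keys v \<subseteq> A"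
  shows "tensor_lin v = (\<Sum>z\<in>A. Poly_Mapping.single [z] (Poly_Mapping.lookup v z))"
  unfolding tensor_lin_def using assms
  by (intro sum.mono_neutral_left) (auto simp: in_keys_iff)

lemma tensor_lin_add: "tensor_lin (v + v') = tensor_lin v + tensor_lin v'"
proof -
  let ?A = "Poly_Mapping.keys v \<union> Poly_Mapping.keys v'"
  have "Poly_Mapping.keys (v + v') \<subseteq> ?A" by (rule keys_add)
  then show ?thesis
    by (simp add: tensor_lin_superset[of ?A] lookup_add single_add sum.distrib)
qed

lemma tensor_lin_single: "tensor_lin (Poly_Mapping.single z c) = Poly_Mapping.single [z] c"
  by (simp add: tensor_lin_def)

lemma tensor_lin_uminus: "tensor_lin (- v) = - tensor_lin v"
proof -
  have "tensor_lin (v + (-v)) = 0" unfolding add.right_inverse by (simp add: tensor_lin_def)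
  then show ?thesis unfolding tensor_lin_add by (metis add_eq_0_iff)
qed

definition env_lin :: "(w22_basis \<Rightarrow>\<^sub>0 complex) \<Rightarrow> w22_env" where
  "env_lin v = abs_w22_env (tensor_lin v)"

lemma env_lin_simps [simp]:
  "env_lin 0 = 0" "env_lin (v + v') = env_lin v + env_lin v'" "env_lin (- v) = - env_lin v"
  "env_lin (Poly_Mapping.single z c) = c \<cdot> env_gen z"
  using word_abs[of "[z]" c]
  by (simp_all add: env_lin_def tensor_lin_add plus_w22_env.abs_eq tensor_lin_uminus
      uminus_w22_env.abs_eq tensor_lin_single) (simp add: tensor_lin_def zero_w22_env.abs_eq)

lemma env_gen_commutator:
  "env_gen x * env_gen y - env_gen y * env_gen x = env_lin (w22_bracket x y)"
proof -
  have "lie_rel (tensor_gen x * tensor_gen y - tensor_gen y * tensor_gen x)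
     (tensor_lin (w22_bracket x y))"
    using lie_ideal.rel[of 1 x y 1] by (simp add: lie_rel_def)
  then show ?thesis
    by (simp add: env_lin_def env_gen.abs_eq times_w22_env.abs_eq minus_w22_env.abs_eq
        w22_env.abs_eq_iff)
qed

lemma UL_UL: "UL m * UL n = UL n * UL m + of_int (m - n) \<cdot> UL (m + n)
    + (if m + n = 0 then of_int (m ^ 3 - m) / 12 else 0) \<cdot> UCL"
  using env_gen_commutator[of "BL m" "BL n"] by (simp add: algebra_simps del: of_int_diff)

lemma UL_UM: "UL m * UM n = UM n * UL m + of_int (m - n) \<cdot> UM (m + n)
    + (if m + n = 0 then of_int (m ^ 3 - m) / 12 else 0) \<cdot> UCM"
  using env_gen_commutator[of "BL m" "BM n"] by (simp add: algebra_simps del: of_int_diff)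

lemma UM_UL: "UM m * UL n = UL n * UM m + of_int (m - n) \<cdot> UM (m + n)
    + (if m + n = 0 then of_int (m ^ 3 - m) / 12 else 0) \<cdot> UCM"
proof (cases "m + n = 0")
  case True
  then have n: "n = - m" by simp
  show ?thesis using UL_UM[of n m] unfolding n
    by (simp add: algebra_simps diff_divide_distrib flip: env.scale_left_distrib)
next
  case False
  then show ?thesis using UL_UM[of n m]
    by (auto simp: algebra_simps add.commute)
qed

lemma UM_UM: "UM m * UM n = UM n * UM m"
  using env_gen_commutator[of "BM m" "BM n"] by simp

lemma UCM_central: "UCM * u = u * UCM" and UCL_central: "UCL * u = u * UCL"
proof -
  have gen: "UCM * env_gen x = env_gen x * UCM" "UCL * env_gen x = env_gen x * UCL" for x
    using env_gen_commutator[of BCM x] env_gen_commutator[of BCL x] by simp_all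
  have w: "UCM * word ws = word ws * UCM" "UCL * word ws = word ws * UCL" for ws
    by (induction ws) (simp_all, (metis gen mult.assoc)+)
  show "UCM * u = u * UCM" by (induction u rule: word_induct) (simp_all add: w algebra_simps)
  show "UCL * u = u * UCL" by (induction u rule: word_induct) (simp_all add: w algebra_simps)
qed



section \<open>Linear forms on Verma modules\<close>

definition lin_ext :: "('k \<Rightarrow> complex) \<Rightarrow> ('k \<Rightarrow>\<^sub>0 complex) \<Rightarrow> complex"
  where "lin_ext f v = (\<Sum>z\<in>Poly_Mapping.keys v. Poly_Mapping.lookup v z * f z)"

lemma lin_ext_superset:
  assumes "finite A" "Poly_Mapping.keys v \<subseteq> A"
  shows "lin_ext f v = (\<Sum>z\<in>A. Poly_Mapping.lookup v z * f z)"
  unfolding lin_ext_def using assms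
  by (intro sum.mono_neutral_left) (auto simp: in_keys_iff)

lemma lin_ext_add [simp]: "lin_ext f (v + v') = lin_ext f v + lin_ext f v'"
proof -
  let ?A = "Poly_Mapping.keys v \<union> Poly_Mapping.keys v'"
  have "Poly_Mapping.keys (v + v') \<subseteq> ?A" by (rule keys_add)
  then show ?thesis
    by (simp add: lin_ext_superset[of ?A] lookup_add sum.distrib distrib_right)
qed

lemma lin_ext_single [simp]: "lin_ext f (Poly_Mapping.single z c) = c * f z"
  by (simp add: lin_ext_def)

lemma lin_ext_zero [simp]: "lin_ext f 0 = 0"
  by (simp add: lin_ext_def)

lemma lin_ext_uminus [simp]: "lin_ext f (- v) = - lin_ext f v"
  using lin_ext_add[of f v "- v"] by (simp del: lin_ext_add add: minus_unique)

lemma lin_ext_minus [simp]: "lin_ext f (v - v') = lin_ext f v - lin_ext f v'"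
  using lin_ext_add[of f v "- v'"] by simp

lemma lin_ext_fun_add: "lin_ext (\<lambda>z. f z + g z) v = lin_ext f v + lin_ext g v"
  by (simp add: lin_ext_def sum.distrib algebra_simps)

lemma lin_ext_fun_minus: "lin_ext (\<lambda>z. f z - g z) v = lin_ext f v - lin_ext g v"
  by (simp add: lin_ext_def sum_subtractf algebra_simps)

lemma lin_ext_fun_uminus: "lin_ext (\<lambda>z. - f z) v = - lin_ext f v"
  by (simp add: lin_ext_def sum_negf)

lemma lin_ext_fun_scale: "lin_ext (\<lambda>z. c * f z) v = c * lin_ext f v"
  by (simp add: lin_ext_def sum_distrib_left mult.left_commute)

lemma lin_ext_swap: "lin_ext (\<lambda>u. lin_ext (\<lambda>z. F u z) V) W = lin_ext (\<lambda>z. lin_ext (\<lambda>u. F u z) W) V"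
  unfolding lin_ext_def sum_distrib_left
  by (subst sum.swap) (simp add: mult.left_commute)

lemma bracket_antisym: "w22_bracket x y = - w22_bracket y x"
proof (cases "\<exists>m n. x = BL m \<and> y = BL n")
  case True
  then obtain m n where xy: "x = BL m" "y = BL n" by auto
  show ?thesis
  proof (cases "m + n = 0")
    case True
    then have n: "n = - m" by simp
    show ?thesis unfolding xy n
      by (intro poly_mapping_eqI) (simp add: lookup_add lookup_minus lookup_uminus lookup_single when_def field_simps)
  next
    case False
    then show ?thesis unfolding xy
      by (intro poly_mapping_eqI) (simp add: add.commute[of n m] lookup_single when_def)
  qed
next
  case False
  then show ?thesis by (cases x; cases y; auto)
qed

lemma lin_ext_bracket_antisym: "lin_ext f (w22_bracket x y) = - lin_ext f (w22_bracket y x)"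
  by (subst bracket_antisym) simp

text \<open>It suffices to treat three L, and two L with one M in the last place; the other positions of the M
follow by antisymmetry.\<close>

lemma jacobi:
  "lin_ext (\<lambda>z. lin_ext f (w22_bracket z u)) (w22_bracket x y) =
   lin_ext (\<lambda>z. lin_ext f (w22_bracket z y)) (w22_bracket x u) +
   lin_ext (\<lambda>z. lin_ext f (w22_bracket x z)) (w22_bracket y u)"
proof -
  have gen: "g (m + n + k) * (of_int (m - n) * of_int (m + n - k)) +
      of_int (m - n) * ((if m + n + k = 0 then of_int ((m + n) ^ 3 - (m + n)) / 12 else 0) * c) =
      g (m + k + n) * (of_int (m - k) * of_int (m + k - n)) +
      of_int (m - k) * ((if m + k + n = 0 then of_int ((m + k) ^ 3 - (m + k)) / 12 else 0) * c) +
      (g (m + (n + k)) * (of_int (n - k) * of_int (m - (n + k))) +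
      of_int (n - k) * ((if m + (n + k) = 0 then of_int (m ^ 3 - m) / 12 else 0) * c))"
    for m n k :: int and g :: "int \<Rightarrow> complex" and c
  proof (cases "m + n + k = 0")
    case True
    then have k: "k = - m - n" by linarith
    let ?x = "of_int m :: complex" and ?y = "of_int n :: complex"
    have "(?x - ?y) * ((?x + ?y) ^ 3 - (?x + ?y)) =
        (?x - (- ?x - ?y)) * ((?x + (- ?x - ?y)) ^ 3 - (?x + (- ?x - ?y))) + (?y - (- ?x - ?y)) * (?x ^ 3 - ?x)"
      by (simp add: power3_eq_cube algebra_simps)
    then have "(?x - ?y) * ((?x + ?y) ^ 3 - (?x + ?y)) * c / 12 =
        (?x - (- ?x - ?y)) * ((?x + (- ?x - ?y)) ^ 3 - (?x + (- ?x - ?y))) * c / 12 + (?y - (- ?x - ?y)) * (?x ^ 3 - ?x) * c / 12"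
      by (simp only: distrib_right add_divide_distrib)
    moreover have "(?x - ?y) * (?x + ?y - (- ?x - ?y)) =
        (?x - (- ?x - ?y)) * (?x + (- ?x - ?y) - ?y) + (?y - (- ?x - ?y)) * (?x - (?y + (- ?x - ?y)))"
      by (simp add: power3_eq_cube algebra_simps)
    then have "g 0 * ((?x - ?y) * (?x + ?y - (- ?x - ?y))) =
        g 0 * ((?x - (- ?x - ?y)) * (?x + (- ?x - ?y) - ?y)) + g 0 * ((?y - (- ?x - ?y)) * (?x - (?y + (- ?x - ?y))))"
      by (simp only: distrib_left)
    ultimately show ?thesis unfolding k of_int_diff of_int_add of_int_minus of_int_power
      by (simp only: k add.assoc mult.assoc) simp
  next
    case False
    then have "m + k + n \<noteq> 0" "m + (n + k) \<noteq> 0" by linarith+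
    with False show ?thesis by (simp add: algebra_simps)
  qed
  \<comment> \<open>The same identity with the second summand read through antisymmetry, as it arises when the third argument is an M.\<close>
  have gen2: "g (m + n + k) * (of_int (m - n) * of_int (m + n - k)) +
      of_int (m - n) * ((if m + n + k = 0 then of_int ((m + n) ^ 3 - (m + n)) / 12 else 0) * c) =
      - (g (n + (m + k)) * (of_int (m - k) * of_int (n - (m + k))) +
      of_int (m - k) * ((if n + (m + k) = 0 then of_int (n ^ 3 - n) / 12 else 0) * c)) +
      (g (m + (n + k)) * (of_int (n - k) * of_int (m - (n + k))) +
      of_int (n - k) * ((if m + (n + k) = 0 then of_int (m ^ 3 - m) / 12 else 0) * c))"
    for m n k :: int and g :: "int \<Rightarrow> complex" and c
  proof (cases "m + n + k = 0")
    case True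
    then have k: "k = - m - n" by linarith
    let ?x = "of_int m :: complex" and ?y = "of_int n :: complex"
    have "(?x - ?y) * ((?x + ?y) ^ 3 - (?x + ?y)) =
        (?x - (- ?x - ?y)) * (- (?y ^ 3 - ?y)) + (?y - (- ?x - ?y)) * (?x ^ 3 - ?x)"
      by (simp add: power3_eq_cube algebra_simps)
    then have "(?x - ?y) * ((?x + ?y) ^ 3 - (?x + ?y)) * c / 12 =
        (?x - (- ?x - ?y)) * (- (?y ^ 3 - ?y)) * c / 12 + (?y - (- ?x - ?y)) * (?x ^ 3 - ?x) * c / 12"
      by (simp only: distrib_right add_divide_distrib)
    moreover have "(?x - ?y) * (?x + ?y - (- ?x - ?y)) =
        (?x - (- ?x - ?y)) * (- (?y - (?x + (- ?x - ?y)))) + (?y - (- ?x - ?y)) * (?x - (?y + (- ?x - ?y)))"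
      by (simp add: power3_eq_cube algebra_simps)
    then have "g 0 * ((?x - ?y) * (?x + ?y - (- ?x - ?y))) =
        g 0 * ((?x - (- ?x - ?y)) * (- (?y - (?x + (- ?x - ?y))))) + g 0 * ((?y - (- ?x - ?y)) * (?x - (?y + (- ?x - ?y))))"
      by (simp only: distrib_left)
    ultimately show ?thesis unfolding k of_int_diff of_int_add of_int_minus of_int_power
      by (simp only: k add.assoc mult.assoc) (simp, simp add: algebra_simps)
  next
    case False
    then have "n + (m + k) \<noteq> 0" "m + (n + k) \<noteq> 0" by linarith+
    with False show ?thesis by (simp add: algebra_simps)
  qed
  have LLL: ?thesis if "x = BL m" "y = BL n" "u = BL k" for m n k
    using gen[of "\<lambda>i. f (BL i)" m n k "f BCL"] unfolding that
    by (simp add: algebra_simps del: of_int_diff of_int_add)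
  have LLM: "lin_ext (\<lambda>z. lin_ext f (w22_bracket z u)) (w22_bracket x y) =
   lin_ext (\<lambda>z. lin_ext f (w22_bracket z y)) (w22_bracket x u) +
   lin_ext (\<lambda>z. lin_ext f (w22_bracket x z)) (w22_bracket y u)"
   if "x = BL m" "y = BL n" "u = BM k" for x y u m n k
    using gen2[of "\<lambda>i. f (BM i)" m n k "f BCM"] unfolding that
    by (simp add: algebra_simps del: of_int_diff of_int_add)
  have flip: "lin_ext (\<lambda>z. lin_ext f (w22_bracket u z)) v = - lin_ext (\<lambda>z. lin_ext f (w22_bracket z u)) v"
    for u v
    by (subst lin_ext_fun_uminus[symmetric], rule arg_cong[where f = "\<lambda>g. lin_ext g v"],
        rule ext, rule lin_ext_bracket_antisym)
  have LML: ?thesis if "x = BL m" "y = BM n" "u = BL k" for m n k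
    using LLM[OF that(1,3,2)] unfolding lin_ext_bracket_antisym[of _ u y] by simp
  have MLL: ?thesis if "x = BM m" "y = BL n" "u = BL k" for m n k
  proof -
    have "lin_ext (\<lambda>z. lin_ext f (w22_bracket z x)) (w22_bracket y u) =
        - lin_ext (\<lambda>z. lin_ext f (w22_bracket z u)) (w22_bracket x y)
        + lin_ext (\<lambda>z. lin_ext f (w22_bracket z y)) (w22_bracket x u)"
      using LLM[OF that(2,3,1)]
      by (simp only: lin_ext_bracket_antisym[of _ y x] lin_ext_bracket_antisym[of _ u x] flip[of y] minus_minus)
    then show ?thesis by (simp add: flip[of x])
  qed
  show ?thesis
    by (cases x; cases y; cases u)
       ((rule LLL; assumption) | (rule LLM; assumption) | (rule LML; assumption)
        | (rule MLL; assumption) | simp)+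
qed

fun neg_gen :: "w22_basis \<Rightarrow> bool" where
  "neg_gen (BL m) \<longleftrightarrow> m < 0"
| "neg_gen (BM m) \<longleftrightarrow> m < 0"
| "neg_gen _ \<longleftrightarrow> False"

abbreviation neg_word :: "w22_basis list \<Rightarrow> bool" where
  "neg_word ws \<equiv> \<forall>x\<in>set ws. neg_gen x"

fun hw_char :: "complex \<Rightarrow> complex \<Rightarrow> complex \<Rightarrow> complex \<Rightarrow> w22_basis \<Rightarrow> complex" where
  "hw_char cL cM hL hM (BL m) = (if m = 0 then hL else 0)"
| "hw_char cL cM hL hM (BM m) = (if m = 0 then hM else 0)"
| "hw_char cL cM hL hM BCL = cL"
| "hw_char cL cM hL hM BCM = cM"

text \<open>The value of \<open>\<phi>\<close> on \<open>x w\<close>, where a letter \<open>x\<close> that is not negative is commuted to the right until it meets the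
highest weight vector, on which it acts by \<open>\<chi> x\<close>. The form \<open>\<phi>\<close> is an argument so that the recursion can
put letters in front.\<close>

primrec dual_act :: "(w22_basis \<Rightarrow> complex) \<Rightarrow> w22_basis list \<Rightarrow> w22_basis \<Rightarrow> (w22_basis list \<Rightarrow> complex) \<Rightarrow> complex"
where
  "dual_act \<chi> [] x \<phi> = (if neg_gen x then \<phi> [x] else \<chi> x * \<phi> [])"
| "dual_act \<chi> (y # w) x \<phi> = (if neg_gen x then \<phi> (x # y # w)
     else dual_act \<chi> w x (\<lambda>v. \<phi> (y # v)) + lin_ext (\<lambda>z. dual_act \<chi> w z \<phi>) (w22_bracket x y))"

lemma dual_act_neg: "neg_gen x \<Longrightarrow> dual_act \<chi> w x \<phi> = \<phi> (x # w)"
  by (cases w) auto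

lemma dual_act_add: "dual_act \<chi> w x (\<lambda>v. \<phi> v + \<psi> v) = dual_act \<chi> w x \<phi> + dual_act \<chi> w x \<psi>"
  by (induction w arbitrary: x \<phi> \<psi>) (auto simp: algebra_simps lin_ext_fun_add)

lemma dual_act_scale: "dual_act \<chi> w x (\<lambda>v. c * \<phi> v) = c * dual_act \<chi> w x \<phi>"
proof (induction w arbitrary: x \<phi>)
  case (Cons y w)
  show ?case by (simp add: Cons distrib_left lin_ext_fun_scale)
qed simp

lemma dual_act_zero: "dual_act \<chi> w x (\<lambda>v. 0) = 0"
  using dual_act_scale[of \<chi> w x 0 "\<lambda>v. 0"] by simp

lemma dual_act_lin_ext: "dual_act \<chi> w x (\<lambda>v. lin_ext (\<lambda>u. F u v) V) = lin_ext (\<lambda>u. dual_act \<chi> w x (F u)) V"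
proof (induction V rule: poly_mapping_induct)
  case zero
  show ?case by (simp only: lin_ext_zero dual_act_zero)
next
  case (single k c)
  show ?case unfolding lin_ext_single by (rule dual_act_scale)
next
  case (add V W)
  show ?case unfolding lin_ext_add add[symmetric] by (rule dual_act_add)
qed

lemma dual_act_minus: "dual_act \<chi> w x (\<lambda>v. \<phi> v - \<psi> v) = dual_act \<chi> w x \<phi> - dual_act \<chi> w x \<psi>"
  using dual_act_add[of \<chi> w x "\<lambda>v. \<phi> v - \<psi> v" \<psi>] unfolding diff_add_cancel by simp

lemma dual_act_cong:
  assumes "\<And>v. neg_word v \<Longrightarrow> \<phi> v = \<psi> v" "neg_word w"
  shows "dual_act \<chi> w x \<phi> = dual_act \<chi> w x \<psi>"
  using assms
proof (induction w arbitrary: x \<phi> \<psi>)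
  case Nil
  have "\<phi> [] = \<psi> []" by (rule Nil(1)) simp
  moreover have "\<phi> [x] = \<psi> [x]" if "neg_gen x" by (rule Nil(1)) (use that in simp)
  ultimately show ?case by simp
next
  case (Cons y w)
  have w: "neg_word w" and y: "neg_gen y" using Cons.prems(2) by simp_all
  show ?case
  proof (cases "neg_gen x")
    case True
    have "\<phi> (x # y # w) = \<psi> (x # y # w)"
      by (rule Cons.prems(1)) (use True y w in simp)
    with True show ?thesis by simp
  next
    case False
    have 1: "dual_act \<chi> w x (\<lambda>v. \<phi> (y # v)) = dual_act \<chi> w x (\<lambda>v. \<psi> (y # v))"
      by (rule Cons.IH[OF _ w], rule Cons.prems(1)) (use y in simp)
    have 2: "(\<lambda>z. dual_act \<chi> w z \<phi>) = (\<lambda>z. dual_act \<chi> w z \<psi>)"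
      by (rule ext, rule Cons.IH[OF Cons.prems(1) w])
    show ?thesis using False by (simp only: dual_act.simps if_False 1 2)
  qed
qed

definition respects_neg :: "(w22_basis list \<Rightarrow> complex) \<Rightarrow> bool" where
  "respects_neg \<phi> \<longleftrightarrow> (\<forall>a b y z. neg_word a \<longrightarrow> neg_word b \<longrightarrow> neg_gen y \<longrightarrow> neg_gen z \<longrightarrow>
     \<phi> (a @ y # z # b) = \<phi> (a @ z # y # b) + lin_ext (\<lambda>u. \<phi> (a @ u # b)) (w22_bracket y z))"

lemma respects_negD:
  "respects_neg \<phi> \<Longrightarrow> neg_word a \<Longrightarrow> neg_word b \<Longrightarrow> neg_gen y \<Longrightarrow> neg_gen z \<Longrightarrow>
     \<phi> (a @ y # z # b) = \<phi> (a @ z # y # b) + lin_ext (\<lambda>u. \<phi> (a @ u # b)) (w22_bracket y z)"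
  unfolding respects_neg_def by blast

lemma respects_neg_Cons:
  assumes "respects_neg \<phi>" "neg_gen x"
  shows "respects_neg (\<lambda>v. \<phi> (x # v))"
  unfolding respects_neg_def
proof (intro allI impI)
  fix a b y z
  assume "neg_word a" "neg_word b" "neg_gen y" "neg_gen z"
  then show "\<phi> (x # a @ y # z # b) = \<phi> (x # a @ z # y # b)
      + lin_ext (\<lambda>u. \<phi> (x # a @ u # b)) (w22_bracket y z)"
    using respects_negD[OF assms(1), of "x # a" b y z] assms(2) by simp
qed

locale nonneg_character =
  fixes \<chi> :: "w22_basis \<Rightarrow> complex"
  assumes character: "\<not> neg_gen x \<Longrightarrow> \<not> neg_gen y \<Longrightarrow> lin_ext \<chi> (w22_bracket x y) = 0"
begin

abbreviation act where "act x \<phi> \<equiv> (\<lambda>v. dual_act \<chi> v x \<phi>)"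

lemma character':
  assumes "\<not> neg_gen x" "\<not> neg_gen y"
  shows "lin_ext (\<lambda>z. if neg_gen z then f z else \<chi> z * c) (w22_bracket x y) = 0"
proof -
  have "lin_ext (\<lambda>z. if neg_gen z then f z else \<chi> z * c) (w22_bracket x y) = lin_ext \<chi> (w22_bracket x y) * c"
    using assms by (cases x; cases y) (auto simp: algebra_simps)
  then show ?thesis using character[OF assms] by simp
qed

lemma lin_ext_act_neg:
  assumes "neg_gen y" "neg_gen z"
  shows "lin_ext (\<lambda>u. \<phi> (a @ u # b)) (w22_bracket y z)
       = lin_ext (\<lambda>u. dual_act \<chi> b u (\<lambda>v. \<phi> (a @ v))) (w22_bracket y z)"
  using assms by (cases y; cases z) (auto simp: dual_act_neg)

text \<open>The essential point of the construction of forms: the recursive action respects the bracket. Moving a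
letter past the first letter of the word produces brackets of brackets, which cancel by the Jacobi
identity; on the empty word the character property is needed.\<close>

lemma act_commute:
  assumes "respects_neg \<phi>" "neg_word v"
  shows "act y (act x \<phi>) v - act x (act y \<phi>) v = lin_ext (\<lambda>z. act z \<phi> v) (w22_bracket x y)"
  using assms
proof (induction v arbitrary: x y \<phi>)
  have mixed: "act y (act x \<phi>) v - act x (act y \<phi>) v = lin_ext (\<lambda>z. act z \<phi> v) (w22_bracket x y)"
    if "neg_gen y" "\<not> neg_gen x" for \<phi> v x y
    using that by (simp add: dual_act_neg)
  have both: "act y (act x \<phi>) v - act x (act y \<phi>) v = lin_ext (\<lambda>z. act z \<phi> v) (w22_bracket x y)"
    if "neg_gen y" "neg_gen x" "respects_neg \<phi>" "neg_word v" for \<phi> v x y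
    using that respects_negD[of \<phi> "[]" v x y] lin_ext_act_neg[of x y \<phi> "[]" v]
    by (simp add: dual_act_neg)
  have neg: "act y (act x \<phi>) v - act x (act y \<phi>) v = lin_ext (\<lambda>z. act z \<phi> v) (w22_bracket x y)"
    if "neg_gen y \<or> neg_gen x" "respects_neg \<phi>" "neg_word v" for \<phi> v x y
    using mixed[of y x v \<phi>] mixed[of x y v \<phi>] both[of y x \<phi> v] that
      lin_ext_bracket_antisym[of "\<lambda>z. act z \<phi> v" x y]
    by (cases "neg_gen x"; cases "neg_gen y") (auto simp: algebra_simps)
  {
    case Nil
    show ?case
    proof (cases "neg_gen x \<or> neg_gen y")
      case False
      then show ?thesis using character'[of x y] by simp
    next
      case True
      show ?thesis by (rule neg) (use True Nil in auto)
    qed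
  next
    case (Cons u v)
    show ?case
    proof (cases "neg_gen x \<or> neg_gen y")
      case True
      then show ?thesis using neg Cons.prems by blast
    next
      case False
      then have nx: "\<not> neg_gen x" "\<not> neg_gen y" by auto
      have u: "neg_gen u" and v: "neg_word v" using Cons.prems by auto
      note \<phi> = \<open>respects_neg \<phi>\<close>
      note \<phi>u = respects_neg_Cons[OF \<phi> u]
      let ?\<phi>u = "\<lambda>v. \<phi> (u # v)"
      have pull: "act y (act x \<phi>) (u # v) = act y (act x ?\<phi>u) v
          + lin_ext (\<lambda>z. act y (act z \<phi>) v) (w22_bracket x u)
          + lin_ext (\<lambda>z. act z (act x \<phi>) v) (w22_bracket y u)"
        if "\<not> neg_gen x" "\<not> neg_gen y" for x y
        using that by (simp add: dual_act_add dual_act_lin_ext)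
      have "act y (act x \<phi>) (u # v) - act x (act y \<phi>) (u # v) =
          (act y (act x ?\<phi>u) v - act x (act y ?\<phi>u) v)
          + lin_ext (\<lambda>z. act y (act z \<phi>) v - act z (act y \<phi>) v) (w22_bracket x u)
          + lin_ext (\<lambda>z. act z (act x \<phi>) v - act x (act z \<phi>) v) (w22_bracket y u)"
        unfolding pull[OF nx] pull[OF nx(2,1)] lin_ext_fun_minus by (simp add: algebra_simps)
      also have "\<dots> = lin_ext (\<lambda>z. act z ?\<phi>u v) (w22_bracket x y)
          + (lin_ext (\<lambda>z. lin_ext (\<lambda>t. act t \<phi> v) (w22_bracket z y)) (w22_bracket x u)
          + lin_ext (\<lambda>z. lin_ext (\<lambda>t. act t \<phi> v) (w22_bracket x z)) (w22_bracket y u))"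
        by (simp only: Cons.IH[OF \<phi>u v] Cons.IH[OF \<phi> v] add.assoc)
      also have "\<dots> = lin_ext (\<lambda>z. act z ?\<phi>u v + lin_ext (\<lambda>t. act t \<phi> v) (w22_bracket z u)) (w22_bracket x y)"
        by (simp only: lin_ext_fun_add jacobi[symmetric])
      also have "\<dots> = lin_ext (\<lambda>z. act z \<phi> (u # v)) (w22_bracket x y)"
        using nx by (cases x; cases y) auto
      finally show ?thesis .
    qed
  }
qed

lemma respects_neg_act:
  assumes "respects_neg \<phi>"
  shows "respects_neg (act x \<phi>)"
proof -
  have "act x \<phi> (a @ y # z # b) = act x \<phi> (a @ z # y # b) + lin_ext (\<lambda>u. act x \<phi> (a @ u # b)) (w22_bracket y z)"
    if "respects_neg \<phi>" "neg_word a" "neg_word b" "neg_gen y" "neg_gen z" for \<phi> a b y z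
    using that
  proof (induction a arbitrary: x \<phi>)
    case Nil
    show ?case
    proof (cases "neg_gen x")
      case True
      then show ?thesis
        using respects_negD[OF respects_neg_Cons[OF Nil(1) True], of "[]" b y z] Nil by (simp add: dual_act_neg)
    next
      case False
      note \<phi> = Nil(1) and b = Nil(3) and yz = Nil(4,5)
      have pull: "act x \<phi> (y # z # b) = act x (act z (act y \<phi>)) b
            + lin_ext (\<lambda>u. act u (act y \<phi>) b) (w22_bracket x z)
            + lin_ext (\<lambda>u. act z (act u \<phi>) b) (w22_bracket x y)" if "neg_gen y" "neg_gen z" for y z
        using that False by (simp add: dual_act_neg)
      have neg2: "act z (act y \<phi>) v - act y (act z \<phi>) v = lin_ext (\<lambda>u. act u \<phi> v) (w22_bracket y z)"
        if "neg_word v" for v using act_commute[OF \<phi> that] .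
      have "act x \<phi> (y # z # b) - act x \<phi> (z # y # b) =
          (act x (act z (act y \<phi>)) b - act x (act y (act z \<phi>)) b)
          + (lin_ext (\<lambda>u. act z (act u \<phi>) b - act u (act z \<phi>) b) (w22_bracket x y)
          + lin_ext (\<lambda>u. act u (act y \<phi>) b - act y (act u \<phi>) b) (w22_bracket x z))"
        unfolding pull[OF yz] pull[OF yz(2,1)] lin_ext_fun_minus by (simp add: algebra_simps)
      also have "act x (act z (act y \<phi>)) b - act x (act y (act z \<phi>)) b =
          act x (\<lambda>v. lin_ext (\<lambda>u. act u \<phi> v) (w22_bracket y z)) b"
        unfolding dual_act_minus[symmetric] using b neg2 by (intro dual_act_cong) auto
      also have "\<dots> = lin_ext (\<lambda>u. act x (act u \<phi>) b) (w22_bracket y z)"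
        by (rule dual_act_lin_ext)
      also have "lin_ext (\<lambda>u. act z (act u \<phi>) b - act u (act z \<phi>) b) (w22_bracket x y)
          + lin_ext (\<lambda>u. act u (act y \<phi>) b - act y (act u \<phi>) b) (w22_bracket x z)
        = lin_ext (\<lambda>t. lin_ext (\<lambda>u. act u \<phi> b) (w22_bracket t z)) (w22_bracket x y)
          - lin_ext (\<lambda>t. lin_ext (\<lambda>u. act u \<phi> b) (w22_bracket t y)) (w22_bracket x z)"
      proof -
        have "act u (act y \<phi>) b - act y (act u \<phi>) b = - lin_ext (\<lambda>t. act t \<phi> b) (w22_bracket u y)" for u
          using act_commute[OF \<phi> b, of y u] by (metis minus_diff_eq)
        then show ?thesis by (simp add: act_commute[OF \<phi> b] lin_ext_def sum_negf)
      qed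
      also have "\<dots> = lin_ext (\<lambda>t. lin_ext (\<lambda>u. act u \<phi> b) (w22_bracket x t)) (w22_bracket y z)"
        using jacobi[of "\<lambda>u. act u \<phi> b" z x y] by simp
      finally have "act x \<phi> (y # z # b) - act x \<phi> (z # y # b) =
        lin_ext (\<lambda>u. act x (act u \<phi>) b + lin_ext (\<lambda>t. act t \<phi> b) (w22_bracket x u)) (w22_bracket y z)"
        by (simp add: lin_ext_fun_add)
      also have "\<dots> = lin_ext (\<lambda>u. act x \<phi> (u # b)) (w22_bracket y z)"
        using yz False by (cases y; cases z) (auto simp: dual_act_neg)
      finally show ?thesis unfolding append_Nil diff_eq_eq by (simp only: add.commute)
    qed
  next
    case (Cons u a)
    show ?case
    proof (cases "neg_gen x")
      case True
      then show ?thesis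
        using respects_negD[OF respects_neg_Cons[OF Cons.prems(1) True], of "u # a" b y z] Cons.prems
        by (simp add: dual_act_neg)
    next
      case False
      have u: "neg_gen u" using Cons.prems by simp
      let ?\<phi>u = "\<lambda>v. \<phi> (u # v)"
      have expand: "act x \<phi> (u # s) = act x ?\<phi>u s + lin_ext (\<lambda>w. act w \<phi> s) (w22_bracket x u)" for s
        using False by simp
      have a: "neg_word a" using Cons.prems by simp
      note IH = Cons.IH[OF respects_neg_Cons[OF Cons.prems(1) u] a Cons.prems(3-5)]
        Cons.IH[OF Cons.prems(1) a Cons.prems(3-5)]
      show ?thesis
        unfolding append_Cons expand IH lin_ext_fun_add
          lin_ext_swap[of _ "w22_bracket y z" "w22_bracket x u"] by (simp only: add_ac)
    qed
  qed
  then show ?thesis using assms unfolding respects_neg_def by blast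
qed

primrec eval_word :: "w22_basis list \<Rightarrow> (w22_basis list \<Rightarrow> complex) \<Rightarrow> complex" where
  "eval_word [] \<phi> = \<phi> []"
| "eval_word (x # ws) \<phi> = eval_word ws (\<lambda>v. dual_act \<chi> v x \<phi>)"

lemma eval_word_neg: "neg_word ws \<Longrightarrow> eval_word ws \<phi> = \<phi> ws"
  by (induction ws arbitrary: \<phi>) (auto simp: dual_act_neg)

lemma eval_word_cong:
  assumes "\<And>v. neg_word v \<Longrightarrow> \<phi> v = \<psi> v"
  shows "eval_word ws \<phi> = eval_word ws \<psi>"
  using assms
proof (induction ws arbitrary: \<phi> \<psi>)
  case Nil
  show ?case using Nil[of "[]"] by simp
next
  case (Cons x ws)
  show ?case unfolding eval_word.simps
    by (intro Cons.IH dual_act_cong) (use Cons.prems in auto)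
qed

lemma eval_word_add: "eval_word ws (\<lambda>v. \<phi> v + \<psi> v) = eval_word ws \<phi> + eval_word ws \<psi>"
  by (induction ws arbitrary: \<phi> \<psi>) (auto simp: dual_act_add)

lemma eval_word_scale: "eval_word ws (\<lambda>v. c * \<phi> v) = c * eval_word ws \<phi>"
  by (induction ws arbitrary: \<phi>) (auto simp: dual_act_scale)

lemma eval_word_zero: "eval_word ws (\<lambda>v. 0) = 0"
  by (induction ws) (simp_all add: dual_act_zero)

lemma eval_word_lin_ext: "eval_word ws (\<lambda>v. lin_ext (\<lambda>u. F u v) V) = lin_ext (\<lambda>u. eval_word ws (F u)) V"
proof (induction V rule: poly_mapping_induct)
  case zero
  show ?case by (simp only: lin_ext_zero eval_word_zero)
next
  case (single k c)
  show ?case unfolding lin_ext_single by (rule eval_word_scale)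
next
  case (add V W)
  show ?case unfolding lin_ext_add add[symmetric] by (rule eval_word_add)
qed

lemma eval_word_relation:
  assumes "respects_neg \<phi>"
  shows "eval_word (a @ x # y # b) \<phi> - eval_word (a @ y # x # b) \<phi>
    = lin_ext (\<lambda>z. eval_word (a @ z # b) \<phi>) (w22_bracket x y)"
  using assms
proof (induction a arbitrary: \<phi>)
  case Nil
  have "eval_word b (act y (act x \<phi>)) =
      eval_word b (\<lambda>v. act x (act y \<phi>) v + lin_ext (\<lambda>z. act z \<phi> v) (w22_bracket x y))"
    using act_commute[OF Nil, of _ y x] by (intro eval_word_cong) (simp add: algebra_simps)
  then show ?case by (simp add: eval_word_add eval_word_lin_ext)
next
  case (Cons u a)
  then show ?case using Cons.IH[OF respects_neg_act] by simp
qed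

lemma lin_ext_lie_ideal:
  assumes "respects_neg \<phi>" "t \<in> lie_ideal"
  shows "lin_ext (\<lambda>ws. eval_word ws \<phi>) t = 0"
  using assms(2)
proof (induction rule: lie_ideal.induct)
  case (rel a x y b)
  show ?case
  proof (induction a rule: poly_mapping_induct)
    case (single wa ca)
    show ?case
    proof (induction b rule: poly_mapping_induct)
      case (single wb cb)
      have lin: "lin_ext f (Poly_Mapping.single wa ca * tensor_lin v * Poly_Mapping.single wb cb)
          = ca * cb * lin_ext (\<lambda>z. f (wa @ z # wb)) v" for f v
      proof (induction v rule: poly_mapping_induct)
        case zero
        show ?case by (simp add: tensor_lin_def)
      next
        case (single k v)
        show ?case by (simp add: tensor_lin_single mult_single plus_list_def)
      next
        case (add v v')
        then show ?case by (simp add: tensor_lin_add distrib_left distrib_right)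
      qed
      have mono: "lin_ext f (Poly_Mapping.single wa ca * (tensor_gen u * tensor_gen v) * Poly_Mapping.single wb cb)
          = ca * cb * f (wa @ u # v # wb)" for f u v
        by (simp add: tensor_gen_def mult_single plus_list_def)
      show ?case
        unfolding left_diff_distrib right_diff_distrib lin_ext_minus lin mono
          eval_word_relation[OF assms(1), symmetric] by (simp add: right_diff_distrib)
    qed (simp_all only: distrib_left lin_ext_add mult_zero_right lin_ext_zero add_0_left)
  qed (simp_all only: distrib_right lin_ext_add mult_zero_left lin_ext_zero add_0_left)
qed (simp_all only: lin_ext_add lin_ext_zero add_0_left)

end

text \<open>The independence half of the Poincare-Birkhoff-Witt theorem, in dual form: a form on negative words
which respects the relations among them extends to \<open>U\<close>, and the last property makes it vanish on the
left ideal of the Verma module.\<close>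

lemma verma_functional:
  assumes "respects_neg \<phi>"
  obtains \<Phi> :: "w22_env \<Rightarrow> complex"
  where "\<And>u v. \<Phi> (u + v) = \<Phi> u + \<Phi> v" "\<And>c u. \<Phi> (c \<cdot> u) = c * \<Phi> u"
    "\<And>ws. neg_word ws \<Longrightarrow> \<Phi> (word ws) = \<phi> ws"
    "\<And>u x. \<not> neg_gen x \<Longrightarrow> \<Phi> (u * env_gen x) = hw_char cL cM hL hM x * \<Phi> u"
proof -
  interpret nonneg_character "hw_char cL cM hL hM"
  proof
    have nn: "\<not> m < 0 \<Longrightarrow> \<not> n < 0 \<Longrightarrow> m + n = 0 \<longleftrightarrow> m = 0 \<and> n = 0" for m n :: int by auto
    fix x y assume "\<not> neg_gen x" "\<not> neg_gen y"
    then show "lin_ext (hw_char cL cM hL hM) (w22_bracket x y) = 0"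
      using nn by (cases x; cases y) auto
  qed
  define F where "F = lin_ext (\<lambda>ws. eval_word ws \<phi>)"
  define \<Phi> where "\<Phi> u = F (rep_w22_env u)" for u
  have \<Phi>: "\<Phi> (abs_w22_env t) = F t" for t
  proof -
    have "lie_rel (rep_w22_env (abs_w22_env t)) t"
      unfolding w22_env.abs_eq_iff[symmetric] by (rule Quotient3_abs_rep[OF Quotient3_w22_env])
    then show ?thesis
      using lin_ext_lie_ideal[OF assms, of "rep_w22_env (abs_w22_env t) - t"]
      by (simp add: \<Phi>_def F_def lie_rel_def)
  qed
  have rep_abs: "abs_w22_env (rep_w22_env u) = u" for u
    by (rule Quotient3_abs_rep[OF Quotient3_w22_env])
  have add: "\<Phi> (u + v) = \<Phi> u + \<Phi> v" for u v
  proof -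
    obtain s t where "u = abs_w22_env s" "v = abs_w22_env t" by (metis rep_abs)
    then show ?thesis by (simp add: \<Phi> plus_w22_env.abs_eq) (simp add: F_def)
  qed
  have val: "\<Phi> (c \<cdot> word ws) = c * eval_word ws \<phi>" for c ws
    by (simp flip: word_abs add: \<Phi>) (simp add: F_def)
  have \<Phi>0: "\<Phi> 0 = 0" using add[of 0 0] by simp
  have scale: "\<Phi> (c \<cdot> u) = c * \<Phi> u" for c u
  proof (induction u rule: word_induct)
    case (word d ws)
    show ?case unfolding env.scale_scale val by simp
  qed (simp_all add: add \<Phi>0 env.scale_right_distrib distrib_left)
  have snoc: "eval_word (ws @ [x]) \<phi> = hw_char cL cM hL hM x * eval_word ws \<phi>"
    if "\<not> neg_gen x" for ws x \<phi>
    using that by (induction ws arbitrary: \<phi>) auto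
  have nonneg: "\<Phi> (u * env_gen x) = hw_char cL cM hL hM x * \<Phi> u" if "\<not> neg_gen x" for u x
  proof (induction u rule: word_induct)
    case zero
    show ?case by (simp add: \<Phi>0)
  next
    case (word c ws)
    show ?case using val[of c "ws @ [x]"] val[of c ws] snoc[OF that] by simp
  qed (simp_all add: add distrib_right distrib_left)
  have neg: "\<Phi> (word ws) = \<phi> ws" if "neg_word ws" for ws
    using val[of 1 ws] eval_word_neg[OF that] by simp
  show ?thesis by (rule that[OF add scale neg nonneg])
qed



section \<open>Modules as quotients of left ideals\<close>

definition left_ideal :: "w22_env set \<Rightarrow> bool" where
  "left_ideal I \<longleftrightarrow> 0 \<in> I \<and> (\<forall>x\<in>I. \<forall>y\<in>I. x + y \<in> I) \<and> (\<forall>u. \<forall>x\<in>I. u * x \<in> I)"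

lemma left_idealI:
  assumes "0 \<in> I" "\<And>x y. x \<in> I \<Longrightarrow> y \<in> I \<Longrightarrow> x + y \<in> I" "\<And>u x. x \<in> I \<Longrightarrow> u * x \<in> I"
  shows "left_ideal I"
  using assms by (simp add: left_ideal_def)

lemma left_ideal_zero: "left_ideal I \<Longrightarrow> 0 \<in> I"
  and left_ideal_add: "left_ideal I \<Longrightarrow> x \<in> I \<Longrightarrow> y \<in> I \<Longrightarrow> x + y \<in> I"
  and left_ideal_mult: "left_ideal I \<Longrightarrow> x \<in> I \<Longrightarrow> u * x \<in> I"
  by (simp_all add: left_ideal_def)

lemma left_ideal_uminus: "left_ideal I \<Longrightarrow> x \<in> I \<Longrightarrow> - x \<in> I"
  using left_ideal_mult[of I x "- 1"] by simp

lemma left_ideal_diff: "left_ideal I \<Longrightarrow> x \<in> I \<Longrightarrow> y \<in> I \<Longrightarrow> x - y \<in> I"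
  using left_ideal_add[of I x "- y"] left_ideal_uminus[of I y] by simp

lemma left_ideal_scale: "left_ideal I \<Longrightarrow> x \<in> I \<Longrightarrow> c \<cdot> x \<in> I"
  by (simp add: scale_env_def left_ideal_mult)

lemma left_ideal_subspace: "left_ideal I \<Longrightarrow> env_subspace I"
  by (simp add: env.subspace_def left_ideal_zero left_ideal_add left_ideal_scale)

lemma left_ideal_UNIV: "left_ideal UNIV" and left_ideal_0: "left_ideal {0}"
  by (simp_all add: left_ideal_def)

text \<open>The module \<open>V\<close> is \<open>A/B\<close> with projection \<open>q\<close>. All modules that occur have this form, and
submodules, quotients, generators, irreducibility and singular vectors turn into statements on left ideals
between \<open>B\<close> and \<open>A\<close>.\<close>

definition presents :: "'v w22_module \<Rightarrow> (w22_env \<Rightarrow> 'v) \<Rightarrow> w22_env set \<Rightarrow> w22_env set \<Rightarrow> bool" where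
  "presents V q A B \<longleftrightarrow> left_ideal A \<and> left_ideal B \<and> B \<subseteq> A \<and> carrier V = q ` A \<and> \<zero>\<^bsub>V\<^esub> = q 0 \<and>
     (\<forall>x\<in>A. \<forall>y\<in>A. q x = q y \<longleftrightarrow> x - y \<in> B) \<and>
     (\<forall>x\<in>A. \<forall>y\<in>A. q x \<oplus>\<^bsub>V\<^esub> q y = q (x + y)) \<and>
     (\<forall>u. \<forall>x\<in>A. u \<odot>\<^bsub>V\<^esub> q x = q (u * x))"

lemma presentsD:
  assumes "presents V q A B"
  shows "left_ideal A" "left_ideal B" "B \<subseteq> A" "carrier V = q ` A" "\<zero>\<^bsub>V\<^esub> = q 0"
    "x \<in> A \<Longrightarrow> y \<in> A \<Longrightarrow> q x = q y \<longleftrightarrow> x - y \<in> B"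
    "x \<in> A \<Longrightarrow> y \<in> A \<Longrightarrow> q x \<oplus>\<^bsub>V\<^esub> q y = q (x + y)"
    "x \<in> A \<Longrightarrow> u \<odot>\<^bsub>V\<^esub> q x = q (u * x)"
  using assms by (simp_all add: presents_def)

lemma presents_zero_iff:
  assumes "presents V q A B" "x \<in> A"
  shows "q x = \<zero>\<^bsub>V\<^esub> \<longleftrightarrow> x \<in> B"
  using presentsD(6)[OF assms(1,2), of 0] presentsD(1,5)[OF assms(1)] left_ideal_zero[of A] by simp

lemma presents_inv:
  assumes P: "presents V q A B" and x: "x \<in> A"
  shows "inv\<^bsub>add_monoid V\<^esub> (q x) = q (- x)"
proof -
  have A: "left_ideal A" and B: "left_ideal B" using presentsD[OF P] by auto
  have mx: "- x \<in> A" using left_ideal_uminus[OF A x] .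
  show ?thesis unfolding m_inv_def
  proof (rule the_equality)
    show "q (- x) \<in> carrier (add_monoid V) \<and>
        q x \<otimes>\<^bsub>add_monoid V\<^esub> q (- x) = \<one>\<^bsub>add_monoid V\<^esub> \<and> q (- x) \<otimes>\<^bsub>add_monoid V\<^esub> q x = \<one>\<^bsub>add_monoid V\<^esub>"
      using presentsD(4,5)[OF P] presentsD(7)[OF P x mx] presentsD(7)[OF P mx x] mx by simp
  next
    fix y
    assume y: "y \<in> carrier (add_monoid V) \<and>
        q x \<otimes>\<^bsub>add_monoid V\<^esub> y = \<one>\<^bsub>add_monoid V\<^esub> \<and> y \<otimes>\<^bsub>add_monoid V\<^esub> q x = \<one>\<^bsub>add_monoid V\<^esub>"
    then obtain z where z: "z \<in> A" "y = q z" using presentsD(4)[OF P] by auto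
    have "q (x + z) = q 0" using y z presentsD(5)[OF P] presentsD(7)[OF P x z(1)] by simp
    then have "x + z \<in> B"
      using presentsD(6)[OF P left_ideal_add[OF A x z(1)] left_ideal_zero[OF A]] by simp
    then have "z - (- x) \<in> B" by (simp add: add.commute)
    then show "y = q (- x)" using presentsD(6)[OF P z(1) mx] z by simp
  qed
qed

lemma presents_submodule:
  assumes P: "presents V q A B"
  shows "w22_submodule N V \<longleftrightarrow> (\<exists>X. left_ideal X \<and> B \<subseteq> X \<and> X \<subseteq> A \<and> N = q ` X)"
proof
  note A = presentsD(1)[OF P] and B = presentsD(2)[OF P]
  assume N: "w22_submodule N V"
  then have sub: "N \<subseteq> q ` A" and add: "\<And>x y. x \<in> N \<Longrightarrow> y \<in> N \<Longrightarrow> x \<oplus>\<^bsub>V\<^esub> y \<in> N"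
    and zero: "\<zero>\<^bsub>V\<^esub> \<in> N" and smult: "\<And>u x. x \<in> N \<Longrightarrow> u \<odot>\<^bsub>V\<^esub> x \<in> N"
    unfolding submodule_def subgroup_def submodule_axioms_def
    by (auto simp: env_ring_def presentsD(4)[OF P])
  define X where "X = {x \<in> A. q x \<in> N}"
  have "left_ideal X"
  proof (rule left_idealI)
    show "0 \<in> X" using zero presentsD(5)[OF P] left_ideal_zero[OF A] by (simp add: X_def)
    show "x + y \<in> X" if "x \<in> X" "y \<in> X" for x y
      using that add[of "q x" "q y"] presentsD(7)[OF P, of x y] left_ideal_add[OF A] by (simp add: X_def)
    show "u * x \<in> X" if "x \<in> X" for u x
      using that smult[of "q x" u] presentsD(8)[OF P, of x u] left_ideal_mult[OF A] by (simp add: X_def)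
  qed
  moreover have "B \<subseteq> X"
    using presents_zero_iff[OF P] zero presentsD(3)[OF P] unfolding X_def
    by (metis (mono_tags, lifting) mem_Collect_eq subsetD subsetI)
  moreover have "N = q ` X" using sub by (auto simp: X_def)
  moreover have "X \<subseteq> A" by (auto simp: X_def)
  ultimately show "\<exists>X. left_ideal X \<and> B \<subseteq> X \<and> X \<subseteq> A \<and> N = q ` X" by blast
next
  assume "\<exists>X. left_ideal X \<and> B \<subseteq> X \<and> X \<subseteq> A \<and> N = q ` X"
  then obtain X where X: "left_ideal X" "B \<subseteq> X" "X \<subseteq> A" "N = q ` X" by blast
  have in_A: "x \<in> A" if "x \<in> X" for x using that X by auto
  have "inv\<^bsub>add_monoid V\<^esub> y \<in> q ` X" if "y \<in> q ` X" for y
    using that presents_inv[OF P] in_A left_ideal_uminus[OF X(1)] by auto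
  then show "w22_submodule N V"
    unfolding submodule_def subgroup_def submodule_axioms_def X(4)
    using X(1,3) in_A presentsD(4,5)[OF P]
    by (auto simp: presentsD(7)[OF P] presentsD(8)[OF P]
        intro!: imageI left_ideal_add left_ideal_mult left_ideal_zero)
qed

lemma left_ideal_Inter: "(\<And>X. X \<in> F \<Longrightarrow> left_ideal X) \<Longrightarrow> left_ideal (\<Inter>F)"
  by (auto simp: left_ideal_def)

definition ideal_join :: "w22_env \<Rightarrow> w22_env set \<Rightarrow> w22_env set" where
  "ideal_join a B = {u * a + b |u b. b \<in> B}"

lemma left_ideal_join:
  assumes "left_ideal B"
  shows "left_ideal (ideal_join a B)"
proof (rule left_idealI)
  show "0 \<in> ideal_join a B"
    unfolding ideal_join_def using left_ideal_zero[OF assms] by (auto intro!: exI[of _ 0])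
  show "x + y \<in> ideal_join a B" if "x \<in> ideal_join a B" "y \<in> ideal_join a B" for x y
  proof -
    from that(1) obtain u b where 1: "x = u * a + b" "b \<in> B" by (auto simp: ideal_join_def)
    from that(2) obtain u' b' where 2: "y = u' * a + b'" "b' \<in> B" by (auto simp: ideal_join_def)
    from 1 2
have "x + y = (u + u') * a + (b + b')" "b + b' \<in> B"
      using left_ideal_add[OF assms] by (simp_all add: algebra_simps)
    then show ?thesis unfolding ideal_join_def by blast
  qed
  show "w * x \<in> ideal_join a B" if "x \<in> ideal_join a B" for w x
  proof -
    from that obtain u b where "x = u * a + b" "b \<in> B"
      by (auto simp: ideal_join_def)
    then have "w * x = (w * u) * a + w * b" "w * b \<in> B"
      using left_ideal_mult[OF assms] by (simp_all add: algebra_simps)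
    then show ?thesis unfolding ideal_join_def by blast
  qed
qed

lemma ideal_join_base: "left_ideal B \<Longrightarrow> a \<in> ideal_join a B"
  unfolding ideal_join_def using left_ideal_zero[of B] by (force intro: exI[of _ 1])

lemma ideal_join_mult: "left_ideal B \<Longrightarrow> u * a \<in> ideal_join a B"
  by (simp add: ideal_join_base left_ideal_join left_ideal_mult)

lemma ideal_join_ideal: "B \<subseteq> ideal_join a B"
proof
  fix x assume "x \<in> B"
  then show "x \<in> ideal_join a B" unfolding ideal_join_def by (force intro: exI[of _ 0])
qed

lemma ideal_join_least: "left_ideal X \<Longrightarrow> a \<in> X \<Longrightarrow> B \<subseteq> X \<Longrightarrow> ideal_join a B \<subseteq> X"
  unfolding ideal_join_def by (auto intro!: left_ideal_add left_ideal_mult)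

lemma presents_generated:
  assumes P: "presents V q A B" and a: "a \<in> A"
  shows "generated_submodule V {q a} = q ` ideal_join a B"
proof
  note A = presentsD(1)[OF P] and B = presentsD(2)[OF P]
  have sub: "ideal_join a B \<subseteq> A"
    using ideal_join_least[OF A a presentsD(3)[OF P]] .
  have "w22_submodule (q ` ideal_join a B) V"
    unfolding presents_submodule[OF P] using left_ideal_join[OF B] ideal_join_ideal sub by blast
  moreover have "q a \<in> q ` ideal_join a B" using ideal_join_base[OF B] by blast
  ultimately show "generated_submodule V {q a} \<subseteq> q ` ideal_join a B"
    unfolding generated_submodule_def by blast
  show "q ` ideal_join a B \<subseteq> generated_submodule V {q a}"
    unfolding generated_submodule_def
  proof (rule Inter_greatest)
    fix N assume "N \<in> {N. w22_submodule N V \<and> {q a} \<subseteq> N}"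
    then obtain X where X: "left_ideal X" "B \<subseteq> X" "X \<subseteq> A" "N = q ` X" and "q a \<in> q ` X"
      unfolding presents_submodule[OF P] by blast
    then obtain x where x: "x \<in> X" "q a = q x" by blast
    then have "a - x \<in> B" using presentsD(6)[OF P a, of x] X by blast
    then have "a - x + x \<in> X" using X x left_ideal_add by blast
    then have "ideal_join a B \<subseteq> X" using ideal_join_least X by simp
    then show "q ` ideal_join a B \<subseteq> N" using X by blast
  qed
qed

lemma presents_restrict:
  assumes "presents V q A B" "left_ideal A'" "B \<subseteq> A'" "A' \<subseteq> A"
  shows "presents (V\<lparr>carrier := q ` A'\<rparr>) q A' B"
proof -
  have in_A: "x \<in> A" if "x \<in> A'" for x using that assms(4) by blast
  show ?thesis
    unfolding presents_def using assms presentsD(5)[OF assms(1)]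
    by (auto simp: presentsD(6-8)[OF assms(1)] presentsD(2)[OF assms(1)] in_A)
qed

lemma presents_quotient:
  assumes P: "presents V q A B" and C: "left_ideal C" "B \<subseteq> C" "C \<subseteq> A"
  shows "presents (quotient_module V (q ` C)) (\<lambda>x. q ` C +>\<^bsub>V\<^esub> q x) A C"
proof -
  note A = presentsD(1)[OF P] and B = presentsD(2)[OF P]
  have coset: "q ` C +>\<^bsub>V\<^esub> q x = q ` {c + x |c. c \<in> C}" if "x \<in> A" for x
  proof -
    have "q c \<oplus>\<^bsub>V\<^esub> q x = q (c + x)" if "c \<in> C" for c
      using presentsD(7)[OF P _ \<open>x \<in> A\<close>] that C(3) by blast
    then show ?thesis unfolding a_r_coset_def' by (simp add: Setcompr_eq_image image_image UNION_singleton_eq_range)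
  qed
  have same: "{c + x |c. c \<in> C} = {c + y |c. c \<in> C}" if "x - y \<in> C" for x y
  proof -
    have "{c + x |c. c \<in> C} \<subseteq> {c + y |c. c \<in> C}" if "x - y \<in> C" for x y
    proof
      fix z assume "z \<in> {c + x |c. c \<in> C}"
      then obtain c where "c \<in> C" "z = (c + (x - y)) + y" by auto
      then show "z \<in> {c + y |c. c \<in> C}" using left_ideal_add[OF C(1) _ that] by blast
    qed
    from this[OF that] this[of y x] left_ideal_uminus[OF C(1) that] show ?thesis by auto
  qed
  have eq: "q ` C +>\<^bsub>V\<^esub> q x = q ` C +>\<^bsub>V\<^esub> q y \<longleftrightarrow> x - y \<in> C" if x: "x \<in> A" and y: "y \<in> A" for x y
  proof
    assume "q ` C +>\<^bsub>V\<^esub> q x = q ` C +>\<^bsub>V\<^esub> q y"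
    moreover have "q x \<in> q ` {c + x |c. c \<in> C}"
      using left_ideal_zero[OF C(1)] by (intro imageI CollectI exI[of _ 0]) simp
    ultimately have "q x \<in> q ` {c + y |c. c \<in> C}" unfolding coset[OF x] coset[OF y] by auto
    then obtain c where c: "c \<in> C" "q x = q (c + y)" by blast
    then have "x - (c + y) \<in> B" using presentsD(6)[OF P x] left_ideal_add[OF A _ y] C(3) by blast
    then have "(x - (c + y)) + c \<in> C" using left_ideal_add[OF C(1)] c C(2) by blast
    then show "x - y \<in> C" by (simp add: algebra_simps)
  next
    assume "x - y \<in> C"
    then show "q ` C +>\<^bsub>V\<^esub> q x = q ` C +>\<^bsub>V\<^esub> q y"
      unfolding coset[OF x] coset[OF y] using same by simp
  qed
  have add: "set_add V (q ` C +>\<^bsub>V\<^esub> q x) (q ` C +>\<^bsub>V\<^esub> q y) = q ` C +>\<^bsub>V\<^esub> q (x + y)"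
    if x: "x \<in> A" and y: "y \<in> A" for x y
  proof -
    have xy: "x + y \<in> A" using left_ideal_add[OF A x y] .
    have eq1: "q (c + x) \<oplus>\<^bsub>V\<^esub> q (d + y) = q ((c + d) + (x + y))" if "c \<in> C" "d \<in> C" for c d
      using presentsD(7)[OF P, of "c + x" "d + y"] left_ideal_add[OF A] x y C(3) that
      by (metis add.assoc add.left_commute subsetD)
    show ?thesis unfolding coset[OF x] coset[OF y] coset[OF xy]
    proof
      show "q ` {c + x |c. c \<in> C} <+>\<^bsub>V\<^esub> q ` {c + y |c. c \<in> C} \<subseteq> q ` {c + (x + y) |c. c \<in> C}"
        unfolding set_add_def' using eq1 left_ideal_add[OF C(1)] by (auto simp: image_iff)
      show "q ` {c + (x + y) |c. c \<in> C} \<subseteq> q ` {c + x |c. c \<in> C} <+>\<^bsub>V\<^esub> q ` {c + y |c. c \<in> C}"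
      proof
        fix z assume "z \<in> q ` {c + (x + y) |c. c \<in> C}"
        then obtain c where c: "c \<in> C" "z = q (c + x) \<oplus>\<^bsub>V\<^esub> q (0 + y)"
          using eq1[OF _ left_ideal_zero[OF C(1)]] by auto
        then show "z \<in> q ` {c + x |c. c \<in> C} <+>\<^bsub>V\<^esub> q ` {c + y |c. c \<in> C}"
          unfolding set_add_def' using left_ideal_zero[OF C(1)] by blast
      qed
    qed
  qed
  have smult: "(\<Union>z\<in>q ` C +>\<^bsub>V\<^esub> q x. q ` C +>\<^bsub>V\<^esub> (u \<odot>\<^bsub>V\<^esub> z)) = q ` C +>\<^bsub>V\<^esub> q (u * x)" if x: "x \<in> A" for u x
  proof -
    have "q ` C +>\<^bsub>V\<^esub> (u \<odot>\<^bsub>V\<^esub> q (c + x)) = q ` C +>\<^bsub>V\<^esub> q (u * x)" if "c \<in> C" for c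
    proof -
      have cx: "c + x \<in> A" using left_ideal_add[OF A _ x] that C(3) by blast
      have "u * (c + x) - u * x \<in> C" using left_ideal_mult[OF C(1) that] by (simp add: algebra_simps)
      then show ?thesis unfolding presentsD(8)[OF P cx]
        using eq[OF left_ideal_mult[OF A cx] left_ideal_mult[OF A x]] by simp
    qed
    then show ?thesis unfolding coset[OF x] using left_ideal_zero[OF C(1)] by auto
  qed
  have zero: "q ` C = q ` C +>\<^bsub>V\<^esub> q 0" unfolding coset[OF left_ideal_zero[OF A]] by simp
  show ?thesis
    unfolding presents_def quotient_module_def using A C eq add smult zero
    by (auto simp: A_RCOSETS_def' presentsD(4)[OF P])
qed

lemma presents_irreducible:
  assumes P: "presents V q A B" and "A \<noteq> B"
    and "\<And>X. left_ideal X \<Longrightarrow> B \<subseteq> X \<Longrightarrow> X \<subseteq> A \<Longrightarrow> X = B \<or> X = A"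
  shows "irreducible_module V"
proof -
  note A = presentsD(1)[OF P] and B = presentsD(2)[OF P]
  have qB: "q ` B = {\<zero>\<^bsub>V\<^esub>}"
    using presents_zero_iff[OF P] presentsD(3,5)[OF P] left_ideal_zero[OF B] by blast
  obtain a where "a \<in> A" "a \<notin> B" using assms(2) presentsD(3)[OF P] by blast
  then have "q a \<in> carrier V" "q a \<noteq> \<zero>\<^bsub>V\<^esub>"
    using presents_zero_iff[OF P] presentsD(4)[OF P] by auto
  moreover have "N = {\<zero>\<^bsub>V\<^esub>} \<or> N = carrier V" if "w22_submodule N V" for N
    using that assms(3) qB presentsD(4)[OF P] unfolding presents_submodule[OF P] by metis
  ultimately show ?thesis unfolding irreducible_module_def by blast
qed

lemma presents_singular:
  assumes P: "presents V q A B" and x: "x \<in> A"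
  shows "singular_vector V (q x) \<longleftrightarrow> x \<notin> B \<and>
    (\<forall>h\<in>{UL 0, UM 0, UCL, UCM}. \<exists>a. h * x - a \<cdot> x \<in> B) \<and>
    (\<forall>n>0. UL n * x \<in> B \<and> UM n * x \<in> B)"
proof -
  note A = presentsD(1)[OF P]
  have "h \<odot>\<^bsub>V\<^esub> q x = env_scalar a \<odot>\<^bsub>V\<^esub> q x \<longleftrightarrow> h * x - a \<cdot> x \<in> B" for h a
    unfolding presentsD(8)[OF P x]
    using presentsD(6)[OF P left_ideal_mult[OF A x] left_ideal_mult[OF A x]] by (simp add: scale_env_def)
  moreover have "u \<odot>\<^bsub>V\<^esub> q x = \<zero>\<^bsub>V\<^esub> \<longleftrightarrow> u * x \<in> B" for u
    unfolding presentsD(8)[OF P x] using presents_zero_iff[OF P left_ideal_mult[OF A x]] .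
  ultimately show ?thesis
    unfolding singular_vector_def presents_zero_iff[OF P x] presentsD(4)[OF P] using x by simp
qed

lemma composition_seriesI:
  assumes P: "presents V q UNIV J" and "I 0 = UNIV" and I: "\<And>i. left_ideal (I i)" "\<And>i. J \<subseteq> I i"
    and strict: "\<And>i. I (Suc i) \<subset> I i"
    and simple: "\<And>i X. left_ideal X \<Longrightarrow> I (Suc i) \<subseteq> X \<Longrightarrow> X \<subseteq> I i \<Longrightarrow> X = I (Suc i) \<or> X = I i"
    and N: "\<And>i. N i = q ` I i"
  shows "infinite_composition_series V N"
  unfolding infinite_composition_series_def
proof (intro conjI allI)
  show "N 0 = carrier V" using assms(2) N presentsD(4)[OF P] by simp
  fix i
  show "w22_submodule (N i) V"
    unfolding presents_submodule[OF P] N using I by blast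
  have P1: "presents (V\<lparr>carrier := N i\<rparr>) q (I i) J"
    unfolding N by (rule presents_restrict[OF P]) (use I in auto)
  have P2: "presents (quotient_module (V\<lparr>carrier := N i\<rparr>) (N (Suc i)))
      (\<lambda>x. q ` I (Suc i) +>\<^bsub>V\<lparr>carrier := N i\<rparr>\<^esub> q x) (I i) (I (Suc i))"
    unfolding N[of "Suc i"] by (rule presents_quotient[OF P1]) (use I strict[of i] in auto)
  show "irreducible_module (quotient_module (V\<lparr>carrier := N i\<rparr>) (N (Suc i)))"
    by (rule presents_irreducible[OF P2]) (use strict[of i] simple in auto)
  have "N (Suc i) \<subseteq> N i" using strict[of i] N by blast
  moreover have "N (Suc i) \<noteq> N i"
  proof
    assume *: "N (Suc i) = N i"
    obtain a where a: "a \<in> I i" "a \<notin> I (Suc i)" using strict[of i] by blast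
    then obtain b where b: "b \<in> I (Suc i)" "q a = q b" using * N by blast
    then have "a - b \<in> J" using presentsD(6)[OF P] by blast
    then have "a - b + b \<in> I (Suc i)" using I b left_ideal_add by blast
    with a show False by simp
  qed
  ultimately show "N (Suc i) \<subset> N i" by blast
qed

section \<open>The ideal defining a Verma module\<close>

lemma presents_regular: "presents regular_module (\<lambda>u. u) UNIV {0}"
  by (simp add: presents_def regular_module_def left_ideal_UNIV left_ideal_0)

lemma verma_ideal_eq: "verma_ideal cL cM hL hM = \<Inter>{I. left_ideal I \<and>
     (\<forall>x. \<not> neg_gen x \<longrightarrow> env_gen x - env_scalar (hw_char cL cM hL hM x) \<in> I)}"
proof -
  have sub: "w22_submodule N regular_module \<longleftrightarrow> left_ideal N" for N
    using presents_submodule[OF presents_regular, of N] left_ideal_zero by auto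
  have "{UL n |n. 0 < n} \<union> {UM n |n. 0 < n} \<union>
      {UL 0 - env_scalar hL, UM 0 - env_scalar hM, UCL - env_scalar cL, UCM - env_scalar cM} \<subseteq> N
    \<longleftrightarrow> (\<forall>x. \<not> neg_gen x \<longrightarrow> env_gen x - env_scalar (hw_char cL cM hL hM x) \<in> N)" (is "?L \<longleftrightarrow> ?R") for N
  proof
    assume L: ?L
    show ?R
    proof (intro allI impI)
      fix x assume "\<not> neg_gen x"
      then show "env_gen x - env_scalar (hw_char cL cM hL hM x) \<in> N"
        using L by (cases x) (auto simp: not_less le_less)
    qed
  next
    assume R: ?R
    have "UL n \<in> N" "UM n \<in> N" if "n > 0" for n
      using R[rule_format, of "BL n"] R[rule_format, of "BM n"] that by auto
    then show ?L
      using R[rule_format, of "BL 0"] R[rule_format, of "BM 0"] R[rule_format, of BCL] R[rule_format, of BCM]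
      by auto
  qed
  then show ?thesis unfolding verma_ideal_def generated_submodule_def sub by simp
qed

lemma left_ideal_verma: "left_ideal (verma_ideal cL cM hL hM)"
  unfolding verma_ideal_eq by (rule left_ideal_Inter) simp

lemma verma_ideal_gen:
  "\<not> neg_gen x \<Longrightarrow> env_gen x - env_scalar (hw_char cL cM hL hM x) \<in> verma_ideal cL cM hL hM"
  unfolding verma_ideal_eq by blast

lemma verma_ideal_least:
  assumes "left_ideal I" "\<And>x. \<not> neg_gen x \<Longrightarrow> env_gen x - env_scalar (hw_char cL cM hL hM x) \<in> I"
  shows "verma_ideal cL cM hL hM \<subseteq> I"
  unfolding verma_ideal_eq using assms by blast

abbreviation verma_proj :: "complex \<Rightarrow> complex \<Rightarrow> complex \<Rightarrow> complex \<Rightarrow> w22_env \<Rightarrow> w22_env set" where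
  "verma_proj cL cM hL hM u \<equiv> verma_ideal cL cM hL hM +>\<^bsub>regular_module\<^esub> u"

lemma presents_verma:
  "presents (verma cL cM hL hM) (verma_proj cL cM hL hM) UNIV (verma_ideal cL cM hL hM)"
  using presents_quotient[OF presents_regular left_ideal_verma] left_ideal_zero[OF left_ideal_verma]
  unfolding verma_def by simp

lemma verma_proj_smult:
  "u \<odot>\<^bsub>verma cL cM hL hM\<^esub> verma_proj cL cM hL hM a = verma_proj cL cM hL hM (u * a)"
  using presentsD(8)[OF presents_verma] by simp



section \<open>Degrees\<close>

definition has_degree :: "int \<Rightarrow> w22_env \<Rightarrow> bool" where
  "has_degree d x \<longleftrightarrow> UL 0 * x = x * UL 0 + of_int d \<cdot> x"

lemma has_degree_add: "has_degree d x \<Longrightarrow> has_degree d y \<Longrightarrow> has_degree d (x + y)"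
  by (simp add: has_degree_def algebra_simps env.scale_right_distrib)

lemma has_degree_scale: "has_degree d x \<Longrightarrow> has_degree d (c \<cdot> x)"
  by (simp add: has_degree_def env.scale_right_distrib mult.commute)

lemma has_degree_0: "has_degree d 0"
  by (simp add: has_degree_def)

lemma has_degree_1: "has_degree 0 1"
  by (simp add: has_degree_def)

lemma has_degree_mult: "has_degree d x \<Longrightarrow> has_degree e y \<Longrightarrow> has_degree (d + e) (x * y)"
proof -
  assume x: "has_degree d x" and y: "has_degree e y"
  have "UL 0 * (x * y) = (x * UL 0 + of_int d \<cdot> x) * y"
    using x by (simp add: has_degree_def flip: mult.assoc)
  also have "\<dots> = x * (UL 0 * y) + of_int d \<cdot> (x * y)" by (simp add: distrib_right mult.assoc)
  also have "\<dots> = x * y * UL 0 + of_int (d + e) \<cdot> (x * y)"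
    using y by (simp add: has_degree_def distrib_left mult.assoc env.scale_left_distrib)
  finally show ?thesis by (simp add: has_degree_def)
qed

lemma has_degree_power: "has_degree d x \<Longrightarrow> has_degree (int n * d) (x ^ n)"
proof (induction n)
  case (Suc n)
  then show ?case using has_degree_mult[of d x "int n * d" "x ^ n"] by (simp add: algebra_simps)
qed (simp add: has_degree_1)

lemma subspace_has_degree: "env_subspace {x. has_degree d x}"
  by (simp add: env.subspace_def has_degree_0 has_degree_add has_degree_scale)

lemma has_degree_span: "x \<in> env_span G \<Longrightarrow> (\<And>g. g \<in> G \<Longrightarrow> has_degree d g) \<Longrightarrow> has_degree d x"
  using env.span_minimal[OF _ subspace_has_degree, of G d] by blast

lemma has_degree_diff: "has_degree d x \<Longrightarrow> has_degree d y \<Longrightarrow> has_degree d (x - y)"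
  using env.subspace_diff[OF subspace_has_degree, of x d y] by simp

lemma has_degree_sum: "(\<And>i. i \<in> A \<Longrightarrow> has_degree d (f i)) \<Longrightarrow> has_degree d (sum f A)"
  using env.subspace_sum[OF subspace_has_degree, of A f d] by simp

fun gen_degree :: "w22_basis \<Rightarrow> int" where
  "gen_degree (BL n) = - n" | "gen_degree (BM n) = - n" | "gen_degree _ = 0"

lemma has_degree_gen: "has_degree (gen_degree x) (env_gen x)"
proof (cases x)
  case (BL n)
  then show ?thesis using UL_UL[of 0 n] by (simp add: has_degree_def)
next
  case (BM n)
  then show ?thesis using UL_UM[of 0 n] by (simp add: has_degree_def)
qed (simp_all add: has_degree_def UCL_central UCM_central)

lemma has_degree_UL: "has_degree (- n) (UL n)" and has_degree_UM: "has_degree (- n) (UM n)"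
  using has_degree_gen[of "BL n"] has_degree_gen[of "BM n"] by simp_all

definition word_degree :: "w22_basis list \<Rightarrow> int" where
  "word_degree ws = sum_list (map gen_degree ws)"

lemma word_degree_simps [simp]: "word_degree [] = 0" "word_degree (x # ws) = gen_degree x + word_degree ws"
  "word_degree (ws @ vs) = word_degree ws + word_degree vs"
  by (simp_all add: word_degree_def)

lemma has_degree_word: "has_degree (word_degree ws) (word ws)"
  by (induction ws) (simp_all add: has_degree_1 has_degree_mult has_degree_gen)

lemma neg_word_degree: "neg_word ws \<Longrightarrow> word_degree ws \<ge> int (length ws)"
proof (induction ws)
  case (Cons x ws)
  then have "gen_degree x \<ge> 1" by (cases x) auto
  with Cons show ?case by simp
qed simp

lemma degree_decomposition:
  assumes "u \<in> env_span G" "\<And>g. g \<in> G \<Longrightarrow> \<exists>d. has_degree d g"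
  obtains D y where "finite D" "\<And>d. y d \<in> env_span {g \<in> G. has_degree d g}" "u = (\<Sum>d\<in>D. y d)"
proof -
  have "\<exists>D y. finite D \<and> (\<forall>d. y d \<in> env_span {g \<in> G. has_degree d g}) \<and> (\<forall>d. d \<notin> D \<longrightarrow> y d = 0) \<and> u = (\<Sum>d\<in>D. y d)"
    using assms(1)
  proof (induction rule: env.span_induct_alt)
    case base
    show ?case by (intro exI[of _ "{}"] exI[of _ "\<lambda>_. 0"]) (simp add: env.span_zero)
  next
    case (step c g u)
    then obtain D y where y: "finite D" "\<forall>d. y d \<in> env_span {g \<in> G. has_degree d g}"
      "\<forall>d. d \<notin> D \<longrightarrow> y d = 0" "u = (\<Sum>d\<in>D. y d)" by blast
    obtain e where e: "has_degree e g" using assms(2) step by blast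
    let ?y = "y(e := c \<cdot> g + y e)"
    have "(\<Sum>d\<in>insert e D. ?y d) = ?y e + (\<Sum>d\<in>D - {e}. ?y d)"
      using y(1) by (simp add: sum.insert_remove)
    also have "(\<Sum>d\<in>D - {e}. ?y d) = (\<Sum>d\<in>D - {e}. y d)" by (intro sum.cong) auto
    also have "?y e + (\<Sum>d\<in>D - {e}. y d) = c \<cdot> g + u"
      using y by (cases "e \<in> D") (simp_all add: sum.remove add.assoc)
    finally have "c \<cdot> g + u = (\<Sum>d\<in>insert e D. ?y d)" ..
    moreover have "?y d \<in> env_span {g \<in> G. has_degree d g}" for d
    proof (cases "d = e")
      case True
      have "g \<in> env_span {g \<in> G. has_degree e g}" using e step by (intro env.span_base) auto
      then show ?thesis using y(2) True by (simp add: env.span_add env.span_scale)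
    qed (use y(2) in simp)
    moreover have "d \<notin> insert e D \<longrightarrow> ?y d = 0" for d using y(3) by auto
    ultimately show ?case using y(1)
      by (intro exI[of _ "insert e D"] exI[of _ ?y] conjI allI) (simp only: finite_insert)
  qed
  then show ?thesis using that by blast
qed

locale highest_weight =
  fixes cL cM hL hM :: complex and H :: "w22_env set"
  assumes left_ideal: "left_ideal H" and verma_le: "verma_ideal cL cM hL hM \<subseteq> H"
begin

lemmas H_0 = left_ideal_zero[OF left_ideal]
lemmas H_add = left_ideal_add[OF left_ideal]
lemmas H_diff = left_ideal_diff[OF left_ideal]
lemmas H_uminus = left_ideal_uminus[OF left_ideal]
lemmas H_mult = left_ideal_mult[OF left_ideal]
lemmas H_scale = left_ideal_scale[OF left_ideal]
lemmas H_subspace = left_ideal_subspace[OF left_ideal]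

lemma H_sum: "(\<And>i. i \<in> A \<Longrightarrow> f i \<in> H) \<Longrightarrow> sum f A \<in> H"
  using env.subspace_sum[OF H_subspace] .

lemma hw_gen: "\<not> neg_gen x \<Longrightarrow> u * env_gen x - hw_char cL cM hL hM x \<cdot> u \<in> H"
  using H_mult[OF subsetD[OF verma_le verma_ideal_gen], of x u]
  by (simp add: right_diff_distrib env_scalar_eq)

lemma hw_central: "UCL * u - cL \<cdot> u \<in> H" "UCM * u - cM \<cdot> u \<in> H"
  using hw_gen[of BCL u] hw_gen[of BCM u] by (simp_all add: UCL_central UCM_central)

lemma hw_pos: "n > 0 \<Longrightarrow> u * UL n \<in> H" "n > 0 \<Longrightarrow> u * UM n \<in> H"
  using hw_gen[of "BL n" u] hw_gen[of "BM n" u] by simp_all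

lemma hw_zero: "u * UM 0 - hM \<cdot> u \<in> H"
  using hw_gen[of "BM 0" u] by simp

lemma hw_weight: "has_degree d x \<Longrightarrow> UL 0 * x - (hL + of_int d) \<cdot> x \<in> H"
  using hw_gen[of "BL 0" x] by (simp add: has_degree_def env.scale_left_distrib algebra_simps)

text \<open>\<open>L\<^sub>0\<close> acts on the components by distinct scalars modulo \<open>H\<close>, so applying it and subtracting a
multiple of the sum removes one component.\<close>

lemma graded:
  assumes Y: "env_subspace Y" "H \<subseteq> Y" "\<And>x. x \<in> Y \<Longrightarrow> UL 0 * x \<in> Y"
    and "finite D" "\<And>d. d \<in> D \<Longrightarrow> has_degree d (x d)" "(\<Sum>d\<in>D. x d) \<in> Y" "d \<in> D"
  shows "x d \<in> Y"
  using assms(4-)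
proof (induction D arbitrary: x d rule: finite_induct)
  case (insert e D)
  let ?s = "x e + (\<Sum>d\<in>D. x d)"
  have s: "?s \<in> Y" using insert by simp
  define r where "r d = UL 0 * x d - (hL + of_int d) \<cdot> x d" for d
  have r: "r d \<in> Y" if "d \<in> insert e D" for d
    using hw_weight[OF insert.prems(1)[OF that]] Y(2) by (auto simp: r_def)
  have pt: "UL 0 * x d - (hL + of_int e) \<cdot> x d = r d + of_int (d - e) \<cdot> x d" for d
    by (simp add: r_def env.scale_left_distrib env.scale_left_diff_distrib)
  have "UL 0 * ?s - (hL + of_int e) \<cdot> ?s = (UL 0 * x e - (hL + of_int e) \<cdot> x e)
      + (\<Sum>d\<in>D. UL 0 * x d - (hL + of_int e) \<cdot> x d)"
    by (simp add: distrib_left sum_distrib_left env.scale_right_distrib env.scale_sum_right sum_subtractf)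
  then have "UL 0 * ?s - (hL + of_int e) \<cdot> ?s = r e + (\<Sum>d\<in>D. r d + of_int (d - e) \<cdot> x d)"
    by (simp add: pt)
  moreover have "UL 0 * ?s - (hL + of_int e) \<cdot> ?s \<in> Y"
    using Y s by (intro env.subspace_diff env.subspace_scale) auto
  ultimately have "r e + ((\<Sum>d\<in>D. r d) + (\<Sum>d\<in>D. of_int (d - e) \<cdot> x d)) \<in> Y"
    by (simp add: sum.distrib)
  moreover have "r e \<in> Y" "(\<Sum>d\<in>D. r d) \<in> Y" using r by (auto intro!: env.subspace_sum[OF Y(1)])
  ultimately have "(\<Sum>d\<in>D. of_int (d - e) \<cdot> x d) \<in> Y"
    using env.subspace_diff[OF Y(1)] by (metis add_diff_cancel_left')
  then have "of_int (d - e) \<cdot> x d \<in> Y" if "d \<in> D" for d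
    using insert.IH[of "\<lambda>d. of_int (d - e) \<cdot> x d" d] insert.prems(1) that has_degree_scale by auto
  then have 1: "x d \<in> Y" if "d \<in> D" for d
  proof -
    have "d \<noteq> e" using that insert by auto
    then have "x d = (1 / of_int (d - e)) \<cdot> (of_int (d - e) \<cdot> x d)" by simp
    then show ?thesis using \<open>d \<in> D \<Longrightarrow> of_int (d - e) \<cdot> x d \<in> Y\<close>[OF that] env.subspace_scale[OF Y(1)] by metis
  qed
  have "?s - (\<Sum>d\<in>D. x d) \<in> Y" using s 1 by (intro env.subspace_diff env.subspace_sum Y(1)) auto
  then have "x e \<in> Y" by simp
  then show ?case using 1 insert.prems(3) by auto
qed simp

text \<open>Letters that are not negative are commuted to the right, where they are absorbed by \<open>Y\<close>.\<close>

lemma triangular: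
  assumes Y: "env_subspace Y" and closed: "\<And>x y. \<not> neg_gen x \<Longrightarrow> y \<in> Y \<Longrightarrow> env_gen x * y \<in> Y"
    and y: "y \<in> Y"
  shows "u * y \<in> env_span {word ws * y |ws y. neg_word ws \<and> y \<in> Y}" (is "_ \<in> env_span ?N")
proof -
  have neg: "env_gen x * z \<in> env_span ?N" if "neg_gen x" "z \<in> env_span ?N" for x z
    using that(2)
  proof (induction rule: env.span_induct_alt)
    case (step c z z')
    then obtain ws y where "z = word ws * y" "neg_word ws" "y \<in> Y" by auto
    then have "env_gen x * z = word (x # ws) * y" "neg_word (x # ws)" "y \<in> Y"
      using that(1) by (simp_all add: mult.assoc)
    then have "env_gen x * z \<in> ?N" by blast
    from env.span_scale[OF env.span_base[OF this], of c] step.IH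
    show ?case by (simp only: distrib_left scale_mult_right env.span_add)
  qed (simp add: env.span_zero)
  have gen: "env_gen x * (word ws * y) \<in> env_span ?N" if "neg_word ws" "y \<in> Y" for x ws y
    using that(1)
  proof (induction ws arbitrary: x)
    case Nil
    show ?case
    proof (cases "neg_gen x")
      case True
      have "word [] * y \<in> ?N" using that(2) by (intro CollectI exI[of _ "[]"] exI[of _ y]) simp
      then show ?thesis using neg[OF True env.span_base] by simp
    next
      case False
      have "word [] * (env_gen x * y) \<in> ?N"
        using closed[OF False that(2)] by (intro CollectI exI[of _ "[]"] exI[of _ "env_gen x * y"]) simp
      from env.span_base[OF this] show ?thesis by simp
    qed
  next
    case (Cons z ws)
    have zws: "word (z # ws) * y \<in> ?N" using Cons.prems that(2) by blast
    show ?case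
    proof (cases "neg_gen x")
      case True
      then show ?thesis using neg[OF True env.span_base[OF zws]] by simp
    next
      case False
      have lin: "env_lin v * (word ws * y) \<in> env_span ?N" for v
      proof (induction v rule: poly_mapping_induct)
        case (single k v)
        have "env_gen k * (word ws * y) \<in> env_span ?N" using Cons by simp
        then show ?case by (simp add: env.span_scale)
      qed (simp_all add: env.span_zero env.span_add distrib_right)
      have "env_gen x * (word (z # ws) * y) = env_gen z * (env_gen x * (word ws * y))
          + (env_gen x * env_gen z - env_gen z * env_gen x) * (word ws * y)"
        by (simp add: algebra_simps)
      also have "\<dots> \<in> env_span ?N"
        unfolding env_gen_commutator
        by (intro env.span_add lin neg Cons.IH) (use Cons.prems in auto)
      finally show ?thesis .
    qed
  qed
  have gen': "env_gen x * z \<in> env_span ?N" if "z \<in> env_span ?N" for x z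
    using that
  proof (induction rule: env.span_induct_alt)
    case (step c z z')
    then have "env_gen x * z \<in> env_span ?N" using gen by auto
    then show ?case using step by (simp add: distrib_left env.span_add env.span_scale)
  qed (simp add: env.span_zero)
  have "word [] * y \<in> ?N" using y by (intro CollectI exI[of _ "[]"] exI[of _ y]) simp
  from env.span_base[OF this] have base: "y \<in> env_span ?N" by simp
  have w: "word ws * y \<in> env_span ?N" for ws
    by (induction ws) (simp_all add: base gen' mult.assoc)
  show ?thesis
    by (induction u rule: word_induct)
       (simp_all add: env.span_zero distrib_right env.span_add w env.span_scale)
qed

lemma neg_words_span: "u \<in> env_span ({word ws |ws. neg_word ws} \<union> H)"
proof -
  define Y where "Y = env_span (insert 1 H)"
  have Y: "env_subspace Y" by (simp add: Y_def env.subspace_span)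
  have "env_gen x * y \<in> Y" if "\<not> neg_gen x" "y \<in> Y" for x y
    using that(2) unfolding Y_def
  proof (induction rule: env.span_induct_alt)
    case (step c z z')
    have "env_gen x * z \<in> env_span (insert 1 H)"
    proof (cases "z = 1")
      case True
      have "(env_gen x * 1 - hw_char cL cM hL hM x \<cdot> 1) + hw_char cL cM hL hM x \<cdot> 1 \<in> env_span (insert 1 H)"
        using hw_gen[OF that(1), of 1] by (intro env.span_add env.span_scale) (auto intro: env.span_base)
      then show ?thesis by (simp add: True)
    next
      case False
      then show ?thesis using step H_mult by (auto intro: env.span_base)
    qed
    then show ?case using step by (simp add: distrib_left env.span_add env.span_scale)
  qed (simp add: env.span_zero)
  then have "u * 1 \<in> env_span {word ws * y |ws y. neg_word ws \<and> y \<in> Y}"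
    by (intro triangular Y) (auto simp: Y_def env.span_base)
  moreover have "word ws * y \<in> env_span ({word ws |ws. neg_word ws} \<union> H)" if "neg_word ws" "y \<in> Y" for ws y
    using that(2) unfolding Y_def
  proof (induction rule: env.span_induct_alt)
    case (step c z z')
    have "word ws * z \<in> {word ws |ws. neg_word ws} \<union> H" using step that(1) H_mult by auto
    then show ?case using step by (simp add: distrib_left env.span_add env.span_scale env.span_base)
  qed (simp add: env.span_zero)
  ultimately show ?thesis
    using env.span_minimal[of "{word ws * y |ws y. neg_word ws \<and> y \<in> Y}"
        "env_span ({word ws |ws. neg_word ws} \<union> H)"] by auto
qed

text \<open>Modulo \<open>H\<close> every element is a combination of negative words, and these have degree at least 0.\<close>

lemma negative_degree:
  assumes "has_degree d x" "d < 0"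
  shows "x \<in> H"
proof -
  obtain z \<eta> where z: "z \<in> env_span {word ws |ws. neg_word ws}" "\<eta> \<in> env_span H" "x = z + \<eta>"
    using neg_words_span[of x] unfolding env.span_Un by blast
  have \<eta>: "\<eta> \<in> H" using z(2) H_subspace env.span_eq_iff by blast
  obtain D y where y: "finite D" "\<And>d. y d \<in> env_span {g \<in> {word ws |ws. neg_word ws}. has_degree d g}"
      "z = (\<Sum>d\<in>D. y d)"
    using degree_decomposition[OF z(1)] has_degree_word by blast
  have deg: "has_degree d (y d)" for d using has_degree_span[OF y(2)] by auto
  have y_neg: "y d \<in> H" if "d < 0" for d
  proof -
    have "g \<in> H" if g: "g = word ws" "neg_word ws" "has_degree d g" for g ws
    proof -
      have deg: "has_degree (word_degree ws) g" using g has_degree_word by simp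
      have "word_degree ws - d \<noteq> 0" using \<open>d < 0\<close> neg_word_degree[OF g(2)] by linarith
      then have ne: "of_int (word_degree ws - d) \<noteq> (0::complex)" by (simp only: of_int_eq_0_iff not_False_eq_True)
      have "of_int (word_degree ws - d) \<cdot> g = 0"
        using deg g(3) by (simp add: has_degree_def env.scale_left_diff_distrib)
      then have "g = 0" using ne by (simp only: env.scale_eq_0_iff) simp
      then show ?thesis using H_0 by simp
    qed
    then have "{g \<in> {word ws |ws. neg_word ws}. has_degree d g} \<subseteq> H" by blast
    then show ?thesis using env.span_minimal[OF _ H_subspace] y(2) by blast
  qed
  define f where "f e = (if e \<in> D then y e else 0) - (if e = d then x else 0)" for e
  have "(\<Sum>e\<in>insert d D. f e) = (\<Sum>e\<in>insert d D. if e \<in> D then y e else 0) - (\<Sum>e\<in>insert d D. if e = d then x else 0)"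
    by (simp only: f_def sum_subtractf)
  also have "(\<Sum>e\<in>insert d D. if e \<in> D then y e else 0) = z"
    unfolding y(3) using y(1) by (intro sum.mono_neutral_cong_right) auto
  also have "(\<Sum>e\<in>insert d D. if e = d then x else 0) = x"
    using y(1) by simp
  also have "z - x \<in> H" using z(3) \<eta> H_uminus by simp
  finally have sum: "(\<Sum>e\<in>insert d D. f e) \<in> H" .
  have "has_degree e (f e)" for e
    unfolding f_def using deg assms(1) by (intro has_degree_diff) (auto simp: has_degree_0)
  then have "f d \<in> H"
    by (intro graded[OF H_subspace order_refl H_mult _ _ sum]) (use y(1) in auto)
  then have "(if d \<in> D then y d else 0) - f d \<in> H" using y_neg[OF assms(2)] H_0 H_diff by auto
  then show ?thesis by (simp add: f_def split: if_splits)
qed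

end

section \<open>The commutative subalgebra of the negative M\<close>

definition M_words :: "nat \<Rightarrow> w22_env set" where
  "M_words d = {UM_neg xs |xs. 0 \<notin> set xs \<and> sum_list xs = d}"

definition M_poly :: "nat \<Rightarrow> w22_env set" where
  "M_poly d = env_span (M_words d)"

lemma UM_neg_simps [simp]: "UM_neg [] = 1" "UM_neg (x # xs) = UM (- int x) * UM_neg xs"
  "UM_neg (xs @ ys) = UM_neg xs * UM_neg ys"
  by (simp_all add: UM_neg_def)

lemma UM_UM_neg: "UM n * UM_neg xs = UM_neg xs * UM n"
  by (induction xs) (simp, metis UM_UM UM_neg_simps(2) mult.assoc)

lemma UM_neg_mset: "mset xs = mset ys \<Longrightarrow> UM_neg xs = UM_neg ys"
proof (induction xs arbitrary: ys)
  case (Cons x xs)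
  then have "x \<in> set ys" using mset_eq_setD[OF Cons.prems] by auto
  then obtain as bs where ys: "ys = as @ x # bs" by (auto dest: split_list)
  have "UM_neg xs = UM_neg (as @ bs)" by (rule Cons.IH) (use Cons.prems ys in simp)
  moreover have "UM (- int x) * (UM_neg as * UM_neg bs) = UM_neg as * (UM (- int x) * UM_neg bs)"
    by (simp only: mult.assoc[symmetric] UM_UM_neg[of _ as])
  ultimately show ?case unfolding ys by simp
qed simp

lemma has_degree_UM_neg: "has_degree (int (sum_list xs)) (UM_neg xs)"
proof (induction xs)
  case (Cons x xs)
  then show ?case using has_degree_mult[OF has_degree_UM[of "- int x"], of "int (sum_list xs)" "UM_neg xs"] by simp
qed (simp add: has_degree_1)

lemma M_poly_UM: "i \<ge> 1 \<Longrightarrow> UM (- int i) \<in> M_poly i"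
  unfolding M_poly_def M_words_def by (rule env.span_base) (auto intro!: exI[of _ "[i]"])

lemma M_poly_1: "1 \<in> M_poly 0"
  unfolding M_poly_def M_words_def by (rule env.span_base) (auto intro!: exI[of _ "[]"])

lemma M_poly_subspace: "env_subspace (M_poly d)"
  by (simp add: M_poly_def env.subspace_span)

lemma M_poly_mult:
  assumes "u \<in> M_poly a" "v \<in> M_poly b"
  shows "u * v \<in> M_poly (a + b)"
proof -
  have 1: "UM_neg xs * v \<in> M_poly (a + b)" if "0 \<notin> set xs" "sum_list xs = a" for xs
    using assms(2) unfolding M_poly_def[of b]
  proof (induction rule: env.span_induct_alt)
    case (step c g u)
    then obtain ys where "g = UM_neg ys" "0 \<notin> set ys" "sum_list ys = b" by (auto simp: M_words_def)
    then have "UM_neg xs * g \<in> M_words (a + b)" using that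
      unfolding M_words_def by (intro CollectI exI[of _ "xs @ ys"]) auto
    then show ?case using step
      by (simp add: distrib_left M_poly_def env.span_add env.span_scale env.span_base)
  qed (simp add: M_poly_def env.span_zero)
  show ?thesis using assms(1) unfolding M_poly_def[of a]
  proof (induction rule: env.span_induct_alt)
    case (step c g u)
    then have "g * v \<in> M_poly (a + b)" using 1 by (auto simp: M_words_def)
    then show ?case using step
      by (simp add: distrib_right env.subspace_add env.subspace_scale M_poly_subspace)
  qed (simp add: M_poly_def env.span_zero)
qed

lemma M_poly_UM_commute: "u \<in> M_poly d \<Longrightarrow> UM n * u = u * UM n"
  unfolding M_poly_def
proof (induction rule: env.span_induct_alt)
  case (step c g u)
  then show ?case by (auto simp: M_words_def distrib_left distrib_right UM_UM_neg)
qed simp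

lemma M_poly_closed:
  assumes "u \<in> M_poly d" "env_subspace Y" "\<And>j y. j \<ge> 1 \<Longrightarrow> y \<in> Y \<Longrightarrow> UM (- int j) * y \<in> Y" "y \<in> Y"
  shows "u * y \<in> Y"
proof -
  have "UM_neg xs * y \<in> Y" if "0 \<notin> set xs" for xs
    using that by (induction xs) (auto simp: assms(4) mult.assoc intro!: assms(3))
  then have 1: "g * y \<in> Y" if "g \<in> M_words d" for g using that by (auto simp: M_words_def)
  show ?thesis using assms(1) unfolding M_poly_def
  proof (induction rule: env.span_induct_alt)
    case (step c g u)
    then show ?case using env.subspace_add[OF assms(2) env.subspace_scale[OF assms(2) 1]]
      by (simp add: distrib_right)
  qed (simp add: env.subspace_0[OF assms(2)])
qed

lemma has_degree_M_poly: "u \<in> M_poly d \<Longrightarrow> has_degree (int d) u"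
  unfolding M_poly_def by (erule has_degree_span) (use has_degree_UM_neg in \<open>auto simp: M_words_def\<close>)

section \<open>The coefficients g of T\<close>

text \<open>With the value 1 at 0 the leading term \<open>L\<^sub>-\<^sub>p\<close> of T joins the sum over the other \<open>L\<^sub>-\<^sub>i\<close>.\<close>

definition g_coeff :: "nat \<Rightarrow> complex \<Rightarrow> nat \<Rightarrow> w22_env" where
  "g_coeff p cM i = (if i = 0 then 1 else g_elem p cM i)"

text \<open>The scalar by which the commutator of \<open>M\<^sub>n\<close> and \<open>L\<^sub>-\<^sub>n\<close> acts on the highest weight vector when \<open>h\<^sub>M\<close> is critical.\<close>

definition pairing :: "nat \<Rightarrow> complex \<Rightarrow> nat \<Rightarrow> complex" where
  "pairing p cM n = of_nat n * (of_nat n ^ 2 - of_nat p ^ 2) * cM / 12"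

lemma pairing_eq: "2 * of_nat n * hM_crit p cM + of_nat (n ^ 3) / 12 * cM - of_nat n / 12 * cM = pairing p cM n"
  by (simp add: pairing_def hM_crit_def power2_eq_square power3_eq_cube algebra_simps) (simp add: field_simps)

lemma pairing_self [simp]: "pairing p cM p = 0"
  by (simp add: pairing_def)

lemma pairing_nonzero:
  assumes "cM \<noteq> 0" "n \<ge> 1" "n \<noteq> p"
  shows "pairing p cM n \<noteq> 0"
proof -
  have "n ^ 2 \<noteq> p ^ 2" using assms(3) by simp
  then have "(of_nat (n ^ 2) :: complex) \<noteq> of_nat (p ^ 2)" by (simp only: of_nat_eq_iff not_False_eq_True)
  then show ?thesis using assms by (simp add: pairing_def)
qed

lemma g_elem_in_M_poly: "i \<ge> 1 \<Longrightarrow> g_elem p cM i \<in> M_poly i"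
proof (induction i rule: less_induct)
  case (less i)
  have "g_elem p cM j * UM (- int (i - j)) \<in> M_poly i" if "j \<in> {1..<i}" for j
    using M_poly_mult[OF less.IH[of j] M_poly_UM[of "i - j"]] that by auto
  then have "(\<Sum>j\<in>{1..<i}. env_scalar (1 - of_nat j / (2 * of_nat p - of_nat i)) * g_elem p cM j * UM (- int (i - j))) \<in> M_poly i"
    by (intro env.subspace_sum[OF M_poly_subspace])
       (auto simp: scale_env_def[symmetric] intro!: env.subspace_scale[OF M_poly_subspace])
  then show ?case unfolding g_elem.simps[of p cM i]
    using M_poly_UM[OF less.prems]
    by (simp only: scale_env_def[symmetric] env.subspace_scale[OF M_poly_subspace] env.subspace_add[OF M_poly_subspace])
qed

lemma g_coeff_in_M_poly: "g_coeff p cM i \<in> M_poly i"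
  by (cases "i = 0") (simp_all add: g_coeff_def M_poly_1 g_elem_in_M_poly)

lemma g_coeff_0 [simp]: "g_coeff p cM 0 = 1"
  by (simp add: g_coeff_def)

text \<open>The defining recursion read as a linear relation: the factor \<open>1 - j/(2p - i)\<close> is the quotient of the structure constant
\<open>n + (p - j)\<close> of the bracket of \<open>M\<^sub>n\<close> with \<open>L\<^sub>-\<^sub>(\<^sub>p\<^sub>-\<^sub>j\<^sub>)\<close> by \<open>2p - i\<close>, where \<open>i = p - n\<close>, and \<open>k\<^sub>i\<close> is \<open>-(2p - i)\<close> divided by the pairing at \<open>n\<close>.\<close>

lemma g_recursion:
  assumes "cM \<noteq> 0" "1 \<le> n" "n \<le> p"
  shows "pairing p cM n \<cdot> g_coeff p cM (p - n)
    + (\<Sum>i\<in>{n<..p}. of_nat (n + i) \<cdot> (g_coeff p cM (p - i) * UM (- int (i - n)))) = 0"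
proof (cases "n = p")
  case False
  define m where "m = p - n"
  have m: "1 \<le> m" "m < p" "n = p - m" "m \<le> p" using assms False by (auto simp: m_def)
  have nz: "(of_nat p - of_nat m :: complex) \<noteq> 0" "(of_nat m :: complex) \<noteq> 0" "(2 * of_nat p - of_nat m :: complex) \<noteq> 0"
  proof -
    have "(of_nat p :: complex) \<noteq> of_nat m" using m by simp
    then show "(of_nat p - of_nat m :: complex) \<noteq> 0" by simp
    have "(of_nat (2 * p) :: complex) \<noteq> of_nat m" using m by (simp only: of_nat_eq_iff)
    then show "(2 * of_nat p - of_nat m :: complex) \<noteq> 0" by simp
  qed (use m in simp)
  have ek: "pairing p cM n * k_coeff p cM m = - (2 * of_nat p - of_nat m)"
    using nz assms(1) m by (simp add: pairing_def k_coeff_def of_nat_diff field_simps power2_eq_square)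
  have g: "g_coeff p cM (p - n) = k_coeff p cM m \<cdot> (UM (- int m) +
      (\<Sum>j\<in>{1..<m}. (1 - of_nat j / (2 * of_nat p - of_nat m)) \<cdot> (g_elem p cM j * UM (- int (m - j)))))"
    using m by (simp add: g_coeff_def g_elem.simps[of p cM m] m_def[symmetric] mult.assoc env.scale_right_distrib
        flip: scale_env_def)
  have "pairing p cM n \<cdot> g_coeff p cM (p - n) = - ((2 * of_nat p - of_nat m) \<cdot> UM (- int m)
      + (\<Sum>j\<in>{1..<m}. (2 * of_nat p - of_nat m - of_nat j) \<cdot> (g_elem p cM j * UM (- int (m - j)))))"
  proof -
    have "- (2 * of_nat p - of_nat m) * (1 - of_nat j / (2 * of_nat p - of_nat m)) =
        - (2 * of_nat p - of_nat m - of_nat j :: complex)" for j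
      using nz by (simp add: field_simps)
    then show ?thesis unfolding g env.scale_scale ek
      by (simp only: env.scale_right_distrib env.scale_sum_right env.scale_scale env.scale_minus_left sum_negf minus_add_distrib)
  qed
  also have "(\<Sum>j\<in>{1..<m}. (2 * of_nat p - of_nat m - of_nat j) \<cdot> (g_elem p cM j * UM (- int (m - j)))) =
      (\<Sum>i\<in>{n<..<p}. of_nat (n + i) \<cdot> (g_coeff p cM (p - i) * UM (- int (i - n))))"
    by (rule sum.reindex_bij_witness[of _ "\<lambda>i. p - i" "\<lambda>j. p - j"])
       (use m in \<open>auto simp: g_coeff_def of_nat_diff algebra_simps\<close>)
  also have "(2 * of_nat p - of_nat m) \<cdot> UM (- int m) = of_nat (n + p) \<cdot> (g_coeff p cM (p - p) * UM (- int (p - n)))"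
    using m by (simp add: of_nat_diff algebra_simps)
  also have "\<dots> + (\<Sum>i\<in>{n<..<p}. of_nat (n + i) \<cdot> (g_coeff p cM (p - i) * UM (- int (i - n)))) =
      (\<Sum>i\<in>{n<..p}. of_nat (n + i) \<cdot> (g_coeff p cM (p - i) * UM (- int (i - n))))"
  proof -
    have "{n<..p} = insert p {n<..<p}" using assms False by auto
    then show ?thesis by simp
  qed
  finally show ?thesis by simp
qed simp



section \<open>The elements S and T\<close>

definition M_words_restr :: "nat \<Rightarrow> nat \<Rightarrow> w22_env set" where
  "M_words_restr p d = {UM_neg xs |xs. 0 \<notin> set xs \<and> p \<notin> set xs \<and> sum_list xs = d}"

text \<open>The part \<open>w\<close> of T in the M alone is a parameter, because it is only determined by the
first existence proof for a singular vector.\<close>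

definition T_of :: "nat \<Rightarrow> complex \<Rightarrow> w22_env \<Rightarrow> w22_env" where
  "T_of p cM w = (\<Sum>i\<in>{1..p}. g_coeff p cM (p - i) * UL (- int i)) + w"

text \<open>This is the commutator of \<open>M\<^sub>0\<close> with T, divided by \<open>p\<close>.\<close>

definition S_of :: "nat \<Rightarrow> complex \<Rightarrow> w22_env" where
  "S_of p cM = (1 / of_nat p) \<cdot> (\<Sum>i\<in>{1..p}. of_nat i \<cdot> (g_coeff p cM (p - i) * UM (- int i)))"

definition UM_UL_bracket :: "nat \<Rightarrow> nat \<Rightarrow> w22_env" where
  "UM_UL_bracket n i = of_nat (n + i) \<cdot> UM (int n - int i)
     + (if n = i then of_nat (n ^ 3) / 12 - of_nat n / 12 else 0) \<cdot> UCM"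

lemma UM_UL_neg: "UM (int n) * UL (- int i) = UL (- int i) * UM (int n) + UM_UL_bracket n i"
  using UM_UL[of "int n" "- int i"] by (auto simp: UM_UL_bracket_def diff_divide_distrib)

lemma UL_UM_neg: "UL (int n) * UM (- int i) = UM (- int i) * UL (int n) + UM_UL_bracket n i"
  using UL_UM[of "int n" "- int i"] by (auto simp: UM_UL_bracket_def diff_divide_distrib)

lemma M_words_restr_subset: "M_words_restr p d \<subseteq> M_words d"
  by (auto simp: M_words_restr_def M_words_def)

lemma M_restr_in_M_poly: "v \<in> env_span (M_words_restr p d) \<Longrightarrow> v \<in> M_poly d"
  unfolding M_poly_def using env.span_mono[OF M_words_restr_subset] by blast

lemma UM_T:
  assumes "w \<in> M_poly p"
  shows "UM (int n) * T_of p cM w = T_of p cM w * UM (int n)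
    + (\<Sum>i\<in>{1..p}. g_coeff p cM (p - i) * UM_UL_bracket n i)"
proof -
  have "UM (int n) * (g_coeff p cM (p - i) * UL (- int i)) =
      g_coeff p cM (p - i) * UL (- int i) * UM (int n) + g_coeff p cM (p - i) * UM_UL_bracket n i" for i
  proof -
    have "UM (int n) * (g_coeff p cM (p - i) * UL (- int i)) = g_coeff p cM (p - i) * (UM (int n) * UL (- int i))"
      by (simp only: mult.assoc[symmetric] M_poly_UM_commute[OF g_coeff_in_M_poly])
    then show ?thesis by (simp only: UM_UL_neg distrib_left mult.assoc)
  qed
  then show ?thesis
    by (simp add: T_of_def distrib_left distrib_right sum_distrib_left sum_distrib_right sum.distrib
        M_poly_UM_commute[OF assms])
qed

lemma UM_0_T:
  assumes "w \<in> M_poly p" "p \<ge> 1"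
  shows "UM 0 * T_of p cM w = T_of p cM w * UM 0 + of_nat p \<cdot> S_of p cM"
proof -
  have "(\<Sum>i\<in>{1..p}. g_coeff p cM (p - i) * UM_UL_bracket 0 i) = of_nat p \<cdot> S_of p cM"
    using assms(2) by (simp add: S_of_def UM_UL_bracket_def)
  with UM_T[OF assms(1), of 0 cM] show ?thesis by simp
qed

lemma S_of_in_M_poly: "S_of p cM \<in> M_poly p"
proof -
  have "g_coeff p cM (p - i) * UM (- int i) \<in> M_poly p" if "i \<in> {1..p}" for i
    using M_poly_mult[OF g_coeff_in_M_poly[of p cM "p - i"] M_poly_UM[of i]] that by simp
  then show ?thesis unfolding S_of_def
    by (intro env.subspace_scale env.subspace_sum M_poly_subspace)
qed

lemma M_poly_mult_restr:
  assumes "u \<in> M_poly a" "v \<in> M_poly b" "a < p" "b < p" "d = a + b"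
  shows "u * v \<in> env_span (M_words_restr p d)"
proof -
  have 1: "UM_neg xs * v \<in> env_span (M_words_restr p d)" if xs: "0 \<notin> set xs" "sum_list xs = a" for xs
    using assms(2) unfolding M_poly_def
  proof (induction rule: env.span_induct_alt)
    case (step c g u)
    then obtain ys where ys: "g = UM_neg ys" "0 \<notin> set ys" "sum_list ys = b" by (auto simp: M_words_def)
    have "p \<notin> set (xs @ ys)"
      using member_le_sum_list[of p xs] member_le_sum_list[of p ys] xs ys assms by auto
    then have "UM_neg xs * g \<in> M_words_restr p d" using xs ys assms
      unfolding M_words_restr_def by (intro CollectI exI[of _ "xs @ ys"]) auto
    then show ?case using step
      by (simp add: distrib_left env.span_add env.span_scale env.span_base)
  qed (simp add: env.span_zero)
  show ?thesis using assms(1) unfolding M_poly_def[of a]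
  proof (induction rule: env.span_induct_alt)
    case (step c g u)
    then have "g * v \<in> env_span (M_words_restr p d)" using 1 by (auto simp: M_words_def)
    then show ?case using step by (simp add: distrib_right env.span_add env.span_scale)
  qed (simp add: env.span_zero)
qed

lemma S_of_lead:
  assumes "p \<ge> 1"
  obtains v where "v \<in> env_span (M_words_restr p p)" "S_of p cM = UM (- int p) + v"
proof -
  define v where "v = (1 / of_nat p) \<cdot> (\<Sum>i\<in>{1..<p}. of_nat i \<cdot> (g_coeff p cM (p - i) * UM (- int i)))"
  have "g_coeff p cM (p - i) * UM (- int i) \<in> env_span (M_words_restr p p)" if "i \<in> {1..<p}" for i
    using M_poly_mult_restr[OF g_coeff_in_M_poly[of p cM "p - i"] M_poly_UM[of i], of p p] that by auto
  then have "v \<in> env_span (M_words_restr p p)"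
    unfolding v_def by (intro env.span_scale env.span_sum)
  moreover have "{1..p} = insert p {1..<p}" using assms by auto
  then have "S_of p cM = UM (- int p) + v"
    using assms by (simp add: S_of_def v_def env.scale_right_distrib)
  ultimately show ?thesis using that by blast
qed

lemma g_elem_lead:
  assumes "1 \<le> d"
  shows "g_elem p cM d - k_coeff p cM d \<cdot> UM (- int d)
    \<in> env_span {UM_neg xs |xs. 0 \<notin> set xs \<and> sum_list xs = d \<and> xs \<noteq> [d]}" (is "_ \<in> env_span ?G")
proof -
  have 1: "g_elem p cM j * UM (- int (d - j)) \<in> env_span ?G" if j: "j \<in> {1..<d}" for j
  proof -
    have "u * UM (- int (d - j)) \<in> env_span ?G" if "u \<in> env_span (M_words j)" for u
      using that
    proof (induction rule: env.span_induct_alt)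
      case (step c g u)
      then obtain xs where xs: "g = UM_neg xs" "0 \<notin> set xs" "sum_list xs = j" by (auto simp: M_words_def)
      then have "xs @ [d - j] \<noteq> [d]" using j by (cases xs) auto
      with xs j have "UM_neg (xs @ [d - j]) \<in> ?G" by (intro CollectI exI[of _ "xs @ [d - j]"]) auto
      then have "g * UM (- int (d - j)) \<in> env_span ?G" using xs by (simp add: env.span_base)
      then show ?case using step by (simp add: distrib_right env.span_add env.span_scale)
    qed (simp add: env.span_zero)
    then show ?thesis using g_elem_in_M_poly[of j p cM] j by (simp add: M_poly_def)
  qed
  have "g_elem p cM d - k_coeff p cM d \<cdot> UM (- int d) = k_coeff p cM d \<cdot>
      (\<Sum>j\<in>{1..<d}. (1 - of_nat j / (2 * of_nat p - of_nat d)) \<cdot> (g_elem p cM j * UM (- int (d - j))))"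
    by (subst g_elem.simps) (simp flip: scale_env_def add: mult.assoc)
  then show ?thesis using 1 by (auto intro!: env.span_scale env.span_sum)
qed

lemma has_degree_T: "w \<in> M_poly p \<Longrightarrow> has_degree (int p) (T_of p cM w)"
proof -
  assume w: "w \<in> M_poly p"
  have "has_degree (int p) (g_coeff p cM (p - i) * UL (- int i))" if "i \<in> {1..p}" for i
    using has_degree_mult[OF has_degree_M_poly[OF g_coeff_in_M_poly[of p cM "p - i"]] has_degree_UL[of "- int i"]] that
    by (simp add: of_nat_diff)
  then show ?thesis unfolding T_of_def
    using has_degree_M_poly[OF w] by (intro has_degree_add has_degree_sum)
qed

lemma has_degree_S: "has_degree (int p) (S_of p cM)"
  by (rule has_degree_M_poly[OF S_of_in_M_poly])

text \<open>This sum is the origin of the constant term of \<open>h'\<^sub>p\<^sub>,\<^sub>1\<close>.\<close>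

lemma critical_weight_sum:
  "(\<Sum>i\<in>{1..<p}. (2 * of_nat p - of_nat i) * (of_nat p + of_nat i) :: complex)
    = of_nat p * (of_nat p - 1) * (13 * of_nat p + 1) / 6"
proof -
  have 1: "(\<Sum>i\<in>{1..n}. (2 * P - of_nat i) * (P + of_nat i) :: complex)
      = 2 * P ^ 2 * of_nat n + P * of_nat n * (of_nat n + 1) / 2 - of_nat n * (of_nat n + 1) * (2 * of_nat n + 1) / 6" for n P
    by (induction n) (simp_all add: field_simps power2_eq_square)
  show ?thesis
  proof (cases p)
    case (Suc n)
    have "{1..<Suc n} = {1..n}" by auto
    show ?thesis unfolding Suc \<open>{1..<Suc n} = {1..n}\<close> 1 by (simp add: field_simps power2_eq_square)
  qed simp
qed

locale critical = highest_weight cL cM hL "hM_crit p cM" H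
  for cL cM hL :: complex and p :: nat and H :: "w22_env set" +
  fixes w :: w22_env
  assumes cM: "cM \<noteq> 0" and p: "p \<ge> 1" and w: "w \<in> env_span (M_words_restr p p)"
begin

abbreviation T where "T \<equiv> T_of p cM w"
abbreviation S where "S \<equiv> S_of p cM"
abbreviation hM where "hM \<equiv> hM_crit p cM"
abbreviation e where "e \<equiv> pairing p cM"

lemmas w' = M_restr_in_M_poly[OF w]

text \<open>The vectors on which the \<open>M\<^sub>n\<close> with \<open>n \<ge> 0\<close> act as on the highest weight vector, modulo \<open>H\<close>.\<close>

definition K :: "w22_env set" where
  "K = {x. (\<forall>n\<ge>1. UM (int n) * x \<in> H) \<and> UM 0 * x - hM \<cdot> x \<in> H}"

lemma K_pos: "x \<in> K \<Longrightarrow> n \<ge> 1 \<Longrightarrow> UM (int n) * x \<in> H"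
  and K_zero: "x \<in> K \<Longrightarrow> UM 0 * x - hM \<cdot> x \<in> H"
  by (simp_all add: K_def)

lemma K_subspace: "env_subspace K"
proof (rule env.subspaceI)
  show "x + y \<in> K" if "x \<in> K" "y \<in> K" for x y
    using that H_add[of "UM 0 * x - hM \<cdot> x" "UM 0 * y - hM \<cdot> y"]
    by (auto simp: K_def distrib_left H_add env.scale_right_distrib algebra_simps)
  show "c \<cdot> x \<in> K" if "x \<in> K" for c x
    using K_pos[OF that] H_scale[OF K_zero[OF that], of c]
    unfolding K_def mem_Collect_eq scale_mult_right
    by (auto intro: H_scale simp: env.scale_right_diff_distrib mult.commute)
qed (simp add: K_def H_0)

lemma K_H: "H \<subseteq> K"
  by (auto simp: K_def H_mult H_diff H_scale)

lemma K_1: "1 \<in> K"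
  using hw_pos(2)[where u = 1] hw_zero[where u = 1] by (auto simp: K_def)

lemma K_UM: "x \<in> K \<Longrightarrow> UM j * x \<in> K"
proof -
  assume x: "x \<in> K"
  have comm: "UM n * (UM j * x) = UM j * (UM n * x)" for n
    by (metis UM_UM mult.assoc)
  have "UM (int n) * (UM j * x) \<in> H" if "n \<ge> 1" for n
    unfolding comm by (rule H_mult[OF K_pos[OF x that]])
  moreover have "UM 0 * (UM j * x) - hM \<cdot> (UM j * x) = UM j * (UM 0 * x - hM \<cdot> x)"
    unfolding comm by (simp add: right_diff_distrib)
  ultimately show ?thesis using H_mult[OF K_zero[OF x], of "UM j"] by (simp add: K_def)
qed

text \<open>On a vector of \<open>K\<close> this is what remains, modulo \<open>H\<close>, of the commutator of \<open>L\<^sub>m\<close> with \<open>M\<^sub>-\<^sub>i\<close>, and also of the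
commutator of \<open>M\<^sub>m\<close> with \<open>L\<^sub>-\<^sub>i\<close>.\<close>

definition adj :: "nat \<Rightarrow> nat \<Rightarrow> w22_env \<Rightarrow> w22_env" where
  "adj m i y = (if m < i then of_nat (m + i) \<cdot> (UM (- int (i - m)) * y) else if m = i then e m \<cdot> y else 0)"

lemma bracket_adj:
  assumes "y \<in> K" "m \<ge> 1" "i \<ge> 1"
  shows "UM_UL_bracket m i * y - adj m i y \<in> H"
proof (cases m i rule: linorder_cases)
  case less
  then have "int m - int i = - int (i - m)" by simp
  then show ?thesis using less H_0 by (simp add: UM_UL_bracket_def adj_def del: of_nat_diff)
next
  case equal
  have "UM_UL_bracket m i * y - adj m i y = (2 * of_nat m) \<cdot> (UM 0 * y - hM \<cdot> y)
     + (of_nat (m ^ 3) / 12 - of_nat m / 12) \<cdot> (UCM * y - cM \<cdot> y)"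
    unfolding equal pairing_eq[of i p cM, symmetric] adj_def UM_UL_bracket_def
    by (simp add: distrib_right env.scale_right_diff_distrib env.scale_left_distrib env.scale_left_diff_distrib algebra_simps)
  then show ?thesis using K_zero[OF assms(1)] hw_central(2) by (simp add: H_add H_scale)
next
  case greater
  then have "int m - int i = int (m - i)" by simp
  then have "UM_UL_bracket m i * y - adj m i y = of_nat (m + i) \<cdot> (UM (int (m - i)) * y)"
    using greater by (simp add: UM_UL_bracket_def adj_def del: of_nat_diff)
  then show ?thesis using K_pos[OF assms(1), of "m - i"] greater by (simp add: H_scale)
qed

lemma UL_UM_K:
  assumes "y \<in> K" "m \<ge> 1" "i \<ge> 1"
  shows "UL (int m) * (UM (- int i) * y) - UM (- int i) * (UL (int m) * y) - adj m i y \<in> H"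
  using bracket_adj[OF assms] arg_cong[OF UL_UM_neg[of m i], of "\<lambda>u. u * y"]
  by (simp add: distrib_right mult.assoc)

lemma UM_UL_K:
  assumes "y \<in> K" "m \<ge> 1" "i \<ge> 1"
  shows "UM (int m) * (UL (- int i) * y) - adj m i y \<in> H"
proof -
  have eq: "UM (int m) * (UL (- int i) * y) - adj m i y =
      UL (- int i) * (UM (int m) * y) + (UM_UL_bracket m i * y - adj m i y)"
    using arg_cong[OF UM_UL_neg[of m i], of "\<lambda>u. u * y"] by (simp add: distrib_right mult.assoc)
  show ?thesis unfolding eq by (rule H_add[OF H_mult[OF K_pos[OF assms(1,2)]] bracket_adj[OF assms]])
qed

text \<open>Commuting \<open>M\<^sub>n\<close> past T leaves exactly the left-hand side of the recursion for the \<open>g\<^sub>i\<close>.\<close>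

lemma UM_T_K:
  assumes y: "y \<in> K" and n: "n \<ge> 1"
  shows "UM (int n) * (T * y) \<in> H"
proof -
  define G where "G i = g_coeff p cM (p - i)" for i
  have "(\<Sum>i\<in>{1..p}. G i * adj n i y) = 0"
  proof (cases "n \<le> p")
    case True
    have "(\<Sum>i\<in>{1..p}. G i * adj n i y) = (\<Sum>i\<in>insert n {n<..p}. G i * adj n i y)"
      using True n by (intro sum.mono_neutral_right) (auto simp: adj_def)
    also have "\<dots> = e n \<cdot> (G n * y) + (\<Sum>i\<in>{n<..p}. of_nat (n + i) \<cdot> (G i * (UM (- int (i - n)) * y)))"
      by (simp add: adj_def)
    also have "\<dots> = (e n \<cdot> G n + (\<Sum>i\<in>{n<..p}. of_nat (n + i) \<cdot> (G i * UM (- int (i - n))))) * y"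
      by (simp add: distrib_right sum_distrib_right mult.assoc)
    also have "\<dots> = 0" using g_recursion[OF cM n True] by (simp add: G_def)
    finally show ?thesis .
  next
    case False
    then show ?thesis by (intro sum.neutral) (auto simp: adj_def)
  qed
  moreover have "(\<Sum>i\<in>{1..p}. G i * UM_UL_bracket n i) * y - (\<Sum>i\<in>{1..p}. G i * adj n i y)
      = (\<Sum>i\<in>{1..p}. G i * (UM_UL_bracket n i * y - adj n i y))"
    by (simp add: sum_distrib_right sum_subtractf right_diff_distrib mult.assoc)
  moreover have "\<dots> \<in> H" using bracket_adj[OF y n] by (intro H_sum H_mult) auto
  ultimately have "(\<Sum>i\<in>{1..p}. G i * UM_UL_bracket n i) * y \<in> H" by simp
  moreover have "UM (int n) * (T * y) = T * (UM (int n) * y) + (\<Sum>i\<in>{1..p}. G i * UM_UL_bracket n i) * y"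
    using arg_cong[OF UM_T[OF w', of n cM], of "\<lambda>u. u * y"] by (simp only: distrib_right mult.assoc G_def)
  ultimately show ?thesis using K_pos[OF y n] by (simp add: H_add H_mult)
qed

lemma UM_0_T_K: "y \<in> K \<Longrightarrow> UM 0 * (T * y) - hM \<cdot> (T * y) - of_nat p \<cdot> (S * y) \<in> H"
proof -
  assume y: "y \<in> K"
  have "UM 0 * (T * y) - hM \<cdot> (T * y) - of_nat p \<cdot> (S * y) = T * (UM 0 * y - hM \<cdot> y)"
    using arg_cong[OF UM_0_T[OF w' p, of cM], of "\<lambda>u. u * y"] by (simp add: distrib_right mult.assoc right_diff_distrib)
  then show ?thesis using K_zero[OF y] by (simp add: H_mult)
qed

lemma T_in_K: "y \<in> K \<Longrightarrow> S * y \<in> H \<Longrightarrow> T * y \<in> K"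
proof -
  assume y: "y \<in> K" and "S * y \<in> H"
  from H_add[OF UM_0_T_K[OF y] H_scale[OF this(2)], of "of_nat p"]
  have "UM 0 * (T * y) - hM \<cdot> (T * y) \<in> H" by simp
  then show ?thesis using UM_T_K[OF y] by (simp add: K_def)
qed

definition M_closed :: "w22_env set \<Rightarrow> bool" where
  "M_closed B \<longleftrightarrow> env_subspace B \<and> H \<subseteq> B \<and> B \<subseteq> K \<and> (\<forall>j\<ge>1. \<forall>b\<in>B. UM (- int j) * b \<in> B)"

lemma M_closedD:
  assumes "M_closed B"
  shows "env_subspace B" "H \<subseteq> B" "B \<subseteq> K" "j \<ge> 1 \<Longrightarrow> b \<in> B \<Longrightarrow> UM (- int j) * b \<in> B"
  using assms by (auto simp: M_closed_def)

lemma M_closed_UM: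
  assumes B: "M_closed B" and b: "b \<in> B"
  shows "UM k * b \<in> B"
proof -
  consider (neg) j where "k = - int j" "j \<ge> 1" | (zero) "k = 0" | (pos) j where "k = int j" "j \<ge> 1"
    by (metis int_cases3 less_eq_Suc_le One_nat_def)
  then show ?thesis
  proof cases
    case zero
    have "(UM 0 * b - hM \<cdot> b) + hM \<cdot> b \<in> B"
      using M_closedD[OF B] b K_zero[of b] by (intro env.subspace_add env.subspace_scale) auto
    then show ?thesis using zero by simp
  next
    case neg
    then show ?thesis using M_closedD(4)[OF B] b by blast
  next
    case pos
    then show ?thesis using M_closedD(2,3)[OF B] b K_pos by blast
  qed
qed

text \<open>Among the terms \<open>L\<^sub>-\<^sub>l b\<^sub>l\<close> only the one with the largest index \<open>m\<close> is seen by \<open>M\<^sub>m\<close>, which turns it into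
\<open>b\<^sub>m\<close> times a pairing that is nonzero as \<open>m < p\<close>. So \<open>b\<^sub>m \<in> H\<close>, and the sum becomes shorter.\<close>

lemma eliminate_lowering:
  assumes B: "M_closed B" and "m < p" and "b0 \<in> B" "\<And>l. b l \<in> B"
    and "\<And>n. 1 \<le> n \<Longrightarrow> UM (int n) * (b0 + (\<Sum>l\<in>{1..m}. UL (- int l) * b l)) \<in> H"
  shows "b0 + (\<Sum>l\<in>{1..m}. UL (- int l) * b l) \<in> B"
  using assms(2-)
proof (induction m arbitrary: b0)
  case (Suc m)
  let ?X = "b0 + (\<Sum>l\<in>{1..Suc m}. UL (- int l) * b l)"
  have bK: "b l \<in> K" for l using Suc.prems(3) M_closedD(3)[OF B] by blast
  have "UM (int (Suc m)) * (UL (- int l) * b l) \<in> H" if "l \<in> {1..m}" for l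
    using UM_UL_K[OF bK, of "Suc m" l l] that by (simp add: adj_def)
  then have rest: "UM (int (Suc m)) * b0 + (\<Sum>l\<in>{1..m}. UM (int (Suc m)) * (UL (- int l) * b l)) \<in> H" (is "?R \<in> H")
    using Suc.prems(2) M_closedD(3)[OF B] K_pos[of b0 "Suc m"] by (intro H_add H_sum) auto
  let ?Q = "UM (int (Suc m)) * (UL (- int (Suc m)) * b (Suc m))"
  have X: "UM (int (Suc m)) * ?X = ?R + ?Q"
    by (simp add: distrib_left sum_distrib_left add.assoc del: of_nat_Suc)
  have "UM (int (Suc m)) * ?X \<in> H" by (rule Suc.prems(4)) simp
  then have "?R + ?Q - ?R \<in> H" unfolding X by (rule H_diff[OF _ rest])
  then have "?Q \<in> H" by (simp only: add_diff_cancel_left')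
  then have "?Q - (?Q - adj (Suc m) (Suc m) (b (Suc m))) \<in> H" by (rule H_diff[OF _ UM_UL_K[OF bK]]) simp_all
  then have "e (Suc m) \<cdot> b (Suc m) \<in> H" by (simp add: adj_def)
  moreover have "e (Suc m) \<noteq> 0" using pairing_nonzero[OF cM] Suc.prems(1) by auto
  ultimately have "b (Suc m) \<in> H" using H_scale[of "e (Suc m) \<cdot> b (Suc m)" "1 / e (Suc m)"] by simp
  then have "UL (- int (Suc m)) * b (Suc m) \<in> B" using H_mult M_closedD(2)[OF B] by blast
  then have b0': "b0 + UL (- int (Suc m)) * b (Suc m) \<in> B"
    using Suc.prems(2) M_closedD(1)[OF B] env.subspace_add by blast
  have eq: "?X = (b0 + UL (- int (Suc m)) * b (Suc m)) + (\<Sum>l\<in>{1..m}. UL (- int l) * b l)"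
    by (simp add: add.assoc add.commute[of "UL (- int (Suc m)) * b (Suc m)"] del: of_nat_Suc)
  show ?case unfolding eq
  proof (rule Suc.IH)
    show "UM (int n) * (b0 + UL (- int (Suc m)) * b (Suc m) + (\<Sum>l\<in>{1..m}. UL (- int l) * b l)) \<in> H" if "1 \<le> n" for n
      using Suc.prems(4)[OF that] unfolding eq .
  qed (use Suc.prems b0' in auto)
qed simp

definition lowered :: "w22_env set \<Rightarrow> w22_env set" where
  "lowered B = env_span (B \<union> {UL (- int l) * b |l b. 1 \<le> l \<and> l < p \<and> b \<in> B})"

lemma lowered_form:
  assumes B: "env_subspace B" and "X \<in> lowered B"
  obtains b0 b where "b0 \<in> B" "\<And>l. b l \<in> B" "X = b0 + (\<Sum>l\<in>{1..p-1}. UL (- int l) * b l)"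
proof -
  have "\<exists>b0\<in>B. \<exists>b. (\<forall>l. b l \<in> B) \<and> X = b0 + (\<Sum>l\<in>{1..p-1}. UL (- int l) * b l)"
    using assms(2) unfolding lowered_def
  proof (induction rule: env.span_induct_alt)
    case base
    show ?case using env.subspace_0[OF B]
      by (intro bexI[of _ 0] exI[of _ "\<lambda>_. 0"]) auto
  next
    case (step c g X)
    then obtain b0 b where b: "b0 \<in> B" "\<And>l. b l \<in> B" "X = b0 + (\<Sum>l\<in>{1..p-1}. UL (- int l) * b l)" by blast
    show ?case
    proof (cases "g \<in> B")
      case True
      then show ?thesis using b B
        by (intro bexI[of _ "c \<cdot> g + b0"] exI[of _ b]) (auto simp: add.assoc intro: env.subspace_add env.subspace_scale)
    next
      case False
      then obtain l a where l: "1 \<le> l" "l < p" "a \<in> B" "g = UL (- int l) * a" using step by auto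
      let ?b = "\<lambda>i. (if i = l then c \<cdot> a else 0) + b i"
      have "(\<Sum>i\<in>{1..p-1}. UL (- int i) * ?b i) =
          (\<Sum>i\<in>{1..p-1}. if i = l then c \<cdot> g else 0) + (\<Sum>i\<in>{1..p-1}. UL (- int i) * b i)"
        unfolding sum.distrib[symmetric] by (rule sum.cong) (auto simp: distrib_left l(4))
      also have "(\<Sum>i\<in>{1..p-1}. if i = l then c \<cdot> g else 0) = c \<cdot> g"
      proof -
        have "l \<in> {1..p-1}" using l by auto
        then show ?thesis by simp
      qed
      finally have "c \<cdot> g + X = b0 + (\<Sum>i\<in>{1..p-1}. UL (- int i) * ?b i)" using b(3) by (simp add: add.left_commute)
      moreover have "?b i \<in> B" for i
        using l b B by (auto intro: env.subspace_add env.subspace_scale)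
      ultimately show ?thesis using b(1) by (intro bexI[of _ b0] exI[of _ ?b]) auto
    qed
  qed
  then show ?thesis using that by blast
qed

lemma lowered_base: "B \<subseteq> lowered B"
  unfolding lowered_def using env.span_superset by blast

lemma lowered_subspace: "env_subspace (lowered B)"
  by (simp add: lowered_def env.subspace_span)

lemma lowered_UL: "1 \<le> l \<Longrightarrow> l < p \<Longrightarrow> b \<in> B \<Longrightarrow> UL (- int l) * b \<in> lowered B"
  unfolding lowered_def by (rule env.span_base) blast

lemma UCM_closed:
  assumes "env_subspace Y" "H \<subseteq> Y" "y \<in> Y"
  shows "UCM * y \<in> Y" "UCL * y \<in> Y"
proof -
  have "(UCM * y - cM \<cdot> y) + cM \<cdot> y \<in> Y" "(UCL * y - cL \<cdot> y) + cL \<cdot> y \<in> Y"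
    using assms hw_central by (intro env.subspace_add env.subspace_scale; blast)+
  then show "UCM * y \<in> Y" "UCL * y \<in> Y" by simp_all
qed

lemma lowered_UM:
  assumes B: "M_closed B" and x: "x \<in> lowered B"
  shows "UM k * x \<in> lowered B"
  using x unfolding lowered_def[of B]
proof (induction rule: env.span_induct_alt)
  case (step c g x)
  have "UM k * g \<in> lowered B"
  proof (cases "g \<in> B")
    case True
    then show ?thesis using M_closed_UM[OF B] lowered_base by blast
  next
    case False
    then obtain l b where l: "1 \<le> l" "l < p" "b \<in> B" "g = UL (- int l) * b" using step by auto
    have "UM k * g = UL (- int l) * (UM k * b) + of_int (k - - int l) \<cdot> (UM (k + - int l) * b)
        + (if k + - int l = 0 then of_int (k ^ 3 - k) / 12 else 0) \<cdot> (UCM * b)"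
      using arg_cong[OF UM_UL[of k "- int l"], of "\<lambda>u. u * b"] unfolding l(4)
      by (simp only: distrib_right mult.assoc scale_mult_left)
    also have "\<dots> \<in> lowered B"
      using M_closed_UM[OF B l(3)] lowered_base[of B] UCM_closed(1)[OF M_closedD(1,2)[OF B] l(3)]
      by (intro env.subspace_add env.subspace_scale lowered_subspace lowered_UL l(1,2)) auto
    finally show ?thesis .
  qed
  moreover have "UM k * (c \<cdot> g + x) = c \<cdot> (UM k * g) + UM k * x" by (simp add: distrib_left)
  ultimately show ?case using step(2) unfolding lowered_def
    by (simp only: env.span_add env.span_scale)
qed (simp add: env.span_zero)

lemma commutator_M_word:
  assumes Y: "env_subspace Y" "H \<subseteq> Y" "\<And>k y. y \<in> Y \<Longrightarrow> UM k * y \<in> Y" and z: "z \<in> Y"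
  shows "UL (int n) * (UM_neg xs * z) - UM_neg xs * (UL (int n) * z) \<in> Y"
proof (induction xs)
  case Nil
  show ?case using env.subspace_0[OF Y(1)] by simp
next
  case (Cons a xs)
  have z': "UM_neg xs * z \<in> Y" using z by (induction xs) (auto simp: mult.assoc Y(3))
  have "UL (int n) * (UM_neg (a # xs) * z) - UM_neg (a # xs) * (UL (int n) * z) =
      UM (- int a) * (UL (int n) * (UM_neg xs * z) - UM_neg xs * (UL (int n) * z))
      + UM_UL_bracket n a * (UM_neg xs * z)"
    using arg_cong[OF UL_UM_neg[of n a], of "\<lambda>u. u * (UM_neg xs * z)"]
    by (simp add: algebra_simps)
  also have "\<dots> \<in> Y"
    unfolding UM_UL_bracket_def distrib_right scale_mult_left
    by (intro env.subspace_add env.subspace_scale Y(1,3) Cons.IH z' UCM_closed(1)[OF Y(1,2)])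
  finally show ?case .
qed

lemma commutator_M_poly:
  assumes Y: "env_subspace Y" "H \<subseteq> Y" "\<And>k y. y \<in> Y \<Longrightarrow> UM k * y \<in> Y" and z: "z \<in> Y" and u: "u \<in> M_poly d"
  shows "UL (int n) * (u * z) - u * (UL (int n) * z) \<in> Y"
  using u unfolding M_poly_def
proof (induction rule: env.span_induct_alt)
  case (step c g u)
  then obtain xs where "g = UM_neg xs" by (auto simp: M_words_def)
  then have g: "UL (int n) * (g * z) - g * (UL (int n) * z) \<in> Y" using commutator_M_word[OF Y(1,2) _ z] Y(3) by simp
  have "UL (int n) * ((c \<cdot> g + u) * z) - (c \<cdot> g + u) * (UL (int n) * z) =
      c \<cdot> (UL (int n) * (g * z) - g * (UL (int n) * z)) + (UL (int n) * (u * z) - u * (UL (int n) * z))"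
    by (simp add: distrib_left distrib_right env.scale_right_diff_distrib algebra_simps)
  then show ?case using g step by (simp add: env.subspace_add env.subspace_scale Y(1))
qed (simp add: env.subspace_0 Y(1))

lemma UL_UL_act:
  "UL (int n) * (UL (- int i) * y) - UL (- int i) * (UL (int n) * y)
    = of_nat (n + i) \<cdot> (UL (int n - int i) * y)
      + (if n = i then of_nat (n ^ 3) / 12 - of_nat n / 12 else 0) \<cdot> (UCL * y)"
  using arg_cong[OF UL_UL[of "int n" "- int i"], of "\<lambda>u. u * y"]
  by (auto simp: distrib_right mult.assoc diff_divide_distrib)

lemma commutator_T_expand:
  "UL (int n) * (T * y) - T * (UL (int n) * y) =
    (\<Sum>i\<in>{1..p}. (UL (int n) * (g_coeff p cM (p - i) * (UL (- int i) * y)) - g_coeff p cM (p - i) * (UL (int n) * (UL (- int i) * y)))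
      + g_coeff p cM (p - i) * (UL (int n) * (UL (- int i) * y) - UL (- int i) * (UL (int n) * y)))
    + (UL (int n) * (w * y) - w * (UL (int n) * y))"
  by (simp add: T_of_def distrib_left distrib_right sum_distrib_left sum_distrib_right
      sum_subtractf right_diff_distrib sum.distrib mult.assoc)

text \<open>The commutator of \<open>L\<^sub>n\<close> with T a priori involves the \<open>L\<^sub>-\<^sub>l\<close> with \<open>l < p\<close>. They disappear because the result is
annihilated by all \<open>M\<^sub>m\<close> with \<open>m > 0\<close>.\<close>

lemma UL_T_lower:
  assumes B: "M_closed B" and y: "\<And>j. UL (int j) * y \<in> B" "y \<in> B" and n: "n \<ge> 1"
  shows "UL (int n) * (T * y) - T * (UL (int n) * y) \<in> B"
proof -
  let ?Y = "lowered B"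
  have HY: "H \<subseteq> ?Y" using M_closedD(2)[OF B] lowered_base by blast
  note Y = lowered_subspace[of B] HY lowered_UM[OF B]
  have gY: "g_coeff p cM d * x \<in> ?Y" if "x \<in> ?Y" for d x
    by (rule M_poly_closed[OF g_coeff_in_M_poly Y(1) _ that]) (rule Y(3))
  have cY: "UL (int n) * (u * z) - u * (UL (int n) * z) \<in> ?Y" if "z \<in> ?Y" "u \<in> M_poly d" for z u d
    by (rule commutator_M_poly[OF Y(1,2) _ that]) (rule Y(3))
  have low: "UL (int n - int i) * y \<in> ?Y" if "i \<in> {1..p}" for i
  proof (cases "i \<le> n")
    case True
    then have eq: "int n - int i = int (n - i)" by simp
    show ?thesis unfolding eq using y(1) lowered_base by blast
  next
    case False
    then have eq: "int n - int i = - int (i - n)" and "1 \<le> i - n" "i - n < p" using that n by auto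
    then show ?thesis unfolding eq using y(2) by (intro lowered_UL)
  qed
  have br: "UL (int n) * (UL (- int i) * y) - UL (- int i) * (UL (int n) * y) \<in> ?Y" if "i \<in> {1..p}" for i
    unfolding UL_UL_act
    using low[OF that] UCM_closed(2)[OF Y(1,2)] lowered_base[of B] y(2)
    by (intro env.subspace_add env.subspace_scale Y(1)) auto
  have 1: "UL (int n) * (g_coeff p cM (p - i) * (UL (- int i) * y)) - g_coeff p cM (p - i) * (UL (int n) * (UL (- int i) * y)) \<in> ?Y"
    if "i \<in> {1..p}" for i
  proof (cases "i = p")
    case False
    then have "UL (- int i) * y \<in> ?Y" using lowered_UL[of i y B] y(2) that by auto
    then show ?thesis by (rule cY[OF _ g_coeff_in_M_poly])
  qed (simp add: env.subspace_0 Y(1))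
  have "UL (int n) * (w * y) - w * (UL (int n) * y) \<in> ?Y"
    using cY[OF _ w'] y(2) lowered_base by blast
  then have X: "UL (int n) * (T * y) - T * (UL (int n) * y) \<in> ?Y"
    unfolding commutator_T_expand by (intro env.subspace_add env.subspace_sum Y(1) gY 1 br)
  obtain b0 b where b: "b0 \<in> B" "\<And>l. b l \<in> B"
      "UL (int n) * (T * y) - T * (UL (int n) * y) = b0 + (\<Sum>l\<in>{1..p-1}. UL (- int l) * b l)"
    using lowered_form[OF M_closedD(1)[OF B] X] by blast
  have "UM (int m) * (UL (int n) * (T * y) - T * (UL (int n) * y)) \<in> H" if m: "m \<ge> 1" for m
  proof -
    have yK: "y \<in> K" and nyK: "UL (int n) * y \<in> K" using y M_closedD(3)[OF B] by auto
    have "UM (int m) * (UL (int n) * (T * y)) = UL (int n) * (UM (int m) * (T * y)) + of_int (int m - int n) \<cdot> (UM (int (m + n)) * (T * y))"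
      using arg_cong[OF UM_UL[of "int m" "int n"], of "\<lambda>u. u * (T * y)"] m
      by (simp add: distrib_right mult.assoc del: of_int_diff)
    also have "\<dots> \<in> H" by (rule H_add[OF H_mult[OF UM_T_K[OF yK m]] H_scale[OF UM_T_K[OF yK]]]) (use m in simp)
    finally show ?thesis using UM_T_K[OF nyK m] by (simp add: right_diff_distrib H_diff)
  qed
  then show ?thesis unfolding b(3)
    by (intro eliminate_lowering[OF B] b(1,2)) (use p in auto)
qed

definition M_ideal :: "w22_env set \<Rightarrow> w22_env set" where
  "M_ideal B = env_span (H \<union> {UM (- int j) * b |j b. 1 \<le> j \<and> b \<in> B})"

lemma M_ideal_subspace: "env_subspace (M_ideal B)"
  by (simp add: M_ideal_def env.subspace_span)

lemma M_ideal_H: "H \<subseteq> M_ideal B"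
  unfolding M_ideal_def using env.span_superset by blast

lemma M_ideal_UM: "1 \<le> j \<Longrightarrow> b \<in> B \<Longrightarrow> UM (- int j) * b \<in> M_ideal B"
  unfolding M_ideal_def by (rule env.span_base) blast

lemma M_poly_M_ideal:
  assumes B: "M_closed B" and "u \<in> M_poly d" "d \<ge> 1" "b \<in> B"
  shows "u * b \<in> M_ideal B"
  using assms(2) unfolding M_poly_def
proof (induction rule: env.span_induct_alt)
  case (step c g u)
  then obtain xs where xs: "g = UM_neg xs" "0 \<notin> set xs" "sum_list xs = d" by (auto simp: M_words_def)
  then obtain a as where as: "xs = a # as" using assms(3) by (cases xs) auto
  have "UM_neg as * b \<in> B" by (induction as) (auto simp: mult.assoc M_closed_UM[OF B] assms(4))
  then have "g * b \<in> M_ideal B" using M_ideal_UM[of a] xs as by (simp add: mult.assoc)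
  then show ?case using step by (simp add: distrib_right env.subspace_add env.subspace_scale M_ideal_subspace)
qed (simp add: env.subspace_0 M_ideal_subspace)

lemma UL_p_M_word_small:
  assumes "y \<in> K" "\<forall>a\<in>set xs. 1 \<le> a \<and> a < p"
  shows "UL (int p) * (UM_neg xs * y) - UM_neg xs * (UL (int p) * y) \<in> H"
  using assms(2)
proof (induction xs)
  case (Cons a xs)
  have yK: "UM_neg xs * y \<in> K" using assms(1) by (induction xs) (auto simp: mult.assoc K_UM)
  have "UL (int p) * (UM_neg (a # xs) * y) - UM_neg (a # xs) * (UL (int p) * y) =
      (UL (int p) * (UM (- int a) * (UM_neg xs * y)) - UM (- int a) * (UL (int p) * (UM_neg xs * y)) - adj p a (UM_neg xs * y))
      + UM (- int a) * (UL (int p) * (UM_neg xs * y) - UM_neg xs * (UL (int p) * y))"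
    using Cons.prems by (simp add: adj_def algebra_simps)
  then show ?case using UL_UM_K[OF yK, of p a] Cons p by (simp add: H_add H_mult)
qed (simp add: H_0)

lemma UL_p_M_word:
  assumes y: "y \<in> K" and i: "1 \<le> i" "i < p" and xs: "0 \<notin> set xs" "sum_list xs + i \<le> p"
  shows "UL (int p) * (UM_neg xs * (UL (- int i) * y)) - UM_neg xs * (UL (int p) * (UL (- int i) * y))
    - (if xs = [p - i] then of_nat (2 * p - i) * e i else 0) \<cdot> y \<in> H"
  using xs
proof (induction xs)
  case (Cons a xs)
  let ?z = "UL (- int i) * y"
  have a: "1 \<le> a" "a + i \<le> p" using Cons.prems by auto
  have "xs \<noteq> [p - i]" using Cons.prems a by auto
  then have IH: "UL (int p) * (UM_neg xs * ?z) - UM_neg xs * (UL (int p) * ?z) \<in> H"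
    using Cons by simp
  have pa: "int p - int a = int (p - a)" "1 \<le> p - a" using a i by auto
  have br: "UM_UL_bracket p a * (UM_neg xs * ?z) = of_nat (p + a) \<cdot> (UM_neg xs * (UM (int (p - a)) * ?z))"
  proof -
    have "UM_UL_bracket p a = of_nat (p + a) \<cdot> UM (int (p - a))"
      unfolding UM_UL_bracket_def pa(1) using a i by simp
    moreover have "UM (int (p - a)) * (UM_neg xs * ?z) = UM_neg xs * (UM (int (p - a)) * ?z)"
      by (simp only: mult.assoc[symmetric] UM_UM_neg)
    ultimately show ?thesis by (simp only: scale_mult_left)
  qed
  have adj: "UM (int (p - a)) * ?z - adj (p - a) i y \<in> H" by (rule UM_UL_K[OF y pa(2) i(1)])
  have "UL (int p) * (UM_neg (a # xs) * ?z) - UM_neg (a # xs) * (UL (int p) * ?z)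
     = UM (- int a) * (UL (int p) * (UM_neg xs * ?z) - UM_neg xs * (UL (int p) * ?z))
      + UM_UL_bracket p a * (UM_neg xs * ?z)"
    using arg_cong[OF UL_UM_neg[of p a], of "\<lambda>u. u * (UM_neg xs * ?z)"] by (simp add: algebra_simps)
  also have "\<dots> = (UM (- int a) * (UL (int p) * (UM_neg xs * ?z) - UM_neg xs * (UL (int p) * ?z))
      + of_nat (p + a) \<cdot> (UM_neg xs * (UM (int (p - a)) * ?z - adj (p - a) i y)))
      + of_nat (p + a) \<cdot> (UM_neg xs * adj (p - a) i y)"
    unfolding br by (simp add: right_diff_distrib env.scale_right_diff_distrib)
  also have "of_nat (p + a) \<cdot> (UM_neg xs * adj (p - a) i y) =
      (if a # xs = [p - i] then of_nat (2 * p - i) * e i else 0) \<cdot> y"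
  proof (cases "a + i = p")
    case True
    then have "xs = []" using Cons.prems by (cases xs) auto
    moreover have "p - a = i" "a = p - i" "p + a = 2 * p - i" using True i by auto
    ultimately show ?thesis by (simp add: adj_def)
  next
    case False
    then have "p - a > i" "a \<noteq> p - i" using a by auto
    then show ?thesis by (simp add: adj_def)
  qed
  finally show ?case using IH adj by (simp add: H_add H_mult H_scale)
qed (simp add: H_0)

text \<open>Only the leading monomial \<open>M\<^sub>-\<^sub>(\<^sub>p\<^sub>-\<^sub>i\<^sub>)\<close> of \<open>g\<^sub>p\<^sub>-\<^sub>i\<close> contributes: all other monomials have smaller parts, and \<open>L\<^sub>p\<close> turns a
factor into an \<open>M\<close> of index larger than \<open>i\<close>, which annihilates \<open>L\<^sub>-\<^sub>i y\<close>.\<close>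

lemma UL_p_g:
  assumes y: "y \<in> K" and i: "1 \<le> i" "i < p"
  shows "UL (int p) * (g_coeff p cM (p - i) * (UL (- int i) * y)) - g_coeff p cM (p - i) * (UL (int p) * (UL (- int i) * y))
    + ((2 * of_nat p - of_nat i) * (of_nat p + of_nat i)) \<cdot> y \<in> H"
proof -
  let ?z = "UL (- int i) * y" and ?d = "p - i"
  define C where "C u = UL (int p) * (u * ?z) - u * (UL (int p) * ?z)" for u
  have C_add: "C (u + v) = C u + C v" for u v by (simp add: C_def algebra_simps)
  have C_scale: "C (c \<cdot> u) = c \<cdot> C u" for c u by (simp add: C_def env.scale_right_diff_distrib)
  have rest: "C u \<in> H" if "u \<in> env_span {UM_neg xs |xs. 0 \<notin> set xs \<and> sum_list xs = ?d \<and> xs \<noteq> [?d]}" for u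
    using that
  proof (induction rule: env.span_induct_alt)
    case (step c g u)
    then obtain xs where "g = UM_neg xs" "0 \<notin> set xs" "sum_list xs = ?d" "xs \<noteq> [?d]" by auto
    then have "C g \<in> H" using UL_p_M_word[OF y i, of xs] i by (simp add: C_def)
    then show ?case using step by (simp add: C_add C_scale H_add H_scale)
  qed (simp add: C_def H_0)
  have lead: "C (UM (- int ?d)) - (of_nat (2 * p - i) * e i) \<cdot> y \<in> H"
    using UL_p_M_word[OF y i, of "[?d]"] i by (simp add: C_def)
  have nz: "(of_nat p - of_nat i :: complex) \<noteq> 0" "(of_nat i :: complex) \<noteq> 0"
  proof -
    have "(of_nat p :: complex) \<noteq> of_nat i" using i by simp
    then show "(of_nat p - of_nat i :: complex) \<noteq> 0" by simp
  qed (use i in simp)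
  have num: "k_coeff p cM ?d * (of_nat (2 * p - i) * e i) = - ((2 * of_nat p - of_nat i) * (of_nat p + of_nat i))"
    using nz cM i by (simp add: k_coeff_def pairing_def of_nat_diff power2_eq_square field_simps)
  have g: "g_coeff p cM ?d = k_coeff p cM ?d \<cdot> UM (- int ?d) + (g_elem p cM ?d - k_coeff p cM ?d \<cdot> UM (- int ?d))"
    using i by (simp add: g_coeff_def)
  have "C (g_coeff p cM ?d) + ((2 * of_nat p - of_nat i) * (of_nat p + of_nat i)) \<cdot> y
     = k_coeff p cM ?d \<cdot> (C (UM (- int ?d)) - (of_nat (2 * p - i) * e i) \<cdot> y)
       + C (g_elem p cM ?d - k_coeff p cM ?d \<cdot> UM (- int ?d))"
    by (subst g) (simp only: C_add C_scale env.scale_right_diff_distrib env.scale_scale num env.scale_minus_left, simp add: algebra_simps)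
  also have "\<dots> \<in> H"
    using lead rest[OF g_elem_lead] i by (intro H_add H_scale) auto
  finally show ?thesis by (simp add: C_def)
qed

text \<open>Modulo multiples of the negative M, the commutator of \<open>L\<^sub>p\<close> with T is a multiple of \<open>L\<^sub>0\<close> shifted by a
constant, and this constant is the critical weight \<open>h'\<^sub>p\<^sub>,\<^sub>1\<close>.\<close>

lemma UL_p_T:
  assumes B: "M_closed B" and y: "\<And>j. UL (int j) * y \<in> B" "y \<in> B"
  shows "UL (int p) * (T * y) - T * (UL (int p) * y) - (2 * of_nat p) \<cdot> (UL 0 * y - hL_crit p 1 cL \<cdot> y) \<in> M_ideal B"
proof -
  have yK: "y \<in> K" using y(2) M_closedD(3)[OF B] by blast
  define G where "G i = g_coeff p cM (p - i)" for i
  define n2 where "n2 i = ((2 * of_nat p - of_nat i) * (of_nat p + of_nat i) :: complex)" for i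
  define A where "A i = UL (int p) * (G i * (UL (- int i) * y)) - G i * (UL (int p) * (UL (- int i) * y))" for i
  define D where "D i = UL (int p) * (UL (- int i) * y) - UL (- int i) * (UL (int p) * y)" for i
  have small: "A i + n2 i \<cdot> y + G i * D i \<in> M_ideal B" if "i \<in> {1..<p}" for i
  proof -
    have "A i + n2 i \<cdot> y \<in> H" using UL_p_g[OF yK, of i] that by (simp add: A_def G_def n2_def)
    moreover have "int p - int i = int (p - i)" using that by auto
    then have D: "D i = of_nat (p + i) \<cdot> (UL (int (p - i)) * y)"
      using that unfolding D_def UL_UL_act by (simp del: of_nat_diff)
    have "G i * (UL (int (p - i)) * y) \<in> M_ideal B"
      unfolding G_def by (rule M_poly_M_ideal[OF B g_coeff_in_M_poly _ y(1)]) (use that in auto)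
    then have "G i * D i \<in> M_ideal B"
      unfolding D scale_mult_right by (rule env.subspace_scale[OF M_ideal_subspace])
    ultimately show ?thesis using M_ideal_H env.subspace_add[OF M_ideal_subspace] by blast
  qed
  have wH: "UL (int p) * (w * y) - w * (UL (int p) * y) \<in> H"
    using w
  proof (induction rule: env.span_induct_alt)
    case (step c g u)
    then obtain xs where xs: "g = UM_neg xs" "0 \<notin> set xs" "p \<notin> set xs" "sum_list xs = p" by (auto simp: M_words_restr_def)
    have "1 \<le> a \<and> a < p" if "a \<in> set xs" for a
      using member_le_sum_list[OF that] that xs by (cases "a = 0"; cases "a = p") auto
    then have g: "UL (int p) * (g * y) - g * (UL (int p) * y) \<in> H" using UL_p_M_word_small[OF yK] xs by simp
    have "UL (int p) * ((c \<cdot> g + u) * y) - (c \<cdot> g + u) * (UL (int p) * y) =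
      c \<cdot> (UL (int p) * (g * y) - g * (UL (int p) * y)) + (UL (int p) * (u * y) - u * (UL (int p) * y))"
      by (simp add: distrib_left distrib_right env.scale_right_diff_distrib algebra_simps)
    then show ?case using g step by (simp add: H_add H_scale)
  qed (simp add: H_0)
  define \<kappa> where "\<kappa> = (of_nat (p ^ 3) / 12 - of_nat p / 12 :: complex)"
  have top: "A p + G p * D p = (2 * of_nat p) \<cdot> (UL 0 * y) + \<kappa> \<cdot> (UCL * y)"
    unfolding A_def D_def UL_UL_act by (simp add: G_def \<kappa>_def)
  have split: "{1..p} = insert p {1..<p}" using p by auto
  have "UL (int p) * (T * y) - T * (UL (int p) * y) =
     (\<Sum>i\<in>{1..p}. A i + G i * D i) + (UL (int p) * (w * y) - w * (UL (int p) * y))"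
    unfolding commutator_T_expand by (simp add: A_def D_def G_def)
  also have "(\<Sum>i\<in>{1..p}. A i + G i * D i) =
     (2 * of_nat p) \<cdot> (UL 0 * y) + \<kappa> \<cdot> (UCL * y) + (\<Sum>i\<in>{1..<p}. A i + G i * D i)"
    unfolding split using top by simp
  also have "(\<Sum>i\<in>{1..<p}. A i + G i * D i) = (\<Sum>i\<in>{1..<p}. A i + n2 i \<cdot> y + G i * D i) - (\<Sum>i\<in>{1..<p}. n2 i) \<cdot> y"
    by (simp add: env.scale_sum_left sum.distrib algebra_simps)
  finally have eq: "UL (int p) * (T * y) - T * (UL (int p) * y) =
     (2 * of_nat p) \<cdot> (UL 0 * y) + \<kappa> \<cdot> (UCL * y) + ((\<Sum>i\<in>{1..<p}. A i + n2 i \<cdot> y + G i * D i) - (\<Sum>i\<in>{1..<p}. n2 i) \<cdot> y)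
     + (UL (int p) * (w * y) - w * (UL (int p) * y))" .
  have num: "2 * of_nat p * hL_crit p 1 cL = (\<Sum>i\<in>{1..<p}. n2 i) - \<kappa> * cL"
    unfolding n2_def critical_weight_sum hL_crit_def \<kappa>_def
    by (simp add: field_simps power2_eq_square power3_eq_cube)
  have "UL (int p) * (T * y) - T * (UL (int p) * y) - (2 * of_nat p) \<cdot> (UL 0 * y - hL_crit p 1 cL \<cdot> y) =
     \<kappa> \<cdot> (UCL * y - cL \<cdot> y) + (\<Sum>i\<in>{1..<p}. A i + n2 i \<cdot> y + G i * D i)
     + (UL (int p) * (w * y) - w * (UL (int p) * y))"
    unfolding eq env.scale_right_diff_distrib env.scale_scale num
    by (simp add: env.scale_left_diff_distrib algebra_simps)
  also have "\<dots> \<in> M_ideal B"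
  proof -
    have "(\<Sum>i\<in>{1..<p}. A i + n2 i \<cdot> y + G i * D i) \<in> M_ideal B"
      by (rule env.subspace_sum[OF M_ideal_subspace small])
    moreover have "\<kappa> \<cdot> (UCL * y - cL \<cdot> y) \<in> M_ideal B"
      using H_scale[OF hw_central(1)] M_ideal_H by blast
    moreover have "UL (int p) * (w * y) - w * (UL (int p) * y) \<in> M_ideal B"
      using wH M_ideal_H by blast
    ultimately show ?thesis by (intro env.subspace_add M_ideal_subspace)
  qed
  finally show ?thesis .
qed

end



section \<open>Euler operators on filtered modules\<close>

text \<open>The words of length less than \<open>r\<close> in the \<open>x\<^sub>i\<close>, \<open>i \<noteq> p\<close>, applied to \<open>B\<close>, modulo \<open>A\<close>. The bound is strict, so
that level 0 is \<open>A\<close> and level 1 is the span of \<open>A\<close> and \<open>B\<close>.\<close>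

definition filt :: "nat \<Rightarrow> (nat \<Rightarrow> w22_env) \<Rightarrow> w22_env set \<Rightarrow> w22_env set \<Rightarrow> nat \<Rightarrow> w22_env set" where
  "filt p x A B r = (if r = 0 then A else env_span (A \<union>
     {prod_list (map x js) * b |js b. b \<in> B \<and> length js < r \<and> (\<forall>i\<in>set js. 1 \<le> i \<and> i \<noteq> p)}))"

definition pair_term :: "nat \<Rightarrow> complex \<Rightarrow> nat \<Rightarrow> nat \<Rightarrow> w22_env \<Rightarrow> w22_env" where
  "pair_term p cM m i y = (if m < i then of_nat (m + i) \<cdot> (UM (- int (i - m)) * y)
     else if m = i then pairing p cM m \<cdot> y else 0)"

text \<open>The solution of the triangular system that the \<open>D\<^sub>m\<close> form: it acts as the partial derivative with respect to \<open>x\<^sub>n\<close> on words whose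
letters are at most \<open>N\<close> and different from \<open>p\<close>.\<close>

function dhat :: "nat \<Rightarrow> complex \<Rightarrow> (nat \<Rightarrow> w22_env) \<Rightarrow> nat \<Rightarrow> nat \<Rightarrow> w22_env" where
  "dhat p cM D N n = (1 / pairing p cM n) \<cdot>
     (D n - (\<Sum>j\<in>{n<..N} - {p}. of_nat (n + j) \<cdot> (UM (- int (j - n)) * dhat p cM D N j)))"
  by auto
termination by (relation "measure (\<lambda>(p, cM, D, N, n). N - n)") auto

declare dhat.simps [simp del]

lemma dhat_closed:
  assumes Y: "env_subspace Y" "\<And>j y. 1 \<le> j \<Longrightarrow> y \<in> Y \<Longrightarrow> UM (- int j) * y \<in> Y"
    and D: "\<And>m. n \<le> m \<Longrightarrow> D m * y \<in> Y"
  shows "dhat p cM D N n * y \<in> Y"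
  using D
proof (induction "N - n" arbitrary: n rule: less_induct)
  case less
  have "UM (- int (j - n)) * (dhat p cM D N j * y) \<in> Y" if "j \<in> {n<..N} - {p}" for j
    by (intro Y(2) less.hyps) (use that less.prems in auto)
  then show ?case
    by (subst dhat.simps)
      (auto simp: left_diff_distrib sum_distrib_right mult.assoc less.prems
        intro!: env.subspace_scale env.subspace_diff env.subspace_sum Y(1))
qed

locale filtration =
  fixes p :: nat and x :: "nat \<Rightarrow> w22_env" and A B :: "w22_env set"
  assumes A: "env_subspace A"
    and x_A: "\<And>i a. 1 \<le> i \<Longrightarrow> i \<noteq> p \<Longrightarrow> a \<in> A \<Longrightarrow> x i * a \<in> A"
begin

abbreviation F where "F \<equiv> filt p x A B"
abbreviation xw where "xw js \<equiv> prod_list (map x js)"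

lemma F_subspace: "env_subspace (F r)"
  by (simp add: filt_def A env.subspace_span)

lemma F_A: "A \<subseteq> F r"
  using env.span_superset by (fastforce simp: filt_def)

lemma F_mono: "r \<le> s \<Longrightarrow> F r \<subseteq> F s"
proof -
  assume "r \<le> s"
  show ?thesis
  proof (cases "r = 0")
    case True
    then show ?thesis using F_A by (simp add: filt_def[of _ _ _ _ 0])
  next
    case False
    then show ?thesis using \<open>r \<le> s\<close> unfolding filt_def
      by (simp, intro env.span_mono) fastforce
  qed
qed

lemma F_word: "b \<in> B \<Longrightarrow> length js < r \<Longrightarrow> \<forall>i\<in>set js. 1 \<le> i \<and> i \<noteq> p \<Longrightarrow> xw js * b \<in> F r"
  unfolding filt_def by (auto intro!: env.span_base)

lemma F_Suc_induct [consumes 1, case_names zero low word add]: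
  assumes "y \<in> F (Suc r)" "P 0" "\<And>a. a \<in> A \<Longrightarrow> P a"
    "\<And>js b. b \<in> B \<Longrightarrow> length js \<le> r \<Longrightarrow> \<forall>i\<in>set js. 1 \<le> i \<and> i \<noteq> p \<Longrightarrow> P (xw js * b)"
    "\<And>c u v. P u \<Longrightarrow> P v \<Longrightarrow> P (c \<cdot> u + v)"
  shows "P y"
proof -
  have "y \<in> env_span (A \<union> {xw js * b |js b. b \<in> B \<and> length js \<le> r \<and> (\<forall>i\<in>set js. 1 \<le> i \<and> i \<noteq> p)})"
    using assms(1) by (simp add: filt_def less_Suc_eq_le)
  then show ?thesis
    by (induction rule: env.span_induct_alt) (use assms(2-) in auto)
qed

lemma F_x: "1 \<le> i \<Longrightarrow> i \<noteq> p \<Longrightarrow> y \<in> F r \<Longrightarrow> x i * y \<in> F (Suc r)"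
proof (cases r)
  case 0
  then show "1 \<le> i \<Longrightarrow> i \<noteq> p \<Longrightarrow> y \<in> F r \<Longrightarrow> x i * y \<in> F (Suc r)"
    using x_A F_A by (auto simp: filt_def[of _ _ _ _ 0])
next
  case (Suc s)
  assume i: "1 \<le> i" "i \<noteq> p" and y: "y \<in> F r"
  show "x i * y \<in> F (Suc r)" using y unfolding Suc
  proof (induction rule: F_Suc_induct)
    case zero
    show ?case by (simp add: env.subspace_0[OF F_subspace])
  next
    case (low a)
    then show ?case using x_A[OF i] F_A by blast
  next
    case (word js b)
    then show ?case using F_word[of b "i # js"] i by (simp add: mult.assoc)
  next
    case (add c u v)
    then show ?case by (simp add: distrib_left env.subspace_add env.subspace_scale F_subspace)
  qed
qed

end

text \<open>Two situations are covered: \<open>x\<^sub>i = L\<^sub>-\<^sub>i\<close> with \<open>D\<^sub>m = M\<^sub>m\<close>, and \<open>x\<^sub>i = M\<^sub>-\<^sub>i\<close> with \<open>D\<^sub>m = L\<^sub>m\<close>. The spaces \<open>Er r\<close>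
take up the deviations from the commutation relations of variables and derivatives.\<close>

locale euler_filtration = filtration p x A B
  for p :: nat and x :: "nat \<Rightarrow> w22_env" and A B :: "w22_env set" +
  fixes cM :: complex and D :: "nat \<Rightarrow> w22_env" and Er :: "nat \<Rightarrow> w22_env set"
  assumes cM: "cM \<noteq> 0"
    and UM_A: "\<And>j a. 1 \<le> j \<Longrightarrow> a \<in> A \<Longrightarrow> UM (- int j) * a \<in> A"
    and D_A: "\<And>m a. 1 \<le> m \<Longrightarrow> a \<in> A \<Longrightarrow> D m * a \<in> A"
    and D_B: "\<And>m b. 1 \<le> m \<Longrightarrow> b \<in> B \<Longrightarrow> D m * b \<in> A"
    and Er: "\<And>r. env_subspace (Er r)" "\<And>r. Er r \<subseteq> filt p x A B r"
    and UM_Er: "\<And>r j a. 1 \<le> j \<Longrightarrow> a \<in> Er r \<Longrightarrow> UM (- int j) * a \<in> Er r"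
    and D_x: "\<And>r m i y. 1 \<le> m \<Longrightarrow> 1 \<le> i \<Longrightarrow> i \<noteq> p \<Longrightarrow> y \<in> filt p x A B (Suc r) \<Longrightarrow>
       D m * (x i * y) - x i * (D m * y) - pair_term p cM m i y \<in> Er r"
    and UM_x: "\<And>r j i z. 1 \<le> j \<Longrightarrow> 1 \<le> i \<Longrightarrow> i \<noteq> p \<Longrightarrow> z \<in> filt p x A B r \<Longrightarrow>
       UM (- int j) * (x i * z) - x i * (UM (- int j) * z) \<in> Er r"
    and x_x: "\<And>r n i z. 1 \<le> n \<Longrightarrow> n \<noteq> p \<Longrightarrow> 1 \<le> i \<Longrightarrow> i \<noteq> p \<Longrightarrow> z \<in> filt p x A B r \<Longrightarrow>
       x n * (x i * z) - x i * (x n * z) \<in> filt p x A B (Suc r)"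
begin

abbreviation dh where "dh \<equiv> dhat p cM D"

lemma dh_word:
  assumes b: "b \<in> B" and "\<forall>i\<in>set js. i \<in> {1..N} - {p}"
  shows "\<forall>n\<in>{1..N} - {p}. dh N n * (xw js * b) \<in> F (length js)"
    and "\<forall>n\<in>{1..N} - {p}. \<forall>i\<in>{1..N} - {p}. dh N n * (x i * (xw js * b)) - x i * (dh N n * (xw js * b))
      - (if n = i then xw js * b else 0) \<in> Er (length js)"
proof -
  have comm: "dh N n * (x i * y) - x i * (dh N n * y) - (if n = i then y else 0) \<in> Er r"
    if y: "y \<in> F (Suc r)" "\<forall>n\<in>{1..N} - {p}. dh N n * y \<in> F r" and n: "n \<in> {1..N} - {p}" and i: "i \<in> {1..N} - {p}"
    for n i y r
    using n
  proof (induction "N - n" arbitrary: n rule: less_induct)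
    case (less n)
    define C where "C u = u * (x i * y) - x i * (u * y)" for u
    define J where "J = {n<..N} - {p}"
    have en: "pairing p cM n \<noteq> 0" using pairing_nonzero[OF cM] less.prems by auto
    have J: "C (dh N j) - (if j = i then y else 0) \<in> Er r" if "j \<in> J" for j
      using less.hyps[of j] that less.prems by (auto simp: C_def J_def)
    have UMC: "C (UM (- int k) * dh N j) - UM (- int k) * (if j = i then y else 0) \<in> Er r"
      if "j \<in> J" "1 \<le> k" for j k
    proof -
      have z: "dh N j * y \<in> F r" using y(2) that less.prems by (auto simp: J_def)
      have "C (UM (- int k) * dh N j) - UM (- int k) * (if j = i then y else 0) =
          UM (- int k) * (C (dh N j) - (if j = i then y else 0))
          + (UM (- int k) * (x i * (dh N j * y)) - x i * (UM (- int k) * (dh N j * y)))"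
        by (simp add: C_def right_diff_distrib mult.assoc)
      then show ?thesis
        using UM_Er[OF that(2) J[OF that(1)]] UM_x[OF that(2) _ _ z, of i] i
        by (simp add: env.subspace_add Er(1))
    qed
    have "(\<Sum>j\<in>J. of_nat (n + j) \<cdot> (UM (- int (j - n)) * (if j = i then y else 0))) =
        (\<Sum>j\<in>J. if j = i then of_nat (n + i) \<cdot> (UM (- int (i - n)) * y) else 0)"
      by (rule sum.cong) auto
    also have "\<dots> = (if i \<in> J then of_nat (n + i) \<cdot> (UM (- int (i - n)) * y) else 0)"
      by (simp add: J_def)
    finally have sumJ: "pair_term p cM n i y - (\<Sum>j\<in>J. of_nat (n + j) \<cdot> (UM (- int (j - n)) * (if j = i then y else 0)))
        = pairing p cM n \<cdot> (if n = i then y else 0)"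
      using i by (auto simp: pair_term_def J_def)
    have Cd: "C (dh N n) = (1 / pairing p cM n) \<cdot> (C (D n) - (\<Sum>j\<in>J. of_nat (n + j) \<cdot> C (UM (- int (j - n)) * dh N j)))"
      by (subst dhat.simps) (simp add: C_def J_def[symmetric] left_diff_distrib right_diff_distrib
          sum_distrib_right sum_distrib_left env.scale_right_diff_distrib sum_subtractf algebra_simps)
    have "C (D n) - (\<Sum>j\<in>J. of_nat (n + j) \<cdot> C (UM (- int (j - n)) * dh N j))
        - pairing p cM n \<cdot> (if n = i then y else 0) =
        (C (D n) - pair_term p cM n i y)
        - (\<Sum>j\<in>J. of_nat (n + j) \<cdot> (C (UM (- int (j - n)) * dh N j) - UM (- int (j - n)) * (if j = i then y else 0)))"
      unfolding sumJ[symmetric] env.scale_right_diff_distrib sum_subtractf by (simp only: algebra_simps)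
    also have "\<dots> \<in> Er r"
    proof (rule env.subspace_diff[OF Er(1) _ env.subspace_sum[OF Er(1) env.subspace_scale[OF Er(1)]]])
      show "C (D n) - pair_term p cM n i y \<in> Er r"
        using D_x[of n i y r] i less.prems y(1) by (auto simp: C_def)
      show "C (UM (- int (j - n)) * dh N j) - UM (- int (j - n)) * (if j = i then y else 0) \<in> Er r" if "j \<in> J" for j
        by (rule UMC[OF that]) (use that in \<open>auto simp: J_def\<close>)
    qed
    finally have "(1 / pairing p cM n) \<cdot> (C (D n) - (\<Sum>j\<in>J. of_nat (n + j) \<cdot> C (UM (- int (j - n)) * dh N j))
        - pairing p cM n \<cdot> (if n = i then y else 0)) \<in> Er r"
      by (rule env.subspace_scale[OF Er(1)])
    then have "C (dh N n) - (if n = i then y else 0) \<in> Er r"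
      unfolding Cd using en by (simp add: env.scale_right_diff_distrib)
    then show ?case by (simp add: C_def)
  qed
  have main: "\<forall>n\<in>{1..N} - {p}. dh N n * (xw js * b) \<in> F (length js)"
    using assms(2)
  proof (induction "js")
    case Nil
    have "dh N n * b \<in> A" if "n \<ge> 1" for n
      by (rule dhat_closed[OF A UM_A]) (use D_B[OF _ b] that in auto)
    then show ?case by (simp add: filt_def)
  next
    case (Cons i "js")
    let ?y = "xw js * b"
    have IH: "\<forall>n\<in>{1..N} - {p}. dh N n * ?y \<in> F (length js)" and i: "i \<in> {1..N} - {p}" using Cons by auto
    have y: "?y \<in> F (Suc (length js))" using F_word[OF b] Cons.prems by auto
    have "dh N n * (x i * ?y) \<in> F (Suc (length js))" if n: "n \<in> {1..N} - {p}" for n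
    proof -
      have "(dh N n * (x i * ?y) - x i * (dh N n * ?y) - (if n = i then ?y else 0))
          + (x i * (dh N n * ?y) + (if n = i then ?y else 0)) \<in> F (Suc (length js))"
      proof (rule env.subspace_add[OF F_subspace _ env.subspace_add[OF F_subspace]])
        show "dh N n * (x i * ?y) - x i * (dh N n * ?y) - (if n = i then ?y else 0) \<in> F (Suc (length js))"
          by (rule subsetD[OF F_mono subsetD[OF Er(2) comm[OF y IH n i]]]) simp
        show "x i * (dh N n * ?y) \<in> F (Suc (length js))" using F_x i IH n by auto
        show "(if n = i then ?y else 0) \<in> F (Suc (length js))" using y env.subspace_0[OF F_subspace] by simp
      qed
      then show ?thesis by simp
    qed
    then show ?case by (simp add: mult.assoc)
  qed
  then show "\<forall>n\<in>{1..N} - {p}. dh N n * (xw js * b) \<in> F (length js)" .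
  have y: "xw js * b \<in> F (Suc (length js))" using F_word[OF b] assms(2) by auto
  show "\<forall>n\<in>{1..N} - {p}. \<forall>i\<in>{1..N} - {p}. dh N n * (x i * (xw js * b)) - x i * (dh N n * (xw js * b))
      - (if n = i then xw js * b else 0) \<in> Er (length js)"
    using comm[OF y main] by blast
qed

definition euler :: "nat \<Rightarrow> w22_env" where
  "euler N = (\<Sum>n\<in>{1..N} - {p}. x n * dh N n)"

text \<open>Passing a letter \<open>x\<^sub>i\<close> from the right of \<open>\<Sum> x\<^sub>n \<partial>\<^sub>n\<close> to its left adds one copy of the word, so the length counts.\<close>

lemma euler_word:
  assumes b: "b \<in> B" and "\<forall>i\<in>set js. i \<in> {1..N} - {p}"
  shows "euler N * (xw js * b) - of_nat (length js) \<cdot> (xw js * b) \<in> F (length js)"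
  using assms(2)
proof (induction "js")
  case Nil
  have "x n * (dh N n * b) \<in> A" if "n \<in> {1..N} - {p}" for n
    by (rule x_A, use that in simp, use that in simp, rule dhat_closed[OF A UM_A])
       (use D_B[OF _ b] that in auto)
  then have "(\<Sum>n\<in>{1..N} - {p}. x n * (dh N n * b)) \<in> A" by (rule env.subspace_sum[OF A])
  then show ?case by (simp add: filt_def euler_def sum_distrib_right mult.assoc)
next
  case (Cons i "js")
  let ?y = "xw js * b" and ?r = "length js" and ?I = "{1..N} - {p}"
  have js: "\<forall>i\<in>set js. i \<in> ?I" and i: "i \<in> ?I" using Cons.prems by auto
  note IH = Cons.IH[OF js]
  have y: "?y \<in> F (Suc ?r)" using F_word[OF b] js by auto
  define er where "er n = dh N n * (x i * ?y) - x i * (dh N n * ?y) - (if n = i then ?y else 0)" for n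
  define cc where "cc n = x n * (x i * (dh N n * ?y)) - x i * (x n * (dh N n * ?y))" for n
  have er: "x n * er n \<in> F (Suc ?r)" if "n \<in> ?I" for n
  proof -
    have "er n \<in> Er ?r" using dh_word(2)[OF b js] that i unfolding er_def by blast
    then show ?thesis using that Er(2)[of ?r] by (intro F_x) auto
  qed
  have cc: "cc n \<in> F (Suc ?r)" if "n \<in> ?I" for n
    using x_x[of n i "dh N n * ?y" ?r] dh_word(1)[OF b js] that i by (auto simp: cc_def)
  have split: "x n * (dh N n * (x i * ?y)) = x i * (x n * (dh N n * ?y)) + (if n = i then x i * ?y else 0) + (cc n + x n * er n)" for n
    by (simp add: er_def cc_def right_diff_distrib)
  have "euler N * (x i * ?y) = (\<Sum>n\<in>?I. x n * (dh N n * (x i * ?y)))"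
    by (simp add: euler_def sum_distrib_right mult.assoc)
  also have "\<dots> = x i * (euler N * ?y) + x i * ?y + (\<Sum>n\<in>?I. cc n + x n * er n)"
    unfolding split sum.distrib using i by (simp add: euler_def sum_distrib_right sum_distrib_left mult.assoc)
  finally have "euler N * (x i * ?y) - of_nat (Suc ?r) \<cdot> (x i * ?y) =
      x i * (euler N * ?y - of_nat ?r \<cdot> ?y) + (\<Sum>n\<in>?I. cc n + x n * er n)"
    by (simp add: right_diff_distrib env.scale_left_distrib)
  also have "\<dots> \<in> F (Suc ?r)"
  proof (rule env.subspace_add[OF F_subspace])
    show "(\<Sum>n\<in>?I. cc n + x n * er n) \<in> F (Suc ?r)"
      by (rule env.subspace_sum[OF F_subspace env.subspace_add[OF F_subspace cc er]])
    show "x i * (euler N * ?y - of_nat ?r \<cdot> ?y) \<in> F (Suc ?r)"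
      by (rule F_x[OF _ _ IH]) (use i in auto)
  qed
  finally show ?case by (simp add: mult.assoc)
qed

lemma euler_step:
  assumes "y \<in> F (Suc r)" "r \<ge> 1"
  shows "\<exists>N0. \<forall>N\<ge>N0. euler N * y - of_nat r \<cdot> y \<in> F r"
  using assms(1)
proof (induction rule: F_Suc_induct)
  case zero
  show ?case by (simp add: env.subspace_0[OF F_subspace])
next
  case (low a)
  have "euler N * a \<in> A" for N
    unfolding euler_def sum_distrib_right mult.assoc
    by (intro env.subspace_sum[OF A] x_A dhat_closed[OF A UM_A] D_A) (use low in auto)
  then have "euler N * a - of_nat r \<cdot> a \<in> F r" for N
    using low F_A[of r] by (intro env.subspace_diff env.subspace_scale F_subspace) auto
  then show ?case by blast
next
  case (word js b)
  obtain N0 where N0: "\<forall>i\<in>set js. i \<le> N0" by (metis finite_set finite_nat_set_iff_bounded_le)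
  have "euler N * (xw js * b) - of_nat r \<cdot> (xw js * b) \<in> F r" if "N \<ge> N0" for N
  proof -
    have "euler N * (xw js * b) - of_nat (length js) \<cdot> (xw js * b) \<in> F (length js)"
      by (rule euler_word[OF word(1)]) (use N0 that word in fastforce)
    then have 1: "euler N * (xw js * b) - of_nat (length js) \<cdot> (xw js * b) \<in> F r"
      using F_mono[OF word(2)] by blast
    show ?thesis
    proof (cases "length js = r")
      case False
      then have "xw js * b \<in> F r" using F_word word by auto
      then have "(euler N * (xw js * b) - of_nat (length js) \<cdot> (xw js * b))
         + (of_nat (length js) - of_nat r) \<cdot> (xw js * b) \<in> F r"
        using 1 by (intro env.subspace_add env.subspace_scale F_subspace)
      then show ?thesis by (simp add: env.scale_left_diff_distrib)
    qed (use 1 in simp)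
  qed
  then show ?case by blast
next
  case (add c u v)
  then obtain N1 N2 where N: "\<forall>N\<ge>N1. euler N * u - of_nat r \<cdot> u \<in> F r" "\<forall>N\<ge>N2. euler N * v - of_nat r \<cdot> v \<in> F r" by blast
  have "euler N * (c \<cdot> u + v) - of_nat r \<cdot> (c \<cdot> u + v) \<in> F r" if "N \<ge> max N1 N2" for N
  proof -
    have "c \<cdot> (euler N * u - of_nat r \<cdot> u) + (euler N * v - of_nat r \<cdot> v) \<in> F r"
      using N that by (intro env.subspace_add env.subspace_scale F_subspace) auto
    then show ?thesis
      by (simp add: distrib_left env.scale_right_distrib env.scale_right_diff_distrib mult.commute algebra_simps)
  qed
  then show ?case by blast
qed

text \<open>The Euler operator annihilates \<open>y\<close> modulo \<open>A\<close>, but multiplies its part of length \<open>r\<close> by \<open>r\<close>. So that part is of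
smaller length, as long as \<open>r\<close> is positive.\<close>

theorem euler_descent:
  assumes "y \<in> F r" "\<And>m. 1 \<le> m \<Longrightarrow> D m * y \<in> A"
  shows "y \<in> F 1"
  using assms(1)
proof (induction r)
  case 0
  then show ?case using F_mono[of 0 1] by auto
next
  case (Suc r)
  show ?case
  proof (cases "r = 0")
    case False
    then obtain N where N: "euler N * y - of_nat r \<cdot> y \<in> F r" using euler_step[OF Suc.prems] by auto
    have "euler N * y \<in> A"
      unfolding euler_def sum_distrib_right mult.assoc
      by (intro env.subspace_sum[OF A] x_A dhat_closed[OF A UM_A]) (use assms(2) in auto)
    then have "euler N * y - (euler N * y - of_nat r \<cdot> y) \<in> F r"
      using F_A by (intro env.subspace_diff[OF F_subspace _ N]) auto
    then have "of_nat r \<cdot> y \<in> F r" by simp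
    from env.subspace_scale[OF F_subspace this, of "1 / of_nat r"]
    show ?thesis using Suc.IH False by simp
  qed (use Suc in simp)
qed

end



section \<open>The vectors annihilated by the positive M\<close>

lemma UL_UM_negneg:
  assumes "i \<ge> 1"
  shows "UL (- int i) * UM (- int a) = UM (- int a) * UL (- int i) + of_int (int a - int i) \<cdot> UM (- int (i + a))"
  using UL_UM[of "- int i" "- int a"] assms by (simp add: algebra_simps)

context critical
begin

text \<open>The \<open>L\<^sub>-\<^sub>i\<close> in T are derivations of the polynomial algebra in the negative M.\<close>

lemma T_M_commutator:
  assumes "u \<in> M_poly d"
  shows "T * u - u * T \<in> M_poly (d + p)"
proof -
  have 1: "T * UM (- int a) - UM (- int a) * T \<in> M_poly (a + p)" if "a \<ge> 1" for a
  proof -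
    have "g_coeff p cM (p - i) * UL (- int i) * UM (- int a) =
        UM (- int a) * (g_coeff p cM (p - i) * UL (- int i)) + of_int (int a - int i) \<cdot> (g_coeff p cM (p - i) * UM (- int (i + a)))"
      if "i \<in> {1..p}" for i
    proof -
      have "g_coeff p cM (p - i) * (UM (- int a) * UL (- int i)) = UM (- int a) * (g_coeff p cM (p - i) * UL (- int i))"
        by (simp only: mult.assoc[symmetric] M_poly_UM_commute[OF g_coeff_in_M_poly])
      then show ?thesis using UL_UM_negneg[of i a] that
        by (simp add: mult.assoc distrib_left del: of_int_diff of_nat_add)
    qed
    then have "T * UM (- int a) - UM (- int a) * T =
        (\<Sum>i\<in>{1..p}. of_int (int a - int i) \<cdot> (g_coeff p cM (p - i) * UM (- int (i + a))))"
      by (simp add: T_of_def distrib_left distrib_right sum_distrib_left sum_distrib_right sum.distrib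
          M_poly_UM_commute[OF w'] del: of_int_diff of_nat_add)
    also have "\<dots> \<in> M_poly (a + p)"
    proof (rule env.subspace_sum[OF M_poly_subspace env.subspace_scale[OF M_poly_subspace]])
      fix i assume "i \<in> {1..p}"
      then show "g_coeff p cM (p - i) * UM (- int (i + a)) \<in> M_poly (a + p)"
        using M_poly_mult[OF g_coeff_in_M_poly[of p cM "p - i"] M_poly_UM[of "i + a"]]
        by (simp add: add.commute del: of_nat_add)
    qed
    finally show ?thesis .
  qed
  have 2: "T * UM_neg xs - UM_neg xs * T \<in> M_poly (sum_list xs + p)" if "0 \<notin> set xs" for xs
    using that
  proof (induction xs)
    case (Cons a xs)
    have xs: "UM_neg xs \<in> M_poly (sum_list xs)"
      using Cons.prems unfolding M_poly_def M_words_def by (intro env.span_base) auto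
    have a: "a \<ge> 1" using Cons.prems by (cases a) auto
    have "T * UM_neg (a # xs) - UM_neg (a # xs) * T =
        UM (- int a) * (T * UM_neg xs - UM_neg xs * T) + (T * UM (- int a) - UM (- int a) * T) * UM_neg xs"
      by (simp add: algebra_simps)
    also have "\<dots> \<in> M_poly (sum_list (a # xs) + p)"
      using M_poly_mult[OF M_poly_UM[OF a] Cons.IH] M_poly_mult[OF 1[OF a] xs] Cons.prems
      by (intro env.subspace_add[OF M_poly_subspace]) (simp_all add: add_ac)
    finally show ?case .
  qed (simp add: env.subspace_0[OF M_poly_subspace])
  show ?thesis using assms unfolding M_poly_def[of d]
  proof (induction rule: env.span_induct_alt)
    case base
    show ?case by (simp add: env.subspace_0[OF M_poly_subspace])
  next
    case (step c g u)
    then have "T * g - g * T \<in> M_poly (d + p)" using 2 by (auto simp: M_words_def)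
    then have "c \<cdot> (T * g - g * T) + (T * u - u * T) \<in> M_poly (d + p)"
      using step by (intro env.subspace_add env.subspace_scale M_poly_subspace)
    then show ?case by (simp add: distrib_left distrib_right env.scale_right_diff_distrib algebra_simps)
  qed
qed

text \<open>The polynomials in T of degree less than \<open>k\<close> with coefficients in the algebra of the negative M, modulo \<open>H\<close>.\<close>

definition Kf :: "nat \<Rightarrow> w22_env set" where
  "Kf k = env_span ({UM_neg xs * T ^ j |xs j. 0 \<notin> set xs \<and> j < k} \<union> H)"

lemma Kf_subspace: "env_subspace (Kf k)"
  by (simp add: Kf_def env.subspace_span)

lemma Kf_H: "H \<subseteq> Kf k"
  unfolding Kf_def using env.span_superset by blast

lemma Kf_word: "0 \<notin> set xs \<Longrightarrow> j < k \<Longrightarrow> UM_neg xs * T ^ j \<in> Kf k"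
  unfolding Kf_def by (rule env.span_base) blast

lemma Kf_power: "j < k \<Longrightarrow> T ^ j \<in> Kf k"
  using Kf_word[of "[]" j k] by simp

lemma Kf_mono: "k \<le> l \<Longrightarrow> Kf k \<subseteq> Kf l"
  unfolding Kf_def by (rule env.span_mono) fastforce

lemma Kf_0: "Kf 0 = H"
  using H_subspace env.span_eq_iff[of H] by (simp add: Kf_def)

lemma Kf_induct [consumes 1, case_names zero word low add]:
  assumes "y \<in> Kf k" "P 0" "\<And>xs j. 0 \<notin> set xs \<Longrightarrow> j < k \<Longrightarrow> P (UM_neg xs * T ^ j)" "\<And>\<eta>. \<eta> \<in> H \<Longrightarrow> P \<eta>"
    "\<And>c u v. P u \<Longrightarrow> P v \<Longrightarrow> P (c \<cdot> u + v)"
  shows "P y"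
  using assms(1) unfolding Kf_def
  by (induction rule: env.span_induct_alt) (use assms(2-) in auto)

lemma Kf_add_scale: "x \<in> Kf k \<Longrightarrow> y \<in> Kf k \<Longrightarrow> c \<cdot> x + y \<in> Kf k"
  by (rule env.subspace_add[OF Kf_subspace env.subspace_scale[OF Kf_subspace]])

lemma Kf_UM: "y \<in> Kf k \<Longrightarrow> 1 \<le> j \<Longrightarrow> UM (- int j) * y \<in> Kf k"
proof (induction rule: Kf_induct)
  case (word xs i)
  then show ?case using Kf_word[of "j # xs" i k] by (simp add: mult.assoc)
next
  case (low \<eta>)
  then show ?case using Kf_H H_mult by blast
qed (simp_all add: env.subspace_0[OF Kf_subspace] distrib_left Kf_add_scale)

lemma Kf_M_poly: "u \<in> M_poly d \<Longrightarrow> y \<in> Kf k \<Longrightarrow> u * y \<in> Kf k"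
  by (rule M_poly_closed[OF _ Kf_subspace]) (use Kf_UM in auto)

lemma K_UM_neg: "y \<in> K \<Longrightarrow> UM_neg xs * y \<in> K"
  by (induction xs) (auto simp: mult.assoc K_UM)

lemma Kf_K:
  assumes "\<And>j. j < k \<Longrightarrow> T ^ j \<in> K" "y \<in> Kf k"
  shows "y \<in> K"
  using assms(2)
proof (induction rule: Kf_induct)
  case (add c u v)
  then show ?case by (intro env.subspace_add[OF K_subspace env.subspace_scale[OF K_subspace]])
qed (use K_UM_neg[OF assms(1)] K_H env.subspace_0[OF K_subspace] in auto)

lemma Kf_M_closed:
  assumes "\<And>j. j < k \<Longrightarrow> T ^ j \<in> K"
  shows "M_closed (Kf k)"
  unfolding M_closed_def using Kf_subspace Kf_H Kf_K[OF assms] Kf_UM by blast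

lemma T_Kf: "y \<in> Kf k \<Longrightarrow> T * y \<in> Kf (Suc k)"
proof (induction rule: Kf_induct)
  case (word xs j)
  have xs: "UM_neg xs \<in> M_poly (sum_list xs)"
    using word unfolding M_poly_def M_words_def by (intro env.span_base) auto
  have "T * (UM_neg xs * T ^ j) = UM_neg xs * T ^ Suc j + (T * UM_neg xs - UM_neg xs * T) * T ^ j"
    by (simp add: algebra_simps)
  also have "\<dots> \<in> Kf (Suc k)"
    by (rule env.subspace_add[OF Kf_subspace Kf_word Kf_M_poly[OF T_M_commutator[OF xs] Kf_power]]) (use word in auto)
  finally show ?case .
next
  case (low \<eta>)
  then show ?case using Kf_H H_mult by blast
qed (simp_all add: env.subspace_0[OF Kf_subspace] distrib_left Kf_add_scale)

lemma adj_eq: "adj m i y = pair_term p cM m i y"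
  by (simp add: adj_def pair_term_def)

lemma adj_in:
  assumes "env_subspace Y" "\<And>j. 1 \<le> j \<Longrightarrow> UM (- int j) * y \<in> Y" "y \<in> Y"
  shows "adj m i y \<in> Y"
  unfolding adj_def using assms env.subspace_0[OF assms(1)]
  by (auto intro!: env.subspace_scale simp del: of_nat_diff)

lemma UL_Kf:
  assumes K: "\<And>j. j < k \<Longrightarrow> T ^ j \<in> K" and L: "\<And>j n. j < k \<Longrightarrow> 1 \<le> n \<Longrightarrow> UL (int n) * T ^ j \<in> Kf j"
    and y: "y \<in> Kf k"
  shows "UL (int n) * y \<in> Kf k"
  using y
proof (induction rule: Kf_induct)
  case (word xs j)
  show ?case
  proof (cases "n = 0")
    case True
    have "has_degree (int (sum_list xs) + int j * int p) (UM_neg xs * T ^ j)"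
      by (intro has_degree_mult has_degree_UM_neg has_degree_power has_degree_T w')
    from hw_weight[OF this] Kf_H[of k] Kf_word[OF word]
    have "(UL 0 * (UM_neg xs * T ^ j) - (hL + of_int (int (sum_list xs) + int j * int p)) \<cdot> (UM_neg xs * T ^ j))
        + (hL + of_int (int (sum_list xs) + int j * int p)) \<cdot> (UM_neg xs * T ^ j) \<in> Kf k"
      by (intro env.subspace_add[OF Kf_subspace] env.subspace_scale[OF Kf_subspace]) auto
    then show ?thesis using True by simp
  next
    case False
    show ?thesis using word(1)
    proof (induction xs)
      case Nil
      then show ?case using L[OF word(2), of n] False Kf_mono[of j k] word(2) by auto
    next
      case (Cons a xs)
      let ?z = "UM_neg xs * T ^ j"
      have a: "a \<ge> 1" and xs: "0 \<notin> set xs" using Cons.prems by (cases a, auto)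
      have z: "?z \<in> Kf k" using Kf_word[OF xs word(2)] .
      have "(UL (int n) * (UM (- int a) * ?z) - UM (- int a) * (UL (int n) * ?z) - adj n a ?z)
          + (UM (- int a) * (UL (int n) * ?z) + adj n a ?z) \<in> Kf k"
      proof (rule env.subspace_add[OF Kf_subspace _ env.subspace_add[OF Kf_subspace]])
        show "UL (int n) * (UM (- int a) * ?z) - UM (- int a) * (UL (int n) * ?z) - adj n a ?z \<in> Kf k"
          using UL_UM_K[OF K_UM_neg[OF K[OF word(2)]], of n a xs] False a Kf_H by auto
        show "UM (- int a) * (UL (int n) * ?z) \<in> Kf k" by (rule Kf_UM[OF Cons.IH[OF xs] a])
        show "adj n a ?z \<in> Kf k" by (rule adj_in[OF Kf_subspace Kf_UM[OF z] z])
      qed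
      then show ?case by (simp add: mult.assoc)
    qed
  qed
next
  case (low \<eta>)
  then show ?case using Kf_H H_mult by blast
qed (simp_all add: env.subspace_0[OF Kf_subspace] distrib_left Kf_add_scale)

text \<open>Since \<open>p S = [M\<^sub>0,T]\<close>, the commutator of \<open>L\<^sub>n\<close> with S is expressed by that of \<open>L\<^sub>n\<close> with T, on which
\<open>M\<^sub>0\<close> acts by \<open>h\<^sub>M\<close>, and by \<open>M\<^sub>n T\<close>, which is in \<open>H\<close>.\<close>

lemma UL_S_commute:
  assumes B: "M_closed B" and y: "\<And>j. UL (int j) * y \<in> B" "y \<in> B" and n: "n \<ge> 1"
  shows "UL (int n) * (S * y) - S * (UL (int n) * y) \<in> H"
proof -
  let ?z = "UL (int n) * y"
  have yK: "y \<in> K" and zK: "?z \<in> K" using M_closedD(3)[OF B] y by auto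
  define a1 where "a1 = UM 0 * (T * y) - hM \<cdot> (T * y) - of_nat p \<cdot> (S * y)"
  define a2 where "a2 = UM 0 * (T * ?z) - hM \<cdot> (T * ?z) - of_nat p \<cdot> (S * ?z)"
  define b where "b = UL (int n) * (T * y) - T * ?z"
  have a: "a1 \<in> H" "a2 \<in> H" using UM_0_T_K yK zK by (simp_all add: a1_def a2_def)
  have "b \<in> K" using UL_T_lower[OF B y n] M_closedD(3)[OF B] by (auto simp: b_def)
  then have b: "UM 0 * b - hM \<cdot> b \<in> H" by (rule K_zero)
  have comm: "UL (int n) * (UM 0 * (T * y)) = UM 0 * (UL (int n) * (T * y)) + of_nat n \<cdot> (UM (int n) * (T * y))"
    using arg_cong[OF UL_UM[of "int n" 0], of "\<lambda>u. u * (T * y)"] n by (simp add: distrib_right mult.assoc)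
  have "of_nat p \<cdot> (UL (int n) * (S * y) - S * ?z) =
      a2 - UL (int n) * a1 + of_nat n \<cdot> (UM (int n) * (T * y)) + (UM 0 * b - hM \<cdot> b)"
    unfolding a1_def a2_def b_def by (simp add: right_diff_distrib env.scale_right_diff_distrib comm)
  also have "\<dots> \<in> H"
    by (rule H_add[OF H_add[OF H_diff[OF a(2) H_mult[OF a(1)]] H_scale[OF UM_T_K[OF yK n]]] b])
  finally have "(1 / of_nat p) \<cdot> (of_nat p \<cdot> (UL (int n) * (S * y) - S * ?z)) \<in> H" by (rule H_scale)
  then show ?thesis using p by simp
qed

lemma T0_K: "j < Suc 0 \<Longrightarrow> T ^ j \<in> K"
  using K_1 by simp

lemma UL_1: "UL (int j) * 1 \<in> Kf (Suc 0)"
proof (rule UL_Kf[OF T0_K])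
  show "UL (int n) * T ^ j \<in> Kf j" if "j < Suc 0" "1 \<le> n" for j n
    using that hw_pos(1)[where u = 1] by (simp add: Kf_0)
qed (use Kf_power[of 0 "Suc 0"] in auto)

lemma UL_S: "n \<ge> 1 \<Longrightarrow> UL (int n) * S \<in> H"
proof -
  assume n: "n \<ge> 1"
  have a: "UL (int n) * (S * 1) - S * (UL (int n) * 1) \<in> H"
    by (rule UL_S_commute[OF Kf_M_closed[OF T0_K] UL_1 _ n]) (use Kf_power[of 0 "Suc 0"] in auto)
  have "S * UL (int n) \<in> H" using n by (intro hw_pos) simp
  from H_add[OF a this] show ?thesis by simp
qed

lemma UL_T: "n \<ge> 1 \<Longrightarrow> UL (int n) * T \<in> Kf (Suc 0)"
proof -
  assume n: "n \<ge> 1"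
  have a: "UL (int n) * (T * 1) - T * (UL (int n) * 1) \<in> Kf (Suc 0)"
    by (rule UL_T_lower[OF Kf_M_closed[OF T0_K] UL_1 _ n]) (use Kf_power[of 0 "Suc 0"] in auto)
  have "T * UL (int n) \<in> H" using n by (intro hw_pos) simp
  from env.subspace_add[OF Kf_subspace a subsetD[OF Kf_H this]] show ?thesis by simp
qed

end

locale critical_quotient = critical +
  assumes S_in: "S \<in> H"
begin

text \<open>These three statements depend on one another and are proved by one induction.\<close>

definition good :: "nat \<Rightarrow> bool" where
  "good k \<longleftrightarrow> (\<forall>j<k. T ^ j \<in> K \<and> (\<forall>n\<ge>1. UL (int n) * T ^ j \<in> Kf j) \<and> S * T ^ j \<in> H)"

lemma goodD:
  assumes "good k" "j < k"
  shows "T ^ j \<in> K" "1 \<le> n \<Longrightarrow> UL (int n) * T ^ j \<in> Kf j" "S * T ^ j \<in> H"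
  using assms by (auto simp: good_def)

lemma good_mono: "good k \<Longrightarrow> j \<le> k \<Longrightarrow> good j"
  by (auto simp: good_def)

lemma S_Kf:
  assumes "good k" "y \<in> Kf k"
  shows "S * y \<in> H"
  using assms(2)
proof (induction rule: Kf_induct)
  case (word xs j)
  have "S * UM_neg xs = UM_neg xs * S"
    by (induction xs) (simp, metis M_poly_UM_commute S_of_in_M_poly UM_neg_simps(2) mult.assoc)
  then have "S * (UM_neg xs * T ^ j) = UM_neg xs * (S * T ^ j)" by (simp flip: mult.assoc)
  then show ?case using goodD(3)[OF assms(1) word(2)] H_mult by simp
qed (simp_all add: H_0 H_mult distrib_left H_add H_scale)

text \<open>The Euler argument with the \<open>M\<^sub>-\<^sub>i\<close> as variables and the \<open>L\<^sub>m\<close> as derivatives, acting on multiples of \<open>T\<^sup>k\<close>.\<close>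

lemma stage2_euler:
  assumes g: "good (Suc k)"
  shows "euler_filtration p (\<lambda>i. UM (- int i)) (Kf k) {T ^ k} cM (\<lambda>m. UL (int m)) (\<lambda>_. Kf k)"
proof -
  have gk: "good k" using good_mono[OF g] by simp
  have KK: "z \<in> K" if "z \<in> Kf (Suc k)" for z using Kf_K[OF _ that] goodD(1)[OF g] by blast
  interpret F: filtration p "\<lambda>i. UM (- int i)" "Kf k" "{T ^ k}"
    by unfold_locales (use Kf_subspace Kf_UM in auto)
  have xw: "prod_list (map (\<lambda>i. UM (- int i)) js) = UM_neg js" for js by (simp add: UM_neg_def)
  have F_Kf: "F.F r \<subseteq> Kf (Suc k)" for r
  proof (cases r)
    case 0
    then show ?thesis using Kf_mono[of k "Suc k"] by (simp add: filt_def)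
  next
    case (Suc s)
    show ?thesis
    proof
      fix z assume "z \<in> F.F r"
      then show "z \<in> Kf (Suc k)" unfolding Suc
      proof (induction rule: F.F_Suc_induct)
        case (low a)
        then show ?case using Kf_mono[of k "Suc k"] by auto
      next
        case (word js b)
        then have "0 \<notin> set js" by force
        then show ?case unfolding xw using word Kf_word[of js k "Suc k"] by simp
      qed (simp_all add: env.subspace_0[OF Kf_subspace] Kf_add_scale)
    qed
  qed
  show ?thesis
  proof unfold_locales
    show "UL (int m) * a \<in> Kf k" if "1 \<le> m" "a \<in> Kf k" for m a
      by (rule UL_Kf[OF _ _ that(2)]) (use goodD[OF gk] in auto)
    show "UL (int m) * b \<in> Kf k" if "1 \<le> m" "b \<in> {T ^ k}" for m b
      using goodD(2)[OF g, of k m] that by auto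
    show "UL (int m) * (UM (- int i) * y) - UM (- int i) * (UL (int m) * y) - pair_term p cM m i y \<in> Kf k"
      if "1 \<le> m" "1 \<le> i" "i \<noteq> p" "y \<in> F.F (Suc r)" for r m i y
      using subsetD[OF Kf_H UL_UM_K[OF KK[OF subsetD[OF F_Kf that(4)]] that(1,2)]] unfolding adj_eq .
    show "UM (- int j) * (UM (- int i) * z) - UM (- int i) * (UM (- int j) * z) \<in> Kf k" for i j z
    proof -
      have "UM (- int j) * (UM (- int i) * z) = UM (- int i) * (UM (- int j) * z)"
        by (metis UM_UM mult.assoc)
      then show ?thesis by (simp add: env.subspace_0[OF Kf_subspace])
    qed
    show "UM (- int n) * (UM (- int i) * z) - UM (- int i) * (UM (- int n) * z) \<in> F.F (Suc r)" for n i z r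
    proof -
      have "UM (- int n) * (UM (- int i) * z) = UM (- int i) * (UM (- int n) * z)"
        by (metis UM_UM mult.assoc)
      then show ?thesis by (simp add: env.subspace_0[OF F.F_subspace])
    qed
  qed (use cM Kf_subspace Kf_UM F.F_A in auto)
qed

text \<open>Because \<open>S \<in> H\<close>, the generator \<open>M\<^sub>-\<^sub>p\<close> can be replaced by products of the others, so all of \<open>Kf (Suc k)\<close> is reached by
words in the \<open>M\<^sub>-\<^sub>i\<close> with \<open>i \<noteq> p\<close>, and the Euler argument applies.\<close>

lemma stage2:
  assumes g: "good (Suc k)" and y: "y \<in> Kf (Suc k)" "\<And>n. 1 \<le> n \<Longrightarrow> UL (int n) * y \<in> Kf k"
  obtains a where "y - a \<cdot> T ^ k \<in> Kf k"
proof -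
  have gk: "good k" using good_mono[OF g] by simp
  interpret F: filtration p "\<lambda>i. UM (- int i)" "Kf k" "{T ^ k}"
    by unfold_locales (use Kf_subspace Kf_UM in auto)
  have xw: "prod_list (map (\<lambda>i. UM (- int i)) js) = UM_neg js" for js by (simp add: UM_neg_def)
  interpret E: euler_filtration p "\<lambda>i. UM (- int i)" "Kf k" "{T ^ k}" cM "\<lambda>m. UL (int m)" "\<lambda>_. Kf k"
    by (rule stage2_euler[OF g])
  define Q where "Q = (\<Union>r. F.F r)"
  have Q_add: "c \<cdot> u + v \<in> Q" if "u \<in> Q" "v \<in> Q" for c u v
  proof -
    from that obtain r s where "u \<in> F.F r" "v \<in> F.F s" by (auto simp: Q_def)
    then have "u \<in> F.F (max r s)" "v \<in> F.F (max r s)" using F.F_mono[of r "max r s"] F.F_mono[of s "max r s"] by auto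
    then have "c \<cdot> u + v \<in> F.F (max r s)" by (intro env.subspace_add[OF F.F_subspace env.subspace_scale[OF F.F_subspace]])
    then show ?thesis by (auto simp: Q_def)
  qed
  have Q_0: "0 \<in> Q" using env.subspace_0[OF F.F_subspace] by (auto simp: Q_def)
  have Q_low: "Kf k \<subseteq> Q" using F.F_A by (auto simp: Q_def)
  have Q_sub: "env_subspace Q"
    using Q_0 Q_add[of _ _ 1] Q_add[of _ 0] by (intro env.subspaceI) auto
  have Q_word: "UM_neg js * T ^ k \<in> Q" if "0 \<notin> set js" "p \<notin> set js" for js
  proof -
    have "\<forall>i\<in>set js. 1 \<le> i \<and> i \<noteq> p" using that by (metis less_one not_le)
    then show ?thesis using F.F_word[of "T ^ k" js "Suc (length js)"] unfolding xw Q_def by blast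
  qed
  have Q_F: "z \<in> Q" if "z \<in> F.F r" for z r using that by (auto simp: Q_def)
  have Q_p: "UM (- int p) * (UM_neg js * T ^ k) \<in> Q" if js: "0 \<notin> set js" "p \<notin> set js" for js
  proof -
    obtain v where v: "v \<in> env_span (M_words_restr p p)" "S = UM (- int p) + v" using S_of_lead[OF p] by blast
    have "v * (UM_neg js * T ^ k) \<in> Q" using v(1)
    proof (induction rule: env.span_induct_alt)
      case (step c g u)
      then obtain xs where xs: "g = UM_neg xs" "0 \<notin> set xs" "p \<notin> set xs" by (auto simp: M_words_restr_def)
      have "g * (UM_neg js * T ^ k) \<in> Q" using Q_word[of "xs @ js"] xs js by (simp add: mult.assoc)
      then show ?case using step Q_add by (simp add: distrib_right)
    qed (simp add: Q_0)
    moreover have "S * (UM_neg js * T ^ k) \<in> Q"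
      using S_Kf[OF g Kf_word[OF js(1)]] Kf_H Q_low by blast
    ultimately have "S * (UM_neg js * T ^ k) - v * (UM_neg js * T ^ k) \<in> Q" by (rule env.subspace_diff[OF Q_sub, rotated])
    then show ?thesis by (simp add: v(2) distrib_right)
  qed
  have Q_UM: "UM (- int a) * z \<in> Q" if "z \<in> Q" "1 \<le> a" for z a
  proof -
    obtain r where "z \<in> F.F r" using \<open>z \<in> Q\<close> by (auto simp: Q_def)
    then have "z \<in> F.F (Suc r)" using F.F_mono[of r "Suc r"] by auto
    then show ?thesis
    proof (induction rule: F.F_Suc_induct)
      case (low b)
      then show ?case using Kf_UM that(2) Q_low by blast
    next
      case (word js b)
      then have js: "0 \<notin> set js" "p \<notin> set js" by force+
      show ?case
      proof (cases "a = p")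
        case True
        then show ?thesis unfolding xw using Q_p[OF js] word by simp
      next
        case False
        then show ?thesis unfolding xw using Q_word[of "a # js"] js word that(2) by (simp add: mult.assoc)
      qed
    qed (simp_all add: Q_0 Q_add distrib_left)
  qed
  have "y \<in> Q" using y(1)
  proof (induction rule: Kf_induct)
    case (word xs j)
    have base: "T ^ j \<in> Q"
      using Q_word[of "[]"] Q_low Kf_power[of j k] word by (cases "j = k") auto
    show ?case using word(1)
      by (induction xs) (auto simp: base mult.assoc intro!: Q_UM simp: Suc_le_eq)
  next
    case (low \<eta>)
    then show ?case using Kf_H Q_low by blast
  qed (simp_all add: Q_0 Q_add)
  then obtain r where "y \<in> F.F r" by (auto simp: Q_def)
  then have "y \<in> F.F 1" by (rule E.euler_descent) (rule y(2))
  then have "y \<in> F.F (Suc 0)" by simp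
  then have "\<exists>a. y - a \<cdot> T ^ k \<in> Kf k"
  proof (induction rule: F.F_Suc_induct)
    case zero
    show ?case by (intro exI[of _ 0]) (simp add: env.subspace_0[OF Kf_subspace])
  next
    case (low b)
    then show ?case by (intro exI[of _ 0]) simp
  next
    case (word js b)
    then show ?case by (intro exI[of _ 1]) (simp add: env.subspace_0[OF Kf_subspace])
  next
    case (add c u v)
    then obtain a a' where "u - a \<cdot> T ^ k \<in> Kf k" "v - a' \<cdot> T ^ k \<in> Kf k" by blast
    then have "c \<cdot> (u - a \<cdot> T ^ k) + (v - a' \<cdot> T ^ k) \<in> Kf k" by (rule Kf_add_scale)
    then show ?case
      by (intro exI[of _ "c * a + a'"]) (simp add: env.scale_right_diff_distrib env.scale_left_distrib algebra_simps)
  qed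
  then show ?thesis using that by blast
qed

text \<open>An element congruent to a multiple of \<open>T\<^sup>j\<close>, but homogeneous of another degree, has no such leading term.\<close>

lemma Kf_graded:
  assumes "good k" "has_degree d y" "d \<noteq> int j * int p" "y - a \<cdot> T ^ j \<in> Kf k"
  shows "y \<in> Kf k"
proof -
  have U: "UL 0 * z \<in> Kf k" if "z \<in> Kf k" for z
    using UL_Kf[OF _ _ that, of 0] goodD[OF assms(1)] by simp
  define f where "f e = (if e = d then y else - (a \<cdot> T ^ j))" for e
  have "f d \<in> Kf k"
  proof (rule graded[OF Kf_subspace Kf_H U, of "{d, int j * int p}" f d])
    show "has_degree e (f e)" if "e \<in> {d, int j * int p}" for e
      using that assms(2,3) has_degree_scale[OF has_degree_power[OF has_degree_T[OF w', of cM], of j], of "- a"]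
      by (auto simp: f_def)
    show "(\<Sum>e\<in>{d, int j * int p}. f e) \<in> Kf k" using assms(3,4) by (simp add: f_def)
  qed auto
  then show ?thesis by (simp add: f_def)
qed

text \<open>The product \<open>S T\<^sup>k\<close> lies in \<open>Kf k\<close> and is annihilated by the positive L. By \<open>stage2\<close> it could only have
leading terms \<open>T\<^sup>j\<close> with \<open>j < k\<close>, and its degree \<open>(k+1)p\<close> excludes them; so it lies in \<open>H\<close>.\<close>

lemma good_all: "good k"
proof (induction k)
  case (Suc k)
  note gk = Suc.IH
  have TK: "T ^ k \<in> K"
  proof (cases k)
    case (Suc m)
    then show ?thesis using T_in_K[of "T ^ m"] goodD(1,3)[OF gk, of m] by simp
  qed (simp add: K_1)
  have K': "T ^ j \<in> K" if "j < Suc k" for j using goodD(1)[OF gk, of j] TK that by (cases "j = k") auto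
  have TL: "UL (int n) * T ^ k \<in> Kf k" if n: "1 \<le> n" for n
  proof (cases k)
    case 0
    then show ?thesis using hw_pos(1)[where u = 1] n by (simp add: Kf_0)
  next
    case (Suc m)
    have U: "UL (int j) * T ^ m \<in> Kf k" for j
      by (rule UL_Kf) (use goodD[OF gk] Kf_power[of m k] Suc in auto)
    have "UL (int n) * (T * T ^ m) - T * (UL (int n) * T ^ m) \<in> Kf k"
      by (rule UL_T_lower[OF Kf_M_closed U _ n]) (use goodD(1)[OF gk] Kf_power[of m k] Suc in auto)
    moreover have "T * (UL (int n) * T ^ m) \<in> Kf k"
      using T_Kf[OF goodD(2)[OF gk, of m n]] n Suc by simp
    ultimately have "(UL (int n) * (T * T ^ m) - T * (UL (int n) * T ^ m)) + T * (UL (int n) * T ^ m) \<in> Kf k"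
      by (rule env.subspace_add[OF Kf_subspace])
    then show ?thesis by (simp add: Suc)
  qed
  have L': "UL (int n) * T ^ j \<in> Kf j" if "j < Suc k" "1 \<le> n" for j n
    using goodD(2)[OF gk, of j n] TL that by (cases "j = k") auto
  have U: "UL (int j) * T ^ k \<in> Kf (Suc k)" for j
    by (rule UL_Kf[OF K' L']) (simp_all add: Kf_power)
  have UST: "UL (int n) * (S * T ^ k) \<in> H" if n: "1 \<le> n" for n
  proof -
    have "UL (int n) * (S * T ^ k) - S * (UL (int n) * T ^ k) \<in> H"
      by (rule UL_S_commute[OF Kf_M_closed[OF K'] U _ n]) (simp_all add: Kf_power)
    then have "(UL (int n) * (S * T ^ k) - S * (UL (int n) * T ^ k)) + S * (UL (int n) * T ^ k) \<in> H"
      using S_Kf[OF gk TL[OF n]] by (rule H_add)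
    then show ?thesis by simp
  qed
  have deg: "has_degree (int (Suc k) * int p) (S * T ^ k)"
    using has_degree_mult[OF has_degree_S[of p cM] has_degree_power[OF has_degree_T[OF w'], of k cM]]
    by (simp add: algebra_simps)
  have STk: "S * T ^ k \<in> Kf k"
  proof (cases k)
    case 0
    then show ?thesis using S_in by (simp add: Kf_0)
  next
    case (Suc m)
    have "(S * T - T * S) * T ^ m = - ((T * S - S * T) * T ^ m)" by (simp add: algebra_simps)
    also have "\<dots> \<in> Kf k"
      using env.subspace_neg[OF Kf_subspace Kf_M_poly[OF T_M_commutator[OF S_of_in_M_poly] Kf_power[of m k]]] Suc by simp
    finally have "(S * T - T * S) * T ^ m + T * (S * T ^ m) \<in> Kf k"
      using goodD(3)[OF gk, of m] Suc H_mult Kf_H env.subspace_add[OF Kf_subspace] by blast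
    then show ?thesis by (simp add: Suc algebra_simps)
  qed
  have "S * T ^ k \<in> Kf j" if "j \<le> k" for j
    using that
  proof (induction rule: inc_induct)
    case base
    show ?case by (rule STk)
  next
    case (step j)
    have gj: "good (Suc j)" using good_mono[OF gk] step by simp
    have "UL (int n) * (S * T ^ k) \<in> Kf j" if "1 \<le> n" for n using UST[OF that] Kf_H by blast
    then obtain a where a: "S * T ^ k - a \<cdot> T ^ j \<in> Kf j" using stage2[OF gj step.IH] by blast
    have ne: "int (Suc k) * int p \<noteq> int j * int p" using step p by auto
    have "good j" using good_mono[OF gj] by simp
    from Kf_graded[OF this deg ne a] show ?case .
  qed
  from this[of 0] have "S * T ^ k \<in> H" by (simp add: Kf_0)
  then show ?case using gk TK TL unfolding good_def by (auto simp: less_Suc_eq)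
qed (simp add: good_def)

lemmas T_power_K = goodD(1)[OF good_all lessI]
lemmas UL_T_power = goodD(2)[OF good_all lessI]
lemma UL_Kf': "y \<in> Kf k \<Longrightarrow> UL (int n) * y \<in> Kf k"
  by (rule UL_Kf) (use T_power_K UL_T_power in auto)

lemma Kf_K': "y \<in> Kf k \<Longrightarrow> y \<in> K"
  by (rule Kf_K) (use T_power_K in auto)

definition K0 :: "w22_env set" where "K0 = (\<Union>k. Kf k)"

lemma Kf_K0: "Kf k \<subseteq> K0" by (auto simp: K0_def)

lemma K0_subspace: "env_subspace K0"
proof (rule env.subspaceI)
  show "0 \<in> K0" using env.subspace_0[OF Kf_subspace] by (auto simp: K0_def)
  show "x + y \<in> K0" if xy: "x \<in> K0" "y \<in> K0" for x y
  proof -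
    obtain k l where "x \<in> Kf k" "y \<in> Kf l" using xy by (auto simp: K0_def)
    then have "x \<in> Kf (max k l)" "y \<in> Kf (max k l)" using Kf_mono[of k "max k l"] Kf_mono[of l "max k l"] by auto
    then show ?thesis using env.subspace_add[OF Kf_subspace] Kf_K0 by blast
  qed
  show "c \<cdot> x \<in> K0" if "x \<in> K0" for c x
    using that env.subspace_scale[OF Kf_subspace] by (auto simp: K0_def)
qed

lemma K0_M_closed: "M_closed K0"
proof -
  have "UM (- int j) * b \<in> K0" if "1 \<le> j" "b \<in> K0" for j b
    using that Kf_UM unfolding K0_def by blast
  moreover have "H \<subseteq> K0" "K0 \<subseteq> K" using Kf_H Kf_K' unfolding K0_def by blast+
  ultimately show ?thesis using K0_subspace unfolding M_closed_def by blast
qed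

lemma K0_T: "y \<in> K0 \<Longrightarrow> T * y \<in> K0"
  using T_Kf by (auto simp: K0_def)

lemma K0_UL: "y \<in> K0 \<Longrightarrow> UL (int n) * y \<in> K0"
  using UL_Kf' by (auto simp: K0_def)

lemma K0_1: "1 \<in> K0"
  using Kf_power[of 0 1] Kf_K0 by auto

lemma H_filtration: "filtration p (\<lambda>i. UL (- int i)) H"
  by unfold_locales (use H_subspace H_mult in auto)

abbreviation Lf where "Lf \<equiv> filt p (\<lambda>i. UL (- int i)) H K0"
abbreviation Lw where "Lw js \<equiv> prod_list (map (\<lambda>i. UL (- int i)) js)"

lemmas Lf_subspace = filtration.F_subspace[OF H_filtration, of K0]
lemmas Lf_H = filtration.F_A[OF H_filtration, of K0]
lemmas Lf_mono = filtration.F_mono[OF H_filtration, of _ _ K0]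
lemmas Lf_word = filtration.F_word[OF H_filtration, of _ K0]
lemmas Lf_x = filtration.F_x[OF H_filtration, of _ _ K0]
lemmas Lf_induct = filtration.F_Suc_induct[OF H_filtration, of _ K0, consumes 1, case_names zero low word add]

lemma Lf_0: "Lf 0 = H" by (simp add: filt_def)

lemma Lf_K0: "b \<in> K0 \<Longrightarrow> b \<in> Lf (Suc r)"
  using Lf_word[of b "[]" "Suc r"] by simp

lemma Lf_add_scale: "x \<in> Lf r \<Longrightarrow> y \<in> Lf r \<Longrightarrow> c \<cdot> x + y \<in> Lf r"
  by (rule env.subspace_add[OF Lf_subspace env.subspace_scale[OF Lf_subspace]])

text \<open>An induction principle: a linear operator shifts the filtration as soon as it does so on words.\<close>

lemma Lf_operator:
  assumes "y \<in> Lf (Suc r)" "\<And>\<eta>. \<eta> \<in> H \<Longrightarrow> u * \<eta> \<in> Lf s"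
    "\<And>js b. b \<in> K0 \<Longrightarrow> length js \<le> r \<Longrightarrow> \<forall>i\<in>set js. 1 \<le> i \<and> i \<noteq> p \<Longrightarrow> u * (Lw js * b) \<in> Lf s"
  shows "u * y \<in> Lf s"
  using assms(1)
proof (induction rule: Lf_induct)
  case (add c v v')
  then show ?case by (simp add: distrib_left Lf_add_scale)
qed (use assms(2,3) env.subspace_0[OF Lf_subspace] in auto)

lemma UM_UL_act: "UM k * (UL (- int i) * z) = UL (- int i) * (UM k * z) + of_int (k + int i) \<cdot> (UM (k - int i) * z)
    + (if k = int i then of_int (k ^ 3 - k) / 12 else 0) \<cdot> (UCM * z)"
  using arg_cong[OF UM_UL[of k "- int i"], of "\<lambda>u. u * z"] by (auto simp: distrib_right mult.assoc)

lemma Lf_UM_word: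
  assumes "b \<in> K0" "\<forall>i\<in>set js. 1 \<le> i \<and> i \<noteq> p"
  shows "UM k * (Lw js * b) \<in> Lf (Suc (length js))"
  using assms(2)
proof (induction js arbitrary: k)
  case Nil
  then show ?case using M_closed_UM[OF K0_M_closed assms(1)] Lf_K0 by simp
next
  case (Cons i js)
  let ?z = "Lw js * b"
  have z: "?z \<in> Lf (Suc (length js))" using Lf_word[OF assms(1)] Cons.prems by auto
  have IH: "UM k * ?z \<in> Lf (Suc (length js))" for k using Cons by simp
  have up: "v \<in> Lf (Suc (Suc (length js)))" if "v \<in> Lf (Suc (length js))" for v
    using Lf_mono[of "Suc (length js)" "Suc (Suc (length js))"] that by auto
  have "UM k * (UL (- int i) * ?z) \<in> Lf (Suc (Suc (length js)))"
    unfolding UM_UL_act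
    by (intro env.subspace_add[OF Lf_subspace] env.subspace_scale[OF Lf_subspace] up[OF IH] Lf_x[OF _ _ IH]
        up[OF UCM_closed(1)[OF Lf_subspace Lf_H z]]) (use Cons.prems in auto)
  then show ?case by (simp add: mult.assoc)
qed

lemma Lf_UM: "y \<in> Lf r \<Longrightarrow> UM k * y \<in> Lf r"
proof (cases r)
  case (Suc s)
  assume "y \<in> Lf r"
  then show ?thesis unfolding Suc
  proof (rule Lf_operator)
    show "UM k * (Lw js * b) \<in> Lf (Suc s)" if "b \<in> K0" "length js \<le> s" "\<forall>i\<in>set js. 1 \<le> i \<and> i \<noteq> p" for js b
      using Lf_UM_word[OF that(1,3)] Lf_mono[of "Suc (length js)" "Suc s"] that(2) by auto
  qed (use H_mult Lf_H in blast)
qed (simp add: Lf_0 H_mult)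

lemma Lf_lower:
  assumes "y \<in> Lf (Suc r)"
  shows "m \<ge> 1 \<Longrightarrow> UM (int m) * y \<in> Lf r" and "(UM 0 - hM \<cdot> 1) * y \<in> Lf r"
proof -
  have word: "(m \<ge> 1 \<longrightarrow> UM (int m) * (Lw js * b) \<in> Lf (length js)) \<and> (UM 0 - hM \<cdot> 1) * (Lw js * b) \<in> Lf (length js)"
    if "b \<in> K0" "\<forall>i\<in>set js. 1 \<le> i \<and> i \<noteq> p" for js b m
    using that(2)
  proof (induction js arbitrary: m)
    case Nil
    have "b \<in> K" using K0_M_closed that(1) M_closedD(3) by blast
    then show ?case using K_pos K_zero by (simp add: Lf_0 left_diff_distrib)
  next
    case (Cons i js)
    let ?z = "Lw js * b" and ?r = "length js"
    have i: "1 \<le> i" "i \<noteq> p" using Cons.prems by auto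
    have z: "?z \<in> Lf (Suc ?r)" using Lf_word[OF that(1)] Cons.prems by auto
    have br: "of_int (k + int i) \<cdot> (UM (k - int i) * ?z) + (if k = int i then of_int (k ^ 3 - k) / 12 else 0) \<cdot> (UCM * ?z) \<in> Lf (Suc ?r)" for k
      by (intro env.subspace_add[OF Lf_subspace] env.subspace_scale[OF Lf_subspace] Lf_UM z UCM_closed(1)[OF Lf_subspace Lf_H])
    have IH: "m \<ge> 1 \<Longrightarrow> UM (int m) * ?z \<in> Lf ?r" "(UM 0 - hM \<cdot> 1) * ?z \<in> Lf ?r" for m
      using Cons by auto
    have "UM (int m) * (UL (- int i) * ?z) \<in> Lf (Suc ?r)" if "m \<ge> 1"
      unfolding UM_UL_act[of "int m"] add.assoc
      by (rule env.subspace_add[OF Lf_subspace Lf_x[OF i IH(1)[OF that]] br])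
    moreover have "(UM 0 - hM \<cdot> 1) * (UL (- int i) * ?z) = UL (- int i) * ((UM 0 - hM \<cdot> 1) * ?z)
        + (of_int (0 + int i) \<cdot> (UM (0 - int i) * ?z) + (if 0 = int i then of_int (0 ^ 3 - 0) / 12 else 0) \<cdot> (UCM * ?z))"
      using UM_UL_act[of 0 i ?z] by (simp add: left_diff_distrib right_diff_distrib)
    then have "(UM 0 - hM \<cdot> 1) * (UL (- int i) * ?z) \<in> Lf (Suc ?r)"
      using env.subspace_add[OF Lf_subspace Lf_x[OF i IH(2)] br[of 0]] by (simp only:)
    ultimately show ?case by (simp add: mult.assoc)
  qed
  have low: "u * \<eta> \<in> Lf r" if "\<eta> \<in> H" for u \<eta> using H_mult[OF that] Lf_H by blast
  have mono: "Lf (length js) \<subseteq> Lf r" if "length js \<le> r" for js :: "nat list" using Lf_mono that .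
  show "m \<ge> 1 \<Longrightarrow> UM (int m) * y \<in> Lf r"
    by (rule Lf_operator[OF assms low]) (use word mono in blast)+
  show "(UM 0 - hM \<cdot> 1) * y \<in> Lf r"
    by (rule Lf_operator[OF assms low]) (use word mono in blast)+
qed

lemma Lf_UL_p: "z \<in> Lf r \<Longrightarrow> UL (- int p) * z \<in> Lf (Suc r)"
proof (cases r)
  case 0
  assume "z \<in> Lf r"
  then show ?thesis using H_mult Lf_H[of "Suc r"] 0 by (auto simp: Lf_0)
next
  case (Suc s)
  have word: "UL (- int p) * (Lw js * b) \<in> Lf (Suc (Suc (length js)))"
    if "b \<in> K0" "\<forall>i\<in>set js. 1 \<le> i \<and> i \<noteq> p" for js b
    using that(2)
  proof (induction js)
    case Nil
    have split: "{1..p} = insert p {1..<p}" using p by auto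
    have T: "T = UL (- int p) + (\<Sum>i\<in>{1..<p}. g_coeff p cM (p - i) * UL (- int i)) + w"
      unfolding T_of_def split by simp
    have "UL (- int p) * b = T * b - (\<Sum>i\<in>{1..<p}. g_coeff p cM (p - i) * (UL (- int i) * b)) - w * b"
      unfolding T by (simp add: distrib_right sum_distrib_right mult.assoc)
    also have "\<dots> \<in> Lf (Suc (Suc 0))"
    proof (intro env.subspace_diff[OF Lf_subspace] env.subspace_sum[OF Lf_subspace])
      show "T * b \<in> Lf (Suc (Suc 0))" using Lf_K0 K0_T that(1) by blast
      show "w * b \<in> Lf (Suc (Suc 0))"
        by (rule M_poly_closed[OF w' Lf_subspace _ Lf_K0[OF that(1)]]) (rule Lf_UM)
      fix i assume i: "i \<in> {1..<p}"
      have mem: "UL (- int i) * b \<in> Lf (Suc (Suc 0))" by (rule Lf_x[OF _ _ Lf_K0[OF that(1)]]) (use i in auto)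
      show "g_coeff p cM (p - i) * (UL (- int i) * b) \<in> Lf (Suc (Suc 0))"
        by (rule M_poly_closed[OF g_coeff_in_M_poly Lf_subspace _ mem]) (rule Lf_UM)
    qed
    finally show ?case by simp
  next
    case (Cons i js)
    let ?z = "Lw js * b"
    have i: "1 \<le> i" "i \<noteq> p" using Cons.prems by auto
    have z: "?z \<in> Lf (Suc (length js))" using Lf_word[OF that(1)] Cons.prems by auto
    have "UL (- int p) * (UL (- int i) * ?z) = UL (- int i) * (UL (- int p) * ?z)
        + of_int (int i - int p) \<cdot> (UL (- int (p + i)) * ?z)"
      using arg_cong[OF UL_UL[of "- int p" "- int i"], of "\<lambda>u. u * ?z"] p by (simp add: distrib_right mult.assoc)
    also have "\<dots> \<in> Lf (Suc (Suc (Suc (length js))))"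
    proof (rule env.subspace_add[OF Lf_subspace _ env.subspace_scale[OF Lf_subspace]])
      show "UL (- int i) * (UL (- int p) * ?z) \<in> Lf (Suc (Suc (Suc (length js))))"
        by (rule Lf_x[OF i]) (use Cons in auto)
      have "UL (- int (p + i)) * ?z \<in> Lf (Suc (Suc (length js)))"
        by (rule Lf_x[OF _ _ z]) (use i in auto)
      then show "UL (- int (p + i)) * ?z \<in> Lf (Suc (Suc (Suc (length js))))"
        using Lf_mono[of "Suc (Suc (length js))" "Suc (Suc (Suc (length js)))"] by auto
    qed
    finally show ?case by (simp add: mult.assoc)
  qed
  assume "z \<in> Lf r"
  then show ?thesis unfolding Suc
  proof (rule Lf_operator)
    show "UL (- int p) * \<eta> \<in> Lf (Suc (Suc s))" if "\<eta> \<in> H" for \<eta> using H_mult[OF that] Lf_H by blast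
    show "UL (- int p) * (Lw js * b) \<in> Lf (Suc (Suc s))" if "b \<in> K0" "length js \<le> s" "\<forall>i\<in>set js. 1 \<le> i \<and> i \<noteq> p" for js b
      using word[OF that(1,3)] Lf_mono[of "Suc (Suc (length js))" "Suc (Suc s)"] that(2) by auto
  qed
qed

lemma Lf_exhausts: "\<exists>r. u \<in> Lf r"
proof -
  have word: "\<exists>r. word ws \<in> Lf r" if "neg_word ws" for ws
    using that
  proof (induction ws)
    case Nil
    then show ?case using Lf_K0[OF K0_1] by auto
  next
    case (Cons x ws)
    then obtain r where r: "word ws \<in> Lf r" by auto
    consider (L) i where "x = BL (- int i)" "i \<ge> 1" | (M) k where "x = BM k"
    proof (cases x)
      case (BL m)
      then have "x = BL (- int (nat (- m)))" "nat (- m) \<ge> 1" using Cons.prems by auto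
      then show ?thesis using that(1) by blast
    qed (use Cons.prems that in auto)
    then show ?case
    proof cases
      case L
      then show ?thesis using Lf_UL_p[OF r] Lf_x[OF L(2) _ r] by (cases "i = p") auto
    next
      case M
      then show ?thesis using Lf_UM[OF r] by auto
    qed
  qed
  show ?thesis using neg_words_span[of u]
  proof (induction rule: env.span_induct_alt)
    case base
    show ?case using env.subspace_0[OF Lf_subspace] by blast
  next
    case (step c g u)
    then obtain s where s: "u \<in> Lf s" by blast
    obtain r where r: "g \<in> Lf r" using step(1) word Lf_H[of 0] by blast
    have "g \<in> Lf (max r s)" "u \<in> Lf (max r s)"
      using r s Lf_mono[of r "max r s"] Lf_mono[of s "max r s"] by auto
    then show ?case using Lf_add_scale by blast
  qed
qed

text \<open>The Euler argument with the \<open>L\<^sub>-\<^sub>i\<close> as variables and the \<open>M\<^sub>m\<close> as derivatives. The generator \<open>L\<^sub>-\<^sub>p\<close> is expressed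
by T, under which \<open>K0\<close> is stable.\<close>

theorem annihilated_by_M:
  assumes "\<And>m. 1 \<le> m \<Longrightarrow> UM (int m) * y \<in> H"
  shows "y \<in> K0"
proof -
  interpret E: euler_filtration p "\<lambda>i. UL (- int i)" H K0 cM "\<lambda>m. UM (int m)" Lf
  proof unfold_locales
    show "UM (int m) * b \<in> H" if "1 \<le> m" "b \<in> K0" for m b
      using K_pos M_closedD(3)[OF K0_M_closed] that by blast
    show "UM (- int j) * a \<in> Lf r" if "a \<in> Lf r" for r j a using Lf_UM[OF that] .
    show "UM (int m) * (UL (- int i) * y) - UL (- int i) * (UM (int m) * y) - pair_term p cM m i y \<in> Lf r"
      if "1 \<le> m" "1 \<le> i" "i \<noteq> p" and y: "y \<in> Lf (Suc r)" for r m i y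
    proof -
      have eq: "UM (int m) * (UL (- int i) * y) - UL (- int i) * (UM (int m) * y) = UM_UL_bracket m i * y"
        using arg_cong[OF UM_UL_neg[of m i], of "\<lambda>u. u * y"] by (simp add: distrib_right mult.assoc)
      have "UM_UL_bracket m i * y - pair_term p cM m i y \<in> Lf r"
      proof (cases m i rule: linorder_cases)
        case less
        then have mi: "int m - int i = - int (i - m)" by simp
        show ?thesis unfolding UM_UL_bracket_def pair_term_def mi using less env.subspace_0[OF Lf_subspace] by simp
      next
        case equal
        have "UM_UL_bracket m i * y - pair_term p cM m i y = (2 * of_nat m) \<cdot> ((UM 0 - hM \<cdot> 1) * y)
           + (of_nat (m ^ 3) / 12 - of_nat m / 12) \<cdot> (UCM * y - cM \<cdot> y)"
          unfolding equal pairing_eq[of i p cM, symmetric] pair_term_def UM_UL_bracket_def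
          by (simp add: distrib_right left_diff_distrib env.scale_right_diff_distrib env.scale_left_distrib env.scale_left_diff_distrib algebra_simps)
        also have "\<dots> \<in> Lf r"
          by (intro env.subspace_add[OF Lf_subspace] env.subspace_scale[OF Lf_subspace] Lf_lower(2)[OF y]
              subsetD[OF Lf_H hw_central(2)])
        finally show ?thesis .
      next
        case greater
        then have mi: "int m - int i = int (m - i)" by simp
        have "UM_UL_bracket m i * y - pair_term p cM m i y = of_nat (m + i) \<cdot> (UM (int (m - i)) * y)"
          unfolding UM_UL_bracket_def pair_term_def mi using greater by simp
        also have "\<dots> \<in> Lf r"
          by (rule env.subspace_scale[OF Lf_subspace Lf_lower(1)[OF y]]) (use greater in simp)
        finally show ?thesis .
      qed
      then show ?thesis unfolding eq .
    qed
    show "UM (- int j) * (UL (- int i) * z) - UL (- int i) * (UM (- int j) * z) \<in> Lf r"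
      if "1 \<le> j" "1 \<le> i" and z: "z \<in> Lf r" for r j i z
    proof -
      have "UM (- int j) * (UL (- int i) * z) - UL (- int i) * (UM (- int j) * z) = of_int (- int j + int i) \<cdot> (UM (- int j - int i) * z)"
        using UM_UL_act[of "- int j" i z] that by (simp del: of_int_add)
      then show ?thesis using env.subspace_scale[OF Lf_subspace Lf_UM[OF z]] by simp
    qed
    show "UL (- int n) * (UL (- int i) * z) - UL (- int i) * (UL (- int n) * z) \<in> Lf (Suc r)"
      if "1 \<le> n" "1 \<le> i" and z: "z \<in> Lf r" for r n i z
    proof -
      have "UL (- int n) * (UL (- int i) * z) - UL (- int i) * (UL (- int n) * z) = of_int (int i - int n) \<cdot> (UL (- int (n + i)) * z)"
        using arg_cong[OF UL_UL[of "- int n" "- int i"], of "\<lambda>u. u * z"] that by (simp add: distrib_right mult.assoc)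
      moreover have "UL (- int (n + i)) * z \<in> Lf (Suc r)"
        using Lf_UL_p[OF z] Lf_x[of "n + i", OF _ _ z] that by (cases "n + i = p") auto
      ultimately show ?thesis using env.subspace_scale[OF Lf_subspace] by simp
    qed
  qed (use cM H_subspace H_mult Lf_subspace in auto)
  obtain r where "y \<in> Lf r" using Lf_exhausts by blast
  then have "y \<in> Lf 1" by (rule E.euler_descent) (rule assms)
  then have "y \<in> Lf (Suc 0)" by simp
  then show ?thesis
  proof (induction rule: Lf_induct)
    case (add c u v)
    then show ?case by (intro env.subspace_add[OF K0_subspace] env.subspace_scale[OF K0_subspace])
  qed (use env.subspace_0[OF K0_subspace] Kf_H Kf_K0 in auto)
qed

end



section \<open>Linear forms that detect leading terms\<close>

text \<open>A representation of the negative part on monomials \<open>x\<^sup>a y\<^sup>b\<close>: up to a scalar, \<open>L\<^sub>m\<close> gives \<open>x\<^sup>a\<^sup>-\<^sup>m y\<^sup>b\<close>, and \<open>M\<^sub>m\<close> gives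
\<open>x\<^sup>a\<^sup>-\<^sup>m\<^sup>+\<^sup>1 y\<^sup>b\<^sup>+\<^sup>1\<close>. The exponent \<open>b\<close> counts the letters M, and \<open>a - b\<close> measures the degree.\<close>

fun mono_step :: "w22_basis \<Rightarrow> int \<times> int \<Rightarrow> int \<times> int" where
  "mono_step (BL m) (a, b) = (a - m, b)"
| "mono_step (BM m) (a, b) = (a - m + 1, b + 1)"
| "mono_step _ st = st"

fun mono_coeff :: "w22_basis \<Rightarrow> int \<times> int \<Rightarrow> complex" where
  "mono_coeff (BL m) (a, b) = of_int (a - (1 - m) * b)"
| "mono_coeff _ st = 1"

text \<open>The word acts on the monomial \<open>x\<close>, and \<open>f\<close> is evaluated on the result. Starting with exponent 1 rather than
0 keeps the scalars of repeated \<open>L\<^sub>-\<^sub>p\<close> nonzero.\<close>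

primrec mono_val :: "w22_basis list \<Rightarrow> (int \<times> int \<Rightarrow> complex) \<Rightarrow> complex" where
  "mono_val [] f = f (1, 0)"
| "mono_val (x # ws) f = mono_val ws (\<lambda>st. mono_coeff x st * f (mono_step x st))"

lemma mono_val_add: "mono_val ws (\<lambda>st. f st + g st) = mono_val ws f + mono_val ws g"
  by (induction ws arbitrary: f g) (auto simp: distrib_left)

lemma mono_val_scale: "mono_val ws (\<lambda>st. c * f st) = c * mono_val ws f"
proof (induction ws arbitrary: f)
  case (Cons x ws)
  have "(\<lambda>st. mono_coeff x st * (c * f (mono_step x st))) = (\<lambda>st. c * (mono_coeff x st * f (mono_step x st)))"
    by (rule ext) (simp add: mult.left_commute)
  then show ?case by (simp add: Cons)
qed simp

lemma respects_neg_mono_val: "respects_neg (\<lambda>ws. mono_val ws f)"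
  unfolding respects_neg_def
proof (intro allI impI)
  fix a b y z
  assume yz: "neg_gen y" "neg_gen z"
  show "mono_val (a @ y # z # b) f = mono_val (a @ z # y # b) f + lin_ext (\<lambda>u. mono_val (a @ u # b) f) (w22_bracket y z)"
  proof (induction a arbitrary: f)
    case Nil
    have swapLL: "mono_val (BL m # BL n # b) f = mono_val (BL n # BL m # b) f + of_int (m - n) * mono_val (BL (m + n) # b) f" for m n f
    proof -
      have "mono_coeff (BL n) st * (mono_coeff (BL m) (mono_step (BL n) st) * f (mono_step (BL m) (mono_step (BL n) st))) =
         mono_coeff (BL m) st * (mono_coeff (BL n) (mono_step (BL m) st) * f (mono_step (BL n) (mono_step (BL m) st)))
         + of_int (m - n) * (mono_coeff (BL (m + n)) st * f (mono_step (BL (m + n)) st))" for st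
        by (cases st) (simp add: algebra_simps)
      then show ?thesis by (simp add: mono_val_add mono_val_scale del: mono_step.simps mono_coeff.simps)
    qed
    have swapLM: "mono_val (BL m # BM n # b) f = mono_val (BM n # BL m # b) f + of_int (m - n) * mono_val (BM (m + n) # b) f" for m n f
    proof -
      have "mono_coeff (BM n) st * (mono_coeff (BL m) (mono_step (BM n) st) * f (mono_step (BL m) (mono_step (BM n) st))) =
         mono_coeff (BL m) st * (mono_coeff (BM n) (mono_step (BL m) st) * f (mono_step (BM n) (mono_step (BL m) st)))
         + of_int (m - n) * (mono_coeff (BM (m + n)) st * f (mono_step (BM (m + n)) st))" for st
        by (cases st) (simp add: algebra_simps)
      then show ?thesis by (simp add: mono_val_add mono_val_scale del: mono_step.simps mono_coeff.simps)
    qed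
    have swapMM: "mono_val (BM m # BM n # b) f = mono_val (BM n # BM m # b) f" for m n f
    proof -
      have "mono_coeff (BM n) st * (mono_coeff (BM m) (mono_step (BM n) st) * f (mono_step (BM m) (mono_step (BM n) st))) =
         mono_coeff (BM m) st * (mono_coeff (BM n) (mono_step (BM m) st) * f (mono_step (BM n) (mono_step (BM m) st)))" for st
        by (cases st) (simp add: algebra_simps)
      then show ?thesis by (simp del: mono_step.simps mono_coeff.simps)
    qed
    consider (LL) m n where "y = BL m" "z = BL n" | (LM) m n where "y = BL m" "z = BM n"
      | (BMBL) m n where "y = BM m" "z = BL n" | (MM) m n where "y = BM m" "z = BM n"
      using yz by (cases y; cases z) auto
    then show ?case
    proof cases
      case LL
      then have "w22_bracket y z = Poly_Mapping.single (BL (m + n)) (of_int (m - n))"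
        using yz by simp
      then show ?thesis using swapLL[of m n f] unfolding LL(1,2) append_Nil by (simp only: lin_ext_single)
    next
      case LM
      then have "w22_bracket y z = Poly_Mapping.single (BM (m + n)) (of_int (m - n))"
        using yz by simp
      then show ?thesis using swapLM[of m n f] unfolding LM(1,2) append_Nil by (simp only: lin_ext_single)
    next
      case BMBL
      then have "w22_bracket y z = - Poly_Mapping.single (BM (n + m)) (of_int (n - m))"
        using yz by simp
      then show ?thesis using swapLM[of n m f] unfolding BMBL(1,2) append_Nil by (simp only: lin_ext_single lin_ext_uminus) simp
    next
      case MM
      then have "w22_bracket y z = 0" by simp
      then show ?thesis using swapMM[of m n f] unfolding MM(1,2) append_Nil by (simp only: lin_ext_zero add_0_right)
    qed
  next
    case (Cons x a)
    show ?case unfolding append_Cons mono_val.simps by (rule Cons)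
  qed
qed

definition count_M :: "w22_basis list \<Rightarrow> nat" where
  "count_M ws = length (filter (\<lambda>x. case x of BM _ \<Rightarrow> True | _ \<Rightarrow> False) ws)"

lemma count_M_simps [simp]: "count_M [] = 0" "count_M (BL m # ws) = count_M ws" "count_M (BM m # ws) = Suc (count_M ws)"
  "count_M (ws @ vs) = count_M ws + count_M vs"
  by (simp_all add: count_M_def)

lemma mono_val_final:
  assumes "neg_word ws"
  shows "\<exists>c. \<forall>f. mono_val ws f = c * f (1 + word_degree ws + int (count_M ws), int (count_M ws))"
  using assms
proof (induction ws)
  case (Cons x ws)
  then obtain c where c: "\<And>f. mono_val ws f = c * f (1 + word_degree ws + int (count_M ws), int (count_M ws))" by auto
  show ?case
  proof (cases x)
    case (BL m)
    have "mono_val (BL m # ws) f = (c * of_int (1 + word_degree ws + int (count_M ws) - (1 - m) * int (count_M ws)))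
        * f (1 + word_degree (BL m # ws) + int (count_M (BL m # ws)), int (count_M (BL m # ws)))" for f
    proof -
      have st: "1 + word_degree ws + int (count_M ws) - m = 1 + word_degree (BL m # ws) + int (count_M (BL m # ws))"
        by simp
      show ?thesis unfolding mono_val.simps c mono_coeff.simps mono_step.simps st by (simp only: count_M_simps mult.assoc)
    qed
    then show ?thesis unfolding BL by blast
  next
    case (BM m)
    have "mono_val (BM m # ws) f = c * f (1 + word_degree (BM m # ws) + int (count_M (BM m # ws)), int (count_M (BM m # ws)))" for f
    proof -
      have st: "1 + word_degree ws + int (count_M ws) - m + 1 = 1 + word_degree (BM m # ws) + int (count_M (BM m # ws))"
        by simp
      show ?thesis unfolding mono_val.simps c mono_coeff.simps mono_step.simps st by (simp add: add.commute[of _ 1])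
    qed
    then show ?thesis unfolding BM by blast
  qed (use Cons.prems in auto)
qed auto

lemma mono_val_M: "mono_val (replicate k (BM (- int p))) f = f (1 + int ((p + 1) * k), int k)"
proof (induction k arbitrary: f)
  case (Suc k)
  have st: "mono_step (BM (- int p)) (1 + int ((p + 1) * k), int k) = (1 + int ((p + 1) * Suc k), int (Suc k))"
    by (simp add: algebra_simps)
  show ?case unfolding replicate_Suc mono_val.simps Suc st by simp
qed simp

lemma mono_val_leading:
  "mono_val (replicate s (BL (- int p)) @ replicate k (BM (- int p))) f =
    (\<Prod>j<s. of_nat (1 + p * j)) * f (1 + int ((p + 1) * k + p * s), int k)"
proof (induction s arbitrary: f)
  case 0
  show ?case using mono_val_M[of k p f] by simp
next
  case (Suc s)
  have "1 + int ((p + 1) * k + p * s) - (1 - - int p) * int k = int (1 + p * s)"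
    by (simp add: algebra_simps)
  then have cf: "mono_coeff (BL (- int p)) (1 + int ((p + 1) * k + p * s), int k) = of_nat (1 + p * s)"
    by (simp only: mono_coeff.simps of_int_of_nat_eq)
  have st: "mono_step (BL (- int p)) (1 + int ((p + 1) * k + p * s), int k) = (1 + int ((p + 1) * k + p * Suc s), int k)"
    by (simp add: algebra_simps)
  show ?case unfolding replicate_Suc append_Cons mono_val.simps Suc cf st prod.lessThan_Suc by (simp only: mult.assoc)
qed

text \<open>The form reads off the coefficient of one monomial; the two exponents of the monomial record the degree
and the number of letters M of a word.\<close>

lemma detecting_form:
  assumes p: "p \<ge> 1"
  obtains \<Psi> :: "w22_env \<Rightarrow> complex"
  where "\<And>u v. \<Psi> (u + v) = \<Psi> u + \<Psi> v" "\<And>c u. \<Psi> (c \<cdot> u) = c * \<Psi> u"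
    "\<And>u. u \<in> verma_ideal cL cM hL hM \<Longrightarrow> \<Psi> u = 0"
    "\<And>ws. neg_word ws \<Longrightarrow> word_degree ws \<noteq> int (p * (s + k)) \<or> count_M ws \<noteq> k \<Longrightarrow> \<Psi> (word ws) = 0"
    "\<Psi> (UL (- int p) ^ s * UM (- int p) ^ k) \<noteq> 0"
proof -
  define f :: "int \<times> int \<Rightarrow> complex" where "f st = (if st = (1 + int ((p + 1) * k + p * s), int k) then 1 else 0)" for st
  obtain \<Psi> where \<Psi>: "\<And>u v. \<Psi> (u + v) = \<Psi> u + \<Psi> v" "\<And>c u. \<Psi> (c \<cdot> u) = c * \<Psi> u"
    "\<And>ws. neg_word ws \<Longrightarrow> \<Psi> (word ws) = mono_val ws f"
    "\<And>u x. \<not> neg_gen x \<Longrightarrow> \<Psi> (u * env_gen x) = hw_char cL cM hL hM x * \<Psi> u"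
    by (rule verma_functional[OF respects_neg_mono_val[of f], where cL = cL and cM = cM and hL = hL and hM = hM],
        rule that; assumption)
  define I where "I = {v. \<forall>u. \<Psi> (u * v) = 0}"
  have zero: "\<Psi> 0 = 0" using \<Psi>(1)[of 0 0] by simp
  have "left_ideal I"
    by (rule left_idealI) (auto simp: I_def zero distrib_left \<Psi>(1) mult.assoc[symmetric])
  moreover have "env_gen x - env_scalar (hw_char cL cM hL hM x) \<in> I" if "\<not> neg_gen x" for x
  proof -
    have "\<Psi> (u * (env_gen x - env_scalar (hw_char cL cM hL hM x))) = 0" for u
    proof -
      have "u * (env_gen x - env_scalar (hw_char cL cM hL hM x)) = u * env_gen x + (- hw_char cL cM hL hM x) \<cdot> u"
        by (simp add: right_diff_distrib env_scalar_eq)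
      then show ?thesis using \<Psi>(4)[OF that, of u] by (simp add: \<Psi>(1,2) del: add_uminus_conv_diff env.scale_minus_left)
    qed
    then show ?thesis by (simp add: I_def)
  qed
  ultimately have J: "verma_ideal cL cM hL hM \<subseteq> I" by (rule verma_ideal_least)
  have words: "\<Psi> (word ws) = 0" if "neg_word ws" "word_degree ws \<noteq> int (p * (s + k)) \<or> count_M ws \<noteq> k" for ws
  proof -
    from mono_val_final[OF that(1)]
    obtain c where c: "mono_val ws f = c * f (1 + word_degree ws + int (count_M ws), int (count_M ws))" by blast
    have "f (1 + word_degree ws + int (count_M ws), int (count_M ws)) = 0"
      using that(2) by (auto simp: f_def algebra_simps)
    then show ?thesis using \<Psi>(3)[OF that(1)] c by simp
  qed
  have "word (replicate s (BL (- int p)) @ replicate k (BM (- int p))) = UL (- int p) ^ s * UM (- int p) ^ k"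
    by (simp add: word_def)
  moreover have "neg_word (replicate s (BL (- int p)) @ replicate k (BM (- int p)))" using p by auto
  ultimately have "\<Psi> (UL (- int p) ^ s * UM (- int p) ^ k) = (\<Prod>j<s. of_nat (1 + p * j))"
    using \<Psi>(3)[of "replicate s (BL (- int p)) @ replicate k (BM (- int p))"] mono_val_leading[of s p k f]
    by (simp add: f_def)
  moreover have "(\<Prod>j<s. of_nat (1 + p * j) :: complex) \<noteq> 0"
    by (simp add: prod_zero_iff del: of_nat_Suc of_nat_add)
  ultimately have lead: "\<Psi> (UL (- int p) ^ s * UM (- int p) ^ k) \<noteq> 0" by simp
  show ?thesis
  proof (rule that[OF \<Psi>(1,2) _ words lead])
    fix u assume "u \<in> verma_ideal cL cM hL hM"
    then have "\<Psi> (1 * u) = 0" using J unfolding I_def by blast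
    then show "\<Psi> u = 0" by simp
  qed
qed

definition M_filt :: "nat \<Rightarrow> w22_env set" where
  "M_filt m = env_span {word ws |ws. neg_word ws \<and> m \<le> count_M ws}"

lemma M_filt_subspace: "env_subspace (M_filt m)"
  by (simp add: M_filt_def env.subspace_span)

lemma M_filt_word: "neg_word ws \<Longrightarrow> m \<le> count_M ws \<Longrightarrow> word ws \<in> M_filt m"
  unfolding M_filt_def by (rule env.span_base) blast

lemma M_filt_mono: "m \<le> n \<Longrightarrow> M_filt n \<subseteq> M_filt m"
  unfolding M_filt_def by (rule env.span_mono) auto

lemma M_filt_mult: "u \<in> M_filt a \<Longrightarrow> v \<in> M_filt b \<Longrightarrow> u * v \<in> M_filt (a + b)"
proof -
  assume u: "u \<in> M_filt a" and v: "v \<in> M_filt b"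
  have 1: "word ws * v \<in> M_filt (a + b)" if ws: "neg_word ws" "a \<le> count_M ws" for ws
    using v unfolding M_filt_def[of b]
  proof (induction rule: env.span_induct_alt)
    case (step c g v)
    then obtain vs where "g = word vs" "neg_word vs" "b \<le> count_M vs" by blast
    then have "word ws * g \<in> M_filt (a + b)" using M_filt_word[of "ws @ vs" "a + b"] ws by auto
    then show ?case using step env.subspace_add[OF M_filt_subspace env.subspace_scale[OF M_filt_subspace]]
      by (simp add: distrib_left)
  qed (simp add: env.subspace_0[OF M_filt_subspace])
  show ?thesis using u unfolding M_filt_def[of a]
  proof (induction rule: env.span_induct_alt)
    case (step c g u)
    then have "g * v \<in> M_filt (a + b)" using 1 by blast
    then show ?case using step env.subspace_add[OF M_filt_subspace env.subspace_scale[OF M_filt_subspace]]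
      by (simp add: distrib_right)
  qed (simp add: env.subspace_0[OF M_filt_subspace])
qed

lemma UM_neg_M_filt: "0 \<notin> set xs \<Longrightarrow> m \<le> length xs \<Longrightarrow> UM_neg xs \<in> M_filt m"
proof -
  assume xs: "0 \<notin> set xs" "m \<le> length xs"
  have "UM_neg xs = word (map (\<lambda>i. BM (- int i)) xs)" by (induction xs) auto
  moreover have "count_M (map (\<lambda>i. BM (- int i)) xs) = length xs" by (induction xs) auto
  moreover have "neg_word (map (\<lambda>i. BM (- int i)) xs)" using xs by (auto intro: gr0I)
  ultimately show ?thesis using M_filt_word[of "map (\<lambda>i. BM (- int i)) xs" m] xs by simp
qed

lemma M_poly_M_filt: "u \<in> M_poly d \<Longrightarrow> 1 \<le> d \<Longrightarrow> u \<in> M_filt 1"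
proof -
  assume u: "u \<in> M_poly d" and d: "1 \<le> d"
  have "M_words d \<subseteq> M_filt 1"
  proof
    fix g assume "g \<in> M_words d"
    then obtain xs where xs: "g = UM_neg xs" "0 \<notin> set xs" "sum_list xs = d" by (auto simp: M_words_def)
    then have "1 \<le> length xs" using d by (cases xs) auto
    then show "g \<in> M_filt 1" using UM_neg_M_filt xs by blast
  qed
  then show ?thesis using u env.span_minimal[OF _ M_filt_subspace] unfolding M_poly_def by blast
qed

lemma M_restr_M_filt: "v \<in> env_span (M_words_restr p p) \<Longrightarrow> p \<ge> 1 \<Longrightarrow> v \<in> M_filt 2"
proof -
  assume v: "v \<in> env_span (M_words_restr p p)" and p: "p \<ge> 1"
  have "M_words_restr p p \<subseteq> M_filt 2"
  proof
    fix g assume "g \<in> M_words_restr p p"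
    then obtain xs where xs: "g = UM_neg xs" "0 \<notin> set xs" "p \<notin> set xs" "sum_list xs = p" by (auto simp: M_words_restr_def)
    then have "2 \<le> length xs" using p by (cases xs; cases "tl xs") auto
    then show "g \<in> M_filt 2" using UM_neg_M_filt xs by blast
  qed
  then show ?thesis using v env.span_minimal[OF _ M_filt_subspace] by blast
qed

lemma UL_M_filt: "i \<ge> 1 \<Longrightarrow> UL (- int i) \<in> M_filt 0"
  using M_filt_word[of "[BL (- int i)]" 0] by simp

lemma UM_M_filt: "i \<ge> 1 \<Longrightarrow> UM (- int i) \<in> M_filt 1"
  using M_filt_word[of "[BM (- int i)]" 1] by simp

lemma one_M_filt: "1 \<in> M_filt 0"
  using M_filt_word[of "[]" 0] by simp

lemma T_lead:
  assumes w: "w \<in> env_span (M_words_restr p p)" and p: "p \<ge> 1"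
  shows "T_of p cM w - UL (- int p) \<in> M_filt 1"
proof -
  have split: "{1..p} = insert p {1..<p}" using p by auto
  have "T_of p cM w - UL (- int p) = (\<Sum>i\<in>{1..<p}. g_coeff p cM (p - i) * UL (- int i)) + w"
    unfolding T_of_def split by simp
  also have "\<dots> \<in> M_filt 1"
  proof (rule env.subspace_add[OF M_filt_subspace env.subspace_sum[OF M_filt_subspace]])
    show "w \<in> M_filt 1" using M_restr_M_filt[OF w p] M_filt_mono[of 1 2] by auto
    fix i assume "i \<in> {1..<p}"
    then have "1 \<le> p - i" "1 \<le> i" by auto
    from M_filt_mult[OF M_poly_M_filt[OF g_coeff_in_M_poly this(1)] UL_M_filt[OF this(2)]]
    show "g_coeff p cM (p - i) * UL (- int i) \<in> M_filt 1" by simp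
  qed
  finally show ?thesis .
qed

lemma power_lead:
  assumes "x \<in> M_filt a" "y - x \<in> M_filt (Suc a)"
  shows "x ^ n \<in> M_filt (n * a) \<and> y ^ n - x ^ n \<in> M_filt (Suc (n * a))"
proof (induction n)
  case 0
  show ?case using one_M_filt by (simp add: env.subspace_0[OF M_filt_subspace])
next
  case (Suc n)
  have y: "y \<in> M_filt a"
    using env.subspace_add[OF M_filt_subspace assms(1), of "y - x"] assms(2) M_filt_mono[of a "Suc a"] by auto
  have "y ^ Suc n - x ^ Suc n = y * (y ^ n - x ^ n) + (y - x) * x ^ n" by (simp add: algebra_simps)
  also have "\<dots> \<in> M_filt (Suc (Suc n * a))"
    using M_filt_mult[OF y, of "y ^ n - x ^ n" "Suc (n * a)"] M_filt_mult[OF assms(2), of "x ^ n" "n * a"] Suc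
    by (intro env.subspace_add[OF M_filt_subspace]) auto
  finally show ?case using M_filt_mult[OF assms(1), of "x ^ n" "n * a"] Suc by simp
qed

lemma T_power_lead:
  assumes "w \<in> env_span (M_words_restr p p)" "p \<ge> 1"
  shows "T_of p cM w ^ n - UL (- int p) ^ n \<in> M_filt 1" and "UL (- int p) ^ n \<in> M_filt 0"
  using power_lead[OF UL_M_filt[OF assms(2)], of "T_of p cM w" n] T_lead[OF assms] by simp_all

lemma S_power_lead:
  assumes "p \<ge> 1"
  shows "S_of p cM ^ n - UM (- int p) ^ n \<in> M_filt (Suc n)" and "UM (- int p) ^ n \<in> M_filt n"
proof -
  obtain v where v: "v \<in> env_span (M_words_restr p p)" "S_of p cM = UM (- int p) + v" using S_of_lead[OF assms] by blast
  then have "S_of p cM - UM (- int p) \<in> M_filt (Suc 1)" using M_restr_M_filt[OF v(1) assms] by (simp add: numeral_2_eq_2)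
  from power_lead[OF UM_M_filt[OF assms] this, of n]
  show "S_of p cM ^ n - UM (- int p) ^ n \<in> M_filt (Suc n)" and "UM (- int p) ^ n \<in> M_filt n" by simp_all
qed

text \<open>A form detecting the power \<open>L\<^sub>-\<^sub>p\<^sup>j\<close> modulo words containing some M.\<close>

definition detects :: "nat \<Rightarrow> w22_env set \<Rightarrow> nat \<Rightarrow> bool" where
  "detects p H j \<longleftrightarrow> (\<exists>\<Psi> :: w22_env \<Rightarrow> complex. (\<forall>u v. \<Psi> (u + v) = \<Psi> u + \<Psi> v) \<and> (\<forall>c u. \<Psi> (c \<cdot> u) = c * \<Psi> u) \<and>
     (\<forall>u\<in>H. \<Psi> u = 0) \<and> (\<forall>u\<in>M_filt 1. \<Psi> u = 0) \<and> (\<forall>i. i \<noteq> j \<longrightarrow> \<Psi> (UL (- int p) ^ i) = 0) \<and>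
     \<Psi> (UL (- int p) ^ j) \<noteq> 0)"

context critical
begin

lemma detects_not_in:
  assumes "detects p H j" and B: "\<And>b. b \<in> B \<Longrightarrow> \<exists>k. b \<in> Kf k"
    and "a \<cdot> T ^ j \<in> env_span (M_ideal B \<union> Kf j)"
  shows "a = 0"
proof -
  obtain \<Psi> :: "w22_env \<Rightarrow> complex" where add: "\<And>u v. \<Psi> (u + v) = \<Psi> u + \<Psi> v" and scale: "\<And>c u. \<Psi> (c \<cdot> u) = c * \<Psi> u"
    and H0: "\<And>u. u \<in> H \<Longrightarrow> \<Psi> u = 0" and M0: "\<And>u. u \<in> M_filt 1 \<Longrightarrow> \<Psi> u = 0"
    and L0: "\<And>i. i \<noteq> j \<Longrightarrow> \<Psi> (UL (- int p) ^ i) = 0" and L1: "\<Psi> (UL (- int p) ^ j) \<noteq> 0"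
    using assms(1) unfolding detects_def by blast
  have zero: "\<Psi> 0 = 0" using add[of 0 0] by simp
  define Z where "Z = {u. \<Psi> u = 0}"
  have Z: "env_subspace Z" by (rule env.subspaceI) (auto simp: Z_def zero add scale)
  have T: "\<Psi> (T ^ i) = \<Psi> (UL (- int p) ^ i)" for i
    using add[of "T ^ i - UL (- int p) ^ i" "UL (- int p) ^ i"] M0[OF T_power_lead(1)[OF w p, of cM i]] by simp
  have T0: "T ^ i \<in> M_filt 0" for i
    using env.subspace_add[OF M_filt_subspace T_power_lead(2)[OF w p], of "T ^ i - UL (- int p) ^ i" i]
      T_power_lead(1)[OF w p, of cM i] M_filt_mono[of 0 1] by auto
  have UMw: "UM_neg xs * T ^ i \<in> M_filt 1" if "0 \<notin> set xs" "xs \<noteq> []" for xs i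
  proof -
    have "1 \<le> length xs" using that by (cases xs) auto
    then show ?thesis using M_filt_mult[OF UM_neg_M_filt[OF that(1)] T0, of 1 i] by simp
  qed
  have KfZ: "Kf j \<subseteq> Z"
  proof
    fix y assume "y \<in> Kf j"
    then show "y \<in> Z"
    proof (induction rule: Kf_induct)
      case (word xs i)
      then show ?case using M0[OF UMw] L0[of i] T by (cases "xs = []") (auto simp: Z_def)
    next
      case (add c u v)
      then show ?case by (intro env.subspace_add[OF Z] env.subspace_scale[OF Z])
    qed (auto simp: Z_def zero H0)
  qed
  have "UM (- int i) * b \<in> Z" if i: "1 \<le> i" and b: "b \<in> Kf k" for i b k
    using b
  proof (induction rule: Kf_induct)
    case (word xs l)
    then show ?case using M0[OF UMw[of "i # xs" l]] i by (simp add: Z_def mult.assoc)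
  next
    case (low \<eta>)
    then show ?case using H_mult H0 by (simp add: Z_def)
  next
    case (add c u v)
    have "UM (- int i) * (c \<cdot> u + v) = c \<cdot> (UM (- int i) * u) + UM (- int i) * v" by (simp add: distrib_left)
    then show ?case using add env.subspace_add[OF Z env.subspace_scale[OF Z]] by simp
  qed (simp add: Z_def zero)
  then have "H \<union> {UM (- int j) * b |j b. 1 \<le> j \<and> b \<in> B} \<subseteq> Z" using B H0 by (force simp: Z_def)
  then have "M_ideal B \<subseteq> Z" unfolding M_ideal_def by (rule env.span_minimal[OF _ Z])
  then have "env_span (M_ideal B \<union> Kf j) \<subseteq> Z" using KfZ by (intro env.span_minimal[OF _ Z]) auto
  then have "\<Psi> (a \<cdot> T ^ j) = 0" using assms(3) by (auto simp: Z_def)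
  then show ?thesis using L1 T by (simp add: scale)
qed

end

context highest_weight
begin

text \<open>The positive generators lower the degree, so they map an element of least degree among those of \<open>X\<close>
outside \<open>H\<close> into \<open>H\<close>.\<close>

lemma minimal_degree:
  assumes X: "left_ideal X" "H \<subseteq> X" "X \<noteq> H"
  obtains x d where "x \<in> X" "x \<notin> H" "has_degree d x" "d \<ge> 0"
    "\<And>m. 1 \<le> m \<Longrightarrow> UL (int m) * x \<in> H" "\<And>m. 1 \<le> m \<Longrightarrow> UM (int m) * x \<in> H"
proof -
  define P where "P n \<longleftrightarrow> (\<exists>x\<in>X. x \<notin> H \<and> has_degree (int n) x)" for n
  obtain x where x: "x \<in> X" "x \<notin> H" using X by blast
  have "x \<in> env_span (range word)" using span_words by simp
  then obtain D y where y: "finite D" "\<And>d. y d \<in> env_span {g \<in> range word. has_degree d g}" "x = (\<Sum>d\<in>D. y d)"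
    using degree_decomposition[of x "range word"] has_degree_word by blast
  have deg: "has_degree d (y d)" for d using has_degree_span[OF y(2)] by auto
  have yX: "y d \<in> X" if "d \<in> D" for d
    using graded[OF left_ideal_subspace[OF X(1)] X(2) left_ideal_mult[OF X(1)] y(1), of y d] deg x(1) y(3) that by auto
  obtain d where d: "d \<in> D" "y d \<notin> H" using x(2) y(3) H_sum by metis
  then have "d \<ge> 0" using negative_degree[OF deg[of d]] by force
  then have "P (nat d)" unfolding P_def using d yX deg by auto
  then have L: "P (LEAST n. P n)" by (rule LeastI)
  define n where "n = (LEAST n. P n)"
  obtain z where z: "z \<in> X" "z \<notin> H" "has_degree (int n) z" using L unfolding P_def n_def by blast
  have low: "v \<in> H" if "v \<in> X" "has_degree (int n - int m) v" "1 \<le> m" for v m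
  proof (cases "m \<le> n")
    case True
    then have "n - m < n" using that(3) by simp
    then have "\<not> P (n - m)" unfolding n_def by (rule not_less_Least)
    moreover have "int n - int m = int (n - m)" using True by simp
    ultimately show ?thesis using that unfolding P_def by metis
  next
    case False
    then show ?thesis using negative_degree[OF that(2)] by simp
  qed
  have "UL (int m) * z \<in> H" "UM (int m) * z \<in> H" if "1 \<le> m" for m
    using low[OF left_ideal_mult[OF X(1) z(1)] _ that] has_degree_mult[OF has_degree_UL[of "int m"] z(3)]
      has_degree_mult[OF has_degree_UM[of "int m"] z(3)] by simp_all
  then show ?thesis using that z by simp
qed

end

context critical_quotient
begin

text \<open>The coefficient \<open>b\<^sub>k\<close> in \<open>L\<^sub>p T\<^sup>k = b\<^sub>k T\<^sup>k\<^sup>-\<^sup>1\<close>, an identity up to multiples of the negative M.\<close>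

definition b_coeff :: "nat \<Rightarrow> complex" where
  "b_coeff k = of_nat (2 * p * k) * (hL - hL_crit p 1 cL + of_nat p * (of_nat k - 1) / 2)"

lemma b_coeff_zero_iff: "b_coeff k = 0 \<longleftrightarrow> k = 0 \<or> hL = hL_crit p k cL"
proof -
  have "hL_crit p k cL = hL_crit p 1 cL - of_nat p * (of_nat k - 1) / 2"
    by (simp add: hL_crit_def field_simps)
  then have eq: "hL - hL_crit p 1 cL + of_nat p * (of_nat k - 1) / 2 = hL - hL_crit p k cL" by simp
  have "b_coeff k = of_nat (2 * p * k) * (hL - hL_crit p k cL)"
    unfolding b_coeff_def by (simp only: eq)
  then show ?thesis using p by auto
qed

abbreviation R where "R \<equiv> M_ideal K0"

lemma R_induct [consumes 1, case_names zero UM low add]: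
  assumes "y \<in> R" "P 0" "\<And>j b. 1 \<le> j \<Longrightarrow> b \<in> K0 \<Longrightarrow> P (UM (- int j) * b)" "\<And>\<eta>. \<eta> \<in> H \<Longrightarrow> P \<eta>"
    "\<And>c u v. P u \<Longrightarrow> P v \<Longrightarrow> P (c \<cdot> u + v)"
  shows "P y"
  using assms(1) unfolding M_ideal_def
  by (induction rule: env.span_induct_alt) (use assms(2-) in auto)

lemma R_add_scale: "x \<in> R \<Longrightarrow> y \<in> R \<Longrightarrow> c \<cdot> x + y \<in> R"
  by (rule env.subspace_add[OF M_ideal_subspace env.subspace_scale[OF M_ideal_subspace]])

lemma T_R: "y \<in> R \<Longrightarrow> T * y \<in> R"
proof (induction rule: R_induct)
  case (UM j b)
  have "T * (UM (- int j) * b) = UM (- int j) * (T * b) + (T * UM (- int j) - UM (- int j) * T) * b"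
    by (simp add: algebra_simps)
  also have "\<dots> \<in> R"
    by (rule env.subspace_add[OF M_ideal_subspace M_ideal_UM[OF UM(1) K0_T[OF UM(2)]]
          M_poly_M_ideal[OF K0_M_closed T_M_commutator[OF M_poly_UM[OF UM(1)]] _ UM(2)]]) (use UM(1) in simp)
  finally show ?case .
next
  case (low \<eta>)
  then show ?case using M_ideal_H H_mult by blast
qed (simp_all add: env.subspace_0[OF M_ideal_subspace] distrib_left R_add_scale)

lemma UL_p_R: "y \<in> R \<Longrightarrow> UL (int p) * y \<in> R"
proof (induction rule: R_induct)
  case (UM j b)
  have bK: "b \<in> K" using UM(2) K0_M_closed M_closedD(3) by blast
  have "adj p j b \<in> R"
    using UM env.subspace_0[OF M_ideal_subspace] M_ideal_UM[of "j - p" b K0] unfolding adj_def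
    by (auto intro!: env.subspace_scale[OF M_ideal_subspace] simp del: of_nat_diff)
  moreover have "UM (- int j) * (UL (int p) * b) \<in> R" by (rule M_ideal_UM[OF UM(1) K0_UL[OF UM(2)]])
  moreover have "UL (int p) * (UM (- int j) * b) - UM (- int j) * (UL (int p) * b) - adj p j b \<in> R"
    using UL_UM_K[OF bK p UM(1)] M_ideal_H by blast
  ultimately have "(UL (int p) * (UM (- int j) * b) - UM (- int j) * (UL (int p) * b) - adj p j b)
      + (UM (- int j) * (UL (int p) * b) + adj p j b) \<in> R"
    by (intro env.subspace_add[OF M_ideal_subspace])
  then show ?case by simp
next
  case (low \<eta>)
  then show ?case using M_ideal_H H_mult by blast
qed (simp_all add: env.subspace_0[OF M_ideal_subspace] distrib_left R_add_scale)

text \<open>Each factor T contributes a multiple of the shifted weight \<open>L\<^sub>0\<close> of the powers of T to its right.\<close>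

lemma UL_p_T_power: "UL (int p) * T ^ Suc k - b_coeff (Suc k) \<cdot> T ^ k \<in> R"
proof -
  have step: "UL (int p) * (T * T ^ k) - T * (UL (int p) * T ^ k) - (2 * of_nat p * (hL + of_nat (k * p) - hL_crit p 1 cL)) \<cdot> T ^ k \<in> R" for k
  proof -
    have K0k: "T ^ k \<in> K0" using Kf_power[of k "Suc k"] Kf_K0 by auto
    have 1: "UL (int p) * (T * T ^ k) - T * (UL (int p) * T ^ k) - (2 * of_nat p) \<cdot> (UL 0 * T ^ k - hL_crit p 1 cL \<cdot> T ^ k) \<in> R"
      by (rule UL_p_T[OF K0_M_closed K0_UL[OF K0k] K0k])
    have "UL 0 * T ^ k - (hL + of_int (int k * int p)) \<cdot> T ^ k \<in> H"
      by (rule hw_weight[OF has_degree_power[OF has_degree_T[OF w']]])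
    then have 2: "(2 * of_nat p) \<cdot> (UL 0 * T ^ k - (hL + of_int (int k * int p)) \<cdot> T ^ k) \<in> R"
      using M_ideal_H env.subspace_scale[OF M_ideal_subspace] by blast
    from env.subspace_add[OF M_ideal_subspace 1 2]
    have "UL (int p) * (T * T ^ k) - T * (UL (int p) * T ^ k)
      - ((2 * of_nat p) \<cdot> ((hL + of_int (int k * int p)) \<cdot> T ^ k) - (2 * of_nat p) \<cdot> (hL_crit p 1 cL \<cdot> T ^ k)) \<in> R"
      by (simp add: env.scale_right_diff_distrib algebra_simps)
    moreover have "(2 * of_nat p) \<cdot> ((hL + of_int (int k * int p)) \<cdot> T ^ k) - (2 * of_nat p) \<cdot> (hL_crit p 1 cL \<cdot> T ^ k)
        = (2 * of_nat p * (hL + of_nat (k * p) - hL_crit p 1 cL)) \<cdot> T ^ k"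
      by (simp add: env.scale_left_diff_distrib[symmetric] algebra_simps)
    ultimately show ?thesis by simp
  qed
  show ?thesis
  proof (induction k)
    case 0
    have "T * UL (int p) \<in> R" using hw_pos(1)[of "int p" T] p M_ideal_H by auto
    from env.subspace_add[OF M_ideal_subspace step[of 0] this] show ?case
      by (simp add: b_coeff_def)
  next
    case (Suc k)
    have c: "b_coeff (Suc (Suc k)) = 2 * of_nat p * (hL + of_nat (Suc k * p) - hL_crit p 1 cL) + b_coeff (Suc k)"
      by (simp add: b_coeff_def field_simps)
    have "(UL (int p) * (T * T ^ Suc k) - T * (UL (int p) * T ^ Suc k) - (2 * of_nat p * (hL + of_nat (Suc k * p) - hL_crit p 1 cL)) \<cdot> T ^ Suc k)
      + T * (UL (int p) * T ^ Suc k - b_coeff (Suc k) \<cdot> T ^ k) \<in> R"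
      by (rule env.subspace_add[OF M_ideal_subspace step T_R[OF Suc]])
    then show ?case
      unfolding c by (simp add: right_diff_distrib env.scale_left_distrib diff_diff_eq)
  qed
qed

lemma UL_p_Kf: "y \<in> Kf (Suc k) \<Longrightarrow> UL (int p) * y \<in> env_span (R \<union> Kf k)"
proof (induction rule: Kf_induct)
  case (word xs j)
  show ?case
  proof (cases xs)
    case Nil
    have "UL (int p) * T ^ j \<in> Kf k" using UL_T_power[OF p] Kf_mono[of j k] word(2) by auto
    then show ?thesis using Nil by (auto intro: env.span_base)
  next
    case (Cons a as)
    have "UM_neg as * T ^ j \<in> K0" using Kf_word[of as j "Suc j"] word Kf_K0 Cons by auto
    moreover have "1 \<le> a" using word(1) Cons by (cases a) auto
    ultimately have "UM_neg xs * T ^ j \<in> R" using M_ideal_UM by (simp add: Cons mult.assoc)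
    then show ?thesis using UL_p_R by (auto intro: env.span_base)
  qed
next
  case (low \<eta>)
  have "UL (int p) * \<eta> \<in> Kf k" using H_mult[OF low] Kf_H by blast
  then show ?case by (intro env.span_base) simp
qed (simp_all add: env.span_zero distrib_left env.span_add env.span_scale)

text \<open>The leading term is a single power of T by the two Euler arguments. Comparing the coefficients of \<open>T\<^sup>k\<^sup>-\<^sup>1\<close> in
\<open>L\<^sub>p x\<close> gives \<open>b\<^sub>k = 0\<close>, provided that some form sees this power modulo \<open>H\<close>.\<close>

lemma singular_vectors:
  assumes "\<And>m. 1 \<le> m \<Longrightarrow> UL (int m) * x \<in> H" "\<And>m. 1 \<le> m \<Longrightarrow> UM (int m) * x \<in> H" "x \<notin> H"
  obtains k a where "a \<noteq> 0" "x - a \<cdot> T ^ k \<in> Kf k" "T ^ k \<notin> Kf k"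
    "1 \<le> k \<Longrightarrow> detects p H (k - 1) \<Longrightarrow> hL = hL_crit p k cL"
proof -
  have "x \<in> K0" by (rule annihilated_by_M) (rule assms(2))
  then have ex: "\<exists>k. x \<in> Kf k" by (auto simp: K0_def)
  define n where "n = (LEAST k. x \<in> Kf k)"
  have n: "x \<in> Kf n" using ex unfolding n_def by (rule LeastI_ex)
  have least: "x \<notin> Kf m" if "m < n" for m using that unfolding n_def by (rule not_less_Least)
  have "n \<noteq> 0" using n assms(3) Kf_0 by (cases "n = 0") auto
  then obtain k where k: "n = Suc k" by (cases n) auto
  have xk: "x \<in> Kf (Suc k)" using n k by simp
  obtain a where a: "x - a \<cdot> T ^ k \<in> Kf k"
    by (rule stage2[OF good_all xk]) (use assms(1) Kf_H in auto)
  have "x \<notin> Kf k" using least k by simp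
  then have a0: "a \<noteq> 0" using a by auto
  have Tk: "T ^ k \<notin> Kf k"
  proof
    assume "T ^ k \<in> Kf k"
    then have "a \<cdot> T ^ k + (x - a \<cdot> T ^ k) \<in> Kf k" using a Kf_add_scale by blast
    then show False using \<open>x \<notin> Kf k\<close> by simp
  qed
  have "hL = hL_crit p k cL" if k1: "1 \<le> k" and det: "detects p H (k - 1)"
  proof -
    obtain l where l: "k = Suc l" using k1 by (cases k) auto
    let ?Y = "env_span (R \<union> Kf l)"
    have Y: "env_subspace ?Y" by (simp add: env.subspace_span)
    have RY: "R \<subseteq> ?Y" using env.span_superset by blast
    have "UL (int p) * (x - a \<cdot> T ^ k) \<in> ?Y" using UL_p_Kf a l by simp
    moreover have "UL (int p) * x \<in> ?Y" using assms(1)[OF p] M_ideal_H RY by blast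
    ultimately have "UL (int p) * x - UL (int p) * (x - a \<cdot> T ^ k) \<in> ?Y" by (rule env.subspace_diff[OF Y, rotated])
    then have 1: "a \<cdot> (UL (int p) * T ^ Suc l) \<in> ?Y" by (simp add: right_diff_distrib l)
    have "UL (int p) * T ^ Suc l - b_coeff (Suc l) \<cdot> T ^ l \<in> ?Y" using UL_p_T_power RY by blast
    then have "a \<cdot> (UL (int p) * T ^ Suc l) - a \<cdot> (UL (int p) * T ^ Suc l - b_coeff (Suc l) \<cdot> T ^ l) \<in> ?Y"
      using 1 env.subspace_diff[OF Y] env.subspace_scale[OF Y] by blast
    then have "(a * b_coeff (Suc l)) \<cdot> T ^ l \<in> ?Y" by (simp add: env.scale_right_diff_distrib)
    then have "a * b_coeff (Suc l) = 0"
      using detects_not_in[of l K0 "a * b_coeff (Suc l)"] det l by (auto simp: K0_def)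
    then show ?thesis using a0 b_coeff_zero_iff[of "Suc l"] l by simp
  qed
  then show ?thesis using that a0 a Tk by blast
qed

end



section \<open>Linear independence over the polynomial algebra of the negative M\<close>

abbreviation UM_mset :: "nat multiset \<Rightarrow> w22_env" where
  "UM_mset \<mu> \<equiv> UM_neg (sorted_list_of_multiset \<mu>)"

lemma UM_mset_mset: "UM_mset (mset xs) = UM_neg xs"
  by (rule UM_neg_mset) simp

lemma UM_mset_add: "UM_mset (add_mset n \<mu>) = UM (- int n) * UM_mset \<mu>"
  using UM_neg_mset[of "sorted_list_of_multiset (add_mset n \<mu>)" "n # sorted_list_of_multiset \<mu>"] by simp

text \<open>The polynomials in the negative M other than \<open>M\<^sub>-\<^sub>p\<close>.\<close>

definition M_free :: "nat \<Rightarrow> w22_env set" where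
  "M_free p = env_span {UM_neg xs |xs. 0 \<notin> set xs \<and> p \<notin> set xs}"

lemma M_restr_free: "v \<in> env_span (M_words_restr p d) \<Longrightarrow> v \<in> M_free p"
  unfolding M_free_def M_words_restr_def by (erule rev_subsetD) (rule env.span_mono, blast)

lemma M_free_expand:
  assumes "v \<in> M_free p"
  obtains A a where "finite A" "\<And>\<mu>. \<mu> \<in> A \<Longrightarrow> 0 \<notin># \<mu> \<and> p \<notin># \<mu>" "v = (\<Sum>\<mu>\<in>A. a \<mu> \<cdot> UM_mset \<mu>)"
proof -
  have "\<exists>A a. finite A \<and> (\<forall>\<mu>\<in>A. 0 \<notin># \<mu> \<and> p \<notin># \<mu>) \<and> v = (\<Sum>\<mu>\<in>A. a \<mu> \<cdot> UM_mset \<mu>)"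
    using assms unfolding M_free_def
  proof (induction rule: env.span_induct_alt)
    case base
    show ?case by (intro exI[of _ "{}"]) simp
  next
    case (step c g v)
    then obtain A a where A: "finite A" "\<forall>\<mu>\<in>A. 0 \<notin># \<mu> \<and> p \<notin># \<mu>" "v = (\<Sum>\<mu>\<in>A. a \<mu> \<cdot> UM_mset \<mu>)" by blast
    obtain xs where xs: "g = UM_neg xs" "0 \<notin> set xs" "p \<notin> set xs" using step by blast
    define B where "B = insert (mset xs) A"
    define b where "b \<mu> = (if \<mu> = mset xs then c else 0) + (if \<mu> \<in> A then a \<mu> else 0)" for \<mu>
    have "(\<Sum>\<mu>\<in>B. b \<mu> \<cdot> UM_mset \<mu>) = (\<Sum>\<mu>\<in>B. if \<mu> = mset xs then c \<cdot> UM_mset \<mu> else 0) + (\<Sum>\<mu>\<in>B. if \<mu> \<in> A then a \<mu> \<cdot> UM_mset \<mu> else 0)"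
      unfolding sum.distrib[symmetric] by (rule sum.cong) (auto simp: b_def env.scale_left_distrib)
    also have "(\<Sum>\<mu>\<in>B. if \<mu> = mset xs then c \<cdot> UM_mset \<mu> else 0) = c \<cdot> g"
      using A(1) by (simp add: B_def UM_mset_mset xs(1) del: sorted_list_of_multiset_mset)
    also have "(\<Sum>\<mu>\<in>B. if \<mu> \<in> A then a \<mu> \<cdot> UM_mset \<mu> else 0) = v"
      unfolding A(3) using A(1) by (intro sum.mono_neutral_cong_right) (auto simp: B_def)
    finally show ?case using A xs by (intro exI[of _ B] exI[of _ b]) (auto simp: B_def)
  qed
  then show ?thesis using that by blast
qed

context critical_quotient
begin

text \<open>The derivative lowers an exponent by one and multiplies by it.\<close>

lemma dhat_count:
  assumes "\<forall>i\<in>set js. i \<in> {1..N} - {p}" "n \<in> {1..N} - {p}"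
  shows "dhat p cM (\<lambda>m. UL (int m)) N n * (UM_neg js * T ^ k)
    - of_nat (count (mset js) n) \<cdot> (UM_mset (mset js - {#n#}) * T ^ k) \<in> Kf k"
proof -
  interpret E: euler_filtration p "\<lambda>i. UM (- int i)" "Kf k" "{T ^ k}" cM "\<lambda>m. UL (int m)" "\<lambda>_. Kf k"
    by (rule stage2_euler[OF good_all])
  have xw: "prod_list (map (\<lambda>i. UM (- int i)) js) = UM_neg js" for js by (simp add: UM_neg_def)
  show ?thesis using assms(1)
  proof (induction js)
    case Nil
    show ?case using E.dh_word(1)[of "T ^ k" "[]" N] assms(2) by (simp add: filt_def)
  next
    case (Cons i js)
    let ?M = "mset js" and ?d = "dhat p cM (\<lambda>m. UL (int m)) N n" and ?c = "of_nat (count (mset js) n) :: complex"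
    have i: "i \<in> {1..N} - {p}" and js: "\<forall>i\<in>set js. i \<in> {1..N} - {p}" using Cons.prems by auto
    have 1: "?d * (UM (- int i) * (UM_neg js * T ^ k)) - UM (- int i) * (?d * (UM_neg js * T ^ k))
       - (if n = i then UM_neg js * T ^ k else 0) \<in> Kf k"
      using E.dh_word(2)[of "T ^ k" js N] js assms(2) i unfolding xw by blast
    have 2: "UM (- int i) * (?d * (UM_neg js * T ^ k) - ?c \<cdot> (UM_mset (?M - {#n#}) * T ^ k)) \<in> Kf k"
      by (rule Kf_UM[OF Cons.IH[OF js]]) (use i in simp)
    have eq: "of_nat (count (mset (i # js)) n) \<cdot> (UM_mset (mset (i # js) - {#n#}) * T ^ k) =
        ?c \<cdot> (UM (- int i) * (UM_mset (?M - {#n#}) * T ^ k)) + (if n = i then UM_neg js * T ^ k else 0)"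
    proof (cases "n = i")
      case True
      have A: "?c \<cdot> (UM (- int i) * (UM_mset (?M - {#n#}) * T ^ k)) = ?c \<cdot> (UM_neg js * T ^ k)"
      proof (cases "n \<in># ?M")
        case True
        then have "UM (- int i) * UM_mset (?M - {#n#}) = UM_neg js"
          unfolding \<open>n = i\<close> UM_mset_add[symmetric] by (metis insert_DiffM UM_mset_mset)
        then show ?thesis by (simp only: mult.assoc[symmetric])
      next
        case False
        then have "count ?M n = 0" by (simp add: not_in_iff)
        then show ?thesis by simp
      qed
      have B: "UM_mset (mset (i # js) - {#n#}) = UM_neg js"
        using True UM_mset_mset[of js] by simp
      show ?thesis unfolding A B using True by (simp add: env.scale_left_distrib add.commute)
    next
      case False
      then have "mset (i # js) - {#n#} = add_mset i (?M - {#n#})" by (simp add: diff_add_mset_swap)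
      then show ?thesis using False by (simp add: UM_mset_add mult.assoc del: sorted_list_of_multiset_insert)
    qed
    show ?case using env.subspace_add[OF Kf_subspace 1 2] unfolding eq
      by (simp add: right_diff_distrib mult.assoc algebra_simps)
  qed
qed

text \<open>The operators \<open>dhat\<close> act on the span of the monomials times \<open>T\<^sup>k\<close> as partial derivatives, so a
  vanishing combination has vanishing derivatives, and its coefficients are eliminated degree by degree.\<close>

lemma independent_coefficients:
  assumes "T ^ k \<notin> Kf k" "finite A" "\<And>\<mu>. \<mu> \<in> A \<Longrightarrow> 0 \<notin># \<mu> \<and> p \<notin># \<mu> \<and> size \<mu> \<le> m"
    "(\<Sum>\<mu>\<in>A. a \<mu> \<cdot> (UM_mset \<mu> * T ^ k)) \<in> Kf k" "\<mu> \<in> A"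
  shows "a \<mu> = 0"
  using assms(2-)
proof (induction m arbitrary: A a \<mu>)
  case 0
  then have "A = {{#}}" "\<mu> = {#}" by auto
  then have at: "a {#} \<cdot> T ^ k \<in> Kf k" using 0 by simp
  show ?case
  proof (rule ccontr)
    assume "a \<mu> \<noteq> 0"
    then show False
      using env.subspace_scale[OF Kf_subspace at, of "1 / a {#}"] assms(1) \<open>\<mu> = {#}\<close> by simp
  qed
next
  case (Suc m)
  let ?s = "\<Sum>\<mu>\<in>A. a \<mu> \<cdot> (UM_mset \<mu> * T ^ k)"
  have nonempty: "a \<nu> = 0" if \<nu>: "\<nu> \<in> A" "n \<in># \<nu>" for n \<nu>
  proof -
    have "finite (\<Union>(set_mset ` A))" using Suc.prems(1) by auto
    then obtain N where N: "\<And>i. i \<in> \<Union>(set_mset ` A) \<Longrightarrow> i \<le> N" by (metis finite_nat_set_iff_bounded_le)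
    have el: "i \<in> {1..N} - {p}" if "\<mu> \<in> A" "i \<in># \<mu>" for i \<mu>
    proof -
      have "i \<noteq> 0" "i \<noteq> p" using Suc.prems(2)[OF that(1)] that(2) by metis+
      then show ?thesis using N that by auto
    qed
    have n: "n \<in> {1..N} - {p}" using el[OF \<nu>] .
    let ?d = "dhat p cM (\<lambda>m. UL (int m)) N n"
    have "?d * ?s \<in> Kf k"
      by (rule dhat_closed[OF Kf_subspace Kf_UM]) (auto intro: UL_Kf' Suc.prems(3))
    moreover have "(\<Sum>\<mu>\<in>A. a \<mu> \<cdot> (?d * (UM_mset \<mu> * T ^ k) - of_nat (count \<mu> n) \<cdot> (UM_mset (\<mu> - {#n#}) * T ^ k))) \<in> Kf k"
    proof (rule env.subspace_sum[OF Kf_subspace env.subspace_scale[OF Kf_subspace]])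
      fix \<mu> assume "\<mu> \<in> A"
      then show "?d * (UM_mset \<mu> * T ^ k) - of_nat (count \<mu> n) \<cdot> (UM_mset (\<mu> - {#n#}) * T ^ k) \<in> Kf k"
        using dhat_count[of "sorted_list_of_multiset \<mu>" N n k] n el by simp
    qed
    ultimately have "?d * ?s - (\<Sum>\<mu>\<in>A. a \<mu> \<cdot> (?d * (UM_mset \<mu> * T ^ k) - of_nat (count \<mu> n) \<cdot> (UM_mset (\<mu> - {#n#}) * T ^ k))) \<in> Kf k"
      by (rule env.subspace_diff[OF Kf_subspace])
    then have 1: "(\<Sum>\<mu>\<in>A. (a \<mu> * of_nat (count \<mu> n)) \<cdot> (UM_mset (\<mu> - {#n#}) * T ^ k)) \<in> Kf k"
      by (simp add: sum_distrib_left env.scale_right_diff_distrib sum_subtractf)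
    define An where "An = {\<mu> \<in> A. n \<in># \<mu>}"
    define A' where "A' = (\<lambda>\<mu>. \<mu> - {#n#}) ` An"
    define a' where "a' \<mu> = a (add_mset n \<mu>) * of_nat (Suc (count \<mu> n))" for \<mu>
    have inj: "inj_on (\<lambda>\<mu>. \<mu> - {#n#}) An" unfolding An_def inj_on_def by (metis insert_DiffM mem_Collect_eq)
    have "(\<Sum>\<mu>\<in>A'. a' \<mu> \<cdot> (UM_mset \<mu> * T ^ k)) = (\<Sum>\<mu>\<in>An. a' (\<mu> - {#n#}) \<cdot> (UM_mset (\<mu> - {#n#}) * T ^ k))"
      unfolding A'_def by (simp add: sum.reindex[OF inj])
    also have "\<dots> = (\<Sum>\<mu>\<in>An. (a \<mu> * of_nat (count \<mu> n)) \<cdot> (UM_mset (\<mu> - {#n#}) * T ^ k))"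
    proof (rule sum.cong[OF refl])
      fix \<mu> assume "\<mu> \<in> An"
      then have "n \<in># \<mu>" by (simp add: An_def)
      then have "add_mset n (\<mu> - {#n#}) = \<mu>" "Suc (count (\<mu> - {#n#}) n) = count \<mu> n" by (simp_all add: count_greater_zero_iff)
      then have "a' (\<mu> - {#n#}) = a \<mu> * of_nat (count \<mu> n)" unfolding a'_def by (simp only:)
      then show "a' (\<mu> - {#n#}) \<cdot> (UM_mset (\<mu> - {#n#}) * T ^ k) = (a \<mu> * of_nat (count \<mu> n)) \<cdot> (UM_mset (\<mu> - {#n#}) * T ^ k)" by simp
    qed
    also have "\<dots> = (\<Sum>\<mu>\<in>A. (a \<mu> * of_nat (count \<mu> n)) \<cdot> (UM_mset (\<mu> - {#n#}) * T ^ k))"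
      unfolding An_def using Suc.prems(1) by (intro sum.mono_neutral_left) (auto simp: not_in_iff)
    finally have 2: "(\<Sum>\<mu>\<in>A'. a' \<mu> \<cdot> (UM_mset \<mu> * T ^ k)) \<in> Kf k" using 1 by simp
    have "a' (\<nu> - {#n#}) = 0"
    proof (rule Suc.IH[OF _ _ 2])
      show "finite A'" using Suc.prems(1) by (simp add: A'_def An_def)
      show "\<nu> - {#n#} \<in> A'" using \<nu> by (auto simp: A'_def An_def)
      fix \<mu>' assume "\<mu>' \<in> A'"
      then obtain \<mu> where \<mu>: "\<mu> \<in> A" "n \<in># \<mu>" "\<mu>' = \<mu> - {#n#}" by (auto simp: A'_def An_def)
      then have "size \<mu>' = size \<mu> - 1" by (simp add: size_Diff_singleton)
      then show "0 \<notin># \<mu>' \<and> p \<notin># \<mu>' \<and> size \<mu>' \<le> m"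
        using Suc.prems(2)[OF \<mu>(1)] \<mu> by (auto dest: in_diffD)
    qed
    then have "a \<nu> * of_nat (Suc (count (\<nu> - {#n#}) n)) = 0" using \<nu>(2) by (simp add: a'_def)
    then show ?thesis by (simp del: of_nat_Suc)
  qed
  show ?case
  proof (cases "\<mu> = {#}")
    case True
    have "?s = (\<Sum>\<nu>\<in>{{#}}. a \<nu> \<cdot> (UM_mset \<nu> * T ^ k))"
    proof (rule sum.mono_neutral_right[OF Suc.prems(1)])
      show "{{#}} \<subseteq> A" using Suc.prems(4) True by simp
      show "\<forall>\<nu>\<in>A - {{#}}. a \<nu> \<cdot> (UM_mset \<nu> * T ^ k) = 0"
      proof
        fix \<nu> assume \<nu>: "\<nu> \<in> A - {{#}}"
        then obtain n where "n \<in># \<nu>" by (metis DiffD2 multiset_nonemptyE singletonI)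
        then have "a \<nu> = 0" using nonempty \<nu> by blast
        then show "a \<nu> \<cdot> (UM_mset \<nu> * T ^ k) = 0" by simp
      qed
    qed
    then have at: "a {#} \<cdot> T ^ k \<in> Kf k" using Suc.prems(3) by simp
    show ?thesis
    proof (rule ccontr)
      assume "a \<mu> \<noteq> 0"
      then show False
        using env.subspace_scale[OF Kf_subspace at, of "1 / a {#}"] assms(1) True by simp
    qed
  next
    case False
    then show ?thesis using nonempty Suc.prems(4) by (metis multiset_nonemptyE)
  qed
qed

lemma M_free_independent:
  assumes "T ^ k \<notin> Kf k" "v \<in> M_free p" "v * T ^ k \<in> Kf k"
  shows "v = 0"
proof -
  obtain A a where A: "finite A" "\<And>\<mu>. \<mu> \<in> A \<Longrightarrow> 0 \<notin># \<mu> \<and> p \<notin># \<mu>" "v = (\<Sum>\<mu>\<in>A. a \<mu> \<cdot> UM_mset \<mu>)"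
    using M_free_expand[OF assms(2)] by blast
  obtain m where m: "\<And>\<mu>. \<mu> \<in> A \<Longrightarrow> size \<mu> \<le> m"
    using A(1) by (metis finite_imageI finite_nat_set_iff_bounded_le imageI)
  have "(\<Sum>\<mu>\<in>A. a \<mu> \<cdot> (UM_mset \<mu> * T ^ k)) \<in> Kf k" using assms(3) A(3) by (simp add: sum_distrib_right)
  then have "a \<mu> = 0" if "\<mu> \<in> A" for \<mu>
    using independent_coefficients[OF assms(1) A(1), of m a \<mu>] A(2) m that by auto
  then show ?thesis using A(3) by simp
qed

lemma M_free_Kf: "v \<in> M_free p \<Longrightarrow> j < k \<Longrightarrow> v * T ^ j \<in> Kf k"
  unfolding M_free_def
proof (induction rule: env.span_induct_alt)
  case base
  show ?case by (simp add: env.subspace_0[OF Kf_subspace])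
next
  case (step c g v)
  then show ?case using Kf_word[of _ j k] by (auto simp: distrib_right Kf_add_scale)
qed

text \<open>The leading coefficient of a vanishing polynomial in T vanishes, by the independence just shown.\<close>

lemma powers_independent:
  assumes "\<And>j. j < k \<Longrightarrow> T ^ j \<notin> Kf j" "\<And>j. j < k \<Longrightarrow> v j \<in> M_free p" "(\<Sum>j<k. v j * T ^ j) \<in> H" "j < k"
  shows "v j = 0"
  using assms
proof (induction k)
  case (Suc k)
  have rest: "(\<Sum>j<k. v j * T ^ j) \<in> Kf k"
    by (rule env.subspace_sum[OF Kf_subspace M_free_Kf]) (use Suc.prems(2) in auto)
  have "(\<Sum>j<Suc k. v j * T ^ j) - (\<Sum>j<k. v j * T ^ j) \<in> Kf k"
    by (rule env.subspace_diff[OF Kf_subspace _ rest]) (use Suc.prems(3) Kf_H in blast)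
  then have "v k = 0" using M_free_independent[of k "v k"] Suc.prems(1,2) by simp
  then show ?case using Suc by (cases "j = k") auto
qed simp

end

section \<open>Homogeneous normal forms\<close>

lemma has_degree_unique: "has_degree d x \<Longrightarrow> has_degree e x \<Longrightarrow> d = e \<or> x = 0"
proof -
  assume "has_degree d x" "has_degree e x"
  then have "(of_int d - of_int e :: complex) \<cdot> x = 0"
    by (simp add: has_degree_def env.scale_left_diff_distrib)
  then show ?thesis by (simp add: env.scale_eq_0_iff)
qed

context critical
begin

lemma has_degree_word_T:
  assumes "0 \<notin> set xs" shows "has_degree (int (sum_list xs + j * p)) (UM_neg xs * T ^ j)"
  using has_degree_mult[OF has_degree_UM_neg has_degree_power[OF has_degree_T[OF w']], of xs j cM] by simp

text \<open>A homogeneous element keeps only the monomials of its own degree.\<close>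

lemma Kf_homogeneous:
  assumes y: "y \<in> Kf k" "has_degree d y"
  obtains g where "g \<in> env_span {UM_neg xs * T ^ j |xs j. 0 \<notin> set xs \<and> j < k \<and> int (sum_list xs + j * p) = d}" "y - g \<in> H"
proof -
  let ?G = "{UM_neg xs * T ^ j |xs j. 0 \<notin> set xs \<and> j < k}"
  let ?Gd = "{UM_neg xs * T ^ j |xs j. 0 \<notin> set xs \<and> j < k \<and> int (sum_list xs + j * p) = d}"
  obtain z \<eta> where z: "z \<in> env_span ?G" "\<eta> \<in> env_span H" "y = z + \<eta>"
    using y(1) unfolding Kf_def env.span_Un by blast
  have \<eta>: "\<eta> \<in> H" using z(2) H_subspace env.span_eq_iff by blast
  obtain D x where x: "finite D" "\<And>d. x d \<in> env_span {g \<in> ?G. has_degree d g}" "z = (\<Sum>d\<in>D. x d)"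
    using degree_decomposition[OF z(1)] has_degree_word_T by blast
  have deg: "has_degree e (x e)" for e using has_degree_span[OF x(2)] by auto
  define f where "f e = (if e \<in> D then x e else 0) - (if e = d then y else 0)" for e
  have "f d \<in> H"
  proof (rule graded[OF H_subspace subset_refl H_mult, of "insert d D" f d])
    show "has_degree e (f e)" for e
      unfolding f_def using deg y(2) by (intro has_degree_diff) (auto simp: has_degree_0)
    have "(\<Sum>e\<in>insert d D. if e \<in> D then x e else 0) = z"
      unfolding x(3) using x(1) by (intro sum.mono_neutral_cong_right) auto
    then have "(\<Sum>e\<in>insert d D. f e) = z - y" using x(1) by (simp add: f_def sum_subtractf)
    then show "(\<Sum>e\<in>insert d D. f e) \<in> H" using z(3) H_uminus[OF \<eta>] by simp
  qed (use x(1) in auto)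
  then have "- f d \<in> H" by (rule H_uminus)
  then have "y - (if d \<in> D then x d else 0) \<in> H" by (simp add: f_def)
  moreover have "{g \<in> ?G. has_degree d g} \<subseteq> env_span ?Gd"
  proof
    fix g assume "g \<in> {g \<in> ?G. has_degree d g}"
    then obtain xs j where g: "g = UM_neg xs * T ^ j" "0 \<notin> set xs" "j < k" "has_degree d g" by blast
    then have "d = int (sum_list xs + j * p) \<or> g = 0"
      using has_degree_unique[OF g(4)] has_degree_word_T by blast
    then show "g \<in> env_span ?Gd"
    proof
      assume "d = int (sum_list xs + j * p)"
      then have "g \<in> ?Gd" using g by blast
      then show ?thesis by (rule env.span_base)
    qed (simp add: env.span_zero)
  qed
  then have "x d \<in> env_span ?Gd" using x(2)[of d] env.span_minimal[OF _ env.subspace_span] by blast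
  then have "(if d \<in> D then x d else 0) \<in> env_span ?Gd" by (simp add: env.span_zero)
  ultimately show ?thesis using that by blast
qed

end

context critical_quotient
begin

text \<open>The relation \<open>S = 0\<close> modulo \<open>H\<close> trades each \<open>M\<^sub>-\<^sub>p\<close> for products of the same degree.\<close>

lemma eliminate_UM_p:
  assumes "0 \<notin> set xs" "j < k"
  shows "UM_neg xs * T ^ j \<in> env_span ({UM_neg ys * T ^ j |ys. 0 \<notin> set ys \<and> p \<notin> set ys \<and> sum_list ys = sum_list xs} \<union> H)"
  using assms(1)
proof (induction xs)
  case Nil
  have "UM_neg [] * T ^ j \<in> {UM_neg ys * T ^ j |ys. 0 \<notin> set ys \<and> p \<notin> set ys \<and> sum_list ys = sum_list []}"
    by (intro CollectI exI[of _ "[]"]) simp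
  then show ?case by (intro env.span_base) simp
next
  case (Cons a xs)
  define G where "G d = {UM_neg ys * T ^ j |ys. 0 \<notin> set ys \<and> p \<notin> set ys \<and> sum_list ys = d} \<union> H" for d
  have up: "UM_neg as * y \<in> env_span (G (sum_list as + d))" if "y \<in> env_span (G d)" "0 \<notin> set as" "p \<notin> set as" for as y d
    using that(1)
  proof (induction rule: env.span_induct_alt)
    case (step c g y)
    have "UM_neg as * g \<in> G (sum_list as + d)"
    proof (cases "g \<in> H")
      case True
      then show ?thesis using H_mult by (simp add: G_def)
    next
      case False
      then obtain ys where "g = UM_neg ys * T ^ j" "0 \<notin> set ys" "p \<notin> set ys" "sum_list ys = d"
        using step(1) by (auto simp: G_def)
      then show ?thesis unfolding G_def using that
        by (intro UnI1 CollectI exI[of _ "as @ ys"]) (simp add: mult.assoc)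
    qed
    then show ?case using step by (simp add: distrib_left env.span_add env.span_scale env.span_base)
  qed (simp add: env.span_zero)
  have IH: "UM_neg xs * T ^ j \<in> env_span (G (sum_list xs))" using Cons by (simp add: G_def)
  have "UM_neg (a # xs) * T ^ j \<in> env_span (G (sum_list (a # xs)))"
  proof (cases "a = p")
    case False
    then show ?thesis using up[OF IH, of "[a]"] Cons.prems by (simp add: mult.assoc)
  next
    case True
    obtain v where v: "v \<in> env_span (M_words_restr p p)" "S = UM (- int p) + v" using S_of_lead[OF p] by blast
    let ?y = "UM_neg xs * T ^ j"
    have "v * ?y \<in> env_span (G (p + sum_list xs))" using v(1)
    proof (induction rule: env.span_induct_alt)
      case (step c g u)
      then obtain as where "g = UM_neg as" "0 \<notin> set as" "p \<notin> set as" "sum_list as = p" by (auto simp: M_words_restr_def)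
      then have "g * ?y \<in> env_span (G (p + sum_list xs))" using up[OF IH, of as] by simp
      then show ?case using step(2) by (simp add: distrib_right env.span_add env.span_scale mult.assoc)
    qed (simp add: env.span_zero)
    moreover have "S * ?y \<in> env_span (G (p + sum_list xs))"
      using S_Kf[OF good_all Kf_word[of xs j k]] Cons.prems assms(2) by (intro env.span_base) (simp add: G_def)
    ultimately have "S * ?y - v * ?y \<in> env_span (G (p + sum_list xs))" by (rule env.span_diff[rotated])
    then show ?thesis using True by (simp add: v(2) distrib_right mult.assoc)
  qed
  then show ?case by (simp add: G_def)
qed

lemma Kf_normal_form:
  assumes y: "y \<in> Kf k" "has_degree (int (k * p)) y"
  obtains v where "\<And>i. i \<in> {1..k} \<Longrightarrow> v i \<in> env_span (M_words_restr p (i * p))" "y - (\<Sum>i\<in>{1..k}. v i * T ^ (k - i)) \<in> H"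
proof -
  define P where "P z \<longleftrightarrow> (\<exists>v. (\<forall>i\<in>{1..k}. v i \<in> env_span (M_words_restr p (i * p))) \<and> z - (\<Sum>i\<in>{1..k}. v i * T ^ (k - i)) \<in> H)" for z
  have P_add: "P (c \<cdot> x + z)" if "P x" "P z" for c x z
  proof -
    from that(1) obtain a where a: "\<forall>i\<in>{1..k}. a i \<in> env_span (M_words_restr p (i * p))" "x - (\<Sum>i\<in>{1..k}. a i * T ^ (k - i)) \<in> H"
      unfolding P_def by blast
    from that(2) obtain b where b: "\<forall>i\<in>{1..k}. b i \<in> env_span (M_words_restr p (i * p))" "z - (\<Sum>i\<in>{1..k}. b i * T ^ (k - i)) \<in> H"
      unfolding P_def by blast
    have "c \<cdot> (x - (\<Sum>i\<in>{1..k}. a i * T ^ (k - i))) + (z - (\<Sum>i\<in>{1..k}. b i * T ^ (k - i))) \<in> H"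
      using a b by (intro H_add H_scale)
    then show ?thesis unfolding P_def using a b
      by (intro exI[of _ "\<lambda>i. c \<cdot> a i + b i"])
        (auto simp: distrib_right sum.distrib env.scale_sum_right env.scale_right_diff_distrib algebra_simps intro: env.span_add env.span_scale)
  qed
  have P_H: "P \<eta>" if "\<eta> \<in> H" for \<eta>
    unfolding P_def using that by (intro exI[of _ "\<lambda>_. 0"]) (simp add: env.span_zero)
  have P_word: "P (UM_neg ys * T ^ j)" if "0 \<notin> set ys" "p \<notin> set ys" "j < k" "sum_list ys + j * p = k * p" for ys j
  proof -
    define i where "i = k - j"
    have i: "i \<in> {1..k}" "k - i = j" using that(3) by (auto simp: i_def)
    have "sum_list ys = i * p" using that(3,4) by (simp add: i_def diff_mult_distrib)
    then have "UM_neg ys \<in> env_span (M_words_restr p (i * p))"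
      using that by (intro env.span_base) (auto simp: M_words_restr_def)
    moreover have "(\<Sum>l\<in>{1..k}. (if l = i then UM_neg ys else 0) * T ^ (k - l)) = (\<Sum>l\<in>{1..k}. if l = i then UM_neg ys * T ^ (k - i) else 0)"
      by (rule sum.cong) auto
    then have "(\<Sum>l\<in>{1..k}. (if l = i then UM_neg ys else 0) * T ^ (k - l)) = UM_neg ys * T ^ j" using i by simp
    ultimately show ?thesis unfolding P_def
      by (intro exI[of _ "\<lambda>l. if l = i then UM_neg ys else 0"]) (auto simp: env.span_zero H_0)
  qed
  obtain g where g: "g \<in> env_span {UM_neg xs * T ^ j |xs j. 0 \<notin> set xs \<and> j < k \<and> int (sum_list xs + j * p) = int (k * p)}" "y - g \<in> H"
    using Kf_homogeneous[OF y] by blast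
  have "P g" using g(1)
  proof (induction rule: env.span_induct_alt)
    case (step c z g)
    then obtain xs j where z: "z = UM_neg xs * T ^ j" "0 \<notin> set xs" "j < k" "sum_list xs + j * p = k * p"
      using of_nat_eq_iff by blast
    have "z \<in> env_span ({UM_neg ys * T ^ j |ys. 0 \<notin> set ys \<and> p \<notin> set ys \<and> sum_list ys = sum_list xs} \<union> H)"
      unfolding z(1) by (rule eliminate_UM_p[OF z(2,3)])
    then have "P z"
    proof (induction rule: env.span_induct_alt)
      case (step c u v)
      have "P u"
      proof (cases "u \<in> H")
        case True
        then show ?thesis by (rule P_H)
      next
        case False
        then obtain ys where "u = UM_neg ys * T ^ j" "0 \<notin> set ys" "p \<notin> set ys" "sum_list ys = sum_list xs" using step(1) by blast
        then show ?thesis using P_word[of ys j] z by simp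
      qed
      then show ?case using P_add step by blast
    qed (rule P_H[OF H_0])
    then show ?case using P_add step by blast
  qed (rule P_H[OF H_0])
  then have "P (1 \<cdot> (y - g) + g)" using P_add P_H[OF g(2)] by blast
  then have "P y" by simp
  then show ?thesis unfolding P_def using that by blast
qed

end



section \<open>Highest weight vectors modulo a left ideal\<close>

text \<open>Modulo \<open>B\<close> the element \<open>a\<close> behaves as a highest weight vector, without being required to lie outside \<open>B\<close>.\<close>

definition hw_vector :: "complex \<Rightarrow> complex \<Rightarrow> complex \<Rightarrow> complex \<Rightarrow> w22_env set \<Rightarrow> w22_env \<Rightarrow> bool" where
  "hw_vector cL cM hL hM B a \<longleftrightarrow> (\<forall>x. \<not> neg_gen x \<longrightarrow> env_gen x * a - hw_char cL cM hL hM x \<cdot> a \<in> B)"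

lemma hw_vector_verma:
  assumes "left_ideal B" "hw_vector cL cM hL hM B a" "u \<in> verma_ideal cL cM hL hM"
  shows "u * a \<in> B"
proof -
  have "left_ideal {u. u * a \<in> B}"
    by (rule left_idealI)
      (auto simp: distrib_right mult.assoc left_ideal_zero[OF assms(1)] left_ideal_add[OF assms(1)] left_ideal_mult[OF assms(1)])
  moreover have "env_gen x - env_scalar (hw_char cL cM hL hM x) \<in> {u. u * a \<in> B}" if "\<not> neg_gen x" for x
    using assms(2) that by (simp add: hw_vector_def left_diff_distrib scale_env_def)
  ultimately show ?thesis using verma_ideal_least assms(3) by blast
qed

lemma hw_vector_mult:
  assumes "hw_vector cL cM hL hM I a" "\<And>u. u \<in> I \<Longrightarrow> u * b \<in> B"
  shows "hw_vector cL cM hL hM B (a * b)"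
proof -
  have "env_gen x * (a * b) - c \<cdot> (a * b) = (env_gen x * a - c \<cdot> a) * b" for x c
    by (simp add: left_diff_distrib mult.assoc)
  then show ?thesis using assms unfolding hw_vector_def by metis
qed

context highest_weight
begin

lemma hw_vectorI:
  assumes "has_degree d a" "\<And>m. 1 \<le> m \<Longrightarrow> UL (int m) * a \<in> H" "\<And>m. 1 \<le> m \<Longrightarrow> UM (int m) * a \<in> H"
    "UM 0 * a - hM' \<cdot> a \<in> H"
  shows "hw_vector cL cM (hL + of_int d) hM' H a"
  unfolding hw_vector_def
proof (intro allI impI)
  fix x assume x: "\<not> neg_gen x"
  have pos: "UL m * a \<in> H" "UM m * a \<in> H" if "m > 0" for m
    using assms(2,3)[of "nat m"] that by simp_all
  show "env_gen x * a - hw_char cL cM (hL + of_int d) hM' x \<cdot> a \<in> H"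
  proof (cases x)
    case (BL m)
    then show ?thesis using x pos(1)[of m] hw_weight[OF assms(1)] by (cases "m = 0") auto
  next
    case (BM m)
    then show ?thesis using x pos(2)[of m] assms(4) by (cases "m = 0") auto
  qed (use hw_central in auto)
qed

text \<open>By triangularity, every element of the submodule generated by a highest weight vector \<open>a\<close> is a
  combination of negative words applied to \<open>a\<close>, so a linear form is tested on these.\<close>

lemma form_zero_join:
  fixes \<Psi> :: "w22_env \<Rightarrow> complex"
  assumes hw: "hw_vector cL cM hL' hM' H a" and \<Psi>: "\<And>u v. \<Psi> (u + v) = \<Psi> u + \<Psi> v" "\<And>c u. \<Psi> (c \<cdot> u) = c * \<Psi> u"
    and low: "\<And>u. u \<in> H \<Longrightarrow> \<Psi> u = 0" and words: "\<And>ws. neg_word ws \<Longrightarrow> \<Psi> (word ws * a) = 0"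
    and x: "x \<in> ideal_join a H"
  shows "\<Psi> x = 0"
proof -
  have zero: "\<Psi> 0 = 0" using \<Psi>(1)[of 0 0] by simp
  define Y where "Y = env_span (insert a H)"
  have closed: "env_gen x * y \<in> Y" if x: "\<not> neg_gen x" and y: "y \<in> Y" for x y
    using y unfolding Y_def
  proof (induction rule: env.span_induct_alt)
    case (step c g y)
    have "env_gen x * g \<in> env_span (insert a H)"
    proof (cases "g = a")
      case True
      have "(env_gen x * a - hw_char cL cM hL' hM' x \<cdot> a) + hw_char cL cM hL' hM' x \<cdot> a \<in> env_span (insert a H)"
        using hw x by (intro env.span_add env.span_scale env.span_base) (auto simp: hw_vector_def)
      then show ?thesis using True by simp
    next
      case False
      then show ?thesis using step H_mult by (intro env.span_base) auto
    qed
    then show ?case using step by (simp add: distrib_left env.span_add env.span_scale)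
  qed (simp add: env.span_zero)
  have wy: "\<Psi> (word ws * y) = 0" if "neg_word ws" "y \<in> Y" for ws y
    using that(2) unfolding Y_def
  proof (induction rule: env.span_induct_alt)
    case (step c g y)
    then have "\<Psi> (word ws * g) = 0" using words[OF that(1)] low[OF H_mult] by auto
    then show ?case using step by (simp add: distrib_left \<Psi>)
  qed (simp add: zero)
  obtain u b where x': "x = u * a + b" "b \<in> H" using x by (auto simp: ideal_join_def)
  have "a \<in> Y" unfolding Y_def by (rule env.span_base) simp
  then have "u * a \<in> env_span {word ws * y |ws y. neg_word ws \<and> y \<in> Y}"
    using triangular[of Y a u] closed env.subspace_span by (simp add: Y_def)
  then have "\<Psi> (u * a) = 0"
  proof (induction rule: env.span_induct_alt)
    case (step c g y)
    then show ?case using wy by (auto simp: \<Psi>)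
  qed (simp add: zero)
  then show ?thesis using x' low by (simp add: \<Psi>)
qed

end

context critical_quotient
begin

lemma singular_hw_vector:
  assumes "has_degree d x" "\<And>m. 1 \<le> m \<Longrightarrow> UL (int m) * x \<in> H" "\<And>m. 1 \<le> m \<Longrightarrow> UM (int m) * x \<in> H"
  shows "hw_vector cL cM (hL + of_int d) hM H x"
proof (rule hw_vectorI[OF assms])
  have "x \<in> K0" by (rule annihilated_by_M[OF assms(3)])
  then show "UM 0 * x - hM \<cdot> x \<in> H" using M_closedD(3)[OF K0_M_closed] K_zero by blast
qed

lemma detects_power_notin: "detects p H k \<Longrightarrow> T ^ k \<notin> Kf k"
proof
  assume d: "detects p H k" and "T ^ k \<in> Kf k"
  then have "1 \<cdot> T ^ k \<in> env_span (M_ideal {} \<union> Kf k)" by (intro env.span_base) simp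
  then have "(1::complex) = 0" by (rule detects_not_in[OF d, rotated]) simp
  then show False by simp
qed

end

section \<open>Recovering S from the T(p,s)\<close>

context critical
begin

lemma UM_T_act: "UM (int n) * (T * y) = T * (UM (int n) * y) + (\<Sum>i\<in>{1..p}. g_coeff p cM (p - i) * (UM_UL_bracket n i * y))"
  using arg_cong[OF UM_T[OF w', of n cM], of "\<lambda>u. u * y"] by (simp add: distrib_right mult.assoc sum_distrib_right)

lemma UM_UL_bracket_less: "i < n \<Longrightarrow> UM_UL_bracket n i * y = of_nat (n + i) \<cdot> (UM (int (n - i)) * y)"
proof -
  assume "i < n"
  then have "int n - int i = int (n - i)" by simp
  then show ?thesis using \<open>i < n\<close> unfolding UM_UL_bracket_def by simp
qed

text \<open>Each factor T that \<open>M\<^sub>n\<close> passes lowers its index by at most \<open>p\<close>, and it stays positive.\<close>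

lemma UM_T_power_low: "1 \<le> n \<Longrightarrow> j * p < n + p \<Longrightarrow> UM (int n) * T ^ j \<in> H"
proof (induction j arbitrary: n)
  case 0
  then show ?case using hw_pos(2)[of "int n" 1] by simp
next
  case (Suc j)
  have jn: "j * p < n" using Suc.prems by simp
  show ?case
  proof (cases j)
    case 0
    then show ?thesis using UM_T_K[OF K_1 Suc.prems(1)] by simp
  next
    case (Suc l)
    then have pn: "p < n" using jn by simp
    have "UM_UL_bracket n i * T ^ j \<in> H" if "i \<in> {1..p}" for i
    proof -
      have i: "i < n" "1 \<le> n - i" "j * p < n - i + p" using that pn jn by auto
      show ?thesis unfolding UM_UL_bracket_less[OF i(1)] by (rule H_scale[OF Suc.IH[OF i(2,3)]])
    qed
    then have "(\<Sum>i\<in>{1..p}. g_coeff p cM (p - i) * (UM_UL_bracket n i * T ^ j)) \<in> H"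
      by (intro H_sum) (rule H_mult)
    then show ?thesis using H_mult[OF Suc.IH[OF Suc.prems(1)]] jn
      by (simp add: UM_T_act H_add)
  qed
qed

text \<open>The operator that returns from \<open>T\<^sup>k\<^sup>+\<^sup>1\<close> to a multiple of S and annihilates the lower powers.\<close>

definition drop_op :: "nat \<Rightarrow> w22_env" where
  "drop_op k = (if k = 0 then UM 0 - hM \<cdot> 1 else UM (int (k * p)))"

lemma drop_op_low: "j \<le> k \<Longrightarrow> drop_op k * T ^ j \<in> H"
proof (cases "k = 0")
  case False
  assume "j \<le> k"
  then have "j * p \<le> k * p" "1 \<le> k * p" using False p by auto
  then have "1 \<le> k * p" "j * p < k * p + p" using p by linarith+
  then have "UM (int (k * p)) * T ^ j \<in> H" by (rule UM_T_power_low)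
  then show ?thesis using False by (simp add: drop_op_def)
qed (use K_zero[OF K_1] in \<open>auto simp: drop_op_def\<close>)

text \<open>The operator reaches the last factor T only if it loses the full amount \<open>p\<close> each time, that is through the leading
terms \<open>L\<^sub>-\<^sub>p\<close>; it arrives there as \<open>M\<^sub>0 - h\<^sub>M\<close>, and \<open>[M\<^sub>0,T] = p S\<close>.\<close>

lemma drop_op_T: "\<exists>c. c \<noteq> 0 \<and> drop_op k * T ^ Suc k - c \<cdot> S \<in> H"
proof (induction k)
  case 0
  have "drop_op 0 * T ^ Suc 0 - of_nat p \<cdot> S \<in> H"
    using UM_0_T_K[OF K_1] by (simp add: drop_op_def left_diff_distrib)
  then show ?case using p by (intro exI[of _ "of_nat p"]) auto
next
  case (Suc k)
  let ?n = "Suc k * p" and ?y = "T ^ Suc k"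
  obtain c where c: "c \<noteq> 0" "drop_op k * ?y - c \<cdot> S \<in> H" using Suc by blast
  have small: "g_coeff p cM (p - i) * (UM_UL_bracket ?n i * ?y) \<in> H" if "i \<in> {1..<p}" for i
  proof -
    have i: "i < ?n" "1 \<le> ?n - i" "Suc k * p < ?n - i + p" using that by auto
    show ?thesis unfolding UM_UL_bracket_less[OF i(1)] by (rule H_mult[OF H_scale[OF UM_T_power_low[OF i(2,3)]]])
  qed
  have top: "UM_UL_bracket ?n p * ?y - of_nat (?n + p) \<cdot> (drop_op k * ?y) \<in> H"
  proof (cases "k = 0")
    case True
    have "UM_UL_bracket p p * ?y - (2 * of_nat p) \<cdot> (UM 0 * ?y - hM \<cdot> ?y) =
       (of_nat (p ^ 3) / 12 - of_nat p / 12) \<cdot> (UCM * ?y - cM \<cdot> ?y) + e p \<cdot> ?y"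
      unfolding pairing_eq[of p p cM, symmetric] UM_UL_bracket_def
      by (simp add: distrib_right env.scale_right_diff_distrib env.scale_left_distrib env.scale_left_diff_distrib algebra_simps)
    then have "UM_UL_bracket p p * ?y - (2 * of_nat p) \<cdot> (UM 0 * ?y - hM \<cdot> ?y) \<in> H"
      using H_scale[OF hw_central(2)] by simp
    then show ?thesis using True by (simp add: drop_op_def left_diff_distrib)
  next
    case False
    have "p < ?n" "?n - p = k * p" using False p by auto
    then show ?thesis using UM_UL_bracket_less[of p ?n ?y] False H_0 by (simp add: drop_op_def del: of_nat_mult of_nat_add power_Suc)
  qed
  have split: "{1..p} = insert p {1..<p}" using p by auto
  have "drop_op (Suc k) * T ^ Suc (Suc k) = T * (UM (int ?n) * ?y) + (\<Sum>i\<in>{1..p}. g_coeff p cM (p - i) * (UM_UL_bracket ?n i * ?y))"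
    unfolding power_Suc[of T "Suc k"] UM_T_act[symmetric] by (simp add: drop_op_def)
  also have "\<dots> = T * (UM (int ?n) * ?y) + (\<Sum>i\<in>{1..<p}. g_coeff p cM (p - i) * (UM_UL_bracket ?n i * ?y)) + UM_UL_bracket ?n p * ?y"
    unfolding split by (simp add: add_ac del: power_Suc)
  finally have eq: "drop_op (Suc k) * T ^ Suc (Suc k) - (of_nat (?n + p) * c) \<cdot> S =
     T * (UM (int ?n) * ?y) + (\<Sum>i\<in>{1..<p}. g_coeff p cM (p - i) * (UM_UL_bracket ?n i * ?y))
     + ((UM_UL_bracket ?n p * ?y - of_nat (?n + p) \<cdot> (drop_op k * ?y)) + of_nat (?n + p) \<cdot> (drop_op k * ?y - c \<cdot> S))"
    by (simp add: env.scale_right_diff_distrib del: power_Suc)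
  have "UM (int ?n) * ?y \<in> H" by (rule UM_T_power_low) (use p in auto)
  then have first: "T * (UM (int ?n) * ?y) \<in> H" by (rule H_mult)
  have "drop_op (Suc k) * T ^ Suc (Suc k) - (of_nat (?n + p) * c) \<cdot> S \<in> H"
    unfolding eq by (rule H_add[OF H_add[OF first H_sum[OF small]] H_add[OF top H_scale[OF c(2)]]])
  moreover have "of_nat (?n + p) * c \<noteq> 0" using c(1) p by (simp del: of_nat_add of_nat_mult)
  ultimately show ?case by blast
qed

lemma drop_op_commute: "u \<in> M_poly d \<Longrightarrow> drop_op k * u = u * drop_op k"
  by (simp add: drop_op_def M_poly_UM_commute left_diff_distrib right_diff_distrib)

text \<open>The operator annihilates the lower powers of T and commutes with their coefficients.\<close>

lemma S_in_join:
  assumes s: "s \<ge> 1" and v: "\<And>i. i \<in> {1..s} \<Longrightarrow> v i \<in> env_span (M_words_restr p (i * p))"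
  shows "S \<in> ideal_join (T ^ s + (\<Sum>i\<in>{1..s}. v i * T ^ (s - i))) H"
proof -
  obtain k where k: "s = Suc k" using s by (cases s) auto
  let ?t = "T ^ s + (\<Sum>i\<in>{1..s}. v i * T ^ (s - i))"
  obtain c where c: "c \<noteq> 0" "drop_op k * T ^ Suc k - c \<cdot> S \<in> H" using drop_op_T by blast
  have "drop_op k * (v i * T ^ (s - i)) \<in> H" if "i \<in> {1..s}" for i
  proof -
    have "drop_op k * (v i * T ^ (s - i)) = v i * (drop_op k * T ^ (s - i))"
      by (simp only: mult.assoc[symmetric] drop_op_commute[OF M_restr_in_M_poly[OF v[OF that]]])
    moreover have "s - i \<le> k" using that k by auto
    ultimately show ?thesis using H_mult[OF drop_op_low, of "s - i" k "v i"] by simp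
  qed
  then have "(\<Sum>i\<in>{1..s}. drop_op k * (v i * T ^ (s - i))) \<in> H" by (rule H_sum)
  from H_add[OF c(2) this] have 1: "drop_op k * ?t - c \<cdot> S \<in> H"
    unfolding k by (simp add: distrib_left sum_distrib_left add_diff_eq diff_add_eq)
  have I: "left_ideal (ideal_join ?t H)" by (rule left_ideal_join[OF left_ideal])
  have "drop_op k * ?t - (drop_op k * ?t - c \<cdot> S) \<in> ideal_join ?t H"
    using left_ideal_diff[OF I ideal_join_mult[OF left_ideal]] 1 ideal_join_ideal by blast
  then have "c \<cdot> S \<in> ideal_join ?t H" by simp
  then have "(1 / c) \<cdot> (c \<cdot> S) \<in> ideal_join ?t H" by (rule left_ideal_scale[OF I])
  then show ?thesis using c(1) by simp
qed

end

section \<open>The critical level\<close>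

locale critical_level =
  fixes cL cM :: complex and p :: nat
  assumes cM: "cM \<noteq> 0" and p: "p \<ge> 1"
begin

abbreviation hM\<^sub>p where "hM\<^sub>p \<equiv> hM_crit p cM"
abbreviation J where "J h \<equiv> verma_ideal cL cM h hM\<^sub>p"
abbreviation S\<^sub>p where "S\<^sub>p \<equiv> S_of p cM"
abbreviation H0 where "H0 h \<equiv> ideal_join S\<^sub>p (J h)"

lemma critical_H:
  assumes "w \<in> env_span (M_words_restr p p)" "left_ideal H" "J h \<subseteq> H"
  shows "critical cL cM h p H w"
  by unfold_locales (use assms cM p in auto)

lemmas critical_J = critical_H[OF _ left_ideal_verma subset_refl]

lemma hw_J: "highest_weight cL cM h hM\<^sub>p (J h)"
  by unfold_locales (auto simp: left_ideal_verma)

lemma left_ideal_H0: "left_ideal (H0 h)"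
  by (rule left_ideal_join[OF left_ideal_verma])

lemma critical_quotient_H:
  assumes "w \<in> env_span (M_words_restr p p)" "left_ideal H" "H0 h \<subseteq> H"
  shows "critical_quotient cL cM h p H w"
proof -
  interpret critical cL cM h p H w
    by (rule critical_H[OF assms(1,2)]) (use ideal_join_ideal assms(3) in blast)
  show ?thesis by unfold_locales (use ideal_join_base[OF left_ideal_verma] assms(3) in blast)
qed

lemmas critical_quotient_H0 = critical_quotient_H[OF _ left_ideal_H0 subset_refl]

lemma S_hw: "hw_vector cL cM (h + of_nat p) hM\<^sub>p (J h) S\<^sub>p"
proof -
  interpret C: critical cL cM h p "J h" 0 by (rule critical_J) (rule env.span_zero)
  have comm: "UM n * S\<^sub>p = S\<^sub>p * UM n" for n by (rule M_poly_UM_commute[OF S_of_in_M_poly])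
  have "hw_vector cL cM (h + of_int (int p)) hM\<^sub>p (J h) S\<^sub>p"
    by (rule C.hw_vectorI[OF has_degree_S C.UL_S]) (auto simp: comm intro: C.hw_pos C.hw_zero)
  then show ?thesis by simp
qed

lemma S_power_hw: "hw_vector cL cM (h + of_nat (k * p)) hM\<^sub>p (J h) (S\<^sub>p ^ k)"
proof (induction k)
  case 0
  interpret highest_weight cL cM h hM\<^sub>p "J h" by (rule hw_J)
  show ?case unfolding hw_vector_def using hw_gen[where u = 1] by simp
next
  case (Suc k)
  have "hw_vector cL cM (h + of_nat (k * p) + of_nat p) hM\<^sub>p (J h) (S\<^sub>p * S\<^sub>p ^ k)"
    by (rule hw_vector_mult[OF S_hw]) (rule hw_vector_verma[OF left_ideal_verma Suc])
  then show ?case by (simp add: algebra_simps)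
qed

lemma J_S_power: "u \<in> J (h + of_nat (k * p)) \<Longrightarrow> u * S\<^sub>p ^ k \<in> J h"
  by (rule hw_vector_verma[OF left_ideal_verma S_power_hw])

text \<open>Since \<open>S\<^sup>k\<close> is singular, right multiplication by it is a homomorphism between Verma modules of weights differing by \<open>kp\<close>.\<close>

lemma H0_S_power: "u \<in> H0 (h + of_nat (k * p)) \<Longrightarrow> u * S\<^sub>p ^ k \<in> ideal_join (S\<^sub>p ^ Suc k) (J h)"
proof -
  assume "u \<in> H0 (h + of_nat (k * p))"
  then obtain a b where ab: "u = a * S\<^sub>p + b" "b \<in> J (h + of_nat (k * p))" by (auto simp: ideal_join_def)
  then have "u * S\<^sub>p ^ k = a * S\<^sub>p ^ Suc k + b * S\<^sub>p ^ k" by (simp add: distrib_right mult.assoc)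
  then show ?thesis using J_S_power[OF ab(2)] unfolding ideal_join_def by blast
qed

text \<open>Composing the form with left multiplication by \<open>L\<^sub>0\<close> multiplies it by a scalar, so it lives in a single degree. It vanishes on
\<open>U S\<^sup>k\<^sup>+\<^sup>1\<close>, where every word has more than \<open>k\<close> letters M.\<close>

lemma level_form:
  obtains \<Psi> :: "w22_env \<Rightarrow> complex"
  where "\<And>u v. \<Psi> (u + v) = \<Psi> u + \<Psi> v" "\<And>c u. \<Psi> (c \<cdot> u) = c * \<Psi> u"
    "\<And>u. u \<in> M_filt (Suc k) \<Longrightarrow> \<Psi> u = 0"
    "\<And>d x. has_degree d x \<Longrightarrow> d \<noteq> int (p * (s + k)) \<Longrightarrow> \<Psi> x = 0"
    "\<And>u. u \<in> ideal_join (S\<^sub>p ^ Suc k) (J h) \<Longrightarrow> \<Psi> u = 0"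
    "\<Psi> (UL (- int p) ^ s * UM (- int p) ^ k) \<noteq> 0"
proof -
  interpret highest_weight cL cM h hM\<^sub>p "J h" by (rule hw_J)
  obtain \<Psi> :: "w22_env \<Rightarrow> complex" where \<Psi>: "\<And>u v. \<Psi> (u + v) = \<Psi> u + \<Psi> v" "\<And>c u. \<Psi> (c \<cdot> u) = c * \<Psi> u"
    "\<And>u. u \<in> J h \<Longrightarrow> \<Psi> u = 0"
    "\<And>ws. neg_word ws \<Longrightarrow> word_degree ws \<noteq> int (p * (s + k)) \<or> count_M ws \<noteq> k \<Longrightarrow> \<Psi> (word ws) = 0"
    "\<Psi> (UL (- int p) ^ s * UM (- int p) ^ k) \<noteq> 0"
    by (rule detecting_form[OF p, where cL = cL and cM = cM and hL = h and hM = hM\<^sub>p and s = s and k = k], rule that; assumption)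
  have zero: "\<Psi> 0 = 0" using \<Psi>(1)[of 0 0] by simp
  have diff: "\<Psi> u = \<Psi> v" if "u - v \<in> J h" for u v
    using \<Psi>(1)[of "u - v" v] \<Psi>(3)[OF that] by simp
  have M: "\<Psi> u = 0" if "u \<in> M_filt (Suc k)" for u
    using that unfolding M_filt_def
  proof (induction rule: env.span_induct_alt)
    case (step c g u)
    then have "\<Psi> g = 0" using \<Psi>(4) by auto
    then show ?case using step by (simp add: \<Psi>(1,2))
  qed (rule zero)
  have L0: "\<Psi> (UL 0 * x) = (h + of_nat (p * (s + k))) * \<Psi> x" for x
    using neg_words_span[of x]
  proof (induction rule: env.span_induct_alt)
    case base
    show ?case by (simp add: zero)
  next
    case (step c g x)
    have "\<Psi> (UL 0 * g) = (h + of_nat (p * (s + k))) * \<Psi> g"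
    proof (cases "g \<in> J h")
      case True
      then show ?thesis using \<Psi>(3)[OF True] \<Psi>(3)[OF H_mult[OF True]] by simp
    next
      case False
      then obtain ws where ws: "g = word ws" "neg_word ws" using step by blast
      have "\<Psi> (UL 0 * g) = \<Psi> ((h + of_int (word_degree ws)) \<cdot> g)"
        by (rule diff) (use hw_weight[OF has_degree_word[of ws]] ws(1) in simp)
      moreover have "\<Psi> g = 0 \<or> word_degree ws = int (p * (s + k))" using \<Psi>(4)[OF ws(2)] ws(1) by blast
      ultimately show ?thesis by (auto simp: \<Psi>(2))
    qed
    then show ?case using step by (simp add: distrib_left \<Psi>(1,2) algebra_simps)
  qed
  have deg: "\<Psi> x = 0" if "has_degree d x" "d \<noteq> int (p * (s + k))" for d x
  proof -
    have "\<Psi> (UL 0 * x) = \<Psi> ((h + of_int d) \<cdot> x)" by (rule diff[OF hw_weight[OF that(1)]])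
    then have "(h + of_nat (p * (s + k))) * \<Psi> x = (h + of_int d) * \<Psi> x" by (simp add: L0 \<Psi>(2))
    then have "(of_int (int (p * (s + k))) - of_int d) * \<Psi> x = 0" by (simp add: algebra_simps)
    then show ?thesis using that(2) by (simp del: of_nat_mult of_nat_add of_int_of_nat_eq)
  qed
  have join: "\<Psi> u = 0" if "u \<in> ideal_join (S\<^sub>p ^ Suc k) (J h)" for u
  proof (rule form_zero_join[OF S_power_hw \<Psi>(1,2,3) _ that])
    have S: "S\<^sub>p ^ Suc k \<in> M_filt (Suc k)"
      using env.subspace_add[OF M_filt_subspace, of "S\<^sub>p ^ Suc k - UM (- int p) ^ Suc k" "Suc k" "UM (- int p) ^ Suc k"]
        S_power_lead(1)[OF p, of cM "Suc k"] S_power_lead(2)[OF p, of "Suc k"] M_filt_mono[of "Suc k" "Suc (Suc k)"] by auto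
    show "\<Psi> (word ws * S\<^sub>p ^ Suc k) = 0" if "neg_word ws" for ws
    proof -
      have "word ws \<in> M_filt 0" by (rule M_filt_word[OF that]) simp
      from M[of "word ws * S\<^sub>p ^ Suc k"] M_filt_mult[OF this S] show ?thesis by simp
    qed
  qed
  show ?thesis by (rule that[OF \<Psi>(1,2) M deg join \<Psi>(5)])
qed

lemma detects_H0: "detects p (H0 h) j"
proof -
  obtain \<Psi> :: "w22_env \<Rightarrow> complex" where \<Psi>: "\<And>u v. \<Psi> (u + v) = \<Psi> u + \<Psi> v" "\<And>c u. \<Psi> (c \<cdot> u) = c * \<Psi> u"
    "\<And>u. u \<in> M_filt (Suc 0) \<Longrightarrow> \<Psi> u = 0"
    "\<And>d x. has_degree d x \<Longrightarrow> d \<noteq> int (p * (j + 0)) \<Longrightarrow> \<Psi> x = 0"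
    "\<And>u. u \<in> ideal_join (S\<^sub>p ^ Suc 0) (J h) \<Longrightarrow> \<Psi> u = 0"
    "\<Psi> (UL (- int p) ^ j * UM (- int p) ^ 0) \<noteq> 0"
    by (rule level_form[where k = 0 and s = j and h = h], rule that; assumption)
  have "\<Psi> (UL (- int p) ^ i) = 0" if "i \<noteq> j" for i
    using \<Psi>(4)[OF has_degree_power[OF has_degree_UL[of "- int p"], of i]] that p by simp
  then show ?thesis unfolding detects_def using \<Psi> by (intro exI[of _ \<Psi>]) auto
qed

lemma S_power_not_in: "S\<^sub>p ^ k \<notin> ideal_join (S\<^sub>p ^ Suc k) (J h)"
proof
  assume S: "S\<^sub>p ^ k \<in> ideal_join (S\<^sub>p ^ Suc k) (J h)"
  obtain \<Psi> :: "w22_env \<Rightarrow> complex" where \<Psi>: "\<And>u v. \<Psi> (u + v) = \<Psi> u + \<Psi> v" "\<And>c u. \<Psi> (c \<cdot> u) = c * \<Psi> u"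
    "\<And>u. u \<in> M_filt (Suc k) \<Longrightarrow> \<Psi> u = 0"
    "\<And>d x. has_degree d x \<Longrightarrow> d \<noteq> int (p * (0 + k)) \<Longrightarrow> \<Psi> x = 0"
    "\<And>u. u \<in> ideal_join (S\<^sub>p ^ Suc k) (J h) \<Longrightarrow> \<Psi> u = 0"
    "\<Psi> (UL (- int p) ^ 0 * UM (- int p) ^ k) \<noteq> 0"
    by (rule level_form[where k = k and s = 0 and h = h], rule that; assumption)
  have "\<Psi> (S\<^sub>p ^ k) = \<Psi> (UM (- int p) ^ k)"
    using \<Psi>(1)[of "S\<^sub>p ^ k - UM (- int p) ^ k" "UM (- int p) ^ k"] \<Psi>(3)[OF S_power_lead(1)[OF p]] by simp
  then show False using \<Psi>(5)[OF S] \<Psi>(6) by simp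
qed

end



section \<open>Existence of the vectors T(p,s)\<close>

lemma underdetermined:
  fixes m :: "'a \<Rightarrow> 'b \<Rightarrow> complex"
  assumes "finite B" "finite A" "card B < card A"
  shows "\<exists>x. (\<exists>a\<in>A. x a \<noteq> 0) \<and> (\<forall>b\<in>B. (\<Sum>a\<in>A. x a * m a b) = 0)"
  using assms
proof (induction B arbitrary: A m rule: finite_induct)
  case empty
  then have "A \<noteq> {}" by auto
  then show ?case by (intro exI[of _ "\<lambda>_. 1"]) auto
next
  case (insert b B)
  show ?case
  proof (cases "\<forall>a\<in>A. m a b = 0")
    case True
    have "card B < card A" using insert.prems insert.hyps by simp
    then obtain x where "\<exists>a\<in>A. x a \<noteq> 0" "\<forall>c\<in>B. (\<Sum>a\<in>A. x a * m a c) = 0"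
      using insert.IH[OF insert.prems(1)] by blast
    with True show ?thesis by (intro exI[of _ x]) auto
  next
    case False
    then obtain a0 where a0: "a0 \<in> A" "m a0 b \<noteq> 0" by blast
    let ?A = "A - {a0}"
    define m' where "m' a c = m a c - m a b / m a0 b * m a0 c" for a c
    have "card B < card ?A" using insert.prems insert.hyps a0(1) by simp
    then obtain x where x: "\<exists>a\<in>?A. x a \<noteq> 0" "\<forall>c\<in>B. (\<Sum>a\<in>?A. x a * m' a c) = 0"
      using insert.IH[of ?A m'] insert.prems(1) by auto
    define y where "y = x(a0 := - (\<Sum>a\<in>?A. x a * m a b) / m a0 b)"
    have split: "(\<Sum>a\<in>A. y a * m a c) = y a0 * m a0 c + (\<Sum>a\<in>?A. x a * m a c)" for c
    proof -
      have "(\<Sum>a\<in>?A. y a * m a c) = (\<Sum>a\<in>?A. x a * m a c)" by (rule sum.cong) (auto simp: y_def)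
      then show ?thesis using sum.remove[OF insert.prems(1) a0(1), of "\<lambda>a. y a * m a c"] by simp
    qed
    have "(\<Sum>a\<in>A. y a * m a c) = 0" if "c \<in> insert b B" for c
    proof (cases "c = b")
      case True
      then show ?thesis unfolding split using a0 by (simp add: y_def)
    next
      case False
      then have "(\<Sum>a\<in>?A. x a * m' a c) = 0" using x that by auto
      moreover have "(\<Sum>a\<in>?A. x a * m' a c) = (\<Sum>a\<in>?A. x a * m a c) - (\<Sum>a\<in>?A. x a * m a b) / m a0 b * m a0 c"
        by (simp add: m'_def right_diff_distrib sum_subtractf sum_distrib_right sum_divide_distrib mult.assoc)
      ultimately show ?thesis unfolding split by (simp add: y_def)
    qed
    moreover have "\<exists>a\<in>A. y a \<noteq> 0" using x(1) by (auto simp: y_def)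
    ultimately show ?thesis by blast
  qed
qed

lemma bounded_on: "finite A \<Longrightarrow> \<exists>N :: nat. \<forall>a\<in>A. f a < N"
  using finite_nat_set_iff_bounded[of "f ` A"] by auto

lemma swap_invariant:
  fixes G :: "'a list \<Rightarrow> 'b"
  assumes "\<And>as a b bs. G (as @ a # b # bs) = G (as @ b # a # bs)"
  shows "mset xs = mset ys \<Longrightarrow> G xs = G ys"
  using assms
proof (induction xs arbitrary: G ys)
  case (Cons x xs)
  obtain pre post where ys: "ys = pre @ x # post" using Cons.prems(1) by (metis list.set_intros(1) set_mset_mset split_list)
  have front: "G (pre @ x # post) = G (x # pre @ post)" for post
  proof (induction pre arbitrary: post rule: rev_induct)
    case (snoc y pre)
    show ?case using Cons.prems(2)[of pre y x post] snoc[of "y # post"] by simp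
  qed simp
  have "G (x # xs) = G (x # pre @ post)"
  proof (rule Cons.IH[of "pre @ post" "\<lambda>l. G (x # l)"])
    show "mset xs = mset (pre @ post)" using Cons.prems(1) ys by simp
    show "G (x # as @ a # b # bs) = G (x # as @ b # a # bs)" for as a b bs
      using Cons.prems(2)[of "x # as" a b bs] by simp
  qed
  then show ?case using front[of post] ys by simp
qed simp

lemma finite_compositions: "finite {xs :: nat list. 0 \<notin> set xs \<and> sum_list xs = n}"
proof (rule finite_subset)
  have len: "length xs \<le> sum_list xs" if "0 \<notin> set xs" for xs :: "nat list"
    using that by (induction xs) (auto simp: Suc_le_eq)
  show "{xs :: nat list. 0 \<notin> set xs \<and> sum_list xs = n} \<subseteq> {xs. set xs \<subseteq> {..n} \<and> length xs \<le> n}"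
    using len member_le_sum_list by fastforce
qed (rule finite_lists_length_le, simp)

abbreviation UL_pos :: "nat list \<Rightarrow> w22_env" where
  "UL_pos ns \<equiv> prod_list (map (\<lambda>i. UL (int i)) ns)"

lemma has_degree_UL_pos: "has_degree (- int (sum_list ns)) (UL_pos ns)"
proof (induction ns)
  case (Cons n ns)
  show ?case using has_degree_mult[OF has_degree_UL[of "int n"] Cons] by (simp add: algebra_simps)
qed (simp add: has_degree_1)

lemma UL_pos_swap:
  assumes "a \<noteq> 0"
  shows "UL_pos (as @ a # b # bs) * y - UL_pos (as @ b # a # bs) * y
    = of_int (int a - int b) \<cdot> (UL_pos (as @ (a + b) # bs) * y)"
proof -
  have "UL (int a) * UL (int b) - UL (int b) * UL (int a) = of_int (int a - int b) \<cdot> UL (int (a + b))"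
    using UL_UL[of "int a" "int b"] assms by (simp del: of_int_diff)
  then have "UL_pos as * (UL (int a) * UL (int b) - UL (int b) * UL (int a)) * (UL_pos bs * y)
     = of_int (int a - int b) \<cdot> (UL_pos as * UL (int (a + b)) * (UL_pos bs * y))"
    by (simp only: scale_mult_left scale_mult_right)
  then show ?thesis by (simp add: left_diff_distrib right_diff_distrib mult.assoc del: of_int_diff)
qed

lemma sum_mset_split: "sum_mset (filter_mset (\<lambda>i. i \<noteq> p) \<kappa>) + count \<kappa> p * p = sum_mset (\<kappa> :: nat multiset)"
  by (induction \<kappa>) auto

lemma mset_split: "filter_mset (\<lambda>i. i \<noteq> p) \<kappa> + replicate_mset (count \<kappa> p) p = \<kappa>"
  by (rule multiset_eqI) simp

lemma sum_list_sorted_mset: "sum_list (sorted_list_of_multiset \<kappa>) = sum_mset (\<kappa> :: nat multiset)"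
  by (metis mset_sorted_list_of_multiset sum_mset_sum_list)

context critical_quotient
begin

text \<open>The first \<open>L\<^sub>p\<close> already kills \<open>T\<^sup>s\<close> up to multiples of the negative M, because \<open>b\<^sub>s = 0\<close>.\<close>

lemma UL_p_T_power_R:
  assumes s: "s \<ge> 1" and h: "hL = hL_crit p s cL"
  shows "UL (int p) ^ s * T ^ s \<in> R"
proof -
  obtain k where k: "s = Suc k" using s by (cases s) auto
  have "b_coeff (Suc k) = 0" using h k b_coeff_zero_iff by simp
  then have 1: "UL (int p) * T ^ s \<in> R" using UL_p_T_power[of k] k by simp
  have "UL (int p) ^ j * y \<in> R" if "y \<in> R" for j y
    using that by (induction j) (auto simp: mult.assoc intro: UL_p_R)
  from this[OF 1, of k] show ?thesis by (simp add: k power_Suc2 mult.assoc del: power_Suc)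
qed

end

context critical_level
begin

text \<open>The monomials \<open>M\<^sub>\<mu> T\<^sup>j\<close> of degree \<open>sp\<close> are indexed by the partitions of \<open>sp\<close>, the number of parts
  equal to \<open>p\<close> being the exponent \<open>j\<close>.\<close>

lemma monomials_independent:
  assumes w: "w \<in> env_span (M_words_restr p p)" and \<Lambda>: "finite \<Lambda>" "\<And>\<kappa>. \<kappa> \<in> \<Lambda> \<Longrightarrow> 0 \<notin># \<kappa>"
    and f: "(\<Sum>\<kappa>\<in>\<Lambda>. x \<kappa> \<cdot> (UM_mset (filter_mset (\<lambda>i. i \<noteq> p) \<kappa>) * T_of p cM w ^ count \<kappa> p)) \<in> H0 h"
    and \<mu>: "\<mu> \<in> \<Lambda>"
  shows "x \<mu> = 0"
proof -
  interpret Q: critical_quotient cL cM h p "H0 h" w by (rule critical_quotient_H0[OF w])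
  let ?T = "T_of p cM w"
  have notin: "?T ^ j \<notin> Q.Kf j" for j by (rule Q.detects_power_notin[OF detects_H0])
  define F where "F \<kappa> = filter_mset (\<lambda>i. i \<noteq> p) (\<kappa> :: nat multiset)" for \<kappa>
  define \<Lambda>j where "\<Lambda>j j = {\<kappa> \<in> \<Lambda>. count \<kappa> p = j}" for j
  define v where "v j = (\<Sum>\<kappa>\<in>\<Lambda>j j. x \<kappa> \<cdot> UM_mset (F \<kappa>))" for j
  have fin: "finite (\<Lambda>j j)" for j using \<Lambda>(1) by (simp add: \<Lambda>j_def)
  obtain N where N: "\<And>\<kappa>. \<kappa> \<in> \<Lambda> \<Longrightarrow> count \<kappa> p < N"
    using bounded_on[OF \<Lambda>(1), of "\<lambda>\<mu>. count \<mu> p"] by blast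
  have vf: "v j \<in> M_free p" for j unfolding v_def M_free_def
  proof (intro env.span_sum env.span_scale env.span_base CollectI)
    fix \<kappa> assume "\<kappa> \<in> \<Lambda>j j"
    then have "0 \<notin># F \<kappa>" "p \<notin># F \<kappa>" using \<Lambda>(2) by (auto simp: F_def \<Lambda>j_def)
    then show "\<exists>xs. UM_mset (F \<kappa>) = UM_neg xs \<and> 0 \<notin> set xs \<and> p \<notin> set xs"
      by (intro exI[of _ "sorted_list_of_multiset (F \<kappa>)"]) simp
  qed
  have vT: "v j * ?T ^ j = (\<Sum>\<kappa>\<in>\<Lambda>j j. x \<kappa> \<cdot> (UM_mset (F \<kappa>) * ?T ^ count \<kappa> p))" for j
    unfolding v_def sum_distrib_right by (rule sum.cong) (auto simp: \<Lambda>j_def)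
  have "(\<Sum>j<N. v j * ?T ^ j) = (\<Sum>\<kappa>\<in>\<Lambda>. x \<kappa> \<cdot> (UM_mset (F \<kappa>) * ?T ^ count \<kappa> p))"
    unfolding vT \<Lambda>j_def by (rule sum.group[OF \<Lambda>(1)]) (use N in auto)
  then have "(\<Sum>j<N. v j * ?T ^ j) \<in> H0 h" using f by (simp add: F_def)
  then have v0: "v j = 0" if "j < N" for j
    by (rule Q.powers_independent[OF notin vf _ that])
  let ?j = "count \<mu> p"
  have restore: "F \<kappa> + replicate_mset ?j p = \<kappa>" if "\<kappa> \<in> \<Lambda>j ?j" for \<kappa>
    using mset_split[of p \<kappa>] that by (simp add: F_def \<Lambda>j_def)
  have inj: "inj_on F (\<Lambda>j ?j)" by (rule inj_on_inverseI[of _ "\<lambda>\<nu>. \<nu> + replicate_mset ?j p"]) (rule restore)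
  obtain m where m: "\<And>\<kappa>. \<kappa> \<in> \<Lambda>j ?j \<Longrightarrow> size (F \<kappa>) \<le> m"
    using bounded_on[OF fin[of ?j], of "\<lambda>\<mu>. size (F \<mu>)"] less_imp_le by blast
  have "(\<Sum>\<nu>\<in>F ` \<Lambda>j ?j. x (\<nu> + replicate_mset ?j p) \<cdot> (UM_mset \<nu> * ?T ^ ?j)) = (\<Sum>\<kappa>\<in>\<Lambda>j ?j. x \<kappa> \<cdot> (UM_mset (F \<kappa>) * ?T ^ ?j))"
    unfolding sum.reindex[OF inj] by (rule sum.cong) (auto simp: restore)
  also have "\<dots> = v ?j * ?T ^ ?j" by (simp add: v_def sum_distrib_right)
  also have "\<dots> \<in> Q.Kf ?j" using v0[OF N[OF \<mu>]] env.subspace_0[OF Q.Kf_subspace] by simp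
  finally have s: "(\<Sum>\<nu>\<in>F ` \<Lambda>j ?j. x (\<nu> + replicate_mset ?j p) \<cdot> (UM_mset \<nu> * ?T ^ ?j)) \<in> Q.Kf ?j" .
  have mem: "\<mu> \<in> \<Lambda>j ?j" using \<mu> by (simp add: \<Lambda>j_def)
  have "x (F \<mu> + replicate_mset ?j p) = 0"
    by (rule Q.independent_coefficients[OF notin finite_imageI[OF fin[of ?j]] _ s imageI[OF mem], of m])
      (use m \<Lambda>(2) in \<open>auto simp: F_def \<Lambda>j_def\<close>)
  then show ?thesis using restore[OF mem] by simp
qed

text \<open>Interchanging two adjacent letters of a word in the positive L changes it by a shorter word of the same
degree, so one order for each multiset of letters is enough.\<close>

lemma UL_pos_zero:
  fixes \<Psi> :: "w22_env \<Rightarrow> complex"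
  assumes \<Psi>: "\<And>u v. \<Psi> (u + v) = \<Psi> u + \<Psi> v" "\<And>c u. \<Psi> (c \<cdot> u) = c * \<Psi> u"
    and canon: "\<And>\<kappa>. 0 \<notin># \<kappa> \<Longrightarrow> sum_mset \<kappa> = d \<Longrightarrow> \<exists>ns. mset ns = \<kappa> \<and> \<Psi> (UL_pos ns * f) = 0"
  shows "0 \<notin> set ns \<Longrightarrow> sum_list ns = d \<Longrightarrow> \<Psi> (UL_pos ns * f) = 0"
proof (induction "length ns" arbitrary: ns rule: less_induct)
  case less
  define G where "G as = (if length as = length ns \<and> 0 \<notin> set as \<and> sum_list as = d then \<Psi> (UL_pos as * f) else 0)" for as
  have swap: "G (as @ a # b # bs) = G (as @ b # a # bs)" for as a b bs
  proof (cases "length (as @ a # b # bs) = length ns \<and> 0 \<notin> set (as @ a # b # bs) \<and> sum_list (as @ a # b # bs) = d")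
    case True
    have "\<Psi> (UL_pos (as @ (a + b) # bs) * f) = 0" by (rule less.hyps) (use True in auto)
    then have "\<Psi> (UL_pos (as @ a # b # bs) * f - UL_pos (as @ b # a # bs) * f) = 0"
      using UL_pos_swap[of a as b bs f] True by (simp add: \<Psi>(2) del: of_int_diff)
    then have "\<Psi> (UL_pos (as @ a # b # bs) * f) = \<Psi> (UL_pos (as @ b # a # bs) * f)"
      using \<Psi>(1)[of "UL_pos (as @ a # b # bs) * f - UL_pos (as @ b # a # bs) * f" "UL_pos (as @ b # a # bs) * f"] by simp
    then show ?thesis using True unfolding G_def by auto
  next
    case False
    then show ?thesis unfolding G_def by auto
  qed
  obtain ms where ms: "mset ms = mset ns" "\<Psi> (UL_pos ms * f) = 0"
    using canon[of "mset ns"] less.prems by (auto simp: sum_mset_sum_list)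
  have "G ns = G ms" by (rule swap_invariant[where G = G, OF swap]) (simp add: ms(1))
  moreover have "length ms = length ns" "set ms = set ns" "sum_list ms = sum_list ns"
    using ms(1) by (metis mset_eq_length, metis mset_eq_setD, metis sum_mset_sum_list)
  ultimately show ?case using less.prems ms(2) by (simp add: G_def)
qed

text \<open>The unknowns are the coefficients of the \<open>M\<^sub>-\<^sub>\<mu> T\<^sup>j\<close> of degree \<open>sp\<close>, the equations say that words of degree \<open>-sp\<close> in the positive L
send their combination into the kernel of \<open>\<Psi>\<close>. Both are indexed by the partitions of \<open>sp\<close>. The equation of
\<open>L\<^sub>p\<^sup>s\<close> holds automatically, by \<open>UL_p_T_power_R\<close>, so there is a nonzero solution.\<close>

lemma exists_T_form:
  fixes \<Psi> :: "w22_env \<Rightarrow> complex"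
  assumes w: "w \<in> env_span (M_words_restr p p)" and s: "s \<ge> 1" and h: "h = hL_crit p s cL"
    and \<Psi>: "\<And>u v. \<Psi> (u + v) = \<Psi> u + \<Psi> v" "\<And>c u. \<Psi> (c \<cdot> u) = c * \<Psi> u"
    "\<And>d x. has_degree d x \<Longrightarrow> d \<noteq> 0 \<Longrightarrow> \<Psi> x = 0" "\<And>u. u \<in> H0 h \<Longrightarrow> \<Psi> u = 0"
  obtains f where "f \<notin> H0 h" "\<And>u. \<Psi> (u * f) = 0"
proof -
  interpret Q: critical_quotient cL cM h p "H0 h" w by (rule critical_quotient_H0[OF w])
  let ?T = "T_of p cM w"
  have zero: "\<Psi> 0 = 0" using \<Psi>(1)[of 0 0] by simp
  have psum: "\<Psi> (sum g A) = (\<Sum>a\<in>A. \<Psi> (g a))" for g and A :: "nat multiset set"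
    by (induction A rule: infinite_finite_induct) (simp_all add: zero \<Psi>(1))
  have neg: "\<Psi> (env_gen x * z) = 0" if "neg_gen x" for x z
    using Q.neg_words_span[of z]
  proof (induction rule: env.span_induct_alt)
    case (step c g z)
    have "\<Psi> (env_gen x * g) = 0"
    proof (cases "g \<in> H0 h")
      case True
      then show ?thesis using \<Psi>(4)[OF Q.H_mult] by blast
    next
      case False
      then obtain ws where ws: "g = word ws" "neg_word ws" using step(1) by blast
      then have "word_degree (x # ws) > 0" using neg_word_degree[of "x # ws"] that by auto
      then show ?thesis using \<Psi>(3)[OF has_degree_word[of "x # ws"]] ws by simp
    qed
    then show ?case using step by (simp add: distrib_left \<Psi>(1,2))
  qed (simp add: zero)
  have R: "\<Psi> y = 0" if "y \<in> Q.R" for y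
    using that by (induction rule: Q.R_induct) (auto simp: zero \<Psi> neg)
  define b where "b \<kappa> = UM_mset (filter_mset (\<lambda>i. i \<noteq> p) \<kappa>) * ?T ^ count \<kappa> p" for \<kappa>
  define \<Lambda> where "\<Lambda> = {\<kappa>. 0 \<notin># \<kappa> \<and> sum_mset \<kappa> = s * p}"
  define \<kappa>0 where "\<kappa>0 = replicate_mset s p"
  \<comment> \<open>The partition consisting of \<open>s\<close> parts \<open>p\<close> stands for \<open>T\<^sup>s\<close> among the unknowns and for \<open>L\<^sub>p\<^sup>s\<close> among the equations.\<close>
  have "\<Lambda> \<subseteq> mset ` {xs. 0 \<notin> set xs \<and> sum_list xs = s * p}"
  proof
    fix \<kappa> assume "\<kappa> \<in> \<Lambda>"
    then show "\<kappa> \<in> mset ` {xs. 0 \<notin> set xs \<and> sum_list xs = s * p}"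
      by (intro image_eqI[of _ _ "sorted_list_of_multiset \<kappa>"]) (simp_all add: \<Lambda>_def sum_list_sorted_mset)
  qed
  then have fin: "finite \<Lambda>" using finite_compositions finite_subset by blast
  have \<kappa>0: "\<kappa>0 \<in> \<Lambda>" using p by (auto simp: \<Lambda>_def \<kappa>0_def in_replicate_mset)
  then have "card (\<Lambda> - {\<kappa>0}) < card \<Lambda>" using fin by (metis card_Diff1_less)
  then obtain x where x: "\<exists>\<kappa>\<in>\<Lambda>. x \<kappa> \<noteq> 0"
      "\<forall>\<nu>\<in>\<Lambda> - {\<kappa>0}. (\<Sum>\<kappa>\<in>\<Lambda>. x \<kappa> * \<Psi> (UL_pos (sorted_list_of_multiset \<nu>) * b \<kappa>)) = 0"
    using underdetermined[of "\<Lambda> - {\<kappa>0}" \<Lambda> "\<lambda>\<kappa> \<nu>. \<Psi> (UL_pos (sorted_list_of_multiset \<nu>) * b \<kappa>)"] fin by auto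
  define f where "f = (\<Sum>\<kappa>\<in>\<Lambda>. x \<kappa> \<cdot> b \<kappa>)"
  have \<Psi>f: "\<Psi> (u * f) = (\<Sum>\<kappa>\<in>\<Lambda>. x \<kappa> * \<Psi> (u * b \<kappa>))" for u
    by (simp add: f_def sum_distrib_left psum \<Psi>(2))
  have bK: "b \<kappa> \<in> Q.K0" and bdeg: "has_degree (int (s * p)) (b \<kappa>)" if "\<kappa> \<in> \<Lambda>" for \<kappa>
  proof -
    have z: "0 \<notin> set (sorted_list_of_multiset (filter_mset (\<lambda>i. i \<noteq> p) \<kappa>))" using that by (simp add: \<Lambda>_def)
    show "b \<kappa> \<in> Q.K0" using Q.Kf_word[OF z lessI] Q.Kf_K0 by (auto simp: b_def)
    have "sum_list (sorted_list_of_multiset (filter_mset (\<lambda>i. i \<noteq> p) \<kappa>)) + count \<kappa> p * p = s * p"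
      using sum_mset_split[of p \<kappa>] that by (simp add: sum_list_sorted_mset \<Lambda>_def)
    then show "has_degree (int (s * p)) (b \<kappa>)" using Q.has_degree_word_T[OF z, of "count \<kappa> p"] unfolding b_def by (simp only:)
  qed
  have fK: "f \<in> Q.K0" unfolding f_def
    by (intro env.subspace_sum[OF Q.K0_subspace] env.subspace_scale[OF Q.K0_subspace] bK)
  have fdeg: "has_degree (int (s * p)) f" unfolding f_def
    by (intro has_degree_sum has_degree_scale bdeg)
  have notin: "f \<notin> H0 h"
  proof
    assume "f \<in> H0 h"
    then have "(\<Sum>\<kappa>\<in>\<Lambda>. x \<kappa> \<cdot> (UM_mset (filter_mset (\<lambda>i. i \<noteq> p) \<kappa>) * T_of p cM w ^ count \<kappa> p)) \<in> H0 h"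
      by (simp add: f_def b_def)
    then have "x \<mu> = 0" if "\<mu> \<in> \<Lambda>" for \<mu>
      by (rule monomials_independent[OF w fin _ _ that, rotated]) (simp add: \<Lambda>_def)
    then show False using x(1) by blast
  qed
  have top: "\<Psi> (UL (int p) ^ s * b \<kappa>) = 0" if \<kappa>: "\<kappa> \<in> \<Lambda>" for \<kappa>
  proof (cases "filter_mset (\<lambda>i. i \<noteq> p) \<kappa> = {#}")
    case True
    then have "count \<kappa> p * p = s * p" using sum_mset_split[of p \<kappa>] \<kappa> unfolding True by (simp add: \<Lambda>_def)
    then have cnt: "count \<kappa> p = s" using p by simp
    have "b \<kappa> = ?T ^ s" unfolding b_def True cnt by simp
    then show ?thesis using R[OF Q.UL_p_T_power_R[OF s h]] by simp
  next
    case False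
    then obtain a \<nu> where a: "filter_mset (\<lambda>i. i \<noteq> p) \<kappa> = add_mset a \<nu>" by (metis multiset_cases)
    then have "set_mset (add_mset a \<nu>) \<subseteq> set_mset \<kappa>" by (metis multiset_filter_subset set_mset_mono)
    then have "1 \<le> a" "0 \<notin># \<nu>" using \<kappa> by (cases a; auto simp: \<Lambda>_def)+
    have "UM_mset \<nu> * ?T ^ count \<kappa> p \<in> Q.K0"
      using Q.Kf_word[of "sorted_list_of_multiset \<nu>", OF _ lessI] Q.Kf_K0 \<open>0 \<notin># \<nu>\<close> by auto
    then have bR: "b \<kappa> \<in> Q.R" using Q.M_ideal_UM[OF \<open>1 \<le> a\<close>] unfolding b_def a UM_mset_add by (simp add: mult.assoc)
    have "UL (int p) ^ j * b \<kappa> \<in> Q.R" for j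
      by (induction j) (auto simp: bR mult.assoc intro: Q.UL_p_R)
    then show ?thesis using R by blast
  qed
  have pos: "\<Psi> (UL_pos ns * f) = 0" if ns: "0 \<notin> set ns" for ns
  proof (cases "sum_list ns = s * p")
    case True
    show ?thesis
    proof (rule UL_pos_zero[OF \<Psi>(1,2) _ ns True])
      fix \<kappa> :: "nat multiset" assume \<kappa>: "0 \<notin># \<kappa>" "sum_mset \<kappa> = s * p"
      then have \<kappa>': "\<kappa> \<in> \<Lambda>" by (simp add: \<Lambda>_def)
      show "\<exists>ns. mset ns = \<kappa> \<and> \<Psi> (UL_pos ns * f) = 0"
      proof (cases "\<kappa> = \<kappa>0")
        case True
        have "\<Psi> (UL_pos (replicate s p) * f) = 0" using top by (simp add: \<Psi>f)
        then show ?thesis using True by (intro exI[of _ "replicate s p"]) (simp add: \<kappa>0_def)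
      next
        case False
        then have "\<Psi> (UL_pos (sorted_list_of_multiset \<kappa>) * f) = 0" using x(2) \<kappa>' by (simp add: \<Psi>f)
        then show ?thesis by (intro exI[of _ "sorted_list_of_multiset \<kappa>"]) simp
      qed
    qed
  next
    case False
    then have "- int (sum_list ns) + int (s * p) \<noteq> 0" by linarith
    then show ?thesis using \<Psi>(3)[OF has_degree_mult[OF has_degree_UL_pos fdeg]] by blast
  qed
  define Y where "Y = env_span ({UL_pos ns * f |ns. 0 \<notin> set ns} \<union> H0 h)"
  have YH: "H0 h \<subseteq> Y" unfolding Y_def using env.span_superset by blast
  have Ysub: "env_subspace Y" by (simp add: Y_def env.subspace_span)
  have gen: "env_gen x * (UL_pos ns * f) \<in> Y" if x: "\<not> neg_gen x" and ns: "0 \<notin> set ns" for x ns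
  proof -
    let ?z = "UL_pos ns * f"
    have z: "?z \<in> Y" unfolding Y_def using ns by (intro env.span_base) blast
    have "?z \<in> Q.K0" by (induction ns) (auto simp: fK mult.assoc intro: Q.K0_UL)
    then have zK: "?z \<in> Q.K" using Q.M_closedD(3)[OF Q.K0_M_closed] by blast
    have near: "u \<in> Y" if "u - c \<cdot> ?z \<in> H0 h" for u c
      using env.subspace_add[OF Ysub subsetD[OF YH that] env.subspace_scale[OF Ysub z, of c]] by simp
    show ?thesis
    proof (cases x)
      case (BL m)
      show ?thesis
      proof (cases "m = 0")
        case True
        then show ?thesis using near[OF Q.hw_weight[OF has_degree_mult[OF has_degree_UL_pos fdeg]]] BL by simp
      next
        case False
        then have m: "m = int (nat m)" "nat m \<noteq> 0" using x BL by auto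
        have "UL_pos (nat m # ns) * f \<in> Y" unfolding Y_def using ns m(2)
          by (intro env.span_base UnI1 CollectI exI[of _ "nat m # ns"]) auto
        then show ?thesis using BL m(1) by (simp add: mult.assoc)
      qed
    next
      case (BM m)
      show ?thesis
      proof (cases "m = 0")
        case True
        then show ?thesis using near[OF Q.K_zero[OF zK]] BM by simp
      next
        case False
        then have m: "m = int (nat m)" "1 \<le> nat m" using x BM by auto
        then show ?thesis using Q.K_pos[OF zK m(2)] YH BM by auto
      qed
    next
      case BCL
      then show ?thesis using near[OF Q.hw_central(1)] by simp
    next
      case BCM
      then show ?thesis using near[OF Q.hw_central(2)] by simp
    qed
  qed
  have closed: "env_gen x * y \<in> Y" if x: "\<not> neg_gen x" and y: "y \<in> Y" for x y
    using y unfolding Y_def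
  proof (induction rule: env.span_induct_alt)
    case (step c g y)
    then have "env_gen x * g \<in> Y" using gen[OF x] Q.H_mult YH by blast
    then show ?case using step(2) unfolding Y_def by (simp add: distrib_left env.span_add env.span_scale)
  qed (simp add: env.span_zero)
  have \<Psi>Y: "\<Psi> y = 0" if "y \<in> Y" for y
    using that unfolding Y_def
  proof (induction rule: env.span_induct_alt)
    case (step c g y)
    then have "\<Psi> g = 0" using pos \<Psi>(4) by blast
    then show ?case using step by (simp add: \<Psi>(1,2))
  qed (rule zero)
  have fY: "f \<in> Y" unfolding Y_def by (intro env.span_base UnI1 CollectI exI[of _ "[]"]) simp
  have tri: "u * f \<in> env_span {word ws * y |ws y. neg_word ws \<and> y \<in> Y}" for u
    by (rule Q.triangular[OF Ysub _ fY]) (rule closed)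
  have "\<Psi> (u * f) = 0" for u
    using tri[of u]
  proof (induction rule: env.span_induct_alt)
    case (step c g z)
    then obtain ws y where g: "g = word ws * y" "neg_word ws" "y \<in> Y" by blast
    have "\<Psi> g = 0"
    proof (cases ws)
      case Nil
      then show ?thesis using g \<Psi>Y by simp
    next
      case (Cons x vs)
      then show ?thesis using g neg[of x "word vs * y"] by (simp add: mult.assoc)
    qed
    then show ?case using step by (simp add: \<Psi>(1,2))
  qed (rule zero)
  then show ?thesis using notin that by blast
qed

lemma hL_crit_inj: "hL_crit p k cL = hL_crit p s cL \<Longrightarrow> k = s"
proof -
  assume "hL_crit p k cL = hL_crit p s cL"
  then have "(of_nat k - of_nat s) * of_nat p = (0::complex)" by (auto simp: hL_crit_def field_simps)
  then show ?thesis using p by simp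
qed

end



section \<open>Uniqueness of the vectors T(p,s)\<close>

context critical_quotient
begin

text \<open>A singular vector with leading term \<open>T\<^sup>s\<close> is homogeneous of degree \<open>sp\<close>, and its remainder is brought into
the normal form that does not involve \<open>M\<^sub>-\<^sub>p\<close>.\<close>

lemma singular_normal_form:
  assumes x: "has_degree d x" "\<And>m. 1 \<le> m \<Longrightarrow> UL (int m) * x \<in> H" "\<And>m. 1 \<le> m \<Longrightarrow> UM (int m) * x \<in> H"
    and a: "a \<noteq> 0" "x - a \<cdot> T ^ s \<in> Kf s" "T ^ s \<notin> Kf s"
  obtains v where "\<And>i. i \<in> {1..s} \<Longrightarrow> v i \<in> env_span (M_words_restr p (i * p))"
    "\<And>m. 1 \<le> m \<Longrightarrow> UL (int m) * (T ^ s + (\<Sum>i\<in>{1..s}. v i * T ^ (s - i))) \<in> H"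
    "\<And>m. 1 \<le> m \<Longrightarrow> UM (int m) * (T ^ s + (\<Sum>i\<in>{1..s}. v i * T ^ (s - i))) \<in> H"
    "(1 / a) \<cdot> x - (T ^ s + (\<Sum>i\<in>{1..s}. v i * T ^ (s - i))) \<in> H"
proof -
  have d: "d = int s * int p"
  proof (rule ccontr)
    assume "d \<noteq> int s * int p"
    then have "x \<in> Kf s" using Kf_graded[OF good_all x(1) _ a(2)] by simp
    then have "x - (x - a \<cdot> T ^ s) \<in> Kf s" using a(2) by (rule env.subspace_diff[OF Kf_subspace])
    then have "a \<cdot> T ^ s \<in> Kf s" by simp
    then have "(1 / a) \<cdot> (a \<cdot> T ^ s) \<in> Kf s" by (rule env.subspace_scale[OF Kf_subspace])
    then show False using a(1,3) by simp
  qed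
  define y where "y = (1 / a) \<cdot> x"
  have "(1 / a) \<cdot> (x - a \<cdot> T ^ s) \<in> Kf s" using a(2) by (rule env.subspace_scale[OF Kf_subspace])
  then have y1: "y - T ^ s \<in> Kf s" using a(1) by (simp add: y_def env.scale_right_diff_distrib)
  have y2: "has_degree (int (s * p)) (y - T ^ s)"
  proof -
    have "has_degree (int s * int p) y" using has_degree_scale[OF x(1), of "1 / a"] d by (simp add: y_def)
    from has_degree_diff[OF this has_degree_power[OF has_degree_T[OF w', of cM], of s]] show ?thesis by simp
  qed
  obtain v where v: "\<And>i. i \<in> {1..s} \<Longrightarrow> v i \<in> env_span (M_words_restr p (i * p))"
      "y - T ^ s - (\<Sum>i\<in>{1..s}. v i * T ^ (s - i)) \<in> H"
    by (rule Kf_normal_form[OF y1 y2], rule that; assumption)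
  let ?t = "T ^ s + (\<Sum>i\<in>{1..s}. v i * T ^ (s - i))"
  have yt: "y - ?t \<in> H" using v(2) by (simp add: diff_diff_eq)
  have kill: "u * ?t \<in> H" if "u * x \<in> H" for u
  proof -
    have "u * y \<in> H" using H_scale[OF that, of "1 / a"] by (simp add: y_def)
    then have "u * y - u * (y - ?t) \<in> H" by (rule H_diff[OF _ H_mult[OF yt]])
    then show ?thesis by (simp add: right_diff_distrib)
  qed
  show ?thesis by (rule that[OF v(1) kill[OF x(2)] kill[OF x(3)] yt[unfolded y_def]])
qed

end

context critical_level
begin

text \<open>With a form that is nonzero on 1, the solution found before generates a left ideal that is proper but larger than
\<open>H0 h\<close>. Its elements of least degree are singular, and they are not of degree 0.\<close>

lemma exists_T:
  assumes w: "w \<in> env_span (M_words_restr p p)" and s: "s \<ge> 1" and h: "h = hL_crit p s cL"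
  obtains v where "\<And>i. i \<in> {1..s} \<Longrightarrow> v i \<in> env_span (M_words_restr p (i * p))"
    "\<And>m. 1 \<le> m \<Longrightarrow> UL (int m) * (T_of p cM w ^ s + (\<Sum>i\<in>{1..s}. v i * T_of p cM w ^ (s - i))) \<in> H0 h"
    "\<And>m. 1 \<le> m \<Longrightarrow> UM (int m) * (T_of p cM w ^ s + (\<Sum>i\<in>{1..s}. v i * T_of p cM w ^ (s - i))) \<in> H0 h"
proof -
  interpret Q: critical_quotient cL cM h p "H0 h" w by (rule critical_quotient_H0[OF w])
  let ?T = "T_of p cM w"
  obtain \<Psi> :: "w22_env \<Rightarrow> complex" where \<Psi>: "\<And>u v. \<Psi> (u + v) = \<Psi> u + \<Psi> v" "\<And>c u. \<Psi> (c \<cdot> u) = c * \<Psi> u"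
    "\<And>u. u \<in> M_filt (Suc 0) \<Longrightarrow> \<Psi> u = 0"
    "\<And>d x. has_degree d x \<Longrightarrow> d \<noteq> int (p * (0 + 0)) \<Longrightarrow> \<Psi> x = 0"
    "\<And>u. u \<in> ideal_join (S\<^sub>p ^ Suc 0) (J h) \<Longrightarrow> \<Psi> u = 0"
    "\<Psi> (UL (- int p) ^ 0 * UM (- int p) ^ 0) \<noteq> 0"
    by (rule level_form[where k = 0 and s = 0 and h = h], rule that; assumption)
  have H: "\<Psi> u = 0" if "u \<in> H0 h" for u using \<Psi>(5) that by simp
  have deg: "\<Psi> x = 0" if "has_degree d x" "d \<noteq> 0" for d x using \<Psi>(4) that by simp
  obtain f where f: "f \<notin> H0 h" "\<And>u. \<Psi> (u * f) = 0"
  proof -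
    have "\<exists>f. f \<notin> H0 h \<and> (\<forall>u. \<Psi> (u * f) = 0)"
      by (rule exists_T_form[OF w s h \<Psi>(1,2)]) (use deg H in blast)+
    then show ?thesis using that by blast
  qed
  have zero: "\<Psi> 0 = 0" using \<Psi>(1)[of 0 0] by simp
  define X where "X = {x. \<forall>u. \<Psi> (u * x) = 0}"
  have X: "left_ideal X"
    by (rule left_idealI) (auto simp: X_def zero distrib_left \<Psi>(1) mult.assoc[symmetric])
  have HX: "H0 h \<subseteq> X" using H Q.H_mult by (auto simp: X_def)
  have "f \<in> X" using f(2) by (simp add: X_def)
  then have ne: "X \<noteq> H0 h" using f(1) by blast
  have one: "1 \<notin> X" using \<Psi>(6) unfolding X_def by (auto intro: exI[of _ 1])
  obtain x d where x: "x \<in> X" "x \<notin> H0 h" "has_degree d x" "d \<ge> 0"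
      "\<And>m. 1 \<le> m \<Longrightarrow> UL (int m) * x \<in> H0 h" "\<And>m. 1 \<le> m \<Longrightarrow> UM (int m) * x \<in> H0 h"
    by (rule Q.minimal_degree[OF X HX ne], rule that; assumption)
  obtain k a where ka: "a \<noteq> 0" "x - a \<cdot> ?T ^ k \<in> Q.Kf k" "?T ^ k \<notin> Q.Kf k" "1 \<le> k \<Longrightarrow> h = hL_crit p k cL"
    using Q.singular_vectors[OF x(5,6,2)] detects_H0 by metis
  have "k \<noteq> 0"
  proof
    assume "k = 0"
    then have "x - a \<cdot> 1 \<in> X" using ka(2) HX by (auto simp: Q.Kf_0)
    then have "x - (x - a \<cdot> 1) \<in> X" by (rule left_ideal_diff[OF X x(1)])
    then have "a \<cdot> 1 \<in> X" by simp
    then have "(1 / a) \<cdot> (a \<cdot> 1) \<in> X" by (rule left_ideal_scale[OF X])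
    then show False using one ka(1) by simp
  qed
  then have ks: "k = s" using ka(4) h hL_crit_inj by simp
  have ka': "x - a \<cdot> ?T ^ s \<in> Q.Kf s" "?T ^ s \<notin> Q.Kf s" using ka ks by simp_all
  show ?thesis
    by (rule Q.singular_normal_form[OF x(3) _ _ ka(1) ka'], erule x(5), erule x(6), rule that; assumption)
qed

text \<open>The difference of two singular vectors with the same leading term would be a singular vector of the same degree
with a leading term of lower order in T. The weight excludes the terms \<open>T\<^sup>k\<close> with \<open>0 < k < s\<close>, and the degree excludes \<open>k = 0\<close>.\<close>

lemma unique_T:
  assumes w: "w \<in> env_span (M_words_restr p p)" and s: "s \<ge> 1" and h: "h = hL_crit p s cL"
    and c: "\<And>i. i \<in> {1..s} \<Longrightarrow> c i \<in> env_span (M_words_restr p (i * p))"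
    and kill: "\<And>m. 1 \<le> m \<Longrightarrow> UL (int m) * (\<Sum>i\<in>{1..s}. c i * T_of p cM w ^ (s - i)) \<in> H0 h"
      "\<And>m. 1 \<le> m \<Longrightarrow> UM (int m) * (\<Sum>i\<in>{1..s}. c i * T_of p cM w ^ (s - i)) \<in> H0 h"
    and i: "i \<in> {1..s}"
  shows "c i = 0"
proof -
  interpret Q: critical_quotient cL cM h p "H0 h" w by (rule critical_quotient_H0[OF w])
  let ?T = "T_of p cM w"
  let ?z = "\<Sum>i\<in>{1..s}. c i * ?T ^ (s - i)"
  have zK: "?z \<in> Q.Kf s"
    by (rule env.subspace_sum[OF Q.Kf_subspace], rule Q.M_free_Kf[OF M_restr_free[OF c]]) auto
  have deg: "has_degree (int (s * p)) ?z"
  proof (rule has_degree_sum)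
    fix i assume i: "i \<in> {1..s}"
    have "has_degree (int (i * p) + int (s - i) * int p) (c i * ?T ^ (s - i))"
      by (rule has_degree_mult[OF has_degree_M_poly[OF M_restr_in_M_poly[OF c[OF i]]] has_degree_power[OF has_degree_T[OF Q.w']]])
    moreover have "int (i * p) + int (s - i) * int p = int (s * p)"
    proof -
      have "i * p + (s - i) * p = s * p" using i by (simp flip: add_mult_distrib)
      then show ?thesis by (metis of_nat_add of_nat_mult)
    qed
    ultimately show "has_degree (int (s * p)) (c i * ?T ^ (s - i))" by (simp only:)
  qed
  have "?z \<in> H0 h"
  proof (rule ccontr)
    assume n: "?z \<notin> H0 h"
    obtain k a where ka: "a \<noteq> 0" "?z - a \<cdot> ?T ^ k \<in> Q.Kf k" "?T ^ k \<notin> Q.Kf k" "1 \<le> k \<Longrightarrow> h = hL_crit p k cL"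
    proof (rule Q.singular_vectors[OF _ _ n], erule kill(1), erule kill(2))
      fix a k
      assume "a \<noteq> 0" "?z - a \<cdot> ?T ^ k \<in> Q.Kf k" "?T ^ k \<notin> Q.Kf k"
        "1 \<le> k \<Longrightarrow> detects p (H0 h) (k - 1) \<Longrightarrow> h = hL_crit p k cL"
      then show thesis using detects_H0 by (intro that) simp_all
    qed
    show False
    proof (cases "k = 0")
      case True
      have "?z \<in> Q.Kf 0"
        by (rule Q.Kf_graded[OF Q.good_all deg _ ka(2)[unfolded True]]) (use s p in simp)
      then show False using n by (simp add: Q.Kf_0)
    next
      case False
      then have "k = s" using ka(4) h hL_crit_inj by simp
      then have "?z - (?z - a \<cdot> ?T ^ k) \<in> Q.Kf k" using ka(2) zK env.subspace_diff[OF Q.Kf_subspace] by blast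
      then have "a \<cdot> ?T ^ k \<in> Q.Kf k" by simp
      then have "(1 / a) \<cdot> (a \<cdot> ?T ^ k) \<in> Q.Kf k" by (rule env.subspace_scale[OF Q.Kf_subspace])
      then show False using ka(1,3) by simp
    qed
  qed
  moreover have "?z = (\<Sum>j<s. c (s - j) * ?T ^ j)"
    by (rule sum.reindex_bij_witness[of _ "\<lambda>j. s - j" "\<lambda>i. s - i"]) auto
  ultimately have sum: "(\<Sum>j<s. c (s - j) * ?T ^ j) \<in> H0 h" by simp
  have "c (s - (s - i)) = 0"
  proof (rule Q.powers_independent[where k = s and v = "\<lambda>j. c (s - j)"])
    show "?T ^ j \<notin> Q.Kf j" for j by (rule Q.detects_power_notin[OF detects_H0])
    show "c (s - j) \<in> M_free p" if "j < s" for j by (rule M_restr_free[OF c]) (use that in auto)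
  qed (use sum i in auto)
  then show ?thesis using i by simp
qed

text \<open>By the Euler argument such an element is a scalar modulo \<open>H0 h\<close>, and its degree is positive.\<close>

lemma restr_zero:
  assumes v: "v \<in> env_span (M_words_restr p p)" and kill: "\<And>n. 1 \<le> n \<Longrightarrow> UL (int n) * v \<in> J h"
  shows "v = 0"
proof -
  interpret Q: critical_quotient cL cM h p "H0 h" 0 by (rule critical_quotient_H0[OF env.span_zero])
  have vK: "v \<in> Q.Kf (Suc 0)" using Q.M_free_Kf[OF M_restr_free[OF v], of 0 "Suc 0"] by simp
  have k: "UL (int n) * v \<in> Q.Kf 0" if "1 \<le> n" for n
    using kill[OF that] ideal_join_ideal by (auto simp: Q.Kf_0)
  obtain a where a: "v - a \<cdot> T_of p cM 0 ^ 0 \<in> Q.Kf 0" by (rule Q.stage2[OF Q.good_all vK k])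
  have "v \<in> Q.Kf 0"
    by (rule Q.Kf_graded[OF Q.good_all has_degree_M_poly[OF M_restr_in_M_poly[OF v]] _ a]) (use p in simp)
  then show ?thesis
    using Q.M_free_independent[OF Q.detects_power_notin[OF detects_H0], of v 0] M_restr_free[OF v] by simp
qed

end

section \<open>Identification of S, T and T(p,s)\<close>

lemma finite_partitions: "finite (partitions n)"
  by (rule finite_subset[OF _ finite_compositions[of n]]) (auto simp: partitions_def)

lemma span_UM_eq:
  assumes "finite P"
  shows "span_UM P = env_span (UM_neg ` P)"
proof
  show "span_UM P \<subseteq> env_span (UM_neg ` P)"
  proof
    fix u assume "u \<in> span_UM P"
    then obtain a where u: "u = (\<Sum>xs\<in>P. a xs \<cdot> UM_neg xs)" unfolding span_UM_def scale_env_def[symmetric] by blast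
    show "u \<in> env_span (UM_neg ` P)"
      unfolding u by (rule env.span_sum, rule env.span_scale, rule env.span_base, erule imageI)
  qed
  show "env_span (UM_neg ` P) \<subseteq> span_UM P"
  proof (rule env.span_minimal)
    have delta: "UM_neg xs = (\<Sum>ys\<in>P. (if ys = xs then 1 else 0) \<cdot> UM_neg ys)" if "xs \<in> P" for xs
    proof -
      have "(\<Sum>ys\<in>P. (if ys = xs then 1 else 0) \<cdot> UM_neg ys) = (\<Sum>ys\<in>P. if ys = xs then UM_neg xs else 0)"
        by (rule sum.cong) auto
      then show ?thesis using assms that by simp
    qed
    show "UM_neg ` P \<subseteq> span_UM P"
    proof
      fix g assume "g \<in> UM_neg ` P"
      then obtain xs where "xs \<in> P" "g = UM_neg xs" by blast
      then have "g = (\<Sum>ys\<in>P. (if ys = xs then 1 else 0) \<cdot> UM_neg ys)" using delta by simp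
      then show "g \<in> span_UM P" unfolding span_UM_def scale_env_def[symmetric] mem_Collect_eq
        by (intro exI[of _ "\<lambda>ys. if ys = xs then 1 else 0"]) simp
    qed
    show "env_subspace (span_UM P)"
    proof (rule env.subspaceI)
      show "0 \<in> span_UM P" unfolding span_UM_def by (intro CollectI exI[of _ "\<lambda>_. 0"]) simp
      show "x + y \<in> span_UM P" if "x \<in> span_UM P" "y \<in> span_UM P" for x y
      proof -
        from that obtain a b where "x = (\<Sum>xs\<in>P. a xs \<cdot> UM_neg xs)" "y = (\<Sum>xs\<in>P. b xs \<cdot> UM_neg xs)"
          unfolding span_UM_def scale_env_def[symmetric] by blast
        then have "x + y = (\<Sum>xs\<in>P. (a xs + b xs) \<cdot> UM_neg xs)" by (simp add: env.scale_left_distrib sum.distrib)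
        then show ?thesis unfolding span_UM_def scale_env_def[symmetric] mem_Collect_eq
          by (intro exI[of _ "\<lambda>xs. a xs + b xs"]) simp
      qed
      show "c \<cdot> x \<in> span_UM P" if "x \<in> span_UM P" for c x
      proof -
        from that obtain a where "x = (\<Sum>xs\<in>P. a xs \<cdot> UM_neg xs)"
          unfolding span_UM_def scale_env_def[symmetric] by blast
        then have "c \<cdot> x = (\<Sum>xs\<in>P. (c * a xs) \<cdot> UM_neg xs)" by (simp add: env.scale_sum_right)
        then show ?thesis unfolding span_UM_def scale_env_def[symmetric] mem_Collect_eq
          by (intro exI[of _ "\<lambda>xs. c * a xs"]) simp
      qed
    qed
  qed
qed

text \<open>Sorting a list does not change its monomial, since the M commute.\<close>

lemma span_UM_restr: "span_UM {xs \<in> partitions d. p \<notin> set xs} = env_span (M_words_restr p d)"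
proof -
  have "UM_neg ` {xs \<in> partitions d. p \<notin> set xs} = M_words_restr p d"
  proof
    show "UM_neg ` {xs \<in> partitions d. p \<notin> set xs} \<subseteq> M_words_restr p d"
      by (auto simp: M_words_restr_def partitions_def)
    show "M_words_restr p d \<subseteq> UM_neg ` {xs \<in> partitions d. p \<notin> set xs}"
    proof
      fix g assume "g \<in> M_words_restr p d"
      then obtain xs where xs: "g = UM_neg xs" "0 \<notin> set xs" "p \<notin> set xs" "sum_list xs = d" by (auto simp: M_words_restr_def)
      have m: "mset (rev (sort xs)) = mset xs" by simp
      have "sum_list (rev (sort xs)) = d" using m xs(4) by (metis sum_mset_sum_list)
      then have "rev (sort xs) \<in> {xs \<in> partitions d. p \<notin> set xs}"
        using xs by (simp add: partitions_def sorted_wrt_rev)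
      then show "g \<in> UM_neg ` {xs \<in> partitions d. p \<notin> set xs}"
        using UM_neg_mset[OF m] xs(1) by (metis imageI)
    qed
  qed
  then show ?thesis using span_UM_eq finite_partitions by simp
qed

lemma partition_contains: "xs \<in> partitions p \<Longrightarrow> p \<in> set xs \<longleftrightarrow> xs = [p]"
proof
  assume xs: "xs \<in> partitions p" and "p \<in> set xs"
  then obtain as bs where s: "xs = as @ p # bs" by (metis split_list)
  then have "sum_list as = 0" "sum_list bs = 0" "0 \<notin> set as" "0 \<notin> set bs" using xs by (auto simp: partitions_def)
  then have "as = []" by (cases as) auto
  moreover have "bs = []" using \<open>sum_list bs = 0\<close> \<open>0 \<notin> set bs\<close> by (cases bs) auto
  ultimately have "as = []" "bs = []" by simp_all
  then show "xs = [p]" using s by simp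
qed simp

lemma partitions_proper: "partitions p - {[p]} = {xs \<in> partitions p. p \<notin> set xs}"
  using partition_contains by blast

lemma partitions_length: "p \<ge> 1 \<Longrightarrow> {xs \<in> partitions p. 2 \<le> length xs} = {xs \<in> partitions p. p \<notin> set xs}"
proof -
  assume p: "p \<ge> 1"
  have "2 \<le> length xs \<longleftrightarrow> p \<notin> set xs" if xs: "xs \<in> partitions p" for xs
  proof (cases xs rule: list.exhaust)
    case Nil
    then show ?thesis using xs p by (simp add: partitions_def)
  next
    case (Cons a as)
    show ?thesis unfolding partition_contains[OF xs] using xs Cons by (cases as) (auto simp: partitions_def)
  qed
  then show ?thesis by blast
qed

lemma hw_vector_singular:
  assumes P: "presents V q A B" and a: "a \<in> A" "a \<notin> B" and hw: "hw_vector cL cM hL hM B a"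
  shows "singular_vector V (q a)"
  unfolding presents_singular[OF P a(1)]
proof (intro conjI allI impI ballI a(2))
  have eig: "env_gen x * a - hw_char cL cM hL hM x \<cdot> a \<in> B" if "\<not> neg_gen x" for x
    using hw that by (simp add: hw_vector_def)
  show "\<exists>c. g * a - c \<cdot> a \<in> B" if "g \<in> {UL 0, UM 0, UCL, UCM}" for g
    using that eig[of "BL 0"] eig[of "BM 0"] eig[of BCL] eig[of BCM] by auto
  show "UL n * a \<in> B" "UM n * a \<in> B" if "0 < n" for n
    using that eig[of "BL n"] eig[of "BM n"] by auto
qed

context critical_level
begin

abbreviation V where "V h \<equiv> verma cL cM h hM\<^sub>p"
abbreviation q where "q h \<equiv> verma_proj cL cM h hM\<^sub>p"

lemma smult_vec: "u \<odot>\<^bsub>V h\<^esub> verma_vec cL cM h hM\<^sub>p = q h u"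
  unfolding verma_vec_def verma_proj_smult by simp

lemma S_singular: "singular_vector (V h) (S\<^sub>p \<odot>\<^bsub>V h\<^esub> verma_vec cL cM h hM\<^sub>p)"
  unfolding smult_vec
proof (rule hw_vector_singular[OF presents_verma UNIV_I _ S_hw])
  show "S\<^sub>p \<notin> J h" using S_power_not_in[of 1 h] ideal_join_ideal by auto
qed

lemma S_elem_eq: "S_elem p cM = S\<^sub>p"
  unfolding S_elem_def
proof (rule the_equality)
  obtain v where v: "v \<in> env_span (M_words_restr p p)" "S\<^sub>p = UM (- int p) + v" using S_of_lead[OF p] by blast
  have "critical_level cM p" by unfold_locales (use cM p in auto)
  then have "singular_vector (verma cL' cM h hM\<^sub>p) (S\<^sub>p \<odot>\<^bsub>verma cL' cM h hM\<^sub>p\<^esub> verma_vec cL' cM h hM\<^sub>p)" for cL' h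
    by (rule critical_level.S_singular)
  then show "(\<exists>w\<in>span_UM (partitions p - {[p]}). S\<^sub>p = UM (- int p) + w) \<and>
     (\<forall>cL h. singular_vector (verma cL cM h hM\<^sub>p) (S\<^sub>p \<odot>\<^bsub>verma cL cM h hM\<^sub>p\<^esub> verma_vec cL cM h hM\<^sub>p))"
    using v by (auto simp: partitions_proper span_UM_restr)
  fix u
  assume u: "(\<exists>w\<in>span_UM (partitions p - {[p]}). u = UM (- int p) + w) \<and>
     (\<forall>cL h. singular_vector (verma cL cM h hM\<^sub>p) (u \<odot>\<^bsub>verma cL cM h hM\<^sub>p\<^esub> verma_vec cL cM h hM\<^sub>p))"
  then obtain v' where v': "v' \<in> env_span (M_words_restr p p)" "u = UM (- int p) + v'"
    by (auto simp: partitions_proper span_UM_restr)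
  have kill: "UL n * z \<in> J 0" if "singular_vector (V 0) (q 0 z)" "n > 0" for n z
    using that unfolding presents_singular[OF presents_verma UNIV_I] by blast
  have "v' - v = 0"
  proof (rule restr_zero[where h = 0])
    show "v' - v \<in> env_span (M_words_restr p p)" using v v' by (intro env.span_diff)
    fix n :: nat assume n: "1 \<le> n"
    have "UL (int n) * u \<in> J 0" using u n by (intro kill) (auto simp flip: smult_vec)
    moreover have "UL (int n) * S\<^sub>p \<in> J 0" using S_singular[of 0] n by (intro kill) (auto simp flip: smult_vec)
    ultimately have "UL (int n) * u - UL (int n) * S\<^sub>p \<in> J 0" by (rule left_ideal_diff[OF left_ideal_verma])
    then show "UL (int n) * (v' - v) \<in> J 0" by (simp add: v v' distrib_left right_diff_distrib)
  qed
  then show "u = S\<^sub>p" using v v' by simp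
qed

text \<open>The singular vector for \<open>s = 1\<close> is only singular modulo S. But \<open>L\<^sub>i T\<close> is a polynomial of degree \<open>p - i < p\<close> in the negative M,
and by linear independence such a polynomial is zero if it vanishes modulo S.\<close>

lemma exists_w:
  obtains w where "w \<in> env_span (M_words_restr p p)"
    "\<And>i. i \<in> {1..<p} \<Longrightarrow> UL (int i) * T_of p cM w \<in> J (hL_crit p 1 cL)"
proof -
  define h where "h = hL_crit p 1 cL"
  obtain v where v: "\<And>i. i \<in> {1..1} \<Longrightarrow> v i \<in> env_span (M_words_restr p (i * p))"
    "\<And>m. 1 \<le> m \<Longrightarrow> UL (int m) * (T_of p cM 0 ^ 1 + (\<Sum>i\<in>{1..1}. v i * T_of p cM 0 ^ (1 - i))) \<in> H0 h"
    "\<And>m. 1 \<le> m \<Longrightarrow> UM (int m) * (T_of p cM 0 ^ 1 + (\<Sum>i\<in>{1..1}. v i * T_of p cM 0 ^ (1 - i))) \<in> H0 h"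
    by (rule exists_T[where w = 0 and s = 1 and h = h, OF env.span_zero _ h_def], simp, rule that; assumption)
  \<comment> \<open>For \<open>s = 1\<close> the only correction term is a polynomial in the M of degree \<open>p\<close>, which is absorbed into T.\<close>
  define w where "w = v 1"
  have w: "w \<in> env_span (M_words_restr p p)" using v(1)[of 1] by (simp add: w_def)
  have T: "T_of p cM 0 ^ 1 + (\<Sum>i\<in>{1..1}. v i * T_of p cM 0 ^ (1 - i)) = T_of p cM w"
    by (simp add: T_of_def w_def)
  interpret C: critical cL cM h p "J h" w by (rule critical_J[OF w])
  interpret Q: critical_quotient cL cM h p "H0 h" w by (rule critical_quotient_H0[OF w])
  have "UL (int i) * T_of p cM w \<in> J h" if i: "i \<in> {1..<p}" for i
  proof -
    have L: "UL (int i) * T_of p cM w \<in> C.Kf (Suc 0)" using C.UL_T i by simp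
    have deg: "has_degree (- int i + int p) (UL (int i) * T_of p cM w)"
      by (rule has_degree_mult[OF has_degree_UL has_degree_T[OF C.w']])
    obtain g where g: "g \<in> env_span {UM_neg xs * T_of p cM w ^ j |xs j. 0 \<notin> set xs \<and> j < Suc 0 \<and> int (sum_list xs + j * p) = - int i + int p}"
      "UL (int i) * T_of p cM w - g \<in> J h"
      by (rule C.Kf_homogeneous[OF L deg], rule that; assumption)
    have "{UM_neg xs * T_of p cM w ^ j |xs j. 0 \<notin> set xs \<and> j < Suc 0 \<and> int (sum_list xs + j * p) = - int i + int p}
        \<subseteq> {UM_neg xs |xs. 0 \<notin> set xs \<and> p \<notin> set xs}"
    proof
      fix z assume "z \<in> {UM_neg xs * T_of p cM w ^ j |xs j. 0 \<notin> set xs \<and> j < Suc 0 \<and> int (sum_list xs + j * p) = - int i + int p}"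
      then obtain xs where xs: "z = UM_neg xs" "0 \<notin> set xs" "int (sum_list xs) = - int i + int p" by auto
      then have "p \<notin> set xs" using member_le_sum_list[of p xs] i by auto
      then show "z \<in> {UM_neg xs |xs. 0 \<notin> set xs \<and> p \<notin> set xs}" using xs by blast
    qed
    then have gf: "g \<in> M_free p" using g(1) env.span_mono unfolding M_free_def by blast
    have "UL (int i) * T_of p cM w \<in> H0 h" using v(2)[of i] i unfolding T by simp
    then have "UL (int i) * T_of p cM w - (UL (int i) * T_of p cM w - g) \<in> H0 h"
      using Q.H_diff g(2) ideal_join_ideal by blast
    then have "g * T_of p cM w ^ 0 \<in> Q.Kf 0" by (simp add: Q.Kf_0)
    then have "g = 0" by (rule Q.M_free_independent[OF Q.detects_power_notin[OF detects_H0] gf])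
    then show ?thesis using g(2) by simp
  qed
  then show ?thesis using that w by (simp add: h_def)
qed

definition w0 where
  "w0 = (SOME w. w \<in> env_span (M_words_restr p p) \<and> (\<forall>i\<in>{1..<p}. UL (int i) * T_of p cM w \<in> J (hL_crit p 1 cL)))"

lemma w0: "w0 \<in> env_span (M_words_restr p p)" "i \<in> {1..<p} \<Longrightarrow> UL (int i) * T_of p cM w0 \<in> J (hL_crit p 1 cL)"
proof -
  have "\<exists>w. w \<in> env_span (M_words_restr p p) \<and> (\<forall>i\<in>{1..<p}. UL (int i) * T_of p cM w \<in> J (hL_crit p 1 cL))"
    using exists_w by metis
  from someI_ex[OF this] show "w0 \<in> env_span (M_words_restr p p)"
    "i \<in> {1..<p} \<Longrightarrow> UL (int i) * T_of p cM w0 \<in> J (hL_crit p 1 cL)" unfolding w0_def by auto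
qed

abbreviation T\<^sub>p where "T\<^sub>p \<equiv> T_of p cM w0"

lemma T_of_form: "T_of p cM w = UL (- int p) + (\<Sum>i\<in>{1..<p}. g_elem p cM (p - i) * UL (- int i)) + w"
proof -
  have split: "{1..p} = insert p {1..<p}" using p by auto
  have "(\<Sum>i\<in>{1..<p}. g_coeff p cM (p - i) * UL (- int i)) = (\<Sum>i\<in>{1..<p}. g_elem p cM (p - i) * UL (- int i))"
    by (rule sum.cong) (auto simp: g_coeff_def)
  then show ?thesis unfolding T_of_def split by simp
qed

text \<open>For uniqueness, the difference of two solutions is annihilated by all \<open>L\<^sub>n\<close> with \<open>n > 0\<close>: by assumption for \<open>n < p\<close>,
because its parts are smaller than \<open>p\<close> for \<open>n = p\<close>, and by degree for \<open>n > p\<close>.\<close>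

lemma T_elem_eq: "T_elem p cL cM = T\<^sub>p"
  unfolding T_elem_def Let_def
proof (rule the_equality)
  let ?h = "hL_crit p 1 cL"
  have zero: "UL (int i) \<odot>\<^bsub>V ?h\<^esub> (u \<odot>\<^bsub>V ?h\<^esub> verma_vec cL cM ?h hM\<^sub>p) = \<zero>\<^bsub>V ?h\<^esub> \<longleftrightarrow> UL (int i) * u \<in> J ?h" for i u
    unfolding smult_vec verma_proj_smult by (rule presents_zero_iff[OF presents_verma UNIV_I])
  show "(\<exists>w\<in>span_UM {xs \<in> partitions p. 2 \<le> length xs}.
        T\<^sub>p = UL (- int p) + (\<Sum>i\<in>{1..<p}. g_elem p cM (p - i) * UL (- int i)) + w) \<and>
      (\<forall>i\<in>{1..<p}. UL (int i) \<odot>\<^bsub>V ?h\<^esub> (T\<^sub>p \<odot>\<^bsub>V ?h\<^esub> verma_vec cL cM ?h hM\<^sub>p) = \<zero>\<^bsub>V ?h\<^esub>)"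
    unfolding zero partitions_length[OF p] span_UM_restr T_of_form[symmetric] using w0 by blast
  fix u
  assume "(\<exists>w\<in>span_UM {xs \<in> partitions p. 2 \<le> length xs}.
        u = UL (- int p) + (\<Sum>i\<in>{1..<p}. g_elem p cM (p - i) * UL (- int i)) + w) \<and>
      (\<forall>i\<in>{1..<p}. UL (int i) \<odot>\<^bsub>V ?h\<^esub> (u \<odot>\<^bsub>V ?h\<^esub> verma_vec cL cM ?h hM\<^sub>p) = \<zero>\<^bsub>V ?h\<^esub>)"
  then obtain w where w: "w \<in> env_span (M_words_restr p p)" "u = T_of p cM w" "\<And>i. i \<in> {1..<p} \<Longrightarrow> UL (int i) * u \<in> J ?h"
    unfolding zero partitions_length[OF p] span_UM_restr T_of_form[symmetric] by blast
  interpret C: critical cL cM ?h p "J ?h" w by (rule critical_J[OF w(1)])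
  have d: "w - w0 \<in> env_span (M_words_restr p p)" using w(1) w0(1) by (rule env.span_diff)
  have diff: "w - w0 = u - T\<^sub>p" by (simp add: w(2) T_of_def)
  have top: "UL (int p) * v \<in> J ?h" if "v \<in> env_span (M_words_restr p p)" for v
    using that
  proof (induction rule: env.span_induct_alt)
    case (step c g v)
    then obtain xs where xs: "g = UM_neg xs" "0 \<notin> set xs" "p \<notin> set xs" "sum_list xs = p" by (auto simp: M_words_restr_def)
    have "1 \<le> a \<and> a < p" if "a \<in> set xs" for a
      using member_le_sum_list[OF that] that xs by (cases "a = 0"; cases "a = p") auto
    then have "UL (int p) * (g * 1) - g * (UL (int p) * 1) \<in> J ?h" using C.UL_p_M_word_small[OF C.K_1, of xs] xs(1) by blast
    moreover have "g * UL (int p) \<in> J ?h" using C.hw_pos(1)[of "int p" g] p by simp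
    ultimately have "(UL (int p) * (g * 1) - g * (UL (int p) * 1)) + g * UL (int p) \<in> J ?h" by (rule C.H_add)
    then have "UL (int p) * g \<in> J ?h" by simp
    from C.H_add[OF C.H_scale[OF this, of c] step(2)] show ?case by (simp add: distrib_left)
  qed (use C.H_0 in simp)
  have "w - w0 = 0"
  proof (rule restr_zero[OF d])
    fix n :: nat assume n: "1 \<le> n"
    show "UL (int n) * (w - w0) \<in> J ?h"
    proof (cases n p rule: linorder_cases)
      case less
      then have "UL (int n) * u - UL (int n) * T\<^sub>p \<in> J ?h" using w(3)[of n] w0(2)[of n] n by (intro C.H_diff) auto
      then show ?thesis by (simp add: diff right_diff_distrib)
    next
      case equal
      then show ?thesis using top[OF d] by simp
    next
      case greater
      show ?thesis
        by (rule C.negative_degree[OF has_degree_mult[OF has_degree_UL has_degree_M_poly[OF M_restr_in_M_poly[OF d]]]])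
          (use greater in simp)
    qed
  qed
  then show "u = T\<^sub>p" using w(2) by simp
qed

abbreviation t\<^sub>p where "t\<^sub>p s \<equiv> Tps_elem p s cL cM"

lemma Tps_elem_spec:
  assumes s: "s \<ge> 1" and h: "h = hL_crit p s cL"
  obtains v where "\<And>i. i \<in> {1..s} \<Longrightarrow> v i \<in> env_span (M_words_restr p (i * p))"
    "t\<^sub>p s = T\<^sub>p ^ s + (\<Sum>i\<in>{1..s}. v i * T\<^sub>p ^ (s - i))"
    "\<And>m. 1 \<le> m \<Longrightarrow> UL (int m) * t\<^sub>p s \<in> H0 h" "\<And>m. 1 \<le> m \<Longrightarrow> UM (int m) * t\<^sub>p s \<in> H0 h"
    "hw_vector cL cM (h + of_nat (s * p)) hM\<^sub>p (H0 h) (t\<^sub>p s)" "has_degree (int (s * p)) (t\<^sub>p s)"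
proof -
  interpret Q: critical_quotient cL cM h p "H0 h" w0 by (rule critical_quotient_H0[OF w0(1)])
  obtain v where v: "\<And>i. i \<in> {1..s} \<Longrightarrow> v i \<in> env_span (M_words_restr p (i * p))"
    "\<And>m. 1 \<le> m \<Longrightarrow> UL (int m) * (T\<^sub>p ^ s + (\<Sum>i\<in>{1..s}. v i * T\<^sub>p ^ (s - i))) \<in> H0 h"
    "\<And>m. 1 \<le> m \<Longrightarrow> UM (int m) * (T\<^sub>p ^ s + (\<Sum>i\<in>{1..s}. v i * T\<^sub>p ^ (s - i))) \<in> H0 h"
    by (rule exists_T[OF w0(1) s h], rule that; assumption)
  define t where "t = T\<^sub>p ^ s + (\<Sum>i\<in>{1..s}. v i * T\<^sub>p ^ (s - i))"
  have deg: "has_degree (int (s * p)) t" unfolding t_def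
  proof (rule has_degree_add[OF _ has_degree_sum])
    show "has_degree (int (s * p)) (T\<^sub>p ^ s)" using has_degree_power[OF has_degree_T[OF Q.w', of cM], of s] by simp
    fix i assume i: "i \<in> {1..s}"
    have "has_degree (int (i * p) + int (s - i) * int p) (v i * T\<^sub>p ^ (s - i))"
      by (rule has_degree_mult[OF has_degree_M_poly[OF M_restr_in_M_poly[OF v(1)[OF i]]] has_degree_power[OF has_degree_T[OF Q.w']]])
    moreover have "int (i * p) + int (s - i) * int p = int (s * p)"
    proof -
      have "i * p + (s - i) * p = s * p" using i by (simp flip: add_mult_distrib)
      then show ?thesis by (metis of_nat_add of_nat_mult)
    qed
    ultimately show "has_degree (int (s * p)) (v i * T\<^sub>p ^ (s - i))" by (simp only:)
  qed
  have "hw_vector cL cM (h + of_int (int (s * p))) hM\<^sub>p (H0 h) t"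
    by (rule Q.singular_hw_vector[OF deg]) (use v(2,3) in \<open>auto simp: t_def\<close>)
  then have hw: "hw_vector cL cM (h + of_nat (s * p)) hM\<^sub>p (H0 h) t" by simp
  have rest: "(\<Sum>i\<in>{1..s}. v i * T\<^sub>p ^ (s - i)) \<in> Q.Kf s"
    by (rule env.subspace_sum[OF Q.Kf_subspace], rule Q.M_free_Kf[OF M_restr_free[OF v(1)]]) auto
  have notin: "t \<notin> H0 h"
  proof
    assume "t \<in> H0 h"
    then have "t - (\<Sum>i\<in>{1..s}. v i * T\<^sub>p ^ (s - i)) \<in> Q.Kf s"
      using Q.Kf_H rest env.subspace_diff[OF Q.Kf_subspace] by blast
    then show False using Q.detects_power_notin[OF detects_H0[of h s]] by (simp add: t_def)
  qed
  let ?N = "generated_submodule (V h) {S_elem p cM \<odot>\<^bsub>V h\<^esub> verma_vec cL cM h hM\<^sub>p}"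
  have N: "?N = q h ` H0 h" unfolding S_elem_eq smult_vec by (rule presents_generated[OF presents_verma UNIV_I])
  have P: "presents (quotient_module (V h) ?N) (\<lambda>x. ?N +>\<^bsub>V h\<^esub> q h x) UNIV (H0 h)"
    unfolding N by (rule presents_quotient[OF presents_verma left_ideal_H0 ideal_join_ideal]) simp
  have "t\<^sub>p s = t"
    unfolding Tps_elem_def Let_def T_elem_eq h[symmetric] smult_vec[of u for u]
  proof (rule the_equality)
    have "singular_vector (quotient_module (V h) ?N) (?N +>\<^bsub>V h\<^esub> q h t)"
      by (rule hw_vector_singular[OF P UNIV_I notin hw])
    then show "(\<exists>w. (\<forall>i\<in>{1..s}. w i \<in> span_UM {xs \<in> partitions (i * p). p \<notin> set xs}) \<and>
          t = T\<^sub>p ^ s + (\<Sum>i\<in>{1..s}. w i * T\<^sub>p ^ (s - i))) \<and>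
        singular_vector (quotient_module (V h) (generated_submodule (V h) {q h (S_elem p cM)}))
          (generated_submodule (V h) {q h (S_elem p cM)} +>\<^bsub>V h\<^esub> q h t)"
      unfolding span_UM_restr smult_vec using v(1) t_def by blast
    fix u
    assume u: "(\<exists>w. (\<forall>i\<in>{1..s}. w i \<in> span_UM {xs \<in> partitions (i * p). p \<notin> set xs}) \<and>
          u = T\<^sub>p ^ s + (\<Sum>i\<in>{1..s}. w i * T\<^sub>p ^ (s - i))) \<and>
        singular_vector (quotient_module (V h) (generated_submodule (V h) {q h (S_elem p cM)}))
          (generated_submodule (V h) {q h (S_elem p cM)} +>\<^bsub>V h\<^esub> q h u)"
    then obtain v' where v': "\<And>i. i \<in> {1..s} \<Longrightarrow> v' i \<in> env_span (M_words_restr p (i * p))"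
      "u = T\<^sub>p ^ s + (\<Sum>i\<in>{1..s}. v' i * T\<^sub>p ^ (s - i))"
      unfolding span_UM_restr by blast
    have "singular_vector (quotient_module (V h) ?N) (?N +>\<^bsub>V h\<^esub> q h u)" using u unfolding smult_vec by blast
    then have ku: "UL n * u \<in> H0 h" "UM n * u \<in> H0 h" if "n > 0" for n
      using that unfolding presents_singular[OF P UNIV_I] by blast+
    have z: "(\<Sum>i\<in>{1..s}. (v' i - v i) * T\<^sub>p ^ (s - i)) = u - t"
      by (simp add: v'(2) t_def left_diff_distrib sum_subtractf)
    have "v' i - v i = 0" if "i \<in> {1..s}" for i
    proof (rule unique_T[OF w0(1) s h _ _ _ that, where c = "\<lambda>i. v' i - v i"])
      show "v' i - v i \<in> env_span (M_words_restr p (i * p))" if "i \<in> {1..s}" for i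
        by (rule env.span_diff[OF v'(1)[OF that] v(1)[OF that]])
      fix m :: nat assume m: "1 \<le> m"
      show "UL (int m) * (\<Sum>i\<in>{1..s}. (v' i - v i) * T\<^sub>p ^ (s - i)) \<in> H0 h"
        unfolding z right_diff_distrib by (rule Q.H_diff) (use ku(1)[of "int m"] v(2)[OF m] m in \<open>auto simp: t_def\<close>)
      show "UM (int m) * (\<Sum>i\<in>{1..s}. (v' i - v i) * T\<^sub>p ^ (s - i)) \<in> H0 h"
        unfolding z right_diff_distrib by (rule Q.H_diff) (use ku(2)[of "int m"] v(3)[OF m] m in \<open>auto simp: t_def\<close>)
    qed
    then have "(\<Sum>i\<in>{1..s}. (v' i - v i) * T\<^sub>p ^ (s - i)) = 0" by simp
    then show "u = t" unfolding z by simp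
  qed
  then show ?thesis using that[of v] v hw deg t_def by simp
qed

end



section \<open>The submodules between consecutive members of the series\<close>

context critical_level
begin

text \<open>Such an \<open>X\<close> contains a singular vector modulo S, and these are known.\<close>

lemma above_H0:
  assumes X: "left_ideal X" "H0 h \<subseteq> X" "X \<noteq> H0 h"
  shows "1 \<in> X \<or> (\<exists>s\<ge>1. h = hL_crit p s cL \<and> t\<^sub>p s \<in> X)"
proof -
  interpret Q: critical_quotient cL cM h p "H0 h" w0 by (rule critical_quotient_H0[OF w0(1)])
  obtain x d where x: "x \<in> X" "x \<notin> H0 h" "has_degree d x" "d \<ge> 0"
      "\<And>m. 1 \<le> m \<Longrightarrow> UL (int m) * x \<in> H0 h" "\<And>m. 1 \<le> m \<Longrightarrow> UM (int m) * x \<in> H0 h"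
    by (rule Q.minimal_degree[OF X], rule that; assumption)
  obtain k a where ka: "a \<noteq> 0" "x - a \<cdot> T\<^sub>p ^ k \<in> Q.Kf k" "T\<^sub>p ^ k \<notin> Q.Kf k" "1 \<le> k \<Longrightarrow> h = hL_crit p k cL"
    using Q.singular_vectors[OF x(5,6,2)] detects_H0 by metis
  show ?thesis
  proof (cases "k = 0")
    case True
    then have "x - a \<cdot> 1 \<in> X" using ka(2) X(2) by (auto simp: Q.Kf_0)
    then have "x - (x - a \<cdot> 1) \<in> X" by (rule left_ideal_diff[OF X(1) x(1)])
    then have "a \<cdot> 1 \<in> X" by simp
    then have "(1 / a) \<cdot> (a \<cdot> 1) \<in> X" by (rule left_ideal_scale[OF X(1)])
    then show ?thesis using ka(1) by simp
  next
    case False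
    then have k: "k \<ge> 1" and h: "h = hL_crit p k cL" using ka(4) by auto
    obtain v where v: "\<And>i. i \<in> {1..k} \<Longrightarrow> v i \<in> env_span (M_words_restr p (i * p))"
      "t\<^sub>p k = T\<^sub>p ^ k + (\<Sum>i\<in>{1..k}. v i * T\<^sub>p ^ (k - i))"
      "\<And>m. 1 \<le> m \<Longrightarrow> UL (int m) * t\<^sub>p k \<in> H0 h" "\<And>m. 1 \<le> m \<Longrightarrow> UM (int m) * t\<^sub>p k \<in> H0 h"
      by (rule Tps_elem_spec[OF k h], rule that; assumption)
    obtain v' where v': "\<And>i. i \<in> {1..k} \<Longrightarrow> v' i \<in> env_span (M_words_restr p (i * p))"
      "\<And>m. 1 \<le> m \<Longrightarrow> UL (int m) * (T\<^sub>p ^ k + (\<Sum>i\<in>{1..k}. v' i * T\<^sub>p ^ (k - i))) \<in> H0 h"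
      "\<And>m. 1 \<le> m \<Longrightarrow> UM (int m) * (T\<^sub>p ^ k + (\<Sum>i\<in>{1..k}. v' i * T\<^sub>p ^ (k - i))) \<in> H0 h"
      "(1 / a) \<cdot> x - (T\<^sub>p ^ k + (\<Sum>i\<in>{1..k}. v' i * T\<^sub>p ^ (k - i))) \<in> H0 h"
      by (rule Q.singular_normal_form[OF x(3) _ _ ka(1-3)], erule x(5), erule x(6), rule that; assumption)
    let ?t = "T\<^sub>p ^ k + (\<Sum>i\<in>{1..k}. v' i * T\<^sub>p ^ (k - i))"
    have z: "(\<Sum>i\<in>{1..k}. (v' i - v i) * T\<^sub>p ^ (k - i)) = ?t - t\<^sub>p k"
      by (simp add: v(2) left_diff_distrib sum_subtractf)
    have "v' i - v i = 0" if "i \<in> {1..k}" for i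
    proof (rule unique_T[OF w0(1) k h _ _ _ that, where c = "\<lambda>i. v' i - v i"])
      show "v' i - v i \<in> env_span (M_words_restr p (i * p))" if "i \<in> {1..k}" for i
        by (rule env.span_diff[OF v'(1)[OF that] v(1)[OF that]])
      fix m :: nat assume m: "1 \<le> m"
      show "UL (int m) * (\<Sum>i\<in>{1..k}. (v' i - v i) * T\<^sub>p ^ (k - i)) \<in> H0 h"
        unfolding z right_diff_distrib[of _ ?t] by (rule Q.H_diff[OF v'(2)[OF m] v(3)[OF m]])
      show "UM (int m) * (\<Sum>i\<in>{1..k}. (v' i - v i) * T\<^sub>p ^ (k - i)) \<in> H0 h"
        unfolding z right_diff_distrib[of _ ?t] by (rule Q.H_diff[OF v'(3)[OF m] v(4)[OF m]])
    qed
    then have "(\<Sum>i\<in>{1..k}. (v' i - v i) * T\<^sub>p ^ (k - i)) = 0" by simp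
    then have "?t = t\<^sub>p k" unfolding z by simp
    then have "(1 / a) \<cdot> x - t\<^sub>p k \<in> X" using v'(4) X(2) by auto
    then have "(1 / a) \<cdot> x - ((1 / a) \<cdot> x - t\<^sub>p k) \<in> X"
      by (rule left_ideal_diff[OF X(1) left_ideal_scale[OF X(1) x(1)]])
    then show ?thesis using k h by auto
  qed
qed

text \<open>All words applied to \<open>T(p,s) S\<^sup>k\<close> have degree at least \<open>(s + k)p\<close>, above the degree of the form.\<close>

lemma form_zero_T:
  fixes \<Psi> :: "w22_env \<Rightarrow> complex"
  assumes s: "s \<ge> 1" and h: "h + of_nat (k * p) = hL_crit p s cL" and j: "j < s"
    and \<Psi>: "\<And>u v. \<Psi> (u + v) = \<Psi> u + \<Psi> v" "\<And>c u. \<Psi> (c \<cdot> u) = c * \<Psi> u"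
    "\<And>d x. has_degree d x \<Longrightarrow> d \<noteq> int (p * (j + k)) \<Longrightarrow> \<Psi> x = 0"
    "\<And>u. u \<in> ideal_join (S\<^sub>p ^ Suc k) (J h) \<Longrightarrow> \<Psi> u = 0"
    and x: "x \<in> ideal_join (t\<^sub>p s * S\<^sub>p ^ k) (ideal_join (S\<^sub>p ^ Suc k) (J h))"
  shows "\<Psi> x = 0"
proof -
  let ?B = "ideal_join (S\<^sub>p ^ Suc k) (J h)"
  interpret B: highest_weight cL cM h hM\<^sub>p ?B
    by unfold_locales (use left_ideal_join[OF left_ideal_verma] ideal_join_ideal in auto)
  obtain v where hw: "hw_vector cL cM (h + of_nat (k * p) + of_nat (s * p)) hM\<^sub>p (H0 (h + of_nat (k * p))) (t\<^sub>p s)"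
    and deg: "has_degree (int (s * p)) (t\<^sub>p s)"
    by (rule Tps_elem_spec[OF s h], rule that; assumption)
  have "hw_vector cL cM (h + of_nat (k * p) + of_nat (s * p)) hM\<^sub>p ?B (t\<^sub>p s * S\<^sub>p ^ k)"
    by (rule hw_vector_mult[OF hw H0_S_power])
  then show ?thesis
  proof (rule B.form_zero_join[OF _ \<Psi>(1,2,4) _ x])
    fix ws assume ws: "neg_word ws"
    have d: "has_degree (word_degree ws + (int (s * p) + int k * int p)) (word ws * (t\<^sub>p s * S\<^sub>p ^ k))"
      by (rule has_degree_mult[OF has_degree_word has_degree_mult[OF deg has_degree_power[OF has_degree_S]]])
    have "j * p < s * p" using j p by simp
    then have "int (p * (j + k)) < int (s * p) + int k * int p"
      by (simp add: algebra_simps flip: of_nat_mult of_nat_add)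
    then have "word_degree ws + (int (s * p) + int k * int p) \<noteq> int (p * (j + k))"
      using neg_word_degree[OF ws] by linarith
    then show "\<Psi> (word ws * (t\<^sub>p s * S\<^sub>p ^ k)) = 0" by (rule \<Psi>(3)[OF d])
  qed
qed

text \<open>Modulo \<open>T(p,s)\<close> all powers \<open>T\<^sup>k\<close> with \<open>k \<ge> s\<close> are of lower order, while for \<open>0 < k < s\<close> the weight does not fit. Only
\<open>k = 0\<close> is left.\<close>

lemma above_T:
  assumes s: "s \<ge> 1" and h: "h = hL_crit p s cL"
    and X: "left_ideal X" "ideal_join (t\<^sub>p s) (H0 h) \<subseteq> X" "X \<noteq> ideal_join (t\<^sub>p s) (H0 h)"
  shows "1 \<in> X"
proof -
  let ?H = "ideal_join (t\<^sub>p s) (H0 h)"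
  interpret Q: critical_quotient cL cM h p ?H w0
    by (rule critical_quotient_H[OF w0(1) left_ideal_join[OF left_ideal_H0] ideal_join_ideal])
  have det: "detects p ?H j" if j: "j < s" for j
  proof -
    obtain \<Psi> :: "w22_env \<Rightarrow> complex" where \<Psi>: "\<And>u v. \<Psi> (u + v) = \<Psi> u + \<Psi> v" "\<And>c u. \<Psi> (c \<cdot> u) = c * \<Psi> u"
      "\<And>u. u \<in> M_filt (Suc 0) \<Longrightarrow> \<Psi> u = 0"
      "\<And>d x. has_degree d x \<Longrightarrow> d \<noteq> int (p * (j + 0)) \<Longrightarrow> \<Psi> x = 0"
      "\<And>u. u \<in> ideal_join (S\<^sub>p ^ Suc 0) (J h) \<Longrightarrow> \<Psi> u = 0"
      "\<Psi> (UL (- int p) ^ j * UM (- int p) ^ 0) \<noteq> 0"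
      by (rule level_form[where k = 0 and s = j and h = h], rule that; assumption)
    have "\<Psi> (UL (- int p) ^ i) = 0" if "i \<noteq> j" for i
      using \<Psi>(4)[OF has_degree_power[OF has_degree_UL[of "- int p"], of i]] that p by simp
    moreover have "\<Psi> u = 0" if "u \<in> ?H" for u
    proof (rule form_zero_T[where k = 0, OF s _ j \<Psi>(1,2)])
      show "h + of_nat (0 * p) = hL_crit p s cL" using h by simp
      show "u \<in> ideal_join (t\<^sub>p s * S\<^sub>p ^ 0) (ideal_join (S\<^sub>p ^ Suc 0) (J h))" using that by simp
    qed (use \<Psi>(4,5) in blast)+
    ultimately show ?thesis unfolding detects_def using \<Psi>(1,2,3,6) by (intro exI[of _ \<Psi>]) auto
  qed
  obtain x d where x: "x \<in> X" "x \<notin> ?H" "has_degree d x" "d \<ge> 0"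
      "\<And>m. 1 \<le> m \<Longrightarrow> UL (int m) * x \<in> ?H" "\<And>m. 1 \<le> m \<Longrightarrow> UM (int m) * x \<in> ?H"
    by (rule Q.minimal_degree[OF X], rule that; assumption)
  obtain k a where ka: "a \<noteq> 0" "x - a \<cdot> T\<^sub>p ^ k \<in> Q.Kf k" "T\<^sub>p ^ k \<notin> Q.Kf k"
      "1 \<le> k \<Longrightarrow> detects p ?H (k - 1) \<Longrightarrow> h = hL_crit p k cL"
    by (rule Q.singular_vectors[OF _ _ x(2)], erule x(5), erule x(6), rule that; assumption)
  obtain v where v: "\<And>i. i \<in> {1..s} \<Longrightarrow> v i \<in> env_span (M_words_restr p (i * p))"
      "t\<^sub>p s = T\<^sub>p ^ s + (\<Sum>i\<in>{1..s}. v i * T\<^sub>p ^ (s - i))"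
    by (rule Tps_elem_spec[OF s h], rule that; assumption)
  have rest: "(\<Sum>i\<in>{1..s}. v i * T\<^sub>p ^ (s - i)) \<in> Q.Kf s"
    by (rule env.subspace_sum[OF Q.Kf_subspace], rule Q.M_free_Kf[OF M_restr_free[OF v(1)]]) auto
  have "t\<^sub>p s - (\<Sum>i\<in>{1..s}. v i * T\<^sub>p ^ (s - i)) \<in> Q.Kf s"
    by (rule env.subspace_diff[OF Q.Kf_subspace _ rest]) (use ideal_join_base[OF left_ideal_H0] Q.Kf_H in blast)
  then have Ts: "T\<^sub>p ^ s \<in> Q.Kf s" by (simp add: v(2))
  have "T\<^sub>p ^ (i + s) \<in> Q.Kf (i + s)" for i
    by (induction i) (use Ts Q.T_Kf in auto)
  then have "T\<^sub>p ^ l \<in> Q.Kf l" if "s \<le> l" for l using that by (metis le_add_diff_inverse2)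
  then have ks: "k < s" using ka(3) not_le by blast
  have "k = 0"
  proof (rule ccontr)
    assume "k \<noteq> 0"
    then have "h = hL_crit p k cL" using ka(4) det[of "k - 1"] ks by simp
    then have "k = s" using h by (intro hL_crit_inj) simp
    then show False using ks by simp
  qed
  then have "x - a \<cdot> 1 \<in> X" using ka(2) X(2) by (auto simp: Q.Kf_0)
  then have "x - (x - a \<cdot> 1) \<in> X" by (rule left_ideal_diff[OF X(1) x(1)])
  then have "a \<cdot> 1 \<in> X" by simp
  then have "(1 / a) \<cdot> (a \<cdot> 1) \<in> X" by (rule left_ideal_scale[OF X(1)])
  then show ?thesis using ka(1) by simp
qed

section \<open>The composition series\<close>

abbreviation A where "A h k \<equiv> ideal_join (S\<^sub>p ^ k) (J h)"
abbreviation B where "B h s k \<equiv> ideal_join (t\<^sub>p s * S\<^sub>p ^ k) (J h)"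

lemma left_ideal_A: "left_ideal (A h k)" and left_ideal_B: "left_ideal (B h s k)"
  by (rule left_ideal_join[OF left_ideal_verma])+

lemma A_Suc_subset: "A h (Suc k) \<subseteq> A h k"
  by (rule ideal_join_least[OF left_ideal_A _ ideal_join_ideal]) (simp add: ideal_join_mult[OF left_ideal_verma])

lemma B_subset_A: "B h s k \<subseteq> A h k"
  by (rule ideal_join_least[OF left_ideal_A ideal_join_mult[OF left_ideal_verma] ideal_join_ideal])

lemma A_subset_B:
  assumes s: "s \<ge> 1" and h: "h + of_nat (k * p) = hL_crit p s cL"
  shows "A h (Suc k) \<subseteq> B h s k"
proof (rule ideal_join_least[OF left_ideal_B _ ideal_join_ideal])
  let ?h = "h + of_nat (k * p)"
  interpret C: critical cL cM ?h p "J ?h" w0 by (rule critical_J[OF w0(1)])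
  obtain v where v: "\<And>i. i \<in> {1..s} \<Longrightarrow> v i \<in> env_span (M_words_restr p (i * p))"
      "t\<^sub>p s = T\<^sub>p ^ s + (\<Sum>i\<in>{1..s}. v i * T\<^sub>p ^ (s - i))"
    by (rule Tps_elem_spec[OF s h], rule that; assumption)
  have "S\<^sub>p \<in> ideal_join (t\<^sub>p s) (J ?h)" unfolding v(2) by (rule C.S_in_join[OF s v(1)])
  then obtain u b where ub: "S\<^sub>p = u * t\<^sub>p s + b" "b \<in> J ?h" by (auto simp: ideal_join_def)
  have "S\<^sub>p ^ Suc k = u * (t\<^sub>p s * S\<^sub>p ^ k) + b * S\<^sub>p ^ k"
    using arg_cong[OF ub(1), of "\<lambda>x. x * S\<^sub>p ^ k"] by (simp add: distrib_right mult.assoc)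
  then show "S\<^sub>p ^ Suc k \<in> B h s k" using J_S_power[OF ub(2)] unfolding ideal_join_def by blast
qed

text \<open>The form detecting \<open>M\<^sub>-\<^sub>p\<^sup>k\<close> is nonzero on \<open>S\<^sup>k\<close>, and vanishes on \<open>U T(p,s) S\<^sup>k\<close> by degree.\<close>

lemma B_not_A:
  assumes s: "s \<ge> 1" and h: "h + of_nat (k * p) = hL_crit p s cL"
  shows "B h s k \<noteq> A h k"
proof
  assume "B h s k = A h k"
  then have "S\<^sub>p ^ k \<in> B h s k" using ideal_join_base[OF left_ideal_verma] by blast
  moreover have "B h s k \<subseteq> ideal_join (t\<^sub>p s * S\<^sub>p ^ k) (A h (Suc k))"
    by (rule ideal_join_least[OF left_ideal_join[OF left_ideal_A] ideal_join_base[OF left_ideal_A]])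
      (use ideal_join_ideal in blast)
  ultimately have mem: "S\<^sub>p ^ k \<in> ideal_join (t\<^sub>p s * S\<^sub>p ^ k) (A h (Suc k))" by blast
  obtain \<Psi> :: "w22_env \<Rightarrow> complex" where \<Psi>: "\<And>u v. \<Psi> (u + v) = \<Psi> u + \<Psi> v" "\<And>c u. \<Psi> (c \<cdot> u) = c * \<Psi> u"
    "\<And>u. u \<in> M_filt (Suc k) \<Longrightarrow> \<Psi> u = 0"
    "\<And>d x. has_degree d x \<Longrightarrow> d \<noteq> int (p * (0 + k)) \<Longrightarrow> \<Psi> x = 0"
    "\<And>u. u \<in> A h (Suc k) \<Longrightarrow> \<Psi> u = 0"
    "\<Psi> (UL (- int p) ^ 0 * UM (- int p) ^ k) \<noteq> 0"
    by (rule level_form[where k = k and s = 0 and h = h], rule that; assumption)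
  have "\<Psi> (S\<^sub>p ^ k) = 0"
    by (rule form_zero_T[OF s h _ \<Psi>(1,2) _ _ mem, of 0]) (use s \<Psi>(4,5) in \<open>simp | blast\<close>)+
  moreover have "\<Psi> (S\<^sub>p ^ k) = \<Psi> (UM (- int p) ^ k)"
    using \<Psi>(1)[of "S\<^sub>p ^ k - UM (- int p) ^ k" "UM (- int p) ^ k"] \<Psi>(3)[OF S_power_lead(1)[OF p]] by simp
  ultimately show False using \<Psi>(6) by simp
qed

text \<open>The form detecting \<open>L\<^sub>-\<^sub>p\<^sup>s M\<^sub>-\<^sub>p\<^sup>k\<close> is nonzero on \<open>T(p,s) S\<^sup>k\<close>, and vanishes on \<open>U S\<^sup>k\<^sup>+\<^sup>1\<close>.\<close>

lemma A_not_B: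
  assumes s: "s \<ge> 1" and h: "h + of_nat (k * p) = hL_crit p s cL"
  shows "A h (Suc k) \<noteq> B h s k"
proof
  assume "A h (Suc k) = B h s k"
  then have mem: "t\<^sub>p s * S\<^sub>p ^ k \<in> A h (Suc k)" using ideal_join_base[OF left_ideal_verma] by blast
  obtain \<Psi> :: "w22_env \<Rightarrow> complex" where \<Psi>: "\<And>u v. \<Psi> (u + v) = \<Psi> u + \<Psi> v" "\<And>c u. \<Psi> (c \<cdot> u) = c * \<Psi> u"
    "\<And>u. u \<in> M_filt (Suc k) \<Longrightarrow> \<Psi> u = 0"
    "\<And>d x. has_degree d x \<Longrightarrow> d \<noteq> int (p * (s + k)) \<Longrightarrow> \<Psi> x = 0"
    "\<And>u. u \<in> A h (Suc k) \<Longrightarrow> \<Psi> u = 0"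
    "\<Psi> (UL (- int p) ^ s * UM (- int p) ^ k) \<noteq> 0"
    by (rule level_form[where k = k and s = s and h = h], rule that; assumption)
  obtain v where v: "\<And>i. i \<in> {1..s} \<Longrightarrow> v i \<in> env_span (M_words_restr p (i * p))"
      "t\<^sub>p s = T\<^sub>p ^ s + (\<Sum>i\<in>{1..s}. v i * T\<^sub>p ^ (s - i))"
    by (rule Tps_elem_spec[OF s h], rule that; assumption)
  note lead = T_power_lead(1)[OF w0(1) p, of cM] T_power_lead(2)[OF w0(1) p]
  have T0: "T\<^sub>p ^ i \<in> M_filt 0" for i
    using env.subspace_add[OF M_filt_subspace lead(2)[of i], of "T\<^sub>p ^ i - UL (- int p) ^ i"]
      lead(1)[of i] M_filt_mono[of 0 1] by auto
  have "v i * T\<^sub>p ^ (s - i) \<in> M_filt 1" if i: "i \<in> {1..s}" for i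
  proof -
    have "1 \<le> i * p" using i p by simp
    then show ?thesis
      using M_filt_mult[OF M_poly_M_filt[OF M_restr_in_M_poly[OF v(1)[OF i]]] T0] by simp
  qed
  then have "(\<Sum>i\<in>{1..s}. v i * T\<^sub>p ^ (s - i)) \<in> M_filt 1" by (rule env.subspace_sum[OF M_filt_subspace])
  then have "(T\<^sub>p ^ s - UL (- int p) ^ s) + (\<Sum>i\<in>{1..s}. v i * T\<^sub>p ^ (s - i)) \<in> M_filt 1"
    by (rule env.subspace_add[OF M_filt_subspace lead(1)])
  then have t: "t\<^sub>p s - UL (- int p) ^ s \<in> M_filt 1" by (simp add: v(2) algebra_simps)
  have Sk: "S\<^sub>p ^ k \<in> M_filt k"
    using env.subspace_add[OF M_filt_subspace, of "S\<^sub>p ^ k - UM (- int p) ^ k" k "UM (- int p) ^ k"]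
      S_power_lead(1)[OF p, of cM k] S_power_lead(2)[OF p, of k] M_filt_mono[of k "Suc k"] by auto
  have 1: "(t\<^sub>p s - UL (- int p) ^ s) * S\<^sub>p ^ k \<in> M_filt (Suc k)" using M_filt_mult[OF t Sk] by simp
  have 2: "UL (- int p) ^ s * (S\<^sub>p ^ k - UM (- int p) ^ k) \<in> M_filt (Suc k)"
    using M_filt_mult[OF lead(2)[of s] S_power_lead(1)[OF p]] by simp
  have "t\<^sub>p s * S\<^sub>p ^ k = (t\<^sub>p s - UL (- int p) ^ s) * S\<^sub>p ^ k
      + (UL (- int p) ^ s * (S\<^sub>p ^ k - UM (- int p) ^ k) + UL (- int p) ^ s * UM (- int p) ^ k)"
    by (simp add: left_diff_distrib right_diff_distrib)
  then have "\<Psi> (t\<^sub>p s * S\<^sub>p ^ k) = \<Psi> (UL (- int p) ^ s * UM (- int p) ^ k)"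
    by (simp only: \<Psi>(1) \<Psi>(3)[OF 1] \<Psi>(3)[OF 2] add_0_left)
  then show False using \<Psi>(5)[OF mem] \<Psi>(6) by simp
qed

text \<open>The left ideal of the \<open>u\<close> with \<open>u S\<^sup>k \<in> X\<close> corresponds to a submodule of the Verma module of weight \<open>h + kp\<close>.\<close>

lemma pull_back:
  assumes X: "left_ideal X" "J h \<subseteq> X"
  shows "left_ideal {u. u * S\<^sub>p ^ k \<in> X}" and "J (h + of_nat (k * p)) \<subseteq> {u. u * S\<^sub>p ^ k \<in> X}"
proof -
  show "left_ideal {u. u * S\<^sub>p ^ k \<in> X}"
    by (rule left_idealI)
      (auto simp: distrib_right mult.assoc left_ideal_zero[OF X(1)] left_ideal_add[OF X(1)] left_ideal_mult[OF X(1)])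
  show "J (h + of_nat (k * p)) \<subseteq> {u. u * S\<^sub>p ^ k \<in> X}" using J_S_power X(2) by blast
qed

lemma pull_back_H0:
  assumes X: "left_ideal X" "A h (Suc k) \<subseteq> X"
  shows "H0 (h + of_nat (k * p)) \<subseteq> {u. u * S\<^sub>p ^ k \<in> X}"
  using H0_S_power X(2) by blast

lemma simple_A_B:
  assumes s: "s \<ge> 1" and h: "h + of_nat (k * p) = hL_crit p s cL"
    and X: "left_ideal X" "B h s k \<subseteq> X" "X \<subseteq> A h k"
  shows "X = B h s k \<or> X = A h k"
proof -
  let ?h = "h + of_nat (k * p)" and ?X = "{u. u * S\<^sub>p ^ k \<in> X}"
  have JX: "J h \<subseteq> X" using X(2) ideal_join_ideal by blast
  note X' = pull_back[OF X(1) JX, of k]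
  have CX: "A h (Suc k) \<subseteq> X" using A_subset_B[OF s h] X(2) by blast
  have "t\<^sub>p s \<in> ?X" using X(2) ideal_join_base[OF left_ideal_verma] by blast
  then have T: "ideal_join (t\<^sub>p s) (H0 ?h) \<subseteq> ?X"
    by (rule ideal_join_least[OF X'(1) _ pull_back_H0[OF X(1) CX]])
  show ?thesis
  proof (cases "?X = ideal_join (t\<^sub>p s) (H0 ?h)")
    case True
    have "X \<subseteq> B h s k"
    proof
      fix x assume x: "x \<in> X"
      then obtain u j where uj: "x = u * S\<^sub>p ^ k + j" "j \<in> J h" using X(3) by (auto simp: ideal_join_def)
      have "x - j \<in> X" using left_ideal_diff[OF X(1) x] uj(2) JX by blast
      then have "u \<in> ideal_join (t\<^sub>p s) (H0 ?h)" using uj(1) True by auto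
      then obtain a b where ab: "u = a * t\<^sub>p s + b" "b \<in> H0 ?h" by (auto simp: ideal_join_def)
      have "a * (t\<^sub>p s * S\<^sub>p ^ k) + (b * S\<^sub>p ^ k + j) \<in> B h s k"
        using ideal_join_mult[OF left_ideal_verma, of a "t\<^sub>p s * S\<^sub>p ^ k"] H0_S_power[OF ab(2)] A_subset_B[OF s h] uj(2)
          ideal_join_ideal
        by (intro left_ideal_add[OF left_ideal_B]) blast+
      then show "x \<in> B h s k" by (simp add: uj(1) ab(1) distrib_right mult.assoc add.assoc)
    qed
    then show ?thesis using X(2) by blast
  next
    case False
    then have "1 \<in> ?X" by (rule above_T[OF s h X'(1) T])
    then have "S\<^sub>p ^ k \<in> X" by simp
    then have "A h k \<subseteq> X" using JX by (rule ideal_join_least[OF X(1)])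
    then show ?thesis using X(3) by blast
  qed
qed

lemma simple_B_A:
  assumes s: "s \<ge> 1" and h: "h + of_nat (k * p) = hL_crit p s cL"
    and X: "left_ideal X" "A h (Suc k) \<subseteq> X" "X \<subseteq> B h s k"
  shows "X = A h (Suc k) \<or> X = B h s k"
proof -
  let ?h = "h + of_nat (k * p)" and ?X = "{u. u * S\<^sub>p ^ k \<in> X}"
  have JX: "J h \<subseteq> X" using X(2) ideal_join_ideal by blast
  note X' = pull_back[OF X(1) JX, of k]
  show ?thesis
  proof (cases "?X = H0 ?h")
    case True
    have "X \<subseteq> A h (Suc k)"
    proof
      fix x assume x: "x \<in> X"
      then obtain u j where uj: "x = u * (t\<^sub>p s * S\<^sub>p ^ k) + j" "j \<in> J h" using X(3) by (auto simp: ideal_join_def)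
      have "x - j \<in> X" using left_ideal_diff[OF X(1) x] uj(2) JX by blast
      then have "u * t\<^sub>p s \<in> ?X" using uj(1) by (simp add: mult.assoc)
      then have "(u * t\<^sub>p s) * S\<^sub>p ^ k \<in> A h (Suc k)" using H0_S_power unfolding True by blast
      moreover have "j \<in> A h (Suc k)" using uj(2) ideal_join_ideal by blast
      ultimately have "(u * t\<^sub>p s) * S\<^sub>p ^ k + j \<in> A h (Suc k)" by (rule left_ideal_add[OF left_ideal_A])
      then show "x \<in> A h (Suc k)" by (simp add: uj(1) mult.assoc)
    qed
    then show ?thesis using X(2) by blast
  next
    case False
    have "t\<^sub>p s \<in> ?X"
    proof (rule disjE[OF above_H0[OF X'(1) pull_back_H0[OF X(1,2)] False]])
      assume "1 \<in> ?X"
      from left_ideal_mult[OF X'(1) this, of "t\<^sub>p s"] show ?thesis by simp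
    next
      assume "\<exists>s'\<ge>1. ?h = hL_crit p s' cL \<and> t\<^sub>p s' \<in> ?X"
      then obtain s' where s': "?h = hL_crit p s' cL" "t\<^sub>p s' \<in> ?X" by blast
      then have "s' = s" using h hL_crit_inj by metis
      then show ?thesis using s'(2) by simp
    qed
    then have "t\<^sub>p s * S\<^sub>p ^ k \<in> X" by simp
    then have "B h s k \<subseteq> X" using JX by (rule ideal_join_least[OF X(1)])
    then show ?thesis using X(3) by blast
  qed
qed

lemma simple_A_A:
  assumes h: "\<And>s. s \<ge> 1 \<Longrightarrow> h + of_nat (k * p) \<noteq> hL_crit p s cL"
    and X: "left_ideal X" "A h (Suc k) \<subseteq> X" "X \<subseteq> A h k"
  shows "X = A h (Suc k) \<or> X = A h k"
proof -
  let ?h = "h + of_nat (k * p)" and ?X = "{u. u * S\<^sub>p ^ k \<in> X}"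
  have JX: "J h \<subseteq> X" using X(2) ideal_join_ideal by blast
  note X' = pull_back[OF X(1) JX, of k]
  show ?thesis
  proof (cases "?X = H0 ?h")
    case True
    have "X \<subseteq> A h (Suc k)"
    proof
      fix x assume x: "x \<in> X"
      then obtain u j where uj: "x = u * S\<^sub>p ^ k + j" "j \<in> J h" using X(3) by (auto simp: ideal_join_def)
      have "x - j \<in> X" using left_ideal_diff[OF X(1) x] uj(2) JX by blast
      then have "u \<in> ?X" using uj(1) by simp
      then have "u * S\<^sub>p ^ k \<in> A h (Suc k)" using H0_S_power unfolding True by blast
      moreover have "j \<in> A h (Suc k)" using uj(2) ideal_join_ideal by blast
      ultimately show "x \<in> A h (Suc k)" unfolding uj(1) by (rule left_ideal_add[OF left_ideal_A])
    qed
    then show ?thesis using X(2) by blast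
  next
    case False
    then have "1 \<in> ?X" using above_H0[OF X'(1) pull_back_H0[OF X(1,2)]] h by blast
    then have "S\<^sub>p ^ k \<in> X" by simp
    then have "A h k \<subseteq> X" using JX by (rule ideal_join_least[OF X(1)])
    then show ?thesis using X(3) by blast
  qed
qed

lemma A_Suc_not_A: "A h (Suc k) \<noteq> A h k"
  using S_power_not_in[of k h] ideal_join_base[OF left_ideal_verma] by blast

text \<open>The weights of the \<open>S\<^sup>k\<close> are critical as long as \<open>2k < r\<close>, with \<open>s = r - 2k\<close>; afterwards no positive \<open>s\<close> is left.\<close>

lemma hL_crit_shift: "hL_crit p r cL + of_nat (k * p) = hL_crit p s cL \<longleftrightarrow> s + 2 * k = r"
proof -
  have "hL_crit p r cL + of_nat (k * p) - hL_crit p s cL = (of_nat (s + 2 * k) - of_nat r) * of_nat p / 2"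
    by (simp add: hL_crit_def field_simps)
  moreover have "(of_nat (s + 2 * k) - of_nat r :: complex) = 0 \<longleftrightarrow> s + 2 * k = r"
    unfolding eq_iff_diff_eq_0[symmetric] by (rule of_nat_eq_iff)
  moreover have "(of_nat p :: complex) \<noteq> 0" using p by simp
  ultimately show ?thesis
    by (metis divide_eq_0_iff eq_iff_diff_eq_0 mult_eq_0_iff zero_neq_numeral)
qed

lemma composition_series:
  assumes r: "r \<ge> 1"
  shows "infinite_composition_series (V (hL_crit p r cL)) (series_module p r cL cM (hL_crit p r cL) hM\<^sub>p)"
proof -
  define h where "h = hL_crit p r cL"
  define m where "m = (r - 1) div 2"
  define I where "I n = (if n \<le> 2 * m + 1
      then (if even n then A h (n div 2) else B h (r - 2 * (n div 2)) (n div 2)) else A h (n - (m + 1)))" for n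
  have gen: "generated_submodule (V h) {q h a} = q h ` ideal_join a (J h)" for a
    by (rule presents_generated[OF presents_verma UNIV_I])
  have N: "series_module p r cL cM h hM\<^sub>p n = q h ` I n" for n
    unfolding series_module_def Let_def S_elem_eq smult_vec verma_proj_smult gen m_def[symmetric] I_def by simp
  have low: "r - 2 * k \<ge> 1" "h + of_nat (k * p) = hL_crit p (r - 2 * k) cL" if "k \<le> m" for k
  proof -
    have k: "2 * k < r" using that r by (auto simp: m_def)
    then show "r - 2 * k \<ge> 1" by simp
    show "h + of_nat (k * p) = hL_crit p (r - 2 * k) cL" unfolding h_def hL_crit_shift using k by simp
  qed
  have high: "h + of_nat (k * p) \<noteq> hL_crit p s cL" if "m < k" "s \<ge> 1" for k s
    unfolding h_def hL_crit_shift using that r by (auto simp: m_def)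
  have step: "(\<exists>k\<le>m. I i = A h k \<and> I (Suc i) = B h (r - 2 * k) k) \<or>
      (\<exists>k\<le>m. I i = B h (r - 2 * k) k \<and> I (Suc i) = A h (Suc k)) \<or>
      (\<exists>k>m. I i = A h k \<and> I (Suc i) = A h (Suc k))" for i
  proof (cases "i \<le> 2 * m + 1")
    case low: True
    show ?thesis
    proof (cases "even i")
      case True
      then obtain k where k: "i = 2 * k" by (rule evenE)
      then have "k \<le> m" using low by simp
      moreover have "I i = A h k" "I (Suc i) = B h (r - 2 * k) k" using k \<open>k \<le> m\<close> by (simp_all add: I_def)
      ultimately show ?thesis by blast
    next
      case False
      then obtain k where k: "i = 2 * k + 1" by (rule oddE)
      then have "k \<le> m" using low by simp
      moreover have "I i = B h (r - 2 * k) k" using k \<open>k \<le> m\<close> by (simp add: I_def)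
      moreover have "I (Suc i) = A h (Suc k)"
      proof (cases "k = m")
        case True
        \<comment> \<open>At the index \<open>2m + 2\<close> the two branches of the definition of the series meet.\<close>
        have "Suc i - (m + 1) = Suc k" using k True by simp
        then show ?thesis using k True by (simp add: I_def)
      next
        case False
        then show ?thesis using k \<open>k \<le> m\<close> by (simp add: I_def)
      qed
      ultimately show ?thesis by blast
    qed
  next
    case False
    define k where "k = i - (m + 1)"
    have "m < k" "Suc i - (m + 1) = Suc k" using False by (simp_all add: k_def)
    moreover have "I i = A h k" "I (Suc i) = A h (Suc k)" using False \<open>Suc i - (m + 1) = Suc k\<close> by (simp_all add: I_def k_def)
    ultimately show ?thesis by blast
  qed
  have "infinite_composition_series (V h) (series_module p r cL cM h hM\<^sub>p)"
  proof (rule composition_seriesI[where I = I, OF presents_verma])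
    have "x \<in> A h 0" for x using ideal_join_mult[OF left_ideal_verma, of x 1] by simp
    then show "I 0 = UNIV" by (auto simp: I_def)
    show "left_ideal (I i)" for i using left_ideal_A left_ideal_B by (simp add: I_def)
    show "J h \<subseteq> I i" for i using ideal_join_ideal by (simp add: I_def)
    show "I (Suc i) \<subset> I i" for i
      using step[of i] B_subset_A[where h = h] B_not_A low A_subset_B A_not_B A_Suc_subset[where h = h] A_Suc_not_A[where h = h]
      by (metis psubsetI)
    show "X = I (Suc i) \<or> X = I i" if X: "left_ideal X" "I (Suc i) \<subseteq> X" "X \<subseteq> I i" for i X
    proof -
      consider (AB) k where "k \<le> m" "I i = A h k" "I (Suc i) = B h (r - 2 * k) k"
        | (BA) k where "k \<le> m" "I i = B h (r - 2 * k) k" "I (Suc i) = A h (Suc k)"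
        | (AA) k where "m < k" "I i = A h k" "I (Suc i) = A h (Suc k)"
        using step[of i] by blast
      then show ?thesis
      proof cases
        case AB
        then show ?thesis using simple_A_B[OF low[OF AB(1)] X(1)] X(2,3) by simp
      next
        case BA
        then show ?thesis using simple_B_A[OF low[OF BA(1)] X(1)] X(2,3) by simp
      next
        case AA
        then show ?thesis using simple_A_A[OF high[OF AA(1)] X(1)] X(2,3) by simp
      qed
    qed
  qed (rule N)
  then show ?thesis by (simp add: h_def)
qed

end

theorem corollary5p10:
  fixes cL cM hL hM :: complex and p r :: nat
  assumes "cM \<noteq> 0"
    and "p \<ge> 1"
    and "2 * hM + (of_nat p ^ 2 - 1) / 12 * cM = 0"
    and "r \<ge> 1"
    and "hL = hL_crit p r cL"
  shows "infinite_composition_series (verma cL cM hL hM) (series_module p r cL cM hL hM)"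
proof -
  have "2 * hM = - ((of_nat p ^ 2 - 1) / 12 * cM)"
    using assms(3) by (simp add: eq_neg_iff_add_eq_0)
  then have hM: "hM = hM_crit p cM" by (simp add: hM_crit_def field_simps)
  have "critical_level cM p" by unfold_locales (use assms(1,2) in auto)
  from critical_level.composition_series[OF this assms(4)] show ?thesis
    unfolding hM assms(5) .
qed


end
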